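(* Let $W_i=(\psi_i,Y_i(0),Y_i(1))$, $i\ge1$, be i.i.d. with $\psi_i\in\mathbb{R}^{d_\psi}$, let $p\in(0,1)$ be a rational constant, $B>0$ a budget, and $C(\cdot)$ a known measurable cost function. Write $\sigma_d^2(\psi)=\mathrm{Var}(Y(d)\mid\psi)$, $c(\psi)=E[Y(1)-Y(0)\mid\psi]$, $\sigma_s^2(\psi)=\sigma_1^2(\psi)/p+\sigma_0^2(\psi)/(1-p)$, $\sigma_s=(\sigma_s^2)^{1/2}$, and $q^*(\psi)=B\,\sigma_s(\psi)C(\psi)^{-1/2}/E[\sigma_s(\psi)C(\psi)^{1/2}]$. Let $\hat\sigma_d^2(\cdot)\ge0$, $d=0,1$, be estimates of $\sigma_d^2(\cdot)$, let $\hat\sigma_s=(\hat\sigma_1^2/p+\hat\sigma_0^2/(1-p))^{1/2}$, $$\hat q(\psi)=B\cdot\frac{\hat\sigma_s(\psi)C(\psi)^{-1/2}}{n^{-1}\sum_{i=1}^n\hat\sigma_s(\psi_i)C(\psi_i)^{1/2}},$$ and let $\hat q_n(\cdot)$ be a discretization of $\hat q(\cdot)$ taking values in a set $\{a_l/k_l:l=1,\dots,L_n\}$ of rational numbers, with $\bar k_n=\max_{l\le L_n}k_l$. Suppose: (i) $T_{1:n}\sim\mathrm{Loc}(\psi,\hat q_n(\psi))$ and $D_{1:n}\sim\mathrm{Loc}(\psi,p)$ (defined in the context); the estimates $\hat\sigma_d^2$ are computed from external data $\xi_n$ that is independent of the experimental units and all design randomness. (ii) $E[Y(d)^4]<\infty$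 for $d\in\{0,1\}$ and $E[|\psi|_2^\alpha]<\infty$ for some $\alpha>d_\psi+1$; $\inf_\psi\sigma_d^2(\psi)>0$; $\hat q_n(\psi),q^*(\psi)\in(\delta,1]$ for some $\delta>0$; $C(\psi)\in[C_l,C_u]\subset(0,\infty)$. (iii) $E_\psi[(\hat\sigma_d^2(\psi)-\sigma_d^2(\psi))^2]=o_p(1)$ for $d\in\{0,1\}$, where $E_\psi$ integrates over the law of $\psi$ with $\hat\sigma_d^2$ held fixed. (iv) $n^{-1}\sum_{i=1}^n(\hat q_n(\psi_i)-\hat q(\psi_i))^2=o_p(1)$, with $\bar k_nL_n=o(n^{1-(d_\psi+1)/\alpha})$ and $\bar k_n=o(n^{1/4})$. Let $Y_i=T_i[D_iY_i(1)+(1-D_i)Y_i(0)]$, $\mathrm{ATE}=E[Y(1)-Y(0)]$ and $\hat\theta=n^{-1}\sum_{i=1}^n\frac{T_i}{\hat q_n(\psi_i)}\left(\frac{D_iY_i}{p}-\frac{(1-D_i)Y_i}{1-p}\right)$. Then $\sqrt n(\hat\theta-\mathrm{ATE})$ converges in distribution to $\mathcal{N}(0,V^* )$, where $$V^*=\mathrm{Var}(c(\psi))+\min_{0<q(\cdot)\le1,\;E[C(\psi)q(\psi)]=B}E\left[\frac{\sigma_s^2(\psi)}{q(\psi)}\right].$$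
   Context: Design. For each $n$ let $\pi_n$ be tie-breaking randomness with $W_{1:n}$, $\pi_n$, $\xi_n$ mutually independent. The discretized propensity $\hat q_n(\cdot)$ is a (random) function determined by $(\xi_n,\psi_{1:n})$; $\bar k_n$ and $L_n$ are bounded by (or equal to) deterministic sequences satisfying (iv). $T_{1:n}\sim\mathrm{Loc}(\psi,\hat q_n(\psi))$ means there is a partition $\mathcal{G}_n^T$ of $\{1,\dots,n\}$ that is a function of $(\psi_{1:n},\pi_n,\xi_n)$ such that: (1) $n^{-1}\sum_{g\in\mathcal{G}_n^T}\sum_{i\in g}|\psi_i-\bar\psi_g|_2^2=o_p(1)$, where $\bar\psi_g=|g|^{-1}\sum_{i\in g}\psi_i$; (2) units in the same group have the same value $\hat q_n(\psi_i)=a_l/k_l$ for some $l$; each group at level $l$ has exactly $k_l$ units, except at most one remainder group per level, which has fewer than $k_l$ units; and conditional on $(W_{1:n},\pi_n,\xi_n)$ the vectors $(T_i)_{i\in g}$ are independent across groups, uniform over binary vectors with exactly $a_l$ ones for full groups, and with i.i.d. Bernoulli$(a_l/k_l)$ entries for remainder groups. $D_{1:n}\sim\mathrm{Loc}(\psi,p)$, with $p=a/k$, means there is a partition $\mathcal{G}_n^D$ of $\{i:T_i=1\}$ that is a function of $(\psi_{1:n},T_{1:n},\pi_n,\xi_n)$, with $n^{-1}\sum_{g\in\mathcal{G}_n^D}\sum_{i\in g}|\psi_i-\bar\psi_g|_2^2=o_p(1)$, all groups of size $k$ except at most one smaller remainder group, and such that conditional on $(W_{1:n},\pi_n,\xi_n,T_{1:n})$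 the vectors $(D_i)_{i\in g}$ are independent across groups, uniform over binary vectors with exactly $a$ ones for full groups, and with i.i.d. Bernoulli$(p)$ entries for the remainder group. *)

theory Defs
  imports "HOL-Probability.Probability" "HOL-Library.Landau_Symbols"
begin

text \<open>
  Conventions. All random objects live on one probability space \<open>M\<close>. Units are numbered from 1;
  the sample of size \<open>n\<close> is \<open>{1..n}\<close>. \<open>Y d i\<close> with \<open>d \<in> {0, 1}\<close> is the potential outcome
  \<open>Y\<^sub>i(d)\<close>. Binary variables have type bool, with True for 1. A random object is ``a function
  of'' another one if it is measurable with respect to the sigma-algebra generated by the latter.
\<close>

section \<open>Sigma-algebras and modes of convergence\<close>

definition sigma_of :: "'a measure \<Rightarrow> ('a \<Rightarrow> 'b) \<Rightarrow> 'b measure \<Rightarrow> 'a measure" where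
  "sigma_of M f N = vimage_algebra (space M) f N"

text \<open>The vector \<open>X\<^sub>1, \<dots>, X\<^sub>n\<close>, as an element of \<open>PiM {1..n}\<close>.\<close>

definition upto_n :: "(nat \<Rightarrow> 'a \<Rightarrow> 'b) \<Rightarrow> nat \<Rightarrow> 'a \<Rightarrow> nat \<Rightarrow> 'b" where
  "upto_n X n \<omega> = (\<lambda>i\<in>{1..n}. X i \<omega>)"

abbreviation borel_vec :: "nat \<Rightarrow> (nat \<Rightarrow> 'b::topological_space) measure" where
  "borel_vec n \<equiv> PiM {1..n} (\<lambda>_. borel)"

abbreviation bool_vec :: "nat \<Rightarrow> (nat \<Rightarrow> bool) measure" where
  "bool_vec n \<equiv> PiM {1..n} (\<lambda>_. count_space UNIV)"

text \<open>Mutual independence of three random objects with values in different types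
  (\<open>indep_vars\<close> needs a common type of values).\<close>

definition mutually_indep3 ::
  "'a measure \<Rightarrow> ('a \<Rightarrow> 'b) \<Rightarrow> 'b measure \<Rightarrow> ('a \<Rightarrow> 'c) \<Rightarrow> 'c measure
    \<Rightarrow> ('a \<Rightarrow> 'd) \<Rightarrow> 'd measure \<Rightarrow> bool" where
  "mutually_indep3 M X NX Y NY Z NZ \<longleftrightarrow>
     X \<in> M \<rightarrow>\<^sub>M NX \<and> Y \<in> M \<rightarrow>\<^sub>M NY \<and> Z \<in> M \<rightarrow>\<^sub>M NZ \<and>
     prob_space.indep_sets M
       (\<lambda>j. [sets (sigma_of M X NX), sets (sigma_of M Y NY), sets (sigma_of M Z NZ)] ! j) {..<3}"

text \<open>\<open>Z n = o\<^sub>p(1)\<close> for nonnegative \<open>Z n\<close>. The values are extended reals so that an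
  integral which diverges counts as \<open>\<infinity>\<close> rather than as 0.\<close>

definition op1 :: "'a measure \<Rightarrow> (nat \<Rightarrow> 'a \<Rightarrow> ennreal) \<Rightarrow> bool" where
  "op1 M Z \<longleftrightarrow> (\<forall>n. Z n \<in> borel_measurable M) \<and>
     (\<forall>\<epsilon>>0. (\<lambda>n. measure M {\<omega> \<in> space M. Z n \<omega> > ennreal \<epsilon>}) \<longlonglongrightarrow> 0)"

section \<open>Conditional mean and variance as functions of the covariate\<close>

text \<open>\<open>f\<close> is a version of \<open>x \<mapsto> E[Y | X = x]\<close>, respectively of \<open>x \<mapsto> Var(Y | X = x)\<close>.\<close>

definition is_cond_mean ::
  "'a measure \<Rightarrow> ('a \<Rightarrow> 'b::topological_space) \<Rightarrow> ('a \<Rightarrow> real) \<Rightarrow> ('b \<Rightarrow> real) \<Rightarrow> bool" where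
  "is_cond_mean M X Y f \<longleftrightarrow> f \<in> borel_measurable borel \<and>
     (AE \<omega> in M. real_cond_exp M (sigma_of M X borel) Y \<omega> = f (X \<omega>))"

definition is_cond_var ::
  "'a measure \<Rightarrow> ('a \<Rightarrow> 'b::topological_space) \<Rightarrow> ('a \<Rightarrow> real) \<Rightarrow> ('b \<Rightarrow> real) \<Rightarrow> bool" where
  "is_cond_var M X Y f \<longleftrightarrow>
     is_cond_mean M X (\<lambda>\<omega>. (Y \<omega> - real_cond_exp M (sigma_of M X borel) Y \<omega>)\<^sup>2) f"

section \<open>Local randomization\<close>

definition group_mean :: "(nat \<Rightarrow> 'v::real_vector) \<Rightarrow> nat set \<Rightarrow> 'v" where
  "group_mean x g = (1 / real (card g)) *\<^sub>R (\<Sum>i\<in>g. x i)"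

definition heterogeneity ::
  "nat \<Rightarrow> (nat \<Rightarrow> 'v::real_normed_vector) \<Rightarrow> nat set set \<Rightarrow> real" where
  "heterogeneity n x G = (1 / real n) * (\<Sum>g\<in>G. \<Sum>i\<in>g. (norm (x i - group_mean x g))\<^sup>2)"

text \<open>Law of the binary vector of a group \<open>g\<close> at level \<open>a/k\<close>: uniform over the vectors with
  exactly \<open>a\<close> ones if \<open>g\<close> is full, i.i.d. Bernoulli otherwise. Vectors are False outside \<open>g\<close>.\<close>

definition group_pmf :: "nat \<Rightarrow> nat \<Rightarrow> nat set \<Rightarrow> (nat \<Rightarrow> bool) pmf" where
  "group_pmf a k g =
     (if card g = k then pmf_of_set {t. {i. t i} \<subseteq> g \<and> card {i. t i} = a}
      else Pi_pmf g False (\<lambda>_. bernoulli_pmf (real a / real k)))"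

text \<open>
  Local randomization of the units \<open>U n \<omega> \<subseteq> {1..n}\<close> with propensity \<open>q n \<omega> x\<close> and levels
  \<open>a n \<omega> l / k n \<omega> l\<close>, \<open>l \<in> {1..L n \<omega>}\<close>. The partition \<open>G n\<close> is measurable with respect to
  \<open>A n\<close>; \<open>lev n \<omega> g\<close> is the level at which group \<open>g\<close> is randomized, which need not be
  determined by the propensity when two levels have the same ratio. The last clause says that
  conditionally on \<open>F n\<close> the vectors \<open>(Z n i)\<close>, \<open>i \<in> g\<close>, are independent across
  groups with the laws \<open>group_pmf\<close>, through the joint probability mass function.
\<close>

definition local_randomization ::
  "'a measure \<Rightarrow> (nat \<Rightarrow> 'a measure) \<Rightarrow> (nat \<Rightarrow> 'a measure) \<Rightarrow> (nat \<Rightarrow> 'a \<Rightarrow> nat set)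
    \<Rightarrow> (nat \<Rightarrow> 'a \<Rightarrow> 'v::real_normed_vector) \<Rightarrow> (nat \<Rightarrow> 'a \<Rightarrow> 'v \<Rightarrow> real)
    \<Rightarrow> (nat \<Rightarrow> 'a \<Rightarrow> nat) \<Rightarrow> (nat \<Rightarrow> 'a \<Rightarrow> nat \<Rightarrow> nat) \<Rightarrow> (nat \<Rightarrow> 'a \<Rightarrow> nat \<Rightarrow> nat)
    \<Rightarrow> (nat \<Rightarrow> nat \<Rightarrow> 'a \<Rightarrow> bool) \<Rightarrow> bool" where
  "local_randomization M A F U \<psi> q L a k Z \<longleftrightarrow>
     (\<forall>n. \<forall>i\<in>{1..n}. Z n i \<in> M \<rightarrow>\<^sub>M count_space UNIV) \<and>
     (\<exists>G :: nat \<Rightarrow> 'a \<Rightarrow> nat set set. \<exists>lev :: nat \<Rightarrow> 'a \<Rightarrow> nat set \<Rightarrow> nat.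
        (\<forall>n. G n \<in> A n \<rightarrow>\<^sub>M count_space UNIV) \<and>
        (\<forall>n g. (\<lambda>\<omega>. lev n \<omega> g) \<in> A n \<rightarrow>\<^sub>M count_space UNIV) \<and>
        (\<forall>n. \<forall>\<omega>\<in>space M. partition_on (U n \<omega>) (G n \<omega>)) \<and>
        op1 M (\<lambda>n \<omega>. ennreal (heterogeneity n (\<lambda>i. \<psi> i \<omega>) (G n \<omega>))) \<and>
        (\<forall>n. AE \<omega> in M. \<forall>g\<in>G n \<omega>. lev n \<omega> g \<in> {1..L n \<omega>} \<and>
           (\<forall>i\<in>g. q n \<omega> (\<psi> i \<omega>) = real (a n \<omega> (lev n \<omega> g)) / real (k n \<omega> (lev n \<omega> g))) \<and>
           card g \<le> k n \<omega> (lev n \<omega> g)) \<and>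
        (\<forall>n. AE \<omega> in M. \<forall>l\<in>{1..L n \<omega>}.
           card {g \<in> G n \<omega>. lev n \<omega> g = l \<and> card g < k n \<omega> l} \<le> 1) \<and>
        (\<forall>n t. AE \<omega> in M.
           real_cond_exp M (F n)
             (indicator {\<omega> \<in> space M. \<forall>i\<in>U n \<omega>. Z n i \<omega> = t i}) \<omega> =
           (\<Prod>g\<in>G n \<omega>. pmf (group_pmf (a n \<omega> (lev n \<omega> g)) (k n \<omega> (lev n \<omega> g)) g)
                                   (\<lambda>i. i \<in> g \<and> t i))))"

text \<open>\<open>T\<^sub>1\<^sub>:\<^sub>n \<sim> Loc(\<psi>, q\<^sub>n(\<psi>))\<close>, where \<open>W i = (\<psi> i, Y 0 i, Y 1 i)\<close> and the values of \<open>\<pi> n\<close>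
  and \<open>\<xi> n\<close> are in \<open>NP n\<close> and \<open>NX n\<close>.\<close>

definition loc_sampling ::
  "'a measure \<Rightarrow> (nat \<Rightarrow> 'b measure) \<Rightarrow> (nat \<Rightarrow> 'c measure) \<Rightarrow> (nat \<Rightarrow> 'a \<Rightarrow> real^'d)
    \<Rightarrow> (nat \<Rightarrow> 'a \<Rightarrow> (real^'d) \<times> real \<times> real) \<Rightarrow> (nat \<Rightarrow> 'a \<Rightarrow> 'b) \<Rightarrow> (nat \<Rightarrow> 'a \<Rightarrow> 'c)
    \<Rightarrow> (nat \<Rightarrow> 'a \<Rightarrow> real^'d \<Rightarrow> real) \<Rightarrow> (nat \<Rightarrow> 'a \<Rightarrow> nat)
    \<Rightarrow> (nat \<Rightarrow> 'a \<Rightarrow> nat \<Rightarrow> nat) \<Rightarrow> (nat \<Rightarrow> 'a \<Rightarrow> nat \<Rightarrow> nat)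
    \<Rightarrow> (nat \<Rightarrow> nat \<Rightarrow> 'a \<Rightarrow> bool) \<Rightarrow> bool" where
  "loc_sampling M NP NX \<psi> W \<pi> \<xi> q L a k T \<longleftrightarrow>
     local_randomization M
       (\<lambda>n. sigma_of M (\<lambda>\<omega>. (upto_n \<psi> n \<omega>, \<pi> n \<omega>, \<xi> n \<omega>)) (borel_vec n \<Otimes>\<^sub>M NP n \<Otimes>\<^sub>M NX n))
       (\<lambda>n. sigma_of M (\<lambda>\<omega>. (upto_n W n \<omega>, \<pi> n \<omega>, \<xi> n \<omega>)) (borel_vec n \<Otimes>\<^sub>M NP n \<Otimes>\<^sub>M NX n))
       (\<lambda>n \<omega>. {1..n}) \<psi> q L a k T"

text \<open>\<open>D\<^sub>1\<^sub>:\<^sub>n \<sim> Loc(\<psi>, a/k)\<close> among the units with \<open>T n i = 1\<close>: a single, constant level.\<close>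

definition loc_assignment ::
  "'a measure \<Rightarrow> (nat \<Rightarrow> 'b measure) \<Rightarrow> (nat \<Rightarrow> 'c measure) \<Rightarrow> (nat \<Rightarrow> 'a \<Rightarrow> real^'d)
    \<Rightarrow> (nat \<Rightarrow> 'a \<Rightarrow> (real^'d) \<times> real \<times> real) \<Rightarrow> (nat \<Rightarrow> 'a \<Rightarrow> 'b) \<Rightarrow> (nat \<Rightarrow> 'a \<Rightarrow> 'c)
    \<Rightarrow> (nat \<Rightarrow> nat \<Rightarrow> 'a \<Rightarrow> bool) \<Rightarrow> nat \<Rightarrow> nat \<Rightarrow> (nat \<Rightarrow> nat \<Rightarrow> 'a \<Rightarrow> bool) \<Rightarrow> bool" where
  "loc_assignment M NP NX \<psi> W \<pi> \<xi> T a k D \<longleftrightarrow>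
     local_randomization M
       (\<lambda>n. sigma_of M (\<lambda>\<omega>. (upto_n \<psi> n \<omega>, upto_n (T n) n \<omega>, \<pi> n \<omega>, \<xi> n \<omega>))
              (borel_vec n \<Otimes>\<^sub>M bool_vec n \<Otimes>\<^sub>M NP n \<Otimes>\<^sub>M NX n))
       (\<lambda>n. sigma_of M (\<lambda>\<omega>. (upto_n W n \<omega>, \<pi> n \<omega>, \<xi> n \<omega>, upto_n (T n) n \<omega>))
              (borel_vec n \<Otimes>\<^sub>M NP n \<Otimes>\<^sub>M NX n \<Otimes>\<^sub>M bool_vec n))
       (\<lambda>n \<omega>. {i \<in> {1..n}. T n i \<omega>}) \<psi>
       (\<lambda>_ _ _. real a / real k) (\<lambda>_ _. 1) (\<lambda>_ _ _. a) (\<lambda>_ _ _. k) D"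

section \<open>Propensities, estimator and limit variance\<close>

definition sigma_s :: "real \<Rightarrow> (nat \<Rightarrow> 'v \<Rightarrow> real) \<Rightarrow> 'v \<Rightarrow> real" where
  "sigma_s p s2 x = sqrt (s2 1 x / p + s2 0 x / (1 - p))"

definition q_star ::
  "'v measure \<Rightarrow> real \<Rightarrow> real \<Rightarrow> ('v \<Rightarrow> real) \<Rightarrow> (nat \<Rightarrow> 'v \<Rightarrow> real) \<Rightarrow> 'v \<Rightarrow> real" where
  "q_star P B p C s2 x =
     B * (sigma_s p s2 x / sqrt (C x)) / (\<integral>z. sigma_s p s2 z * sqrt (C z) \<partial>P)"

text \<open>Here \<open>x i\<close>, \<open>i \<in> {1..n}\<close>, are the observed covariates and \<open>s2\<close> are variance estimates.\<close>

definition q_hat ::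
  "nat \<Rightarrow> (nat \<Rightarrow> 'v) \<Rightarrow> real \<Rightarrow> real \<Rightarrow> ('v \<Rightarrow> real) \<Rightarrow> (nat \<Rightarrow> 'v \<Rightarrow> real) \<Rightarrow> 'v \<Rightarrow> real" where
  "q_hat n x B p C s2 y =
     B * (sigma_s p s2 y / sqrt (C y)) /
       ((1 / real n) * (\<Sum>i=1..n. sigma_s p s2 (x i) * sqrt (C (x i))))"

definition observed ::
  "(nat \<Rightarrow> nat \<Rightarrow> 'a \<Rightarrow> real) \<Rightarrow> (nat \<Rightarrow> nat \<Rightarrow> 'a \<Rightarrow> bool) \<Rightarrow> (nat \<Rightarrow> nat \<Rightarrow> 'a \<Rightarrow> bool)
    \<Rightarrow> nat \<Rightarrow> nat \<Rightarrow> 'a \<Rightarrow> real" where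
  "observed Y T D n i \<omega> =
     of_bool (T n i \<omega>) *
       (of_bool (D n i \<omega>) * Y 1 i \<omega> + (1 - of_bool (D n i \<omega>)) * Y 0 i \<omega>)"

definition theta_hat ::
  "real \<Rightarrow> (nat \<Rightarrow> 'a \<Rightarrow> 'v) \<Rightarrow> (nat \<Rightarrow> nat \<Rightarrow> 'a \<Rightarrow> real) \<Rightarrow> (nat \<Rightarrow> 'a \<Rightarrow> 'v \<Rightarrow> real)
    \<Rightarrow> (nat \<Rightarrow> nat \<Rightarrow> 'a \<Rightarrow> bool) \<Rightarrow> (nat \<Rightarrow> nat \<Rightarrow> 'a \<Rightarrow> bool) \<Rightarrow> nat \<Rightarrow> 'a \<Rightarrow> real" where
  "theta_hat p \<psi> Y q T D n \<omega> =
     (1 / real n) * (\<Sum>i=1..n. of_bool (T n i \<omega>) / q n \<omega> (\<psi> i \<omega>) *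
        (of_bool (D n i \<omega>) * observed Y T D n i \<omega> / p -
         (1 - of_bool (D n i \<omega>)) * observed Y T D n i \<omega> / (1 - p)))"

definition feasible :: "'v::topological_space measure \<Rightarrow> real \<Rightarrow> ('v \<Rightarrow> real) \<Rightarrow> ('v \<Rightarrow> real) set" where
  "feasible P B C =
     {q \<in> borel_measurable borel. (\<forall>x. 0 < q x \<and> q x \<le> 1) \<and> (\<integral>x. C x * q x \<partial>P) = B}"

text \<open>\<open>E[\<sigma>\<^sub>s\<^sup>2(\<psi>) / q(\<psi>)]\<close>, with value \<open>\<infinity>\<close> when this expectation diverges.\<close>

definition objective ::
  "'v measure \<Rightarrow> real \<Rightarrow> (nat \<Rightarrow> 'v \<Rightarrow> real) \<Rightarrow> ('v \<Rightarrow> real) \<Rightarrow> ennreal" where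
  "objective P p s2 q = (\<integral>\<^sup>+x. ennreal ((sigma_s p s2 x)\<^sup>2 / q x) \<partial>P)"

end

theory Submission
  imports Defs
begin

text \<open>
  Let \<open>m\<^sub>d(\<psi>) = E[Y(d) | \<psi>]\<close> and \<open>b = m\<^sub>1/p + m\<^sub>0/(1 - p)\<close>. Centering the outcomes splits
  \<open>\<surd>n (\<theta>\<^sub>n - ATE)\<close> into \<open>A = n\<^sup>-\<^sup>1\<^sup>/\<^sup>2 \<Sum>\<^sub>i (c(\<psi>\<^sub>i) - ATE)\<close>, a weighted sum \<open>S\<close> of the residuals
  \<open>Y\<^sub>i(d) - m\<^sub>d(\<psi>\<^sub>i)\<close>, and the imbalances \<open>n\<^sup>-\<^sup>1\<^sup>/\<^sup>2 \<Sum>\<^sub>i c(\<psi>\<^sub>i)/q\<^sub>n(\<psi>\<^sub>i) (T\<^sub>i - q\<^sub>n(\<psi>\<^sub>i))\<close> and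
  \<open>n\<^sup>-\<^sup>1\<^sup>/\<^sup>2 \<Sum>\<^sub>i T\<^sub>i b(\<psi>\<^sub>i)/q\<^sub>n(\<psi>\<^sub>i) (D\<^sub>i - p)\<close>.

  Fixing the number of ones in each full group removes the part of the weights that is constant on
  the group, so the conditional second moment of an imbalance is bounded by the within-group
  variation of the weights, up to the remainder groups. For Lipschitz functions of \<open>\<psi>\<close> that
  variation is at most a constant times the heterogeneity of the partition; since bounded Lipschitz
  functions are dense in mean square, both imbalances vanish.

  Given the covariates and the design, the summands of \<open>S\<close> are independent and centered. Replacing
  them one at a time by Gaussian factors, as in Lindeberg's proof, compares
  \<open>E[exp(is(A + S))]\<close> with \<open>E[exp(isA - s\<^sup>2 V/2)]\<close>, where the conditional variance \<open>V\<close> of \<open>S\<close>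
  converges in probability to the constant \<open>E[\<sigma>\<^sub>s\<^sup>2(\<psi>)/q\<^sup>*(\<psi>)]\<close>; the central limit theorem for \<open>A\<close>
  does the rest. By Cauchy-Schwarz, \<open>E[\<sigma>\<^sub>s(\<psi>) C(\<psi>)\<^sup>1\<^sup>/\<^sup>2]\<^sup>2 \<le> E[\<sigma>\<^sub>s\<^sup>2(\<psi>)/q(\<psi>)] E[C(\<psi>) q(\<psi>)]\<close>, with
  equality for \<open>q = q\<^sup>*\<close>, so this constant is the minimum.
\<close>

section \<open>Convergence in probability to zero\<close>

text \<open>Sampling and assignment of one unit depend on the covariates of all units, so that the
  residuals are independent and centered given the design does not follow from the i.i.d. assumption
  alone. It is reduced to orthogonality. The pair of sampled and assigned sets takes finitely many
  values, and given W, \<pi> and \<xi> the probability of each value is a function of the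
  covariates, \<pi> and \<xi> only. With the value frozen, every factor that multiplies a residual
  of unit j is measurable for the sigma-algebra that omits just the outcomes of j, over which the
  residual has mean zero. The replacement argument uses independence in this form only.

  A second obstacle is that the weights contain the random propensity while the conditional means
  are merely square integrable. Weights are therefore only asked to be close in mean square to
  h(\<psi>)/sqrt n for a fixed h, and limits tolerate an error that is small in mean, as truncation
  and Lipschitz approximation leave one. The variances, in contrast, are bounded: q* \<le> 1 and the
  upper bound on C bound \<sigma>_s.\<close>

definition vanishes :: "'a measure \<Rightarrow> (nat \<Rightarrow> 'a \<Rightarrow> real) \<Rightarrow> bool" where
  "vanishes M X \<longleftrightarrow> (\<forall>n. X n \<in> borel_measurable M) \<and>
     (\<forall>\<epsilon>>0. (\<lambda>n. measure M {\<omega> \<in> space M. \<epsilon> < \<bar>X n \<omega>\<bar>}) \<longlonglongrightarrow> 0)"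

lemma vanishes_measurable: "vanishes M X \<Longrightarrow> X n \<in> borel_measurable M"
  by (simp add: vanishes_def)

lemma vanishesD:
  "vanishes M X \<Longrightarrow> \<epsilon> > 0 \<Longrightarrow> (\<lambda>n. measure M {\<omega> \<in> space M. \<epsilon> < \<bar>X n \<omega>\<bar>}) \<longlonglongrightarrow> 0"
  by (simp add: vanishes_def)

context prob_space
begin

text \<open>An epsilon of room: the dominating pair may depend on \<open>e\<close>, and only
  \<open>U\<close> has to tend to zero in probability, while \<open>V\<close> enters through
  Markov's inequality. The truncation and density arguments below end here, with \<open>V\<close> as
  their approximation error.\<close>

lemma vanishes_approx:
  assumes X: "\<And>n. X n \<in> borel_measurable M"
    and approx: "\<And>e. e > 0 \<Longrightarrow> \<exists>U V. vanishes M U \<and> (\<forall>\<^sub>F n in sequentially.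
        integrable M (V n) \<and> (\<integral>\<omega>. \<bar>V n \<omega>\<bar> \<partial>M) \<le> e \<and> (AE \<omega> in M. \<bar>X n \<omega>\<bar> \<le> \<bar>U n \<omega>\<bar> + \<bar>V n \<omega>\<bar>))"
  shows "vanishes M X"
  unfolding vanishes_def
proof (intro conjI allI impI X)
  fix \<epsilon> :: real assume \<epsilon>: "\<epsilon> > 0"
  show "(\<lambda>n. prob {\<omega> \<in> space M. \<epsilon> < \<bar>X n \<omega>\<bar>}) \<longlonglongrightarrow> 0"
  proof (rule LIMSEQ_I)
    fix r :: real assume r: "r > 0"
    \<comment> \<open>Markov at level \<epsilon> / 2 turns a mean of r * \<epsilon> / 4 into a
      probability of r / 2; \<open>U\<close> takes less than the other half.\<close>
    have "r * \<epsilon> / 4 > 0" using \<epsilon> r by simp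
    from approx[OF this] obtain U V where U: "vanishes M U"
      and ev: "\<forall>\<^sub>F n in sequentially. integrable M (V n) \<and> (\<integral>\<omega>. \<bar>V n \<omega>\<bar> \<partial>M) \<le> r * \<epsilon> / 4 \<and>
        (AE \<omega> in M. \<bar>X n \<omega>\<bar> \<le> \<bar>U n \<omega>\<bar> + \<bar>V n \<omega>\<bar>)" by blast
    have "(\<lambda>n. prob {\<omega> \<in> space M. \<epsilon> / 2 < \<bar>U n \<omega>\<bar>}) \<longlonglongrightarrow> 0"
      by (rule vanishesD[OF U]) (use \<epsilon> in simp)
    then have "\<forall>\<^sub>F n in sequentially. prob {\<omega> \<in> space M. \<epsilon> / 2 < \<bar>U n \<omega>\<bar>} < r / 2"
      by (rule order_tendstoD(2)) (use r in simp)
    with ev have "\<forall>\<^sub>F n in sequentially. prob {\<omega> \<in> space M. \<epsilon> < \<bar>X n \<omega>\<bar>} < r"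
    proof eventually_elim
      case (elim n)
      note [measurable] = X vanishes_measurable[OF U]
      have [measurable]: "V n \<in> borel_measurable M" using elim by auto
      have "prob {\<omega> \<in> space M. \<epsilon> < \<bar>X n \<omega>\<bar>} \<le>
          prob ({\<omega> \<in> space M. \<epsilon> / 2 < \<bar>U n \<omega>\<bar>} \<union> {\<omega> \<in> space M. \<epsilon> / 2 \<le> \<bar>V n \<omega>\<bar>})"
      proof (rule finite_measure_mono_AE)
        have "AE \<omega> in M. \<bar>X n \<omega>\<bar> \<le> \<bar>U n \<omega>\<bar> + \<bar>V n \<omega>\<bar>" using elim by blast
        then show "AE x in M. x \<in> {\<omega> \<in> space M. \<epsilon> < \<bar>X n \<omega>\<bar>} \<longrightarrow>
          x \<in> {\<omega> \<in> space M. \<epsilon> / 2 < \<bar>U n \<omega>\<bar>} \<union> {\<omega> \<in> space M. \<epsilon> / 2 \<le> \<bar>V n \<omega>\<bar>}"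
          by eventually_elim auto
      qed measurable
      also have "\<dots> \<le> prob {\<omega> \<in> space M. \<epsilon> / 2 < \<bar>U n \<omega>\<bar>} + prob {\<omega> \<in> space M. \<epsilon> / 2 \<le> \<bar>V n \<omega>\<bar>}"
        by (rule measure_Un_le) measurable
      also have "prob {\<omega> \<in> space M. \<epsilon> / 2 \<le> \<bar>V n \<omega>\<bar>} \<le> (\<integral>\<omega>. \<bar>V n \<omega>\<bar> \<partial>M) / (\<epsilon> / 2)"
        by (rule integral_Markov_inequality_measure[where A="space M"]) (use elim \<epsilon> in auto)
      also have "\<dots> \<le> (r * \<epsilon> / 4) / (\<epsilon> / 2)"
        by (rule divide_right_mono) (use elim \<epsilon> in auto)
      finally show ?case using elim \<epsilon> by simp
    qed
    then show "\<exists>no. \<forall>n\<ge>no. norm (prob {\<omega> \<in> space M. \<epsilon> < \<bar>X n \<omega>\<bar>} - 0) < r"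
      by (auto simp: eventually_sequentially)
  qed
qed

lemma vanishes_0: "vanishes M (\<lambda>n \<omega>. 0)"
  by (simp add: vanishes_def)

lemma vanishes_mono:
  assumes "\<And>n. X n \<in> borel_measurable M" "vanishes M U"
    and "\<forall>\<^sub>F n in sequentially. AE \<omega> in M. \<bar>X n \<omega>\<bar> \<le> \<bar>U n \<omega>\<bar>"
  shows "vanishes M X"
proof (rule vanishes_approx[OF assms(1)])
  fix e :: real assume "e > 0"
  then show "\<exists>U V. vanishes M U \<and> (\<forall>\<^sub>F n in sequentially.
        integrable M (V n) \<and> (\<integral>\<omega>. \<bar>V n \<omega>\<bar> \<partial>M) \<le> e \<and> (AE \<omega> in M. \<bar>X n \<omega>\<bar> \<le> \<bar>U n \<omega>\<bar> + \<bar>V n \<omega>\<bar>))"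
    using assms by (intro exI[of _ U] exI[of _ "\<lambda>n \<omega>. 0"]) auto
qed

lemma vanishes_L1:
  assumes "\<And>n. X n \<in> borel_measurable M"
    and "\<forall>\<^sub>F n in sequentially. integrable M (X n) \<and> (\<integral>\<omega>. \<bar>X n \<omega>\<bar> \<partial>M) \<le> b n"
    and "b \<longlonglongrightarrow> 0"
  shows "vanishes M X"
proof (rule vanishes_approx[OF assms(1)])
  fix e :: real assume "e > 0"
  then have "\<forall>\<^sub>F n in sequentially. b n < e" using assms(3) order_tendstoD(2) by blast
  with assms(2) have "\<forall>\<^sub>F n in sequentially. integrable M (X n) \<and> (\<integral>\<omega>. \<bar>X n \<omega>\<bar> \<partial>M) \<le> e"
    by eventually_elim auto
  then show "\<exists>U V. vanishes M U \<and> (\<forall>\<^sub>F n in sequentially.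
        integrable M (V n) \<and> (\<integral>\<omega>. \<bar>V n \<omega>\<bar> \<partial>M) \<le> e \<and> (AE \<omega> in M. \<bar>X n \<omega>\<bar> \<le> \<bar>U n \<omega>\<bar> + \<bar>V n \<omega>\<bar>))"
    by (intro exI[of _ "\<lambda>n \<omega>. 0"] exI[of _ X]) (auto simp: vanishes_0)
qed

lemma vanishes_add:
  assumes "vanishes M X" "vanishes M Y"
  shows "vanishes M (\<lambda>n \<omega>. X n \<omega> + Y n \<omega>)"
  unfolding vanishes_def
proof (intro conjI allI impI)
  note [measurable] = assms[THEN vanishes_measurable]
  show "(\<lambda>\<omega>. X n \<omega> + Y n \<omega>) \<in> borel_measurable M" for n by measurable
  fix \<epsilon> :: real assume \<epsilon>: "\<epsilon> > 0"
  have "(\<lambda>n. prob {\<omega> \<in> space M. \<epsilon> / 2 < \<bar>X n \<omega>\<bar>} + prob {\<omega> \<in> space M. \<epsilon> / 2 < \<bar>Y n \<omega>\<bar>}) \<longlonglongrightarrow> 0 + 0"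
    by (intro tendsto_add vanishesD[OF assms(1)] vanishesD[OF assms(2)]) (use \<epsilon> in auto)
  moreover have le: "prob {\<omega> \<in> space M. \<epsilon> < \<bar>X n \<omega> + Y n \<omega>\<bar>} \<le>
      prob {\<omega> \<in> space M. \<epsilon> / 2 < \<bar>X n \<omega>\<bar>} + prob {\<omega> \<in> space M. \<epsilon> / 2 < \<bar>Y n \<omega>\<bar>}" for n
    by (rule order.trans[OF finite_measure_mono measure_Un_le]) auto
  ultimately show "(\<lambda>n. prob {\<omega> \<in> space M. \<epsilon> < \<bar>X n \<omega> + Y n \<omega>\<bar>}) \<longlonglongrightarrow> 0"
    using Lim_null_comparison[OF always_eventually, of "\<lambda>n. prob {\<omega> \<in> space M. \<epsilon> < \<bar>X n \<omega> + Y n \<omega>\<bar>}"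
       "\<lambda>n. prob {\<omega> \<in> space M. \<epsilon> / 2 < \<bar>X n \<omega>\<bar>} + prob {\<omega> \<in> space M. \<epsilon> / 2 < \<bar>Y n \<omega>\<bar>}" sequentially] le
    by (auto simp del: less_divide_eq_numeral1 divide_less_eq_numeral1)
qed

lemma vanishes_cmult:
  assumes "vanishes M X"
  shows "vanishes M (\<lambda>n \<omega>. c * X n \<omega>)"
proof (cases "c = 0")
  case False
  show ?thesis unfolding vanishes_def
  proof (intro conjI allI impI)
    note [measurable] = assms[THEN vanishes_measurable]
    show "(\<lambda>\<omega>. c * X n \<omega>) \<in> borel_measurable M" for n by measurable
    fix \<epsilon> :: real assume "\<epsilon> > 0"
    then have "\<epsilon> / \<bar>c\<bar> > 0" using False by simp
    moreover have "{\<omega> \<in> space M. \<epsilon> < \<bar>c * X n \<omega>\<bar>} = {\<omega> \<in> space M. \<epsilon> / \<bar>c\<bar> < \<bar>X n \<omega>\<bar>}" for n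
      using False by (auto simp: abs_mult field_simps)
    ultimately show "(\<lambda>n. prob {\<omega> \<in> space M. \<epsilon> < \<bar>c * X n \<omega>\<bar>}) \<longlonglongrightarrow> 0"
      using assms by (simp add: vanishes_def)
  qed
qed (simp add: vanishes_0)

lemma vanishes_power2_iff:
  assumes [measurable]: "\<And>n. X n \<in> borel_measurable M"
  shows "vanishes M (\<lambda>n \<omega>. (X n \<omega>)\<^sup>2) \<longleftrightarrow> vanishes M X"
proof -
  have eq: "{\<omega> \<in> space M. e < \<bar>X n \<omega>\<bar>} = {\<omega> \<in> space M. e\<^sup>2 < (X n \<omega>)\<^sup>2}" if "e \<ge> 0" for e n
    using that abs_le_square_iff[of "X n _" e] by (auto simp: not_le[symmetric])
  have "(\<forall>\<epsilon>>0. (\<lambda>n. prob {\<omega> \<in> space M. \<epsilon> < (X n \<omega>)\<^sup>2}) \<longlonglongrightarrow> 0) \<longleftrightarrow>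
    (\<forall>\<epsilon>>0. (\<lambda>n. prob {\<omega> \<in> space M. \<epsilon> < \<bar>X n \<omega>\<bar>}) \<longlonglongrightarrow> 0)" (is "?A \<longleftrightarrow> ?B")
  proof
    assume ?A
    then show ?B using eq by (simp add: zero_less_power2)
  next
    assume B: ?B
    show ?A
    proof (intro allI impI)
      fix \<epsilon> :: real assume "\<epsilon> > 0"
      then have "sqrt \<epsilon> > 0" "(sqrt \<epsilon>)\<^sup>2 = \<epsilon>" by auto
      with B eq[of "sqrt \<epsilon>"] show "(\<lambda>n. prob {\<omega> \<in> space M. \<epsilon> < (X n \<omega>)\<^sup>2}) \<longlonglongrightarrow> 0" by fastforce
    qed
  qed
  then show ?thesis by (simp add: vanishes_def)
qed

text \<open>It suffices to bound \<open>X\<close> on events whose probability tends to one.\<close>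

lemma vanishes_on:
  assumes X: "\<And>n. X n \<in> borel_measurable M" and Y: "vanishes M Y" and U: "vanishes M U" and "c > 0"
    and le: "\<forall>\<^sub>F n in sequentially. AE \<omega> in M. \<bar>Y n \<omega>\<bar> \<le> c \<longrightarrow> \<bar>X n \<omega>\<bar> \<le> \<bar>U n \<omega>\<bar>"
  shows "vanishes M X"
  unfolding vanishes_def
proof (intro conjI allI impI X)
  note [measurable] = X vanishes_measurable[OF Y] vanishes_measurable[OF U]
  fix \<epsilon> :: real assume \<epsilon>: "\<epsilon> > 0"
  have lim: "(\<lambda>n. prob {\<omega> \<in> space M. c < \<bar>Y n \<omega>\<bar>} + prob {\<omega> \<in> space M. \<epsilon> < \<bar>U n \<omega>\<bar>}) \<longlonglongrightarrow> 0 + 0"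
    by (rule tendsto_add) (use Y U \<epsilon> \<open>c > 0\<close> in \<open>auto simp: vanishes_def\<close>)
  have "\<forall>\<^sub>F n in sequentially. prob {\<omega> \<in> space M. \<epsilon> < \<bar>X n \<omega>\<bar>} \<le>
      prob {\<omega> \<in> space M. c < \<bar>Y n \<omega>\<bar>} + prob {\<omega> \<in> space M. \<epsilon> < \<bar>U n \<omega>\<bar>}"
    using le
  proof eventually_elim
    case (elim n)
    have "AE x in M. x \<in> {\<omega> \<in> space M. \<epsilon> < \<bar>X n \<omega>\<bar>} \<longrightarrow>
        x \<in> {\<omega> \<in> space M. c < \<bar>Y n \<omega>\<bar>} \<union> {\<omega> \<in> space M. \<epsilon> < \<bar>U n \<omega>\<bar>}"
      using elim by eventually_elim auto
    then show ?case
      by (rule order.trans[OF finite_measure_mono_AE measure_Un_le]) auto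
  qed
  then have "\<forall>\<^sub>F n in sequentially. norm (prob {\<omega> \<in> space M. \<epsilon> < \<bar>X n \<omega>\<bar>}) \<le>
      prob {\<omega> \<in> space M. c < \<bar>Y n \<omega>\<bar>} + prob {\<omega> \<in> space M. \<epsilon> < \<bar>U n \<omega>\<bar>}" by simp
  from Lim_null_comparison[OF this] lim
  show "(\<lambda>n. prob {\<omega> \<in> space M. \<epsilon> < \<bar>X n \<omega>\<bar>}) \<longlonglongrightarrow> 0" by simp
qed

text \<open>Splits the mean at the level r / 2, the bound \<open>K\<close> being paid only on an
  event of small probability. This is the passage from convergence in probability to characteristic
  functions, whose integrands are bounded.\<close>

lemma vanishes_bounded_L1:
  assumes X: "vanishes M X" and b: "\<And>n. AE \<omega> in M. \<bar>X n \<omega>\<bar> \<le> K"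
  shows "(\<lambda>n. \<integral>\<omega>. \<bar>X n \<omega>\<bar> \<partial>M) \<longlonglongrightarrow> 0"
proof (rule LIMSEQ_I)
  note [measurable] = vanishes_measurable[OF X]
  fix r :: real assume r: "r > 0"
  \<comment> \<open>\<open>K\<close> may be 0, while the threshold r / (2 * K') needs a positive
    bound.\<close>
  define K' where "K' = max K 1"
  have K': "K' > 0" "\<And>n. AE \<omega> in M. \<bar>X n \<omega>\<bar> \<le> K'"
    subgoal by (simp add: K'_def)
    subgoal for n using b[of n] by eventually_elim (auto simp: K'_def)
    done
  have "(\<lambda>n. prob {\<omega> \<in> space M. r / 2 < \<bar>X n \<omega>\<bar>}) \<longlonglongrightarrow> 0"
    by (rule vanishesD[OF X]) (use r in simp)
  then have "\<forall>\<^sub>F n in sequentially. prob {\<omega> \<in> space M. r / 2 < \<bar>X n \<omega>\<bar>} < r / (2 * K')"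
    by (rule order_tendstoD(2)) (use r K' in simp)
  then have "\<forall>\<^sub>F n in sequentially. (\<integral>\<omega>. \<bar>X n \<omega>\<bar> \<partial>M) < r"
  proof eventually_elim
    case (elim n)
    define A where "A = {\<omega> \<in> space M. r / 2 < \<bar>X n \<omega>\<bar>}"
    have A[measurable]: "A \<in> sets M" unfolding A_def by measurable
    have int: "integrable M (\<lambda>\<omega>. \<bar>X n \<omega>\<bar>)"
      by (rule integrable_const_bound[where B=K']) (use K'(2)[of n] in auto)
    have "(\<integral>\<omega>. \<bar>X n \<omega>\<bar> \<partial>M) \<le> (\<integral>\<omega>. r / 2 + K' * indicator A \<omega> \<partial>M)"
    proof (rule integral_mono_AE[OF int])
      show "AE x in M. \<bar>X n x\<bar> \<le> r / 2 + K' * indicator A x"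
        using K'(2)[of n] AE_space by eventually_elim (use r in \<open>auto simp: indicator_def A_def\<close>)
    next
      show "integrable M (\<lambda>\<omega>. r / 2 + K' * indicator A \<omega>)"
        by (rule integrable_const_bound[where B="r + K'"])
           (use r K'(1) in \<open>auto intro!: AE_I2 simp: indicator_def A_def\<close>)
    qed
    also have "\<dots> = r / 2 + K' * prob A"
      by (subst Bochner_Integration.integral_add) (auto simp: prob_space emeasure_eq_measure)
    also have "\<dots> < r / 2 + K' * (r / (2 * K'))"
      using elim K' unfolding A_def by (intro add_strict_left_mono mult_strict_left_mono) auto
    also have "\<dots> = r" using K' by (simp add: field_simps)
    finally show ?case .
  qed
  then show "\<exists>no. \<forall>n\<ge>no. norm ((\<integral>\<omega>. \<bar>X n \<omega>\<bar> \<partial>M) - 0) < r"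
    by (auto simp: eventually_sequentially)
qed

lemma op1_imp_vanishes:
  assumes op: "op1 M (\<lambda>n \<omega>. ennreal (Z n \<omega>))"
    and pos: "\<And>n \<omega>. \<omega> \<in> space M \<Longrightarrow> 0 \<le> Z n \<omega>"
  shows "vanishes M Z"
  unfolding vanishes_def
proof (intro conjI allI impI)
  fix n
  have [measurable]: "(\<lambda>\<omega>. ennreal (Z n \<omega>)) \<in> borel_measurable M"
    using op by (simp add: op1_def)
  \<comment> \<open>Only the extended-real version is known to be measurable; nonnegativity makes
    \<open>enn2real\<close> recover \<open>Z n\<close>.\<close>
  have "(\<lambda>\<omega>. enn2real (ennreal (Z n \<omega>))) \<in> borel_measurable M"
    by (rule borel_measurable_enn2real) measurable
  then show "Z n \<in> borel_measurable M"
    by (subst (asm) measurable_cong[where g="Z n"]) (simp_all add: pos)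
next
  fix \<epsilon> :: real assume "\<epsilon> > 0"
  moreover have "{\<omega> \<in> space M. \<epsilon> < \<bar>Z n \<omega>\<bar>} = {\<omega> \<in> space M. ennreal \<epsilon> < ennreal (Z n \<omega>)}" for n
    using pos \<open>\<epsilon> > 0\<close> by (auto simp: ennreal_less_iff)
  ultimately show "(\<lambda>n. prob {\<omega> \<in> space M. \<epsilon> < \<bar>Z n \<omega>\<bar>}) \<longlonglongrightarrow> 0"
    using op by (simp add: op1_def)
qed

text \<open>A conditional Chebyshev inequality: \<open>B n\<close> bounds the conditional second moment of \<open>X n\<close>
  given \<open>F n\<close>.\<close>

lemma vanishes_cond_second_moment:
  assumes sub: "\<And>n. subalgebra M (F n)"
    and X[measurable]: "\<And>n. X n \<in> borel_measurable M"
    and B: "\<And>n. B n \<in> borel_measurable (F n)" "\<And>n \<omega>. \<omega> \<in> space M \<Longrightarrow> 0 \<le> B n \<omega>" "vanishes M B"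
    and le: "\<And>n S. S \<in> sets (F n) \<Longrightarrow>
      (\<integral>\<^sup>+\<omega>. ennreal ((X n \<omega>)\<^sup>2) * indicator S \<omega> \<partial>M) \<le> (\<integral>\<^sup>+\<omega>. ennreal (B n \<omega>) * indicator S \<omega> \<partial>M)"
  shows "vanishes M X"
  unfolding vanishes_power2_iff[OF X, symmetric]
proof (rule vanishes_approx)
  fix e :: real assume e: "e > 0"
  note [measurable] = B(1)[THEN measurable_from_subalg[OF sub]]
  \<comment> \<open>On \<open>S n\<close> the conditional bound is at most \<open>e\<close>. The
    event lies in \<open>F n\<close>, so the hypothesis may be applied to it and gives mean at most
    \<open>e\<close>. Outside it nothing is known about the size of \<open>X n\<close>, but the
    probability of that part tends to 0.\<close>
  define S where "S n = {\<omega> \<in> space M. \<bar>B n \<omega>\<bar> \<le> e}" for n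
  have sF: "space (F n) = space M" for n using sub by (simp add: subalgebra_def)
  have S: "S n \<in> sets (F n)" for n
    using borel_measurable_le[OF borel_measurable_abs[OF B(1)[of n]] borel_measurable_const[of e]]
    by (simp add: S_def sF)
  then have SM[measurable]: "S n \<in> sets M" for n using sub by (auto simp: subalgebra_def)
  define V where "V n \<omega> = (X n \<omega>)\<^sup>2 * indicator (S n) \<omega>" for n \<omega>
  have V[measurable]: "V n \<in> borel_measurable M" for n unfolding V_def by measurable
  have nnV: "(\<integral>\<^sup>+\<omega>. ennreal (V n \<omega>) \<partial>M) \<le> ennreal e" for n
  proof -
    have "(\<integral>\<^sup>+\<omega>. ennreal (V n \<omega>) \<partial>M) = (\<integral>\<^sup>+\<omega>. ennreal ((X n \<omega>)\<^sup>2) * indicator (S n) \<omega> \<partial>M)"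
      by (intro nn_integral_cong) (auto simp: V_def indicator_def)
    also have "\<dots> \<le> (\<integral>\<^sup>+\<omega>. ennreal (B n \<omega>) * indicator (S n) \<omega> \<partial>M)" by (rule le[OF S])
    also have "\<dots> \<le> (\<integral>\<^sup>+\<omega>. ennreal e \<partial>M)"
      using B(2) by (intro nn_integral_mono) (auto simp: S_def indicator_def ennreal_leI)
    finally show ?thesis by (simp add: emeasure_space_1)
  qed
  have intV: "integrable M (V n)" for n
    by (rule integrableI_nonneg) (use nnV[of n] in \<open>auto simp: V_def intro: order.strict_trans1\<close>)
  have Ve: "(\<integral>\<omega>. \<bar>V n \<omega>\<bar> \<partial>M) \<le> e" for n
  proof -
    have "ennreal (\<integral>\<omega>. \<bar>V n \<omega>\<bar> \<partial>M) = (\<integral>\<^sup>+\<omega>. ennreal \<bar>V n \<omega>\<bar> \<partial>M)"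
      using intV by (intro nn_integral_eq_integral[symmetric]) auto
    also have "\<dots> = (\<integral>\<^sup>+\<omega>. ennreal (V n \<omega>) \<partial>M)" by (intro nn_integral_cong) (auto simp: V_def)
    finally have "ennreal (\<integral>\<omega>. \<bar>V n \<omega>\<bar> \<partial>M) \<le> ennreal e" using nnV[of n] by simp
    then show ?thesis using e by (subst (asm) ennreal_le_iff) auto
  qed
  define U where "U n \<omega> = (X n \<omega>)\<^sup>2 * indicator (space M - S n) \<omega>" for n \<omega>
  have U: "vanishes M U"
  proof (rule vanishes_on[where c=e])
    show "U n \<in> borel_measurable M" for n unfolding U_def by measurable
    show "\<forall>\<^sub>F n in sequentially. AE \<omega> in M. \<bar>B n \<omega>\<bar> \<le> e \<longrightarrow> \<bar>U n \<omega>\<bar> \<le> \<bar>(\<lambda>_ _. 0) n \<omega>\<bar>"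
      by (intro always_eventually allI AE_I2) (auto simp: U_def S_def)
  qed (use e vanishes_0 B in auto)
  show "\<exists>U V. vanishes M U \<and> (\<forall>\<^sub>F n in sequentially. integrable M (V n) \<and> (\<integral>\<omega>. \<bar>V n \<omega>\<bar> \<partial>M) \<le> e \<and>
          (AE \<omega> in M. \<bar>(X n \<omega>)\<^sup>2\<bar> \<le> \<bar>U n \<omega>\<bar> + \<bar>V n \<omega>\<bar>))"
    by (intro exI[of _ U] exI[of _ V] conjI U always_eventually allI intV Ve AE_I2)
       (auto simp: U_def V_def indicator_def)
qed measurable

end

section \<open>Approximation in mean square by bounded Lipschitz functions\<close>

text \<open>The two bounds serve the two kinds of groups: the Lipschitz bound turns variation within
  a full group into heterogeneity of the partition, boundedness controls the remainder groups, where
  nothing is centered.\<close>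

definition bl_fun :: "('v::metric_space \<Rightarrow> real) \<Rightarrow> bool" where
  "bl_fun f \<longleftrightarrow> f \<in> borel_measurable borel \<and> (\<exists>K. \<forall>x. \<bar>f x\<bar> \<le> K) \<and>
     (\<exists>l. \<forall>x y. \<bar>f x - f y\<bar> \<le> l * dist x y)"

lemma bl_fun_add:
  assumes "bl_fun f" "bl_fun g" shows "bl_fun (\<lambda>x. f x + g x)"
proof -
  obtain K l where f: "f \<in> borel_measurable borel" "\<And>x. \<bar>f x\<bar> \<le> K" "\<And>x y. \<bar>f x - f y\<bar> \<le> l * dist x y"
    using assms by (auto simp: bl_fun_def)
  obtain K' l' where g: "g \<in> borel_measurable borel" "\<And>x. \<bar>g x\<bar> \<le> K'" "\<And>x y. \<bar>g x - g y\<bar> \<le> l' * dist x y"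
    using assms by (auto simp: bl_fun_def)
  have "\<bar>f x + g x\<bar> \<le> K + K'" for x using f(2)[of x] g(2)[of x] by linarith
  moreover have "\<bar>(f x + g x) - (f y + g y)\<bar> \<le> (l + l') * dist x y" for x y
    using f(3)[of x y] g(3)[of x y] unfolding distrib_right by linarith
  ultimately show ?thesis using f(1) g(1) unfolding bl_fun_def by (auto intro!: borel_measurable_add)
qed

lemma bl_fun_cmult:
  assumes "bl_fun f" shows "bl_fun (\<lambda>x. c * f x)"
proof -
  obtain K l where f: "f \<in> borel_measurable borel" "\<And>x. \<bar>f x\<bar> \<le> K" "\<And>x y. \<bar>f x - f y\<bar> \<le> l * dist x y"
    using assms by (auto simp: bl_fun_def)
  have "\<bar>c * f x\<bar> \<le> \<bar>c\<bar> * K" for x using f(2)[of x] by (simp add: abs_mult mult_left_mono)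
  moreover have "\<bar>c * f x - c * f y\<bar> \<le> (\<bar>c\<bar> * l) * dist x y" for x y
    using mult_left_mono[OF f(3)[of x y], of "\<bar>c\<bar>"]
    by (simp add: abs_mult[symmetric] right_diff_distrib mult.assoc)
  ultimately show ?thesis using f(1) unfolding bl_fun_def by (auto intro!: borel_measurable_times)
qed

lemma nn_integral_square_diff_le:
  assumes [measurable]: "f \<in> borel_measurable M" "g \<in> borel_measurable M" "h \<in> borel_measurable M"
  shows "(\<integral>\<^sup>+x. ennreal ((f x - h x)\<^sup>2) \<partial>M) \<le>
     2 * (\<integral>\<^sup>+x. ennreal ((f x - g x)\<^sup>2) \<partial>M) + 2 * (\<integral>\<^sup>+x. ennreal ((g x - h x)\<^sup>2) \<partial>M)"
proof -
  have "(a - c)\<^sup>2 \<le> 2 * (a - b)\<^sup>2 + 2 * (b - c)\<^sup>2" for a b c :: real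
    using sum_squares_bound[of "a - b" "b - c"] by (auto simp: power2_eq_square algebra_simps)
  then have "(\<integral>\<^sup>+x. ennreal ((f x - h x)\<^sup>2) \<partial>M) \<le>
      (\<integral>\<^sup>+x. 2 * ennreal ((f x - g x)\<^sup>2) + 2 * ennreal ((g x - h x)\<^sup>2) \<partial>M)"
    by (intro nn_integral_mono)
      (simp add: ennreal_plus[symmetric] ennreal_mult'[symmetric] ennreal_numeral[symmetric]
        del: ennreal_plus ennreal_numeral)
  also have "\<dots> = 2 * (\<integral>\<^sup>+x. ennreal ((f x - g x)\<^sup>2) \<partial>M) + 2 * (\<integral>\<^sup>+x. ennreal ((g x - h x)\<^sup>2) \<partial>M)"
    by (simp add: nn_integral_add nn_integral_cmult)
  finally show ?thesis .
qed

text \<open>Regularity is used twice: a compact \<open>K\<close> inside \<open>A\<close>, then an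
  open \<open>U\<close> around \<open>K\<close>, each losing at most e / 2. The tent function that
  is 1 on \<open>K\<close> and 0 off \<open>U\<close> differs from the indicator of \<open>A\<close>
  only on A - K and U - K. Choosing \<open>U\<close> around \<open>K\<close> and not around
  \<open>A\<close> matters: a compact set has positive distance to a disjoint closed set, and that
  distance gives the Lipschitz constant.\<close>

lemma bl_fun_approx_indicator:
  fixes P :: "'v::euclidean_space measure"
  assumes P: "finite_measure P" "sets P = sets borel" and A: "A \<in> sets borel" and e: "e > 0"
  shows "\<exists>f. bl_fun f \<and> (\<integral>\<^sup>+x. ennreal ((indicator A x - f x)\<^sup>2) \<partial>P) \<le> ennreal e"
proof -
  interpret finite_measure P by fact
  have [measurable_cong]: "sets P = sets borel" by fact
  have fin: "emeasure P (space P) \<noteq> \<infinity>" by simp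
  have sp: "space P = UNIV" using sets_eq_imp_space_eq[OF P(2)] by simp
  have "emeasure P A < emeasure P A + ennreal (e / 2)"
    using e by (simp add: ennreal_add_left_cancel_less emeasure_eq_measure)
  have ePA: "emeasure P A + ennreal (e/2) > emeasure P A" by fact
  have "\<exists>K\<in>{K. K \<subseteq> A \<and> compact K}. emeasure P A < emeasure P K + ennreal (e / 2)"
  proof (rule ccontr)
    assume "\<not> ?thesis"
    then have *: "emeasure P K + ennreal (e / 2) \<le> emeasure P A" if "K \<subseteq> A" "compact K" for K
      using that by (auto simp: not_less)
    have "emeasure P A \<le> ennreal (measure P A - e / 2)"
      unfolding inner_regular[OF P(2) fin A]
    proof (rule SUP_least)
      fix K assume "K \<in> {K. K \<subseteq> A \<and> compact K}"
      then have "ennreal (measure P K + e / 2) \<le> ennreal (measure P A)"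
        using *[of K] e by (subst ennreal_plus) (auto simp: emeasure_eq_measure)
      then have "measure P K + e / 2 \<le> measure P A"
        by (subst (asm) ennreal_le_iff) auto
      then show "emeasure P K \<le> ennreal (measure P A - e / 2)"
        using e by (simp add: emeasure_eq_measure ennreal_leI)
    qed
    \<comment> \<open>The empty compact set yields e / 2 \<le> \<open>measure P A\<close>; otherwise
      \<open>ennreal\<close> could truncate the difference above to 0 and there would be no
      contradiction.\<close>
    moreover have "emeasure P {} + ennreal (e / 2) \<le> emeasure P A" by (rule *) auto
    ultimately show False using e by (simp add: emeasure_eq_measure)
  qed
  then obtain K where K: "K \<subseteq> A" "compact K" "emeasure P A < emeasure P K + ennreal (e / 2)" by auto
  have "emeasure P K < emeasure P K + ennreal (e / 2)"
    using e by (simp add: ennreal_add_left_cancel_less emeasure_eq_measure)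
  moreover have Kb[measurable]: "K \<in> sets borel" by (rule borel_closed[OF compact_imp_closed[OF K(2)]])
  ultimately obtain U where U: "K \<subseteq> U" "open U" "emeasure P U < emeasure P K + ennreal (e / 2)"
    using outer_regular[OF P(2) fin Kb] by (auto simp: INF_less_iff)
  have [measurable]: "U \<in> sets borel" using U(2) by simp
  have "K \<inter> - U = {}" "closed (- U)" using U by auto
  then obtain d where d: "d > 0" "\<And>x y. x \<in> K \<Longrightarrow> y \<notin> U \<Longrightarrow> d \<le> dist x y"
    using separate_compact_closed[OF K(2), of "- U"] by auto
  \<comment> \<open>\<open>infdist\<close> to the empty set is 0 by convention, which would make the
    tent function 1 everywhere; hence the separate case.\<close>
  define f where "f x = (if K = {} then 0 else max 0 (1 - infdist x K / d))" for x
  have f01: "0 \<le> f x" "f x \<le> 1" for x using d by (auto simp: f_def infdist_nonneg)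
  have f1: "f x = 1" if "x \<in> K" for x using that by (auto simp: f_def)
  have f0: "f x = 0" if "x \<notin> U" for x
  proof (cases "K = {}")
    case False
    have "d \<le> infdist x K"
      unfolding infdist_notempty[OF False]
    proof (rule cINF_greatest[OF False])
      fix y assume "y \<in> K" then show "d \<le> dist x y" using d(2)[of y x] that by (simp add: dist_commute)
    qed
    then show ?thesis using d(1) by (auto simp: f_def field_simps)
  qed (simp add: f_def)
  have cont: "continuous_on UNIV f"
  proof (cases "K = {}")
    case False
    have "continuous_on UNIV (\<lambda>x. max 0 (1 - infdist x K / d))"
      by (intro continuous_intros) (use d in auto)
    then show ?thesis using False by (simp add: f_def[abs_def])
  qed (simp add: f_def)
  then have [measurable]: "f \<in> borel_measurable borel" by (rule borel_measurable_continuous_onI)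
  have lip: "\<bar>f x - f y\<bar> \<le> (1 / d) * dist x y" for x y
  proof (cases "K = {}")
    case False
    have "\<bar>infdist x K - infdist y K\<bar> \<le> dist x y"
      using infdist_triangle[of x K y] infdist_triangle[of y K x] by (auto simp: dist_commute)
    then have "\<bar>(infdist x K - infdist y K) / d\<bar> \<le> dist x y / d"
      unfolding abs_divide using d(1) by (simp add: divide_right_mono)
    then have "\<bar>max 0 (1 - infdist x K / d) - max 0 (1 - infdist y K / d)\<bar> \<le> dist x y / d"
      unfolding diff_divide_distrib by (simp only: abs_le_iff max_def split: if_split) linarith
    then show ?thesis using False by (simp add: f_def)
  qed (use d in \<open>simp add: f_def\<close>)
  have "\<bar>f x\<bar> \<le> 1" for x using f01[of x] by simp
  then have "bl_fun f" unfolding bl_fun_def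
    using lip by (intro conjI exI[of _ 1] exI[of _ "1 / d"] allI) auto
  moreover have "(\<integral>\<^sup>+x. ennreal ((indicator A x - f x)\<^sup>2) \<partial>P) \<le> ennreal e"
  proof -
    have "(\<integral>\<^sup>+x. ennreal ((indicator A x - f x)\<^sup>2) \<partial>P) \<le>
        (\<integral>\<^sup>+x. indicator (A - K) x + indicator (U - K) x \<partial>P)"
    proof (rule nn_integral_mono)
      fix x
      have "f x \<le> 1" "0 \<le> f x" using f01 by auto
      then have "(1 - f x)\<^sup>2 \<le> 1" "(f x)\<^sup>2 \<le> 1"
        by (auto simp: abs_square_le_1)
      moreover from this have "ennreal ((1 - f x)\<^sup>2) \<le> ennreal 2"
        by (intro ennreal_leI) simp
      ultimately show "ennreal ((indicator A x - f x)\<^sup>2) \<le> indicator (A - K) x + indicator (U - K) x"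
        using f1[of x] f0[of x] K(1) U(1)
        by (cases "x \<in> A"; cases "x \<in> K"; cases "x \<in> U")
           (auto simp: subset_iff ennreal_le_1)
    qed
    also have "\<dots> = emeasure P (A - K) + emeasure P (U - K)"
      using A by (subst nn_integral_add) auto
    also have "\<dots> \<le> ennreal (e / 2) + ennreal (e / 2)"
    proof (rule add_mono)
      have "emeasure P (A - K) = ennreal (measure P A - measure P K)"
        using A K(1) Kb P(2) by (simp add: emeasure_eq_measure finite_measure_Diff)
      moreover have "measure P A - measure P K \<le> e / 2"
        using K(3) e by (simp add: emeasure_eq_measure ennreal_plus[symmetric] ennreal_less_iff del: ennreal_plus)
      ultimately show "emeasure P (A - K) \<le> ennreal (e / 2)" by (simp add: ennreal_leI)
      have "emeasure P (U - K) = ennreal (measure P U - measure P K)"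
        using U(1) Kb P(2) by (simp add: emeasure_eq_measure finite_measure_Diff)
      moreover have "measure P U - measure P K \<le> e / 2"
        using U(3) e by (simp add: emeasure_eq_measure ennreal_plus[symmetric] ennreal_less_iff del: ennreal_plus)
      ultimately show "emeasure P (U - K) \<le> ennreal (e / 2)" by (simp add: ennreal_leI)
    qed
    also have "\<dots> = ennreal e" using e by (simp add: ennreal_plus[symmetric] del: ennreal_plus)
    finally show ?thesis .
  qed
  ultimately show ?thesis by blast
qed

text \<open>The approximable functions contain the indicators and are closed under sums, multiples
  and mean-square limits, so induction over nonnegative measurable functions reaches every one with
  finite second moment; positive and negative parts do the rest.\<close>

theorem bl_fun_dense_L2:
  fixes P :: "'v::euclidean_space measure" and h :: "'v \<Rightarrow> real"
  assumes P: "finite_measure P" "sets P = sets borel"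
    and h: "h \<in> borel_measurable borel" "(\<integral>\<^sup>+x. ennreal ((h x)\<^sup>2) \<partial>P) < \<infinity>" and e: "e > 0"
  shows "\<exists>f. bl_fun f \<and> (\<integral>\<^sup>+x. ennreal ((h x - f x)\<^sup>2) \<partial>P) \<le> ennreal e"
proof -
  interpret finite_measure P by fact
  have [measurable_cong]: "sets P = sets borel" by fact
  define good where "good h \<longleftrightarrow> (\<forall>e>0. \<exists>f. bl_fun f \<and> (\<integral>\<^sup>+x. ennreal ((h x - f x)\<^sup>2) \<partial>P) \<le> ennreal e)"
    for h :: "'v \<Rightarrow> real"
  \<comment> \<open>The squared triangle inequality doubles each of the two errors, so both are kept
    at e / 4.\<close>
  have four: "2 * ennreal (e / 4) + 2 * ennreal (e / 4) = ennreal (2 * (e / 4) + 2 * (e / 4))"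
    if "e > 0" for e :: real
  proof -
    have "2 * ennreal (e / 4) = ennreal 2 * ennreal (e / 4)" by simp
    also have "\<dots> = ennreal (2 * (e / 4))" by (rule ennreal_mult'[symmetric]) simp
    finally show ?thesis using that by (simp add: ennreal_plus[symmetric] del: ennreal_plus)
  qed
  have goodD: "\<exists>f. bl_fun f \<and> f \<in> borel_measurable P \<and> (\<integral>\<^sup>+x. ennreal ((h x - f x)\<^sup>2) \<partial>P) \<le> ennreal e"
    if "good h" "e > 0" for h e
  proof -
    obtain f where "bl_fun f" "(\<integral>\<^sup>+x. ennreal ((h x - f x)\<^sup>2) \<partial>P) \<le> ennreal e"
      using \<open>good h\<close> \<open>e > 0\<close> unfolding good_def by blast
    then show ?thesis
      by (auto simp: bl_fun_def measurable_cong_sets[OF P(2) refl] intro!: exI[of _ f])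
  qed
  have good_approx: "good h" if [measurable]: "h \<in> borel_measurable borel"
    and *: "\<And>e. e > 0 \<Longrightarrow> \<exists>g\<in>borel_measurable borel. good g \<and> (\<integral>\<^sup>+x. ennreal ((h x - g x)\<^sup>2) \<partial>P) \<le> ennreal e" for h
    unfolding good_def
  proof (intro allI impI)
    fix e :: real assume e: "e > 0"
    then have e4: "e / 4 > 0" by simp
    obtain g where [measurable]: "g \<in> borel_measurable borel" and "good g"
      and 1: "(\<integral>\<^sup>+x. ennreal ((h x - g x)\<^sup>2) \<partial>P) \<le> ennreal (e / 4)" using *[OF e4] by blast
    from goodD[OF \<open>good g\<close> e4] obtain f where f: "bl_fun f" and [measurable]: "f \<in> borel_measurable P"
      and 2: "(\<integral>\<^sup>+x. ennreal ((g x - f x)\<^sup>2) \<partial>P) \<le> ennreal (e / 4)" by blast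
    have "(\<integral>\<^sup>+x. ennreal ((h x - f x)\<^sup>2) \<partial>P) \<le> 2 * ennreal (e / 4) + 2 * ennreal (e / 4)"
      by (rule order.trans[OF nn_integral_square_diff_le[of _ _ g] add_mono[OF mult_left_mono[OF 1]
          mult_left_mono[OF 2]]]) auto
    also have "\<dots> = ennreal (2 * (e / 4) + 2 * (e / 4))"
      by (rule four[OF e])
    finally show "\<exists>f. bl_fun f \<and> (\<integral>\<^sup>+x. ennreal ((h x - f x)\<^sup>2) \<partial>P) \<le> ennreal e"
      using f by auto
  qed
  have good_add: "good (\<lambda>x. v x + u x)" if uv[measurable]: "u \<in> borel_measurable borel" "v \<in> borel_measurable borel"
    and g: "good u" "good v" for u v
    unfolding good_def
  proof (intro allI impI)
    fix e :: real assume e: "e > 0"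
    then have e4: "e / 4 > 0" by simp
    obtain f where f: "bl_fun f" and [measurable]: "f \<in> borel_measurable P"
      and 1: "(\<integral>\<^sup>+x. ennreal ((u x - f x)\<^sup>2) \<partial>P) \<le> ennreal (e / 4)" using goodD[OF g(1) e4] by blast
    obtain f' where f': "bl_fun f'" and [measurable]: "f' \<in> borel_measurable P"
      and 2: "(\<integral>\<^sup>+x. ennreal ((v x - f' x)\<^sup>2) \<partial>P) \<le> ennreal (e / 4)" using goodD[OF g(2) e4] by blast
    have "(\<integral>\<^sup>+x. ennreal (((v x + u x) - (f' x + f x))\<^sup>2) \<partial>P) \<le>
        2 * (\<integral>\<^sup>+x. ennreal (((v x + u x) - (v x + f x))\<^sup>2) \<partial>P) + 2 * (\<integral>\<^sup>+x. ennreal (((v x + f x) - (f' x + f x))\<^sup>2) \<partial>P)"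
      by (rule nn_integral_square_diff_le) auto
    also have "\<dots> \<le> 2 * ennreal (e / 4) + 2 * ennreal (e / 4)"
      using 1 2 by (intro add_mono mult_left_mono) auto
    also have "\<dots> = ennreal (2 * (e / 4) + 2 * (e / 4))"
      by (rule four[OF e])
    finally show "\<exists>f. bl_fun f \<and> (\<integral>\<^sup>+x. ennreal (((v x + u x) - f x)\<^sup>2) \<partial>P) \<le> ennreal e"
      using bl_fun_add[OF f' f] by auto
  qed
  have good_cmult: "good (\<lambda>x. c * u x)" if [measurable]: "u \<in> borel_measurable borel" and g: "good u" for u c
    unfolding good_def
  proof (intro allI impI)
    fix e :: real assume e: "e > 0"
    define e' where "e' = e / (c\<^sup>2 + 1)"
    have c1: "c\<^sup>2 + 1 > 0" by (simp add: add_nonneg_pos)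
    have e': "e' > 0" using e c1 by (simp add: e'_def)
    obtain f where f: "bl_fun f" and [measurable]: "f \<in> borel_measurable P"
      and 1: "(\<integral>\<^sup>+x. ennreal ((u x - f x)\<^sup>2) \<partial>P) \<le> ennreal e'" using goodD[OF g e'] by blast
    have "(\<integral>\<^sup>+x. ennreal ((c * u x - c * f x)\<^sup>2) \<partial>P) = (\<integral>\<^sup>+x. ennreal (c\<^sup>2) * ennreal ((u x - f x)\<^sup>2) \<partial>P)"
      by (simp add: ennreal_mult'[symmetric] right_diff_distrib[symmetric] power_mult_distrib)
    also have "\<dots> = ennreal (c\<^sup>2) * (\<integral>\<^sup>+x. ennreal ((u x - f x)\<^sup>2) \<partial>P)"
      by (rule nn_integral_cmult) auto
    also have "\<dots> \<le> ennreal (c\<^sup>2) * ennreal e'" by (rule mult_left_mono[OF 1]) simp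
    also have "\<dots> = ennreal (c\<^sup>2 * e')" by (simp add: ennreal_mult')
    also have "c\<^sup>2 * e' \<le> e" using e c1 by (simp add: e'_def field_simps)
    finally show "\<exists>f. bl_fun f \<and> (\<integral>\<^sup>+x. ennreal ((c * u x - f x)\<^sup>2) \<partial>P) \<le> ennreal e"
      using bl_fun_cmult[OF f, of c] e by (auto simp: ennreal_leI order.trans)
  qed
  \<comment> \<open>The finite second moment is kept as a premise inside the induction: each
    constituent lies below the function built from it, up to a nonzero factor, and so inherits
    it.\<close>
  have good_nonneg: "(\<integral>\<^sup>+x. ennreal ((u x)\<^sup>2) \<partial>P) < \<infinity> \<longrightarrow> good u"
    if "u \<in> borel_measurable borel" "\<And>x. 0 \<le> u x" for u
    using that
  proof (induction rule: borel_measurable_induct_real)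
    case (set A)
    then show ?case unfolding good_def using bl_fun_approx_indicator[OF P] by auto
  next
    case (mult u c)
    show ?case
    proof (cases "c = 0")
      case True
      then show ?thesis using bl_fun_approx_indicator[OF P, of "{}"] by (auto simp: good_def)
    next
      case False
      have [measurable]: "u \<in> borel_measurable borel" by fact
      have "(\<integral>\<^sup>+x. ennreal ((c * u x)\<^sup>2) \<partial>P) = ennreal (c\<^sup>2) * (\<integral>\<^sup>+x. ennreal ((u x)\<^sup>2) \<partial>P)"
        by (subst nn_integral_cmult[symmetric]) (auto simp: ennreal_mult'[symmetric] power_mult_distrib)
      then show ?thesis
        using mult.IH False good_cmult[OF mult.hyps(2), of c] by (auto simp: ennreal_mult_less_top)
    qed
  next
    case (add u v)
    have [measurable]: "u \<in> borel_measurable borel" "v \<in> borel_measurable borel" by fact+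
    have "(u x)\<^sup>2 \<le> (v x + u x)\<^sup>2" "(v x)\<^sup>2 \<le> (v x + u x)\<^sup>2" for x
      using add.hyps by (auto intro!: power_mono)
    then have "(\<integral>\<^sup>+x. ennreal ((u x)\<^sup>2) \<partial>P) \<le> (\<integral>\<^sup>+x. ennreal ((v x + u x)\<^sup>2) \<partial>P)"
      "(\<integral>\<^sup>+x. ennreal ((v x)\<^sup>2) \<partial>P) \<le> (\<integral>\<^sup>+x. ennreal ((v x + u x)\<^sup>2) \<partial>P)"
      by (auto intro!: nn_integral_mono ennreal_leI)
    then show ?case using add.IH good_add[of u v] by (auto dest: order.strict_trans1)
  next
    case (seq U)
    have [measurable]: "U i \<in> borel_measurable borel" "u \<in> borel_measurable borel" for i using seq that(1) by auto
    have lim: "(\<lambda>i. U i x) \<longlonglongrightarrow> u x" for x using seq by simp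
    have Uu: "U i x \<le> u x" for i x
      using incseq_le[OF _ lim, of x i] \<open>incseq U\<close> by (auto simp: incseq_def le_fun_def)
    show ?case
    proof
      assume fin: "(\<integral>\<^sup>+x. ennreal ((u x)\<^sup>2) \<partial>P) < \<infinity>"
      have gU: "good (U i)" for i
      proof -
        have "(\<integral>\<^sup>+x. ennreal ((U i x)\<^sup>2) \<partial>P) \<le> (\<integral>\<^sup>+x. ennreal ((u x)\<^sup>2) \<partial>P)"
          using Uu seq by (intro nn_integral_mono ennreal_leI power_mono) auto
        with fin seq.IH show ?thesis by (auto dest: order.strict_trans1)
      qed
      have "(\<lambda>i. \<integral>\<^sup>+x. ennreal ((u x - U i x)\<^sup>2) \<partial>P) \<longlonglongrightarrow> (\<integral>\<^sup>+x. ennreal 0 \<partial>P)"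
      proof (rule nn_integral_dominated_convergence[where w="\<lambda>x. ennreal ((u x)\<^sup>2)"])
        show "AE x in P. ennreal ((u x - U j x)\<^sup>2) \<le> ennreal ((u x)\<^sup>2)" for j
          using Uu seq by (intro AE_I2 ennreal_leI power_mono) auto
        show "AE x in P. (\<lambda>i. ennreal ((u x - U i x)\<^sup>2)) \<longlonglongrightarrow> ennreal 0"
        proof (intro AE_I2 tendsto_ennrealI)
          fix x
          have "(\<lambda>i. (u x - U i x)\<^sup>2) \<longlonglongrightarrow> (u x - u x)\<^sup>2" by (intro tendsto_intros lim)
          then show "(\<lambda>i. (u x - U i x)\<^sup>2) \<longlonglongrightarrow> 0" by simp
        qed
      qed (use fin in auto)
      then have lim0: "(\<lambda>i. \<integral>\<^sup>+x. ennreal ((u x - U i x)\<^sup>2) \<partial>P) \<longlonglongrightarrow> 0" by simp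
      show "good u"
      proof (rule good_approx)
        fix e :: real assume "e > 0"
        then have "\<forall>\<^sub>F i in sequentially. (\<integral>\<^sup>+x. ennreal ((u x - U i x)\<^sup>2) \<partial>P) < ennreal e"
          using order_tendstoD(2)[OF lim0] by simp
        then obtain i where "(\<integral>\<^sup>+x. ennreal ((u x - U i x)\<^sup>2) \<partial>P) < ennreal e"
          by (auto simp: eventually_sequentially)
        then show "\<exists>g\<in>borel_measurable borel. good g \<and> (\<integral>\<^sup>+x. ennreal ((u x - g x)\<^sup>2) \<partial>P) \<le> ennreal e"
          using gU[of i] by (intro bexI[of _ "U i"]) auto
      qed simp
    qed
  qed
  have [measurable]: "h \<in> borel_measurable borel" by fact
  define hp hm where "hp = (\<lambda>x. max (h x) 0)" and "hm = (\<lambda>x. max (- h x) 0)"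
  have m[measurable]: "hp \<in> borel_measurable borel" "hm \<in> borel_measurable borel"
    by (auto simp: hp_def hm_def)
  have "(\<integral>\<^sup>+x. ennreal ((hp x)\<^sup>2) \<partial>P) \<le> (\<integral>\<^sup>+x. ennreal ((h x)\<^sup>2) \<partial>P)"
    "(\<integral>\<^sup>+x. ennreal ((hm x)\<^sup>2) \<partial>P) \<le> (\<integral>\<^sup>+x. ennreal ((h x)\<^sup>2) \<partial>P)"
    by (auto intro!: nn_integral_mono simp: hp_def hm_def max_def)
  then have "good hp" "good hm"
    using good_nonneg[OF m(1)] good_nonneg[OF m(2)] h(2)
    by (auto simp: hp_def hm_def dest: order.strict_trans1)
  then have "good (\<lambda>x. hp x + (- 1) * hm x)" by (intro good_add good_cmult) auto
  also have "(\<lambda>x. hp x + (- 1) * hm x) = h" by (auto simp: hp_def hm_def max_def)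
  finally show ?thesis using e by (simp add: good_def)
qed

text \<open>The Doob-Dynkin lemma. It makes conditional expectations functions of \<psi> and, for
  the design, allows a prescribed vector to be substituted for the realized one.\<close>

lemma measurable_vimage_algebra_factor:
  fixes f :: "'a \<Rightarrow> real"
  assumes X: "X \<in> \<Omega> \<rightarrow> space N" and f: "f \<in> borel_measurable (vimage_algebra \<Omega> X N)"
  shows "\<exists>g\<in>borel_measurable N. \<forall>\<omega>\<in>\<Omega>. f \<omega> = g (X \<omega>)"
proof -
  have fact: "\<exists>g\<in>borel_measurable N. \<forall>\<omega>\<in>\<Omega>. u \<omega> = g (X \<omega>)"
    if "u \<in> borel_measurable (vimage_algebra \<Omega> X N)" for u :: "'a \<Rightarrow> ennreal"
    using that
  proof (induction rule: borel_measurable_induct)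
    case (cong f g)
    then show ?case by simp
  next
    case (set A)
    then obtain B where "B \<in> sets N" "A = X -` B \<inter> \<Omega>" using sets_vimage_algebra2[OF X] by auto
    then show ?case by (intro bexI[of _ "indicator B"]) (auto simp: indicator_def)
  next
    case (mult u c)
    then obtain g where "g \<in> borel_measurable N" "\<forall>\<omega>\<in>\<Omega>. u \<omega> = g (X \<omega>)" by blast
    then show ?case by (intro bexI[of _ "\<lambda>x. c * g x"]) auto
  next
    case (add u v)
    then obtain g g' where "g \<in> borel_measurable N" "\<forall>\<omega>\<in>\<Omega>. u \<omega> = g (X \<omega>)"
      "g' \<in> borel_measurable N" "\<forall>\<omega>\<in>\<Omega>. v \<omega> = g' (X \<omega>)" by blast
    then show ?case by (intro bexI[of _ "\<lambda>x. g' x + g x"]) auto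
  next
    case (seq U)
    then obtain g where "\<And>i. g i \<in> borel_measurable N" "\<And>i. \<forall>\<omega>\<in>\<Omega>. U i \<omega> = g i (X \<omega>)"
      by metis
    then show ?case by (intro bexI[of _ "\<lambda>x. SUP i. g i x"]) (auto simp: image_comp)
  qed
  obtain g where g: "g \<in> borel_measurable N" "\<forall>\<omega>\<in>\<Omega>. ennreal (f \<omega>) = g (X \<omega>)"
    using fact[of "\<lambda>\<omega>. ennreal (f \<omega>)"] f by auto
  obtain g' where g': "g' \<in> borel_measurable N" "\<forall>\<omega>\<in>\<Omega>. ennreal (- f \<omega>) = g' (X \<omega>)"
    using fact[of "\<lambda>\<omega>. ennreal (- f \<omega>)"] f by auto
  have eq: "t = enn2real (ennreal t) - enn2real (ennreal (- t))" for t :: real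
    by (cases "t \<ge> 0") (auto simp: ennreal_neg)
  show ?thesis
  proof (rule bexI[of _ "\<lambda>x. enn2real (g x) - enn2real (g' x)"])
    show "\<forall>\<omega>\<in>\<Omega>. f \<omega> = enn2real (g (X \<omega>)) - enn2real (g' (X \<omega>))"
      using g(2) g'(2) eq by metis
  qed (use g(1) g'(1) in measurable)
qed

section \<open>Second moments of stratified randomization\<close>

lemma sum_Pow_Un_disjoint:
  assumes "A \<inter> B = {}" "finite A" "finite B"
  shows "(\<Sum>t\<in>Pow (A \<union> B). F (t \<inter> A) (t \<inter> B)) = (\<Sum>s\<in>Pow A. \<Sum>r\<in>Pow B. (F s r :: real))"
  unfolding sum.cartesian_product
  by (rule sum.reindex_bij_witness[where i="\<lambda>(s, r). s \<union> r" and j="\<lambda>t. (t \<inter> A, t \<inter> B)"])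
     (use assms in \<open>auto simp: Int_Un_distrib2 Int_absorb2 Int_absorb1
        intro: arg_cong2[where f=F]\<close>)

text \<open>A binary vector is encoded as the set of its ones, a law as a weight on subsets. For a
  product law the second moments of centered sums add, because the cross term is a product of two
  means that are zero.\<close>

lemma moments_combine:
  fixes \<mu> \<nu> f h :: "'i set \<Rightarrow> real"
  assumes AB: "A \<inter> B = {}" "finite A" "finite B"
    and \<mu>: "(\<Sum>s\<in>Pow A. \<mu> s) = 1" "(\<Sum>s\<in>Pow A. \<mu> s * f s) = 0"
    and \<nu>: "(\<Sum>s\<in>Pow B. \<nu> s) = 1" "(\<Sum>s\<in>Pow B. \<nu> s * h s) = 0"
  shows "(\<Sum>t\<in>Pow (A \<union> B). \<mu> (t \<inter> A) * \<nu> (t \<inter> B)) = 1"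
    "(\<Sum>t\<in>Pow (A \<union> B). \<mu> (t \<inter> A) * \<nu> (t \<inter> B) * (f (t \<inter> A) + h (t \<inter> B))) = 0"
    "(\<Sum>t\<in>Pow (A \<union> B). \<mu> (t \<inter> A) * \<nu> (t \<inter> B) * (f (t \<inter> A) + h (t \<inter> B))\<^sup>2) =
       (\<Sum>s\<in>Pow A. \<mu> s * (f s)\<^sup>2) + (\<Sum>s\<in>Pow B. \<nu> s * (h s)\<^sup>2)"
proof -
  have prod: "(\<Sum>s\<in>Pow A. \<Sum>r\<in>Pow B. u s * v r) = (\<Sum>s\<in>Pow A. u s) * (\<Sum>r\<in>Pow B. v r)"
    for u v :: "'i set \<Rightarrow> real" by (simp add: sum_product)
  show "(\<Sum>t\<in>Pow (A \<union> B). \<mu> (t \<inter> A) * \<nu> (t \<inter> B)) = 1"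
    by (subst sum_Pow_Un_disjoint[OF AB]) (simp add: prod \<mu> \<nu>)
  have "(\<Sum>t\<in>Pow (A \<union> B). \<mu> (t \<inter> A) * \<nu> (t \<inter> B) * (f (t \<inter> A) + h (t \<inter> B))) =
      (\<Sum>s\<in>Pow A. \<Sum>r\<in>Pow B. (\<mu> s * f s) * \<nu> r) + (\<Sum>s\<in>Pow A. \<Sum>r\<in>Pow B. \<mu> s * (\<nu> r * h r))"
    by (subst sum_Pow_Un_disjoint[OF AB, of "\<lambda>s r. \<mu> s * \<nu> r * (f s + h r)"])
       (simp add: sum.distrib[symmetric] algebra_simps)
  then show "(\<Sum>t\<in>Pow (A \<union> B). \<mu> (t \<inter> A) * \<nu> (t \<inter> B) * (f (t \<inter> A) + h (t \<inter> B))) = 0"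
    by (simp only: prod \<mu> \<nu>)
  have "(\<Sum>t\<in>Pow (A \<union> B). \<mu> (t \<inter> A) * \<nu> (t \<inter> B) * (f (t \<inter> A) + h (t \<inter> B))\<^sup>2) =
      (\<Sum>s\<in>Pow A. \<Sum>r\<in>Pow B. (\<mu> s * (f s)\<^sup>2) * \<nu> r) + (\<Sum>s\<in>Pow A. \<Sum>r\<in>Pow B. \<mu> s * (\<nu> r * (h r)\<^sup>2))
      + 2 * (\<Sum>s\<in>Pow A. \<Sum>r\<in>Pow B. (\<mu> s * f s) * (\<nu> r * h r))"
    by (subst sum_Pow_Un_disjoint[OF AB, of "\<lambda>s r. \<mu> s * \<nu> r * (f s + h r)\<^sup>2"])
       (simp add: sum.distrib[symmetric] sum_distrib_left algebra_simps power2_eq_square)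
  then show "(\<Sum>t\<in>Pow (A \<union> B). \<mu> (t \<inter> A) * \<nu> (t \<inter> B) * (f (t \<inter> A) + h (t \<inter> B))\<^sup>2) =
       (\<Sum>s\<in>Pow A. \<mu> s * (f s)\<^sup>2) + (\<Sum>s\<in>Pow B. \<nu> s * (h s)\<^sup>2)"
    by (simp add: prod \<mu> \<nu>)
qed

text \<open>Induction on the number of groups: those already included act as a single block with
  product weight, to which the next group is joined.\<close>

lemma moments_partition:
  fixes \<mu> f :: "'i set \<Rightarrow> 'i set \<Rightarrow> real"
  assumes "finite G" "disjoint G" "\<And>g. g \<in> G \<Longrightarrow> finite g"
    and "\<And>g. g \<in> G \<Longrightarrow> (\<Sum>s\<in>Pow g. \<mu> g s) = 1" "\<And>g. g \<in> G \<Longrightarrow> (\<Sum>s\<in>Pow g. \<mu> g s * f g s) = 0"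
  shows "(\<Sum>t\<in>Pow (\<Union>G). \<Prod>g\<in>G. \<mu> g (t \<inter> g)) = 1 \<and>
    (\<Sum>t\<in>Pow (\<Union>G). (\<Prod>g\<in>G. \<mu> g (t \<inter> g)) * (\<Sum>g\<in>G. f g (t \<inter> g))) = 0 \<and>
    (\<Sum>t\<in>Pow (\<Union>G). (\<Prod>g\<in>G. \<mu> g (t \<inter> g)) * (\<Sum>g\<in>G. f g (t \<inter> g))\<^sup>2) =
       (\<Sum>g\<in>G. \<Sum>s\<in>Pow g. \<mu> g s * (f g s)\<^sup>2)"
  using assms
proof (induction G rule: finite_induct)
  case (insert a G)
  have dis: "a \<inter> \<Union>G = {}" using insert.prems(1) insert.hyps by (auto simp: disjoint_def)
  have fin: "finite a" "finite (\<Union>G)" using insert by auto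
  have sub: "t \<inter> g = (t \<inter> \<Union>G) \<inter> g" if "g \<in> G" for t g using that by auto
  have IH: "(\<Sum>t\<in>Pow (\<Union>G). \<Prod>g\<in>G. \<mu> g (t \<inter> g)) = 1"
    "(\<Sum>t\<in>Pow (\<Union>G). (\<Prod>g\<in>G. \<mu> g (t \<inter> g)) * (\<Sum>g\<in>G. f g (t \<inter> g))) = 0"
    "(\<Sum>t\<in>Pow (\<Union>G). (\<Prod>g\<in>G. \<mu> g (t \<inter> g)) * (\<Sum>g\<in>G. f g (t \<inter> g))\<^sup>2) =
       (\<Sum>g\<in>G. \<Sum>s\<in>Pow g. \<mu> g s * (f g s)\<^sup>2)"
    using insert.IH insert.prems by (auto simp: disjoint_def)
  define \<nu> h where "\<nu> t = (\<Prod>g\<in>G. \<mu> g (t \<inter> g))" and "h t = (\<Sum>g\<in>G. f g (t \<inter> g))" for t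
  have 1: "(\<Prod>g\<in>insert a G. \<mu> g (t \<inter> g)) = \<mu> a (t \<inter> a) * \<nu> (t \<inter> \<Union>G)" for t
  proof -
    have "(\<Prod>g\<in>G. \<mu> g (t \<inter> g)) = \<nu> (t \<inter> \<Union>G)"
      unfolding \<nu>_def by (intro prod.cong refl) (metis sub)
    then show ?thesis using insert.hyps by simp
  qed
  have 2: "(\<Sum>g\<in>insert a G. f g (t \<inter> g)) = f a (t \<inter> a) + h (t \<inter> \<Union>G)" for t
  proof -
    have "(\<Sum>g\<in>G. f g (t \<inter> g)) = h (t \<inter> \<Union>G)"
      unfolding h_def by (intro sum.cong refl) (metis sub)
    then show ?thesis using insert.hyps by simp
  qed
  have \<nu>: "(\<Sum>t\<in>Pow (\<Union>G). \<nu> t) = 1" "(\<Sum>t\<in>Pow (\<Union>G). \<nu> t * h t) = 0"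
    "(\<Sum>t\<in>Pow (\<Union>G). \<nu> t * (h t)\<^sup>2) = (\<Sum>g\<in>G. \<Sum>s\<in>Pow g. \<mu> g s * (f g s)\<^sup>2)"
    using IH by (simp_all add: \<nu>_def h_def)
  have \<mu>: "(\<Sum>s\<in>Pow a. \<mu> a s) = 1" "(\<Sum>s\<in>Pow a. \<mu> a s * f a s) = 0" using insert.prems by auto
  note mc = moments_combine[OF dis fin \<mu> \<nu>(1,2)]
  show ?case unfolding 1 2 Union_insert using mc \<nu>(3) insert.hyps by simp
qed simp

text \<open>Removing \<open>s\<close> is a bijection onto the subsets of g - s with a - card s
  elements. If a < card s, truncated subtraction would make the binomial coefficient 1, hence the
  case distinction.\<close>

lemma card_subsets_containing:
  assumes "finite g" "s \<subseteq> g"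
  shows "card {t. s \<subseteq> t \<and> t \<subseteq> g \<and> card t = a} =
    (if card s \<le> a then (card g - card s) choose (a - card s) else 0)"
proof (cases "card s \<le> a")
  case True
  have fs: "finite s" using assms finite_subset by auto
  have "bij_betw (\<lambda>t. t - s) {t. s \<subseteq> t \<and> t \<subseteq> g \<and> card t = a} {t. t \<subseteq> g - s \<and> card t = a - card s}"
  proof (rule bij_betwI[where g="\<lambda>t. t \<union> s"])
    show "(\<lambda>t. t \<union> s) \<in> {t. t \<subseteq> g - s \<and> card t = a - card s} \<rightarrow> {t. s \<subseteq> t \<and> t \<subseteq> g \<and> card t = a}"
    proof (intro Pi_I CollectI conjI)
      fix t assume t: "t \<in> {t. t \<subseteq> g - s \<and> card t = a - card s}"
      have "finite t" using t assms by (auto intro: finite_subset)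
      then have "card (t \<union> s) = card t + card s" using t fs by (intro card_Un_disjoint) auto
      then show "card (t \<union> s) = a" using t True by simp
    qed (use assms in auto)
  qed (use assms fs in \<open>auto simp: card_Diff_subset\<close>)
  then have "card {t. s \<subseteq> t \<and> t \<subseteq> g \<and> card t = a} = card {t. t \<subseteq> g - s \<and> card t = a - card s}"
    by (rule bij_betw_same_card)
  then show ?thesis using True assms fs by (simp add: n_subsets card_Diff_subset)
next
  case False
  have "{t. s \<subseteq> t \<and> t \<subseteq> g \<and> card t = a} = {}"
  proof (intro equals0I)
    fix t assume "t \<in> {t. s \<subseteq> t \<and> t \<subseteq> g \<and> card t = a}"
    then have "card s \<le> a" using card_mono[of t s] finite_subset[OF _ assms(1)] by auto
    then show False using False by simp
  qed
  then show ?thesis using False by (simp only: if_False card.empty)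
qed

text \<open>Centering is free because \<open>\<Sum>\<^sub>i t\<^sub>i\<close> is constant; for centered weights only the diagonal terms survive.\<close>

lemma moments_fixed_size:
  fixes x :: "'i \<Rightarrow> real"
  assumes g: "finite g" "g \<noteq> {}" and a: "a \<le> card g"
  defines "S \<equiv> {t. t \<subseteq> g \<and> card t = a}"
  defines "f \<equiv> (\<lambda>t. \<Sum>i\<in>g. x i * (of_bool (i \<in> t) - real a / real (card g)))"
  shows "(\<Sum>t\<in>S. f t) = 0"
    and "(\<Sum>t\<in>S. (f t)\<^sup>2) \<le> real (card S) * (\<Sum>i\<in>g. (x i - (\<Sum>j\<in>g. x j) / real (card g))\<^sup>2)"
proof -
  have S: "finite S" using g by (auto simp: S_def intro: finite_subset[of _ "Pow g"])
  have k: "real (card g) > 0" using g by (simp add: card_gt_0_iff)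
  \<comment> \<open>The numbers of sets in \<open>S\<close> that contain one, respectively two,
    prescribed elements; by symmetry they do not depend on which elements these are. Divided by
    \<open>card S\<close> they are the first and second inclusion probabilities.\<close>
  define c1 where "c1 = real (if 1 \<le> a then (card g - 1) choose (a - 1) else 0)"
  define c2 where "c2 = real (if 2 \<le> a then (card g - 2) choose (a - 2) else 0)"
  have C1: "(\<Sum>t\<in>S. of_bool (i \<in> t)) = c1" if "i \<in> g" for i
  proof -
    have "(\<Sum>t\<in>S. of_bool (i \<in> t)) = real (card {t\<in>S. i \<in> t})"
      using S by (simp add: of_bool_def sum.If_cases Int_def)
    also have "{t\<in>S. i \<in> t} = {t. {i} \<subseteq> t \<and> t \<subseteq> g \<and> card t = a}" by (auto simp: S_def)
    also have "real (card \<dots>) = c1" using card_subsets_containing[of g "{i}" a] g that by (auto simp: c1_def)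
    finally show ?thesis .
  qed
  have C2: "(\<Sum>t\<in>S. of_bool (i \<in> t) * of_bool (j \<in> t)) = c2" if "i \<in> g" "j \<in> g" "i \<noteq> j" for i j
  proof -
    have "(\<Sum>t\<in>S. of_bool (i \<in> t) * of_bool (j \<in> t)) = (\<Sum>t\<in>S. of_bool (i \<in> t \<and> j \<in> t) :: real)"
      by (intro sum.cong) auto
    also have "\<dots> = real (card {t\<in>S. i \<in> t \<and> j \<in> t})"
      using S by (simp add: of_bool_def sum.If_cases Int_def)
    also have "{t\<in>S. i \<in> t \<and> j \<in> t} = {t. {i, j} \<subseteq> t \<and> t \<subseteq> g \<and> card t = a}" by (auto simp: S_def)
    also have "real (card \<dots>) = c2" using card_subsets_containing[of g "{i, j}" a] g that
        by (auto simp: c2_def numeral_2_eq_2)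
    finally show ?thesis .
  qed
  have sum_t: "(\<Sum>i\<in>g. of_bool (i \<in> t)) = real a" if "t \<in> S" for t
    using that g by (auto simp: S_def of_bool_def sum.If_cases Int_absorb1 Int_absorb2)
  have "real (card g) * c1 = (\<Sum>i\<in>g. \<Sum>t\<in>S. of_bool (i \<in> t))" using C1 by simp
  also have "\<dots> = (\<Sum>t\<in>S. \<Sum>i\<in>g. of_bool (i \<in> t))" by (rule sum.swap)
  also have "\<dots> = real (card S) * real a" using sum_t by simp
  finally have kc1: "c1 = real (card S) * (real a / real (card g))" using k by (simp add: field_simps)
  have "(\<Sum>t\<in>S. f t) = (\<Sum>i\<in>g. x i * ((\<Sum>t\<in>S. of_bool (i \<in> t)) - real (card S) * (real a / real (card g))))"
    unfolding f_def by (subst sum.swap) (simp add: sum_distrib_left[symmetric] sum_subtractf)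
  also have "\<dots> = 0" using C1 kc1 by simp
  finally show "(\<Sum>t\<in>S. f t) = 0" .
  define y where "y i = x i - (\<Sum>j\<in>g. x j) / real (card g)" for i
  have y0: "(\<Sum>i\<in>g. y i) = 0" using k by (simp add: y_def sum_subtractf)
  have fy: "f t = (\<Sum>i\<in>g. y i * of_bool (i \<in> t))" if "t \<in> S" for t
  proof -
    define m q where "m = (\<Sum>j\<in>g. x j) / real (card g)" and "q = real a / real (card g)"
    have "f t = (\<Sum>i\<in>g. (y i + m) * (of_bool (i \<in> t) - q))"
      by (simp add: f_def y_def m_def q_def)
    also have "\<dots> = (\<Sum>i\<in>g. y i * of_bool (i \<in> t)) - q * (\<Sum>i\<in>g. y i) + m * (\<Sum>i\<in>g. of_bool (i \<in> t)) - real (card g) * (m * q)"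
      by (simp add: algebra_simps sum.distrib sum_subtractf sum_distrib_left)
    also have "\<dots> = (\<Sum>i\<in>g. y i * of_bool (i \<in> t))"
      using y0 sum_t[OF that] k by (simp add: q_def)
    finally show ?thesis .
  qed
  have "(\<Sum>t\<in>S. (f t)\<^sup>2) = (\<Sum>t\<in>S. \<Sum>i\<in>g. \<Sum>j\<in>g. y i * y j * (of_bool (i \<in> t) * of_bool (j \<in> t)))"
    by (intro sum.cong refl) (simp add: fy power2_eq_square sum_product algebra_simps)
  also have "\<dots> = (\<Sum>i\<in>g. \<Sum>j\<in>g. y i * y j * (\<Sum>t\<in>S. of_bool (i \<in> t) * of_bool (j \<in> t)))"
    by (subst sum.swap, intro sum.cong refl, subst sum.swap) (simp add: sum_distrib_left)
  \<comment> \<open>Splitting off \<open>c2\<close> from the diagonal makes the remaining double sum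
    a constant times the square of the sum of the y i, which is 0.\<close>
  also have "\<dots> = (\<Sum>i\<in>g. \<Sum>j\<in>g. y i * y j * c2 + (if j = i then (y i)\<^sup>2 * (c1 - c2) else 0))"
  proof (intro sum.cong refl)
    fix i j assume ij: "i \<in> g" "j \<in> g"
    show "y i * y j * (\<Sum>t\<in>S. of_bool (i \<in> t) * of_bool (j \<in> t)) =
      y i * y j * c2 + (if j = i then (y i)\<^sup>2 * (c1 - c2) else 0)"
    proof (cases "i = j")
      case True
      have "(\<Sum>t\<in>S. of_bool (j \<in> t) * of_bool (j \<in> t)) = (\<Sum>t\<in>S. of_bool (j \<in> t) :: real)"
        by (intro sum.cong) auto
      then show ?thesis using True C1[OF ij(2)] by (simp add: power2_eq_square algebra_simps)
    qed (use C2[OF ij] in auto)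
  qed
  also have "\<dots> = c2 * (\<Sum>i\<in>g. y i) * (\<Sum>j\<in>g. y j) + (c1 - c2) * (\<Sum>i\<in>g. (y i)\<^sup>2)"
    using g by (simp add: sum.distrib sum_subtractf sum_product sum_distrib_left sum_distrib_right algebra_simps)
  also have "\<dots> \<le> real (card S) * (\<Sum>i\<in>g. (y i)\<^sup>2)"
  proof -
    have "c1 \<le> real (card S) * 1" unfolding kc1 using a k by (intro mult_left_mono) auto
    then have "c1 - c2 \<le> real (card S)" by (simp add: c2_def)
    then show ?thesis by (simp add: y0 mult_right_mono sum_nonneg)
  qed
  finally show "(\<Sum>t\<in>S. (f t)\<^sup>2) \<le> real (card S) * (\<Sum>i\<in>g. (x i - (\<Sum>j\<in>g. x j) / real (card g))\<^sup>2)"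
    by (simp add: y_def)
qed

text \<open>Independent coins are the case of a partition into singletons, so additivity over groups
  gives all three claims; the factor q * (1 - q) is simply bounded by 1.\<close>

lemma moments_bernoulli:
  fixes x :: "'i \<Rightarrow> real"
  assumes g: "finite g" and q: "0 \<le> q" "q \<le> 1"
  defines "\<mu> \<equiv> (\<lambda>t. \<Prod>i\<in>g. if i \<in> t then q else 1 - q)"
  defines "f \<equiv> (\<lambda>t. \<Sum>i\<in>g. x i * (of_bool (i \<in> t) - q))"
  shows "(\<Sum>t\<in>Pow g. \<mu> t) = 1" "(\<Sum>t\<in>Pow g. \<mu> t * f t) = 0"
    "(\<Sum>t\<in>Pow g. \<mu> t * (f t)\<^sup>2) \<le> (\<Sum>i\<in>g. (x i)\<^sup>2)"
proof -
  define G where "G = (\<lambda>i. {i}) ` g"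
  define m where "m h s = (if s = {} then 1 - q else q)" for h s :: "'i set"
  define \<phi> where "\<phi> h s = x (the_elem h) * (of_bool (s \<noteq> {}) - q)" for h s :: "'i set"
  have U: "\<Union>G = g" by (auto simp: G_def)
  have inj: "inj_on (\<lambda>i. {i}) g" by (auto simp: inj_on_def)
  have P: "(\<Prod>h\<in>G. m h (t \<inter> h)) = \<mu> t" for t
    unfolding G_def prod.reindex[OF inj] \<mu>_def by (intro prod.cong) (auto simp: m_def)
  have F: "(\<Sum>h\<in>G. \<phi> h (t \<inter> h)) = f t" for t
    unfolding G_def sum.reindex[OF inj] f_def by (intro sum.cong) (auto simp: \<phi>_def)
  have Pow1: "Pow {i} = {{}, {i}}" for i :: 'i by auto
  have S: "(\<Sum>h\<in>G. \<Sum>s\<in>Pow h. m h s * (\<phi> h s)\<^sup>2) = (\<Sum>i\<in>g. q * (1 - q) * (x i)\<^sup>2)"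
    unfolding G_def sum.reindex[OF inj]
    by (intro sum.cong) (auto simp: Pow1 m_def \<phi>_def power2_eq_square algebra_simps)
  have "(\<Sum>t\<in>Pow (\<Union>G). \<Prod>h\<in>G. m h (t \<inter> h)) = 1 \<and>
    (\<Sum>t\<in>Pow (\<Union>G). (\<Prod>h\<in>G. m h (t \<inter> h)) * (\<Sum>h\<in>G. \<phi> h (t \<inter> h))) = 0 \<and>
    (\<Sum>t\<in>Pow (\<Union>G). (\<Prod>h\<in>G. m h (t \<inter> h)) * (\<Sum>h\<in>G. \<phi> h (t \<inter> h))\<^sup>2) =
       (\<Sum>h\<in>G. \<Sum>s\<in>Pow h. m h s * (\<phi> h s)\<^sup>2)"
    by (rule moments_partition)
       (use g in \<open>auto simp: G_def disjoint_def Pow1 m_def \<phi>_def algebra_simps\<close>)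
  then have *: "(\<Sum>t\<in>Pow g. \<mu> t) = 1" "(\<Sum>t\<in>Pow g. \<mu> t * f t) = 0"
    "(\<Sum>t\<in>Pow g. \<mu> t * (f t)\<^sup>2) = (\<Sum>i\<in>g. q * (1 - q) * (x i)\<^sup>2)"
    unfolding P F U S by auto
  show "(\<Sum>t\<in>Pow g. \<mu> t) = 1" "(\<Sum>t\<in>Pow g. \<mu> t * f t) = 0" by fact+
  have "q * (1 - q) \<le> 1 * 1" using q by (intro mult_mono) auto
  then have "q * (1 - q) * (x i)\<^sup>2 \<le> 1 * (x i)\<^sup>2" for i by (intro mult_right_mono) auto
  then show "(\<Sum>t\<in>Pow g. \<mu> t * (f t)\<^sup>2) \<le> (\<Sum>i\<in>g. (x i)\<^sup>2)"
    unfolding *(3) by (intro sum_mono) simp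
qed

text \<open>A full group has fixed size \<open>a\<close> and pays only for variation within the
  group. Coins do not fix the number of ones, so a remainder group pays for the full second moment
  of its weights. With a \<le> k the fixed-size law has nonempty support and the Bernoulli parameter
  is at most 1.\<close>

lemma group_pmf_moments:
  fixes x :: "nat \<Rightarrow> real"
  assumes g: "finite g" "g \<noteq> {}" and ak: "card g \<le> k" "a \<le> k"
  defines "\<mu> \<equiv> (\<lambda>t. pmf (group_pmf a k g) (\<lambda>i. i \<in> t))"
  defines "f \<equiv> (\<lambda>t. \<Sum>i\<in>g. x i * (of_bool (i \<in> t) - real a / real k))"
  shows "(\<Sum>t\<in>Pow g. \<mu> t) = 1" "(\<Sum>t\<in>Pow g. \<mu> t * f t) = 0"
    "(\<Sum>t\<in>Pow g. \<mu> t * (f t)\<^sup>2) \<le>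
      (if card g = k then \<Sum>i\<in>g. (x i - (\<Sum>j\<in>g. x j) / real (card g))\<^sup>2 else \<Sum>i\<in>g. (x i)\<^sup>2)"
proof -
  have "(\<Sum>t\<in>Pow g. \<mu> t) = 1 \<and> (\<Sum>t\<in>Pow g. \<mu> t * f t) = 0 \<and> (\<Sum>t\<in>Pow g. \<mu> t * (f t)\<^sup>2) \<le>
      (if card g = k then \<Sum>i\<in>g. (x i - (\<Sum>j\<in>g. x j) / real (card g))\<^sup>2 else \<Sum>i\<in>g. (x i)\<^sup>2)"
  proof (cases "card g = k")
    case True
    define S where "S = {t. t \<subseteq> g \<and> card t = a}"
    have finS: "finite S" using g by (auto simp: S_def intro: finite_subset[of _ "Pow g"])
    have cS: "real (card S) > 0"
      unfolding S_def n_subsets[OF g(1)] using ak True by (simp add: zero_less_binomial)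
    \<comment> \<open>The uniform law lives on boolean functions, the moments on sets; this
      injection transcribes one into the other.\<close>
    have inj: "inj_on (\<lambda>s i. i \<in> s) S" by (auto simp: inj_on_def fun_eq_iff)
    have S': "{t. {i. t i} \<subseteq> g \<and> card {i. t i} = a} = (\<lambda>s i. i \<in> s) ` S" (is "?S' = _")
    proof safe
      fix t assume "{i. t i} \<subseteq> g" "a = card {i. t i}"
      then show "t \<in> (\<lambda>s i. i \<in> s) ` S" if "a = card {i. t i}"
        by (intro image_eqI[of _ _ "{i. t i}"]) (auto simp: S_def)
    qed (auto simp: S_def)
    have \<mu>: "\<mu> t = (if t \<in> S then 1 / real (card S) else 0)" for t
    proof -
      have "\<mu> t = indicator ((\<lambda>s i. i \<in> s) ` S) (\<lambda>i. i \<in> t) / real (card ((\<lambda>s i. i \<in> s) ` S))"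
        unfolding \<mu>_def group_pmf_def S' using True pmf_of_set[OF _ finite_imageI[OF finS], of "\<lambda>s i. i \<in> s" "\<lambda>i. i \<in> t"] cS
            by (cases "S = {}") auto
      moreover have "(\<lambda>i. i \<in> t) \<in> (\<lambda>s i. i \<in> s) ` S \<longleftrightarrow> t \<in> S"
        by (auto simp: image_iff fun_eq_iff) (metis set_eqI)
      ultimately show ?thesis using card_image[OF inj] by (simp add: indicator_def)
    qed
    have sum\<mu>: "(\<Sum>t\<in>Pow g. \<mu> t * F t) = (\<Sum>t\<in>S. F t) / real (card S)" for F
    proof -
      have "(\<Sum>t\<in>Pow g. \<mu> t * F t) = (\<Sum>t\<in>S. \<mu> t * F t)"
        using g by (intro sum.mono_neutral_right) (auto simp: S_def \<mu>)
      also have "\<dots> = (\<Sum>t\<in>S. F t / real (card S))" by (intro sum.cong) (auto simp: \<mu>)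
      finally show ?thesis by (simp add: sum_divide_distrib)
    qed
    have "a \<le> card g" using True ak by simp
    note mf = moments_fixed_size[OF g this, of x, unfolded S_def[symmetric], unfolded True]
    have f: "f t = (\<Sum>i\<in>g. x i * (of_bool (i \<in> t) - real a / real k))" for t by (simp add: f_def)
    have "(\<Sum>t\<in>Pow g. \<mu> t * 1) = 1" unfolding sum\<mu> using cS by simp
    moreover have "(\<Sum>t\<in>Pow g. \<mu> t * f t) = 0" unfolding sum\<mu> f using mf(1) by simp
    moreover have "(\<Sum>t\<in>Pow g. \<mu> t * (f t)\<^sup>2) \<le> (\<Sum>i\<in>g. (x i - (\<Sum>j\<in>g. x j) / real k)\<^sup>2)"
      unfolding sum\<mu> f using mf(2) cS by (simp add: field_simps)
    ultimately show ?thesis using True by simp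
  next
    case False
    define q where "q = real a / real k"
    have q: "0 \<le> q" "q \<le> 1" using ak by (auto simp: q_def divide_le_eq_1)
    have \<mu>: "\<mu> t = (\<Prod>i\<in>g. if i \<in> t then q else 1 - q)" if "t \<in> Pow g" for t
    proof -
      have "\<mu> t = (\<Prod>i\<in>g. pmf (bernoulli_pmf q) (i \<in> t))"
        unfolding \<mu>_def group_pmf_def using False g that by (auto simp: pmf_Pi q_def)
      also have "\<dots> = (\<Prod>i\<in>g. if i \<in> t then q else 1 - q)"
        using q by (intro prod.cong) auto
      finally show ?thesis .
    qed
    have eq: "(\<Sum>t\<in>Pow g. \<mu> t * F t) = (\<Sum>t\<in>Pow g. (\<Prod>i\<in>g. if i \<in> t then q else 1 - q) * F t)" for F
      by (intro sum.cong refl) (simp only: \<mu>)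
    have f: "f = (\<lambda>t. \<Sum>i\<in>g. x i * (of_bool (i \<in> t) - q))" by (simp only: f_def q_def)
    note mb = moments_bernoulli(1)[OF g(1) q] moments_bernoulli(2)[OF g(1) q, of x] moments_bernoulli(3)[OF g(1) q, of x]
    have "(\<Sum>t\<in>Pow g. \<mu> t * 1) = 1" unfolding eq using mb(1) by (simp only: mult_1_right)
    moreover have "(\<Sum>t\<in>Pow g. \<mu> t * f t) = 0" unfolding eq f by (rule mb(2))
    moreover have "(\<Sum>t\<in>Pow g. \<mu> t * (f t)\<^sup>2) \<le> (\<Sum>i\<in>g. (x i)\<^sup>2)" unfolding eq f by (rule mb(3))
    ultimately show ?thesis using False by (simp only: if_False mult_1_right simp_thms)
  qed
  then show "(\<Sum>t\<in>Pow g. \<mu> t) = 1" "(\<Sum>t\<in>Pow g. \<mu> t * f t) = 0"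
    "(\<Sum>t\<in>Pow g. \<mu> t * (f t)\<^sup>2) \<le>
      (if card g = k then \<Sum>i\<in>g. (x i - (\<Sum>j\<in>g. x j) / real (card g))\<^sup>2 else \<Sum>i\<in>g. (x i)\<^sup>2)"
    by blast+
qed

text \<open>The price of one group in the conditional variance of an imbalance. Whether it is
  centered is decided by \<open>card g = k\<close>, the same test that \<open>group_pmf\<close> uses
  to choose the law.\<close>

definition stratum_bound :: "(nat \<Rightarrow> real) \<Rightarrow> nat \<Rightarrow> nat set \<Rightarrow> real" where
  "stratum_bound x k g =
    (if card g = k then \<Sum>i\<in>g. (x i - (\<Sum>j\<in>g. x j) / real (card g))\<^sup>2 else \<Sum>i\<in>g. (x i)\<^sup>2)"

lemma stratum_bound_nonneg: "0 \<le> stratum_bound x k g"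
  by (auto simp: stratum_bound_def intro: sum_nonneg)

text \<open>The groups are independent and each contributes a centered sum, so the second moment
  over the partition is the sum of those of the groups.\<close>

lemma stratified_second_moment:
  fixes x q :: "nat \<Rightarrow> real"
  assumes G: "partition_on U G" "finite U"
    and ak: "\<And>g. g \<in> G \<Longrightarrow> card g \<le> k g \<and> a g \<le> k g"
    and q: "\<And>g i. g \<in> G \<Longrightarrow> i \<in> g \<Longrightarrow> q i = real (a g) / real (k g)"
  shows "(\<Sum>t\<in>Pow U. (\<Prod>g\<in>G. pmf (group_pmf (a g) (k g) g) (\<lambda>i. i \<in> g \<and> i \<in> t)) *
      (\<Sum>i\<in>U. x i * (of_bool (i \<in> t) - q i))\<^sup>2) \<le> (\<Sum>g\<in>G. stratum_bound x (k g) g)"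
proof -
  have U: "\<Union>G = U" and dis: "disjoint G" and ne: "{} \<notin> G"
    using G(1) by (auto simp: partition_on_def)
  have finG: "finite G" using G by (rule finite_elements[rotated])
  have fin: "finite g" if "g \<in> G" for g using finite_subset[of g U] that U G(2) by auto
  define \<mu> f where "\<mu> g t = pmf (group_pmf (a g) (k g) g) (\<lambda>i. i \<in> t)"
    and "f g t = (\<Sum>i\<in>g. x i * (of_bool (i \<in> t) - real (a g) / real (k g)))" for g t
  have mom: "(\<Sum>t\<in>Pow g. \<mu> g t) = 1" "(\<Sum>t\<in>Pow g. \<mu> g t * f g t) = 0"
    "(\<Sum>t\<in>Pow g. \<mu> g t * (f g t)\<^sup>2) \<le> stratum_bound x (k g) g" if "g \<in> G" for g
  proof -
    have "g \<noteq> {}" using ne that by auto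
    note gm = fin[OF that] this conjunct1[OF ak[OF that]] conjunct2[OF ak[OF that]]
    show "(\<Sum>t\<in>Pow g. \<mu> g t) = 1" "(\<Sum>t\<in>Pow g. \<mu> g t * f g t) = 0"
      "(\<Sum>t\<in>Pow g. \<mu> g t * (f g t)\<^sup>2) \<le> stratum_bound x (k g) g"
      unfolding \<mu>_def f_def stratum_bound_def
      using group_pmf_moments(1)[OF gm] group_pmf_moments(2)[OF gm, of x] group_pmf_moments(3)[OF gm, of x] by simp_all
  qed
  have f: "(\<Sum>i\<in>U. x i * (of_bool (i \<in> t) - q i)) = (\<Sum>g\<in>G. f g (t \<inter> g))" for t
  proof -
    have "(\<Sum>i\<in>\<Union>G. x i * (of_bool (i \<in> t) - q i)) = (\<Sum>g\<in>G. \<Sum>i\<in>g. x i * (of_bool (i \<in> t) - q i))"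
      using sum.Union_disjoint[of G] fin dis by (auto simp: disjoint_def)
    also have "\<dots> = (\<Sum>g\<in>G. f g (t \<inter> g))" unfolding f_def by (intro sum.cong refl) (simp add: q)
    finally show ?thesis by (simp add: U)
  qed
  have \<mu>: "pmf (group_pmf (a g) (k g) g) (\<lambda>i. i \<in> g \<and> i \<in> t) = \<mu> g (t \<inter> g)" for g t
    unfolding \<mu>_def by (intro arg_cong[where f="pmf _"]) auto
  show ?thesis
    unfolding f \<mu> using moments_partition[OF finG dis fin mom(1,2)] mom(3)
    by (auto simp: U intro!: sum_mono)
qed

section \<open>Local randomization\<close>

context prob_space
begin

lemma finite_measure_subalgebraI: "subalgebra M F \<Longrightarrow> finite_measure_subalgebra M F"
  by (intro finite_measure_subalgebra.intro finite_measure_axioms finite_measure_subalgebra_axioms.intro)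

text \<open>The design prescribes its probabilities through \<open>real_cond_exp\<close>, but the
  squared weights multiplied with them come without integrability. Identifying the real conditional
  expectation of an indicator with the nonnegative one makes every nonnegative factor
  admissible.\<close>

lemma nn_integral_mult_cond_prob:
  assumes F: "subalgebra M F" and f[measurable]: "f \<in> borel_measurable F" and E[measurable]: "E \<in> sets M"
  shows "(\<integral>\<^sup>+\<omega>. f \<omega> * indicator E \<omega> \<partial>M) = (\<integral>\<^sup>+\<omega>. f \<omega> * ennreal (real_cond_exp M F (indicator E) \<omega>) \<partial>M)"
proof -
  interpret finite_measure_subalgebra M F by (rule finite_measure_subalgebraI[OF F])
  have int: "integrable M (indicator E :: 'a \<Rightarrow> real)" by (simp add: integrable_real_indicator emeasure_eq_measure)
  have pos: "AE \<omega> in M. 0 \<le> real_cond_exp M F (indicator E) \<omega>" by (rule real_cond_exp_pos) auto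
  have "AE \<omega> in M. ennreal (real_cond_exp M F (indicator E) \<omega>) = nn_cond_exp M F (indicator E) \<omega>"
  proof (rule nn_cond_exp_charact)
    fix A assume A: "A \<in> sets F"
    then have [measurable]: "A \<in> sets M" using F by (auto simp: subalgebra_def)
    have "(\<integral>\<^sup>+\<omega>\<in>A. indicator E \<omega> \<partial>M) = (\<integral>\<^sup>+\<omega>. ennreal (indicator A \<omega> * indicator E \<omega>) \<partial>M)"
      by (intro nn_integral_cong) (auto simp: indicator_def)
    also have "\<dots> = ennreal (\<integral>\<omega>. indicator A \<omega> * indicator E \<omega> \<partial>M)"
      by (rule nn_integral_eq_integral) (auto intro!: integrable_const_bound[where B=1] AE_I2 simp: indicator_def)
    also have "(\<integral>\<omega>. indicator A \<omega> * indicator E \<omega> \<partial>M) = (\<integral>\<omega>. indicator A \<omega> * real_cond_exp M F (indicator E) \<omega> \<partial>M)"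
      using real_cond_exp_intA[OF int A] by (simp add: set_lebesgue_integral_def)
    also have "ennreal \<dots> = (\<integral>\<^sup>+\<omega>. ennreal (indicator A \<omega> * real_cond_exp M F (indicator E) \<omega>) \<partial>M)"
    proof (rule nn_integral_eq_integral[symmetric])
      show "integrable M (\<lambda>\<omega>. indicator A \<omega> * real_cond_exp M F (indicator E) \<omega>)"
        using integrable_mult_indicator[OF \<open>A \<in> sets M\<close> real_cond_exp_int(1)[OF int]] by simp
      show "AE \<omega> in M. 0 \<le> indicator A \<omega> * real_cond_exp M F (indicator E) \<omega>"
        using pos by eventually_elim simp
    qed
    also have "\<dots> = (\<integral>\<^sup>+\<omega>\<in>A. ennreal (real_cond_exp M F (indicator E) \<omega>) \<partial>M)"
      by (intro nn_integral_cong) (auto simp: indicator_def)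
    finally show "(\<integral>\<^sup>+\<omega>\<in>A. indicator E \<omega> \<partial>M) = (\<integral>\<^sup>+\<omega>\<in>A. ennreal (real_cond_exp M F (indicator E) \<omega>) \<partial>M)" .
  qed auto
  then have "(\<integral>\<^sup>+\<omega>. f \<omega> * ennreal (real_cond_exp M F (indicator E) \<omega>) \<partial>M) = (\<integral>\<^sup>+\<omega>. f \<omega> * nn_cond_exp M F (indicator E) \<omega> \<partial>M)"
    by (intro nn_integral_cong_AE) (auto elim: eventually_mono)
  also have "\<dots> = (\<integral>\<^sup>+\<omega>. f \<omega> * indicator E \<omega> \<partial>M)" by (rule nn_cond_exp_intg) auto
  finally show ?thesis by simp
qed

end

lemma sum_square_diff_mean_le:
  fixes x :: "'i \<Rightarrow> real"
  assumes "finite g"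
  shows "(\<Sum>i\<in>g. (x i - (\<Sum>j\<in>g. x j) / real (card g))\<^sup>2) \<le> (\<Sum>i\<in>g. (x i - z)\<^sup>2)"
proof (cases "g = {}")
  case False
  define m where "m = (\<Sum>j\<in>g. x j) / real (card g)"
  have k: "real (card g) > 0" using assms False by (simp add: card_gt_0_iff)
  have "(\<Sum>i\<in>g. x i - m) = 0" using k by (simp add: m_def sum_subtractf)
  then have "(2 * (m - z)) * (\<Sum>i\<in>g. x i - m) = 0" by simp
  then have "(\<Sum>i\<in>g. 2 * (x i - m) * (m - z)) = 0"
    unfolding sum_distrib_left by (simp only: mult_ac)
  moreover have "(\<Sum>i\<in>g. (x i - z)\<^sup>2) = (\<Sum>i\<in>g. (x i - m)\<^sup>2) + (\<Sum>i\<in>g. 2 * (x i - m) * (m - z)) + (\<Sum>i\<in>g. (m - z)\<^sup>2)"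
    unfolding sum.distrib[symmetric] by (intro sum.cong refl) (simp add: power2_eq_square algebra_simps)
  moreover have "0 \<le> (\<Sum>i\<in>g. (m - z)\<^sup>2)" by (intro sum_nonneg) auto
  ultimately show ?thesis by (simp add: m_def)
qed simp

lemma square_sum_le: "(a + b)\<^sup>2 \<le> 2 * a\<^sup>2 + 2 * (b::real)\<^sup>2"
  using sum_squares_bound[of a b] by (simp add: power2_eq_square algebra_simps)

lemma sum_stratum_bound_le:
  fixes f :: "'v::real_normed_vector \<Rightarrow> real"
  assumes G: "partition_on U G" "U \<subseteq> {1..n}" and n: "n \<ge> 1"
    and K: "\<And>x. \<bar>f x\<bar> \<le> K" and l: "\<And>x y. \<bar>f x - f y\<bar> \<le> l * dist x y"
    and lev: "\<And>g. g \<in> G \<Longrightarrow> lev g \<in> {1..L} \<and> card g \<le> k (lev g)"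
    and kb: "\<And>l. l \<in> {1..L} \<Longrightarrow> k l \<le> kb"
    and rem: "\<And>l. l \<in> {1..L} \<Longrightarrow> card {g \<in> G. lev g = l \<and> card g < k l} \<le> 1"
  shows "(\<Sum>g\<in>G. stratum_bound x (k (lev g)) g) \<le>
    2 * (\<Sum>i=1..n. (x i - f (\<psi> i) / sqrt (real n))\<^sup>2) +
    2 * (l\<^sup>2 * heterogeneity n \<psi> G + K\<^sup>2 * (real kb * real L) / real n)"
proof -
  have finU: "finite U" using G(2) by (rule finite_subset) simp
  have finG: "finite G" using finite_elements[OF finU G(1)] .
  have U: "\<Union>G = U" and dis: "disjoint G" using G(1) by (auto simp: partition_on_def)
  have fin: "finite g" if "g \<in> G" for g using finite_subset[of g U] that U finU by auto
  have n0: "real n > 0" using n by simp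
  define y where "y i = f (\<psi> i) / sqrt (real n)" for i
  define R where "R = {g \<in> G. card g < k (lev g)}"
  have each: "stratum_bound x (k (lev g)) g \<le> 2 * (\<Sum>i\<in>g. (x i - y i)\<^sup>2) +
      2 * (l\<^sup>2 * ((\<Sum>i\<in>g. (norm (\<psi> i - group_mean \<psi> g))\<^sup>2) / real n) + (if g \<in> R then real (card g) * K\<^sup>2 / real n else 0))"
    if g: "g \<in> G" for g
  proof (cases "g \<in> R")
    case True
    have "stratum_bound x (k (lev g)) g = (\<Sum>i\<in>g. (x i)\<^sup>2)" using True by (auto simp: stratum_bound_def R_def)
    also have "\<dots> \<le> (\<Sum>i\<in>g. 2 * (x i - y i)\<^sup>2 + 2 * (K\<^sup>2 / real n))"
    proof (rule sum_mono)
      fix i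
      have "(f (\<psi> i))\<^sup>2 \<le> K\<^sup>2" using power_mono[OF K[of "\<psi> i"] abs_ge_zero, of 2] by simp
      then have "(y i)\<^sup>2 \<le> K\<^sup>2 / real n" using n0 by (simp add: y_def power_divide divide_right_mono)
      then show "(x i)\<^sup>2 \<le> 2 * (x i - y i)\<^sup>2 + 2 * (K\<^sup>2 / real n)"
        using square_sum_le[of "x i - y i" "y i"] by simp
    qed
    also have "\<dots> = 2 * (\<Sum>i\<in>g. (x i - y i)\<^sup>2) + 2 * (real (card g) * K\<^sup>2 / real n)"
      by (simp add: sum.distrib sum_distrib_left)
    finally have "stratum_bound x (k (lev g)) g \<le> 2 * (\<Sum>i\<in>g. (x i - y i)\<^sup>2) + 2 * (real (card g) * K\<^sup>2 / real n)" .
    moreover have "0 \<le> l\<^sup>2 * ((\<Sum>i\<in>g. (norm (\<psi> i - group_mean \<psi> g))\<^sup>2) / real n)"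
      by (intro mult_nonneg_nonneg divide_nonneg_nonneg sum_nonneg) auto
    ultimately show ?thesis unfolding if_P[OF True] distrib_left by linarith
  next
    case False
    then have full: "card g = k (lev g)" using lev[OF g] g by (auto simp: R_def)
    \<comment> \<open>The sum of squares is smallest when centered at the mean, so any other center
      is allowed. The one chosen is the value of \<open>f\<close> at the mean covariate of the
      group, because heterogeneity measures distances to that point.\<close>
    define z where "z = f (group_mean \<psi> g) / sqrt (real n)"
    have "stratum_bound x (k (lev g)) g \<le> (\<Sum>i\<in>g. (x i - z)\<^sup>2)"
      unfolding stratum_bound_def using full sum_square_diff_mean_le[OF fin[OF g]] by simp
    also have "\<dots> \<le> (\<Sum>i\<in>g. 2 * (x i - y i)\<^sup>2 + 2 * (l\<^sup>2 * ((norm (\<psi> i - group_mean \<psi> g))\<^sup>2 / real n)))"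
    proof (rule sum_mono)
      fix i
      have "(f (\<psi> i) - f (group_mean \<psi> g))\<^sup>2 \<le> (l * dist (\<psi> i) (group_mean \<psi> g))\<^sup>2"
        using power_mono[OF l[of "\<psi> i" "group_mean \<psi> g"] abs_ge_zero, of 2] by simp
      then have "(y i - z)\<^sup>2 \<le> l\<^sup>2 * ((norm (\<psi> i - group_mean \<psi> g))\<^sup>2 / real n)"
        using n0 by (simp add: y_def z_def power_divide diff_divide_distrib[symmetric] power_mult_distrib
          dist_norm divide_right_mono)
      then show "(x i - z)\<^sup>2 \<le> 2 * (x i - y i)\<^sup>2 + 2 * (l\<^sup>2 * ((norm (\<psi> i - group_mean \<psi> g))\<^sup>2 / real n))"
        using square_sum_le[of "x i - y i" "y i - z"] by simp
    qed
    finally show ?thesis using False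
      by (simp add: sum.distrib sum_distrib_left sum_divide_distrib)
  qed
  have sumU: "(\<Sum>g\<in>G. \<Sum>i\<in>g. (x i - y i)\<^sup>2) \<le> (\<Sum>i=1..n. (x i - y i)\<^sup>2)"
  proof -
    have "(\<Sum>g\<in>G. \<Sum>i\<in>g. (x i - y i)\<^sup>2) = (\<Sum>i\<in>\<Union>G. (x i - y i)\<^sup>2)"
      using sum.Union_disjoint[of G "\<lambda>i. (x i - y i)\<^sup>2"] fin dis by (simp add: disjoint_def)
    also have "\<dots> \<le> (\<Sum>i=1..n. (x i - y i)\<^sup>2)" unfolding U using G(2) by (intro sum_mono2) auto
    finally show ?thesis .
  qed
  have RL: "(\<Sum>g\<in>R. real (card g)) \<le> real kb * real L"
  proof -
    \<comment> \<open>One remainder group per level gives at most \<open>L\<close> of them, each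
      with at most \<open>kb\<close> units.\<close>
    have "R = (\<Union>l\<in>{1..L}. {g \<in> G. lev g = l \<and> card g < k l})" using lev by (auto simp: R_def)
    then have "card R \<le> (\<Sum>l\<in>{1..L}. card {g \<in> G. lev g = l \<and> card g < k l})"
      using card_UN_le[of "{1..L}" "\<lambda>l. {g \<in> G. lev g = l \<and> card g < k l}"] by simp
    also have "\<dots> \<le> (\<Sum>l\<in>{1..L}. 1)" by (intro sum_mono rem)
    finally have "card R \<le> L" by simp
    have "(\<Sum>g\<in>R. card g) \<le> (\<Sum>g\<in>R. kb)"
    proof (rule sum_mono)
      fix g assume "g \<in> R"
      then show "card g \<le> kb" using lev[of g] kb[of "lev g"] by (auto simp: R_def)
    qed
    also have "\<dots> \<le> L * kb" using \<open>card R \<le> L\<close> by simp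
    finally show ?thesis by (simp add: mult.commute flip: of_nat_mult of_nat_sum)
  qed
  have "(\<Sum>g\<in>G. stratum_bound x (k (lev g)) g) \<le> 2 * (\<Sum>g\<in>G. \<Sum>i\<in>g. (x i - y i)\<^sup>2) +
      2 * (l\<^sup>2 * ((\<Sum>g\<in>G. \<Sum>i\<in>g. (norm (\<psi> i - group_mean \<psi> g))\<^sup>2) / real n) +
        (\<Sum>g\<in>G. if g \<in> R then real (card g) * K\<^sup>2 / real n else 0))"
    using sum_mono[OF each] by (simp add: sum.distrib sum_distrib_left sum_divide_distrib)
  also have "(\<Sum>g\<in>G. if g \<in> R then real (card g) * K\<^sup>2 / real n else 0) = (\<Sum>g\<in>R. real (card g)) * K\<^sup>2 / real n"
    using finG by (subst sum.inter_restrict[symmetric])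
      (auto simp: R_def Int_def sum_distrib_right sum_divide_distrib intro!: sum.cong)
  also have "\<dots> \<le> real kb * real L * K\<^sup>2 / real n" by (intro divide_right_mono mult_right_mono RL) auto
  finally show ?thesis using sumU unfolding y_def
    by (simp add: heterogeneity_def mult_ac)
qed

context prob_space
begin

text \<open>A conditional Chebyshev argument with the sum of the stratum bounds as conditional
  second moment. The function \<open>h\<close> is only square integrable, so that this sum vanishes
  is shown for a Lipschitz approximation of \<open>h\<close>, the error being small in mean. The set
  of units may be random, which covers both the sampling of all units and the assignment of the
  sampled ones.\<close>

theorem local_randomization_vanishes:
  fixes \<psi> :: "nat \<Rightarrow> 'a \<Rightarrow> 'v::euclidean_space"
  assumes lr: "local_randomization M A F U \<psi> q L a k Z"
    and AF: "\<And>n. subalgebra (F n) (A n)" and F: "\<And>n. subalgebra M (F n)"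
    and U: "\<And>n \<omega>. \<omega> \<in> space M \<Longrightarrow> U n \<omega> \<subseteq> {1..n}"
    and kb: "\<And>n \<omega> l. \<omega> \<in> space M \<Longrightarrow> l \<in> {1..L n \<omega>} \<Longrightarrow> 0 < k n \<omega> l \<and> k n \<omega> l \<le> kb n"
    and Lb: "\<And>n \<omega>. \<omega> \<in> space M \<Longrightarrow> L n \<omega> \<le> Lb n"
    and rate: "(\<lambda>n. real (kb n) * real (Lb n) / real n) \<longlonglongrightarrow> 0"
    and q: "\<And>n i. i \<in> {1..n} \<Longrightarrow> (\<lambda>\<omega>. q n \<omega> (\<psi> i \<omega>)) \<in> borel_measurable (F n)"
    and q1: "\<And>n. AE \<omega> in M. \<forall>i\<in>U n \<omega>. q n \<omega> (\<psi> i \<omega>) \<le> 1"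
    and km: "\<And>n l. (\<lambda>\<omega>. k n \<omega> l) \<in> F n \<rightarrow>\<^sub>M count_space UNIV"
    and \<psi>: "\<And>i. i \<ge> 1 \<Longrightarrow> \<psi> i \<in> borel_measurable M" "\<And>i. i \<ge> 1 \<Longrightarrow> distr M borel (\<psi> i) = P"
    and x: "\<And>n i. i \<in> {1..n} \<Longrightarrow> x n i \<in> borel_measurable (F n)"
    and h: "h \<in> borel_measurable borel" "(\<integral>\<^sup>+z. ennreal ((h z)\<^sup>2) \<partial>P) < \<infinity>"
    and xh: "vanishes M (\<lambda>n \<omega>. \<Sum>i=1..n. (x n i \<omega> - h (\<psi> i \<omega>) / sqrt (real n))\<^sup>2)"
  shows "vanishes M (\<lambda>n \<omega>. \<Sum>i\<in>U n \<omega>. x n i \<omega> * (of_bool (Z n i \<omega>) - q n \<omega> (\<psi> i \<omega>)))"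
proof -
  have Z: "\<And>n i. i \<in> {1..n} \<Longrightarrow> Z n i \<in> M \<rightarrow>\<^sub>M count_space UNIV"
    using lr by (auto simp: local_randomization_def)
  obtain G lev where G: "\<And>n. G n \<in> A n \<rightarrow>\<^sub>M count_space UNIV"
    and lev: "\<And>n g. (\<lambda>\<omega>. lev n \<omega> g) \<in> A n \<rightarrow>\<^sub>M count_space UNIV"
    and part: "\<And>n \<omega>. \<omega> \<in> space M \<Longrightarrow> partition_on (U n \<omega>) (G n \<omega>)"
    and het: "op1 M (\<lambda>n \<omega>. ennreal (heterogeneity n (\<lambda>i. \<psi> i \<omega>) (G n \<omega>)))"
    and levels: "\<And>n. AE \<omega> in M. \<forall>g\<in>G n \<omega>. lev n \<omega> g \<in> {1..L n \<omega>} \<and>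
           (\<forall>i\<in>g. q n \<omega> (\<psi> i \<omega>) = real (a n \<omega> (lev n \<omega> g)) / real (k n \<omega> (lev n \<omega> g))) \<and>
           card g \<le> k n \<omega> (lev n \<omega> g)"
    and rem: "\<And>n. AE \<omega> in M. \<forall>l\<in>{1..L n \<omega>}. card {g \<in> G n \<omega>. lev n \<omega> g = l \<and> card g < k n \<omega> l} \<le> 1"
    and law: "\<And>n t. AE \<omega> in M. real_cond_exp M (F n)
             (indicator {\<omega> \<in> space M. \<forall>i\<in>U n \<omega>. Z n i \<omega> = t i}) \<omega> =
           (\<Prod>g\<in>G n \<omega>. pmf (group_pmf (a n \<omega> (lev n \<omega> g)) (k n \<omega> (lev n \<omega> g)) g) (\<lambda>i. i \<in> g \<and> t i))"
    using lr unfolding local_randomization_def by blast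
  have sF: "space (F n) = space M" for n using F by (simp add: subalgebra_def)
  have FM: "f \<in> F n \<rightarrow>\<^sub>M N \<Longrightarrow> f \<in> M \<rightarrow>\<^sub>M N" for f n and N :: "'z measure"
    by (rule measurable_from_subalg[OF F])
  \<comment> \<open>A partition of a subset of {1..n} is one of finitely many objects. Measurability
    of anything built from \<open>G n\<close> can thus be checked with the partition frozen;
    \<open>compG\<close> packages this.\<close>
  have GF: "G n \<in> F n \<rightarrow>\<^sub>M count_space (Pow (Pow {1..n}))" for n
  proof -
    have "G n \<in> F n \<rightarrow>\<^sub>M count_space UNIV" using measurable_from_subalg[OF AF G] .
    moreover have "G n \<omega> \<in> Pow (Pow {1..n})" if "\<omega> \<in> space M" for \<omega>
      using part[OF that, of n] U[OF that, of n] by (auto simp: partition_on_def)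
    moreover have "G n -` {Q} \<inter> space (F n) \<in> sets (F n)" for Q
      using \<open>G n \<in> F n \<rightarrow>\<^sub>M count_space UNIV\<close> by (rule measurable_sets) simp
    ultimately show ?thesis
      by (subst measurable_count_space_eq2) (auto simp: sF)
  qed
  have UG: "U n \<omega> = \<Union>(G n \<omega>)" if "\<omega> \<in> space M" for n \<omega>
    using part[OF that, of n] by (simp add: partition_on_def)
  have compG: "(\<lambda>\<omega>. f (G n \<omega>) \<omega>) \<in> F n \<rightarrow>\<^sub>M N" if "\<And>Q. Q \<subseteq> Pow {1..n} \<Longrightarrow> f Q \<in> F n \<rightarrow>\<^sub>M N" for f n and N :: "'z measure"
    by (rule measurable_compose_countable'[OF _ GF]) (use that in \<open>auto intro: countable_finite\<close>)
  have klev: "(\<lambda>\<omega>. k n \<omega> (lev n \<omega> g)) \<in> F n \<rightarrow>\<^sub>M count_space UNIV" for n g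
    by (rule measurable_compose_countable[OF km measurable_from_subalg[OF AF lev]])
  define B where "B n \<omega> = (\<Sum>g\<in>G n \<omega>. stratum_bound (\<lambda>i. x n i \<omega>) (k n \<omega> (lev n \<omega> g)) g)" for n \<omega>
  have BF: "B n \<in> borel_measurable (F n)" for n
    unfolding B_def
  proof (rule compG)
    fix Q assume Q: "Q \<subseteq> Pow {1..n}"
    have "(\<lambda>\<omega>. stratum_bound (\<lambda>i. x n i \<omega>) (k n \<omega> (lev n \<omega> g)) g) \<in> borel_measurable (F n)" if "g \<in> Q" for g
    proof -
      have [measurable]: "x n i \<in> borel_measurable (F n)" if "i \<in> g" for i
        using x Q \<open>g \<in> Q\<close> that by blast
      note [measurable] = klev
      show ?thesis unfolding stratum_bound_def by measurable
    qed
    then show "(\<lambda>\<omega>. \<Sum>g\<in>Q. stratum_bound (\<lambda>i. x n i \<omega>) (k n \<omega> (lev n \<omega> g)) g) \<in> borel_measurable (F n)"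
      by (rule borel_measurable_sum)
  qed
  have B0: "0 \<le> B n \<omega>" for n \<omega> unfolding B_def by (intro sum_nonneg stratum_bound_nonneg)
  have finG: "finite (G n \<omega>)" if "\<omega> \<in> space M" for n \<omega>
    using finite_elements[OF _ part[OF that]] U[OF that, of n] finite_subset[of "U n \<omega>" "{1..n}"] by blast
  have het0: "0 \<le> heterogeneity n (\<lambda>i. \<psi> i \<omega>) (G n \<omega>)" for n \<omega>
    unfolding heterogeneity_def by (intro mult_nonneg_nonneg sum_nonneg) auto
  have hetv: "vanishes M (\<lambda>n \<omega>. heterogeneity n (\<lambda>i. \<psi> i \<omega>) (G n \<omega>))"
    by (rule op1_imp_vanishes[OF het het0])
  interpret P: prob_space P
    using prob_space_distr[OF \<psi>(1)[of 1]] \<psi>(2)[of 1] by simp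
  have sP: "sets P = sets borel" using \<psi>(2)[of 1] by auto
  note [measurable] = \<psi>(1) h(1)
  have Bv: "vanishes M B"
  proof (rule vanishes_approx)
    show "B n \<in> borel_measurable M" for n by (rule FM[OF BF])
    fix e :: real assume e: "e > 0"
    then have e4: "e / 4 > 0" by simp
    obtain f where f: "bl_fun f" and fe: "(\<integral>\<^sup>+z. ennreal ((h z - f z)\<^sup>2) \<partial>P) \<le> ennreal (e / 4)"
      using bl_fun_dense_L2[OF _ sP h e4] P.finite_measure_axioms by blast
    obtain K l where [measurable]: "f \<in> borel_measurable borel" and K: "\<And>x. \<bar>f x\<bar> \<le> K"
      and l: "\<And>x y. \<bar>f x - f y\<bar> \<le> l * dist x y" using f by (auto simp: bl_fun_def)
    \<comment> \<open>The factor 4 is 2 from the stratum bounds times 2 from splitting x - f into x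
      - h and h - f; this is why \<open>f\<close> was chosen with error e / 4.\<close>
    define V where "V n \<omega> = 4 * ((\<Sum>i=1..n. (h (\<psi> i \<omega>) - f (\<psi> i \<omega>))\<^sup>2) / real n)" for n \<omega>
    define D where "D n \<omega> = (\<Sum>i=1..n. (x n i \<omega> - h (\<psi> i \<omega>) / sqrt (real n))\<^sup>2)" for n \<omega>
    define W where "W n \<omega> = 4 * D n \<omega> + 2 * (l\<^sup>2 * heterogeneity n (\<lambda>i. \<psi> i \<omega>) (G n \<omega>) +
        K\<^sup>2 * (real (kb n) * real (Lb n) / real n))" for n \<omega>
    have const: "vanishes M (\<lambda>n \<omega>. real (kb n) * real (Lb n) / real n)"
      by (rule vanishes_L1[OF _ _ rate]) (auto simp: prob_space)
    have Wv: "vanishes M W"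
      unfolding W_def D_def
      by (intro vanishes_add vanishes_cmult xh hetv const)
    have int1: "integrable M (\<lambda>\<omega>. (h (\<psi> i \<omega>) - f (\<psi> i \<omega>))\<^sup>2)"
      and le1: "(\<integral>\<omega>. (h (\<psi> i \<omega>) - f (\<psi> i \<omega>))\<^sup>2 \<partial>M) \<le> e / 4" if i: "i \<ge> 1" for i
    proof -
      have eq: "(\<integral>\<^sup>+\<omega>. ennreal ((h (\<psi> i \<omega>) - f (\<psi> i \<omega>))\<^sup>2) \<partial>M) \<le> ennreal (e / 4)"
        using fe i unfolding \<psi>(2)[OF i, symmetric] by (subst (asm) nn_integral_distr) auto
      show "integrable M (\<lambda>\<omega>. (h (\<psi> i \<omega>) - f (\<psi> i \<omega>))\<^sup>2)"
        by (rule integrableI_nonneg) (use eq i in \<open>auto intro: order.strict_trans1\<close>)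
      from nn_integral_eq_integral[OF this] eq
      have "ennreal (\<integral>\<omega>. (h (\<psi> i \<omega>) - f (\<psi> i \<omega>))\<^sup>2 \<partial>M) \<le> ennreal (e / 4)" by simp
      then show "(\<integral>\<omega>. (h (\<psi> i \<omega>) - f (\<psi> i \<omega>))\<^sup>2 \<partial>M) \<le> e / 4" using e by (subst (asm) ennreal_le_iff) auto
    qed
    have Vint: "integrable M (V n)" for n
      unfolding V_def by (intro integrable_mult_right integrable_divide Bochner_Integration.integrable_sum int1) auto
    have Vle: "(\<integral>\<omega>. \<bar>V n \<omega>\<bar> \<partial>M) \<le> e" if n: "n \<ge> 1" for n
    proof -
      have "(\<integral>\<omega>. \<bar>V n \<omega>\<bar> \<partial>M) = (\<integral>\<omega>. V n \<omega> \<partial>M)"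
        by (intro Bochner_Integration.integral_cong) (auto simp: V_def sum_nonneg)
      also have "\<dots> = 4 * ((\<Sum>i=1..n. \<integral>\<omega>. (h (\<psi> i \<omega>) - f (\<psi> i \<omega>))\<^sup>2 \<partial>M) / real n)"
        unfolding V_def by (subst integral_mult_right_zero, subst integral_divide_zero,
          subst Bochner_Integration.integral_sum) (auto intro!: int1)
      also have "\<dots> \<le> 4 * ((\<Sum>i=1..n. e / 4) / real n)"
        by (intro mult_left_mono divide_right_mono sum_mono le1) auto
      also have "\<dots> = e" using n by simp
      finally show ?thesis .
    qed
    have BW: "AE \<omega> in M. \<bar>B n \<omega>\<bar> \<le> \<bar>W n \<omega>\<bar> + \<bar>V n \<omega>\<bar>" if n: "n \<ge> 1" for n
      using levels[of n] rem[of n] AE_space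
    proof eventually_elim
      case (elim \<omega>)
      have "B n \<omega> \<le> 2 * (\<Sum>i=1..n. (x n i \<omega> - f (\<psi> i \<omega>) / sqrt (real n))\<^sup>2) +
          2 * (l\<^sup>2 * heterogeneity n (\<lambda>i. \<psi> i \<omega>) (G n \<omega>) + K\<^sup>2 * (real (kb n) * real (L n \<omega>)) / real n)"
        unfolding B_def
        by (rule sum_stratum_bound_le[OF part[OF elim(3)] U[OF elim(3)] n K l]) (use elim kb in auto)
      also have "K\<^sup>2 * (real (kb n) * real (L n \<omega>)) / real n \<le> K\<^sup>2 * (real (kb n) * real (Lb n)) / real n"
        using Lb[OF elim(3), of n] by (intro divide_right_mono mult_left_mono) auto
      also have "(\<Sum>i=1..n. (x n i \<omega> - f (\<psi> i \<omega>) / sqrt (real n))\<^sup>2) \<le>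
          (\<Sum>i=1..n. 2 * (x n i \<omega> - h (\<psi> i \<omega>) / sqrt (real n))\<^sup>2 + 2 * ((h (\<psi> i \<omega>) - f (\<psi> i \<omega>))\<^sup>2 / real n))"
      proof (rule sum_mono)
        fix i
        have "((h (\<psi> i \<omega>) - f (\<psi> i \<omega>)) / sqrt (real n))\<^sup>2 = (h (\<psi> i \<omega>) - f (\<psi> i \<omega>))\<^sup>2 / real n"
          by (simp add: power_divide)
        then show "(x n i \<omega> - f (\<psi> i \<omega>) / sqrt (real n))\<^sup>2 \<le>
          2 * (x n i \<omega> - h (\<psi> i \<omega>) / sqrt (real n))\<^sup>2 + 2 * ((h (\<psi> i \<omega>) - f (\<psi> i \<omega>))\<^sup>2 / real n)"
          using square_sum_le[of "x n i \<omega> - h (\<psi> i \<omega>) / sqrt (real n)" "(h (\<psi> i \<omega>) - f (\<psi> i \<omega>)) / sqrt (real n)"]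
          by (simp add: diff_divide_distrib)
      qed
      also have "\<dots> = 2 * D n \<omega> + 2 * ((\<Sum>i=1..n. (h (\<psi> i \<omega>) - f (\<psi> i \<omega>))\<^sup>2) / real n)"
        by (simp add: D_def sum.distrib sum_distrib_left sum_divide_distrib)
      finally have "B n \<omega> \<le> W n \<omega> + V n \<omega>" by (simp add: W_def V_def)
      then show ?case using B0[of n \<omega>] by linarith
    qed
    show "\<exists>U V. vanishes M U \<and> (\<forall>\<^sub>F n in sequentially. integrable M (V n) \<and> (\<integral>\<omega>. \<bar>V n \<omega>\<bar> \<partial>M) \<le> e \<and>
        (AE \<omega> in M. \<bar>B n \<omega>\<bar> \<le> \<bar>U n \<omega>\<bar> + \<bar>V n \<omega>\<bar>))"
      using Wv Vint Vle BW
      by (intro exI[of _ W] exI[of _ V] conjI eventually_sequentiallyI[of 1]) auto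
  qed
  \<comment> \<open>The value the imbalance would take if the realized vector were \<open>t\<close>.
    Freezing \<open>t\<close> makes it measurable for \<open>F n\<close>, and the randomness left is
    in the event \<open>E n t\<close> that the realized vector agrees with \<open>t\<close> on the
    units concerned.\<close>
  define Xs where "Xs n t \<omega> = (\<Sum>i\<in>U n \<omega>. x n i \<omega> * (of_bool (i \<in> t) - q n \<omega> (\<psi> i \<omega>)))" for n t \<omega>
  define E where "E n t = {\<omega> \<in> space M. \<forall>i\<in>U n \<omega>. Z n i \<omega> = (i \<in> t)}" for n t
  define X where "X n \<omega> = (\<Sum>i\<in>U n \<omega>. x n i \<omega> * (of_bool (Z n i \<omega>) - q n \<omega> (\<psi> i \<omega>)))" for n \<omega>
  have XsF: "Xs n t \<in> borel_measurable (F n)" for n t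
  proof -
    have "(\<lambda>\<omega>. \<Sum>i\<in>\<Union>(G n \<omega>). x n i \<omega> * (of_bool (i \<in> t) - q n \<omega> (\<psi> i \<omega>))) \<in> borel_measurable (F n)"
    proof (rule compG)
      fix Q assume Q: "Q \<subseteq> Pow {1..n}"
      have "x n i \<in> borel_measurable (F n)" "(\<lambda>\<omega>. q n \<omega> (\<psi> i \<omega>)) \<in> borel_measurable (F n)" if "i \<in> \<Union>Q" for i
        using x q Q that by blast+
      then show "(\<lambda>\<omega>. \<Sum>i\<in>\<Union>Q. x n i \<omega> * (of_bool (i \<in> t) - q n \<omega> (\<psi> i \<omega>))) \<in> borel_measurable (F n)"
        by (intro borel_measurable_sum borel_measurable_times borel_measurable_diff borel_measurable_const) auto
    qed
    then show ?thesis by (rule measurable_cong[THEN iffD2, rotated]) (simp add: Xs_def UG sF)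
  qed
  have EM: "E n t \<in> sets M" for n t
  proof -
    have "(\<lambda>\<omega>. \<forall>i\<in>\<Union>(G n \<omega>). Z n i \<omega> = (i \<in> t)) \<in> M \<rightarrow>\<^sub>M count_space UNIV"
    proof (rule measurable_compose_countable'[OF _ FM[OF GF]])
      fix Q assume "Q \<in> Pow (Pow {1..n})"
      then have [measurable]: "Z n i \<in> M \<rightarrow>\<^sub>M count_space UNIV" if "i \<in> \<Union>Q" for i using Z that by blast
      have "\<Union>Q \<subseteq> {1..n}" using \<open>Q \<in> _\<close> by blast
      then have "finite (\<Union>Q)" by (rule finite_subset) simp
      then show "(\<lambda>\<omega>. \<forall>i\<in>\<Union>Q. Z n i \<omega> = (i \<in> t)) \<in> M \<rightarrow>\<^sub>M count_space UNIV"
        by (intro pred_intros_finite) auto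
    qed (auto intro: countable_finite)
    then have "{\<omega> \<in> space M. \<forall>i\<in>\<Union>(G n \<omega>). Z n i \<omega> = (i \<in> t)} \<in> sets M" by (simp add: pred_def)
    also have "{\<omega> \<in> space M. \<forall>i\<in>\<Union>(G n \<omega>). Z n i \<omega> = (i \<in> t)} = E n t" by (auto simp: E_def UG)
    finally show ?thesis .
  qed
  have EU: "E' n t \<in> sets (F n)" if "E' = (\<lambda>n t. {\<omega> \<in> space M. t \<subseteq> U n \<omega>})" for E' n t
  proof -
    have "(\<lambda>\<omega>. t \<subseteq> \<Union>(G n \<omega>)) \<in> F n \<rightarrow>\<^sub>M count_space UNIV" by (rule compG) simp
    then have "{\<omega> \<in> space M. t \<subseteq> \<Union>(G n \<omega>)} \<in> sets (F n)" by (simp add: pred_def sF)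
    also have "{\<omega> \<in> space M. t \<subseteq> \<Union>(G n \<omega>)} = {\<omega> \<in> space M. t \<subseteq> U n \<omega>}"
      by (intro Collect_cong conj_cong refl) (simp add: UG)
    finally show ?thesis using that by simp
  qed
  \<comment> \<open>\<open>E n t\<close> constrains \<open>t\<close> only on
    \<open>U n \<omega>\<close>, so sets that differ outside it define the same event; requiring t
    \<subseteq> \<open>U n \<omega>\<close> leaves exactly one contributing term.\<close>
  have decomp: "(X n \<omega>)\<^sup>2 * indicator S \<omega> = (\<Sum>t\<in>Pow {1..n}.
      ((Xs n t \<omega>)\<^sup>2 * indicator {\<omega> \<in> space M. t \<subseteq> U n \<omega>} \<omega> * indicator S \<omega>) * indicator (E n t) \<omega>)"
    if \<omega>: "\<omega> \<in> space M" for n \<omega> S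
  proof -
    define t0 where "t0 = {i \<in> U n \<omega>. Z n i \<omega>}"
    have t0: "t0 \<in> Pow {1..n}" using U[OF \<omega>, of n] by (auto simp: t0_def)
    have "(\<Sum>t\<in>Pow {1..n}. ((Xs n t \<omega>)\<^sup>2 * indicator {\<omega> \<in> space M. t \<subseteq> U n \<omega>} \<omega> * indicator S \<omega>) * indicator (E n t) \<omega>) =
      (\<Sum>t\<in>Pow {1..n}. if t = t0 then (X n \<omega>)\<^sup>2 * indicator S \<omega> else 0)"
    proof (intro sum.cong refl)
      fix t
      have "t = t0 \<longleftrightarrow> t \<subseteq> U n \<omega> \<and> \<omega> \<in> E n t" using \<omega> by (auto simp: t0_def E_def)
      moreover have "Xs n t \<omega> = X n \<omega>" if "\<omega> \<in> E n t"
        using that unfolding Xs_def X_def by (intro sum.cong) (auto simp: E_def)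
      ultimately show "((Xs n t \<omega>)\<^sup>2 * indicator {\<omega> \<in> space M. t \<subseteq> U n \<omega>} \<omega> * indicator S \<omega>) * indicator (E n t) \<omega> =
          (if t = t0 then (X n \<omega>)\<^sup>2 * indicator S \<omega> else 0)"
        using \<omega> by (auto simp: indicator_def)
    qed
    then show ?thesis using t0 by (simp add: sum.delta)
  qed
  have XM: "X n \<in> borel_measurable M" for n
  proof -
    have [measurable]: "Xs n t \<in> borel_measurable M" "E n t \<in> sets M" "{\<omega> \<in> space M. t \<subseteq> U n \<omega>} \<in> sets M" for t
      using FM[OF XsF] EM subsetD[of "sets (F n)" "sets M", OF _ EU[OF refl, of t n]] F[of n]
      by (auto simp: subalgebra_def)
    define U' where "U' t = {\<omega> \<in> space M. t \<subseteq> U n \<omega>}" for t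
    have [measurable]: "U' t \<in> sets M" for t unfolding U'_def by measurable
    have "(\<lambda>\<omega>. \<Sum>t\<in>Pow {1..n}. Xs n t \<omega> * indicator (U' t) \<omega> * indicator (E n t) \<omega>) \<in> borel_measurable M"
      by measurable
    moreover have "(\<Sum>t\<in>Pow {1..n}. Xs n t \<omega> * indicator (U' t) \<omega> * indicator (E n t) \<omega>) = X n \<omega>" if \<omega>: "\<omega> \<in> space M" for \<omega>
    proof -
      define t0 where "t0 = {i \<in> U n \<omega>. Z n i \<omega>}"
      have t0: "t0 \<in> Pow {1..n}" using U[OF \<omega>, of n] by (auto simp: t0_def)
      have "(\<Sum>t\<in>Pow {1..n}. Xs n t \<omega> * indicator (U' t) \<omega> * indicator (E n t) \<omega>) =
        (\<Sum>t\<in>Pow {1..n}. if t = t0 then X n \<omega> else 0)"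
      proof (intro sum.cong refl)
        fix t
        have "t = t0 \<longleftrightarrow> \<omega> \<in> U' t \<and> \<omega> \<in> E n t" using \<omega> by (auto simp: t0_def E_def U'_def)
        moreover have "Xs n t \<omega> = X n \<omega>" if "\<omega> \<in> E n t"
          using that unfolding Xs_def X_def by (intro sum.cong) (auto simp: E_def)
        ultimately show "Xs n t \<omega> * indicator (U' t) \<omega> * indicator (E n t) \<omega> = (if t = t0 then X n \<omega> else 0)"
          by (auto simp: indicator_def)
      qed
      then show ?thesis using t0 by (simp add: sum.delta)
    qed
    ultimately show ?thesis by (subst measurable_cong[of M "X n"]) auto
  qed
  have "vanishes M X"
  proof (rule vanishes_cond_second_moment[OF F XM BF B0 Bv])
    fix n S assume S: "S \<in> sets (F n)"
    then have SM[measurable]: "S \<in> sets M" using F by (auto simp: subalgebra_def)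
    define w where "w t \<omega> = (\<Prod>g\<in>G n \<omega>. pmf (group_pmf (a n \<omega> (lev n \<omega> g)) (k n \<omega> (lev n \<omega> g)) g) (\<lambda>i. i \<in> g \<and>
        i \<in> t))" for t \<omega>
    define Y where "Y t \<omega> = (Xs n t \<omega>)\<^sup>2 * indicator {\<omega> \<in> space M. t \<subseteq> U n \<omega>} \<omega> * indicator S \<omega>" for t \<omega>
    have YF: "Y t \<in> borel_measurable (F n)" for t
      unfolding Y_def using XsF S EU[OF refl, of t n] by (intro borel_measurable_times borel_measurable_power) auto
    note [measurable] = FM[OF YF] EM
    have Y0: "0 \<le> Y t \<omega>" for t \<omega> by (simp add: Y_def)
    have w: "AE \<omega> in M. \<forall>t\<in>Pow {1..n}. real_cond_exp M (F n) (indicator (E n t)) \<omega> = w t \<omega>"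
      using law unfolding E_def w_def by (intro AE_finite_allI) auto
    have "(\<integral>\<^sup>+\<omega>. ennreal ((X n \<omega>)\<^sup>2) * indicator S \<omega> \<partial>M) = (\<integral>\<^sup>+\<omega>. (\<Sum>t\<in>Pow {1..n}. ennreal (Y t \<omega>) * indicator (E n t) \<omega>) \<partial>M)"
    proof (intro nn_integral_cong)
      fix \<omega> assume \<omega>: "\<omega> \<in> space M"
      have "ennreal ((X n \<omega>)\<^sup>2) * indicator S \<omega> = ennreal ((X n \<omega>)\<^sup>2 * indicator S \<omega>)" by (auto simp: indicator_def)
      also have "\<dots> = ennreal (\<Sum>t\<in>Pow {1..n}. Y t \<omega> * indicator (E n t) \<omega>)"
        unfolding decomp[OF \<omega>] Y_def ..
      also have "\<dots> = (\<Sum>t\<in>Pow {1..n}. ennreal (Y t \<omega> * indicator (E n t) \<omega>))"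
        using Y0 by (intro sum_ennreal[symmetric]) auto
      also have "\<dots> = (\<Sum>t\<in>Pow {1..n}. ennreal (Y t \<omega>) * indicator (E n t) \<omega>)"
        by (intro sum.cong refl) (auto simp: indicator_def)
      finally show "ennreal ((X n \<omega>)\<^sup>2) * indicator S \<omega> = (\<Sum>t\<in>Pow {1..n}. ennreal (Y t \<omega>) * indicator (E n t) \<omega>)" .
    qed
    also have "\<dots> = (\<Sum>t\<in>Pow {1..n}. \<integral>\<^sup>+\<omega>. ennreal (Y t \<omega>) * indicator (E n t) \<omega> \<partial>M)"
      by (rule nn_integral_sum) auto
    also have "\<dots> = (\<Sum>t\<in>Pow {1..n}. \<integral>\<^sup>+\<omega>. ennreal (Y t \<omega>) * ennreal (real_cond_exp M (F n) (indicator (E n t)) \<omega>) \<partial>M)"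
      by (intro sum.cong refl nn_integral_mult_cond_prob[OF F _ EM] measurable_compose[OF YF measurable_ennreal])
    also have "\<dots> = (\<integral>\<^sup>+\<omega>. (\<Sum>t\<in>Pow {1..n}. ennreal (Y t \<omega>) * ennreal (real_cond_exp M (F n) (indicator (E n t)) \<omega>)) \<partial>M)"
      by (rule nn_integral_sum[symmetric]) auto
    also have "\<dots> \<le> (\<integral>\<^sup>+\<omega>. ennreal (B n \<omega>) * indicator S \<omega> \<partial>M)"
    proof (rule nn_integral_mono_AE)
      show "AE \<omega> in M. (\<Sum>t\<in>Pow {1..n}. ennreal (Y t \<omega>) * ennreal (real_cond_exp M (F n) (indicator (E n t)) \<omega>))
          \<le> ennreal (B n \<omega>) * indicator S \<omega>"
        using w levels[of n] q1[of n] AE_space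
      proof eventually_elim
        case (elim \<omega>)
        have w0: "0 \<le> w t \<omega>" for t unfolding w_def by (intro prod_nonneg) auto
        have Usub: "U n \<omega> \<subseteq> {1..n}" using U elim by blast
        \<comment> \<open>The levels come without a \<le> k. It is recovered from q \<le> 1 at some
          unit of the group, the groups of a partition being nonempty.\<close>
        have ak: "card g \<le> k n \<omega> (lev n \<omega> g) \<and> a n \<omega> (lev n \<omega> g) \<le> k n \<omega> (lev n \<omega> g)" if g: "g \<in> G n \<omega>" for g
        proof -
          have "g \<noteq> {}" "g \<subseteq> U n \<omega>" using part[OF elim(4), of n] g by (auto simp: partition_on_def)
          then obtain i where i: "i \<in> g" "i \<in> U n \<omega>" by auto
          have "0 < k n \<omega> (lev n \<omega> g)" using kb[OF elim(4)] elim(2) g by blast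
          moreover have "real (a n \<omega> (lev n \<omega> g)) / real (k n \<omega> (lev n \<omega> g)) \<le> 1"
            using elim(2,3) g i by fastforce
          ultimately show ?thesis using elim(2) g by (simp add: divide_le_eq_1)
        qed
        have "(\<Sum>t\<in>Pow {1..n}. ennreal (Y t \<omega>) * ennreal (real_cond_exp M (F n) (indicator (E n t)) \<omega>)) =
            (\<Sum>t\<in>Pow {1..n}. ennreal (Y t \<omega> * w t \<omega>))"
          using elim(1) Y0 by (intro sum.cong refl) (simp add: ennreal_mult')
        also have "\<dots> = ennreal (\<Sum>t\<in>Pow {1..n}. Y t \<omega> * w t \<omega>)"
          using Y0 w0 by (intro sum_ennreal) auto
        also have "(\<Sum>t\<in>Pow {1..n}. Y t \<omega> * w t \<omega>) = (\<Sum>t\<in>Pow (U n \<omega>). w t \<omega> * (Xs n t \<omega>)\<^sup>2) * indicator S \<omega>"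
        proof -
          have "(\<Sum>t\<in>Pow {1..n}. Y t \<omega> * w t \<omega>) = (\<Sum>t\<in>Pow (U n \<omega>). Y t \<omega> * w t \<omega>)"
            using Usub by (intro sum.mono_neutral_right) (auto simp: Y_def)
          also have "\<dots> = (\<Sum>t\<in>Pow (U n \<omega>). (w t \<omega> * (Xs n t \<omega>)\<^sup>2) * indicator S \<omega>)"
            using elim(4) by (intro sum.cong refl) (auto simp: Y_def)
          finally show ?thesis by (simp add: sum_distrib_right)
        qed
        also have "\<dots> \<le> B n \<omega> * indicator S \<omega>"
        proof (rule mult_right_mono)
          show "(\<Sum>t\<in>Pow (U n \<omega>). w t \<omega> * (Xs n t \<omega>)\<^sup>2) \<le> B n \<omega>"
            unfolding w_def Xs_def B_def
            by (rule stratified_second_moment[OF part[OF elim(4)] finite_subset[OF Usub] ak])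
               (use elim(2) in auto)
        qed simp
        also have "ennreal (B n \<omega> * indicator S \<omega>) = ennreal (B n \<omega>) * indicator S \<omega>"
          by (auto simp: indicator_def)
        finally show ?case by (simp add: ennreal_leI)
      qed
    qed
    finally show "(\<integral>\<^sup>+\<omega>. ennreal ((X n \<omega>)\<^sup>2) * indicator S \<omega> \<partial>M) \<le> (\<integral>\<^sup>+\<omega>. ennreal (B n \<omega>) * indicator S \<omega> \<partial>M)" .
  qed
  then show ?thesis unfolding X_def[abs_def] .
qed

end

section \<open>Comparison of characteristic functions\<close>

text \<open>Taylor bound for the Gaussian factor. A quadratic error means that in the telescoping
  sum only the squares of the conditional variances appear, each of order n to the power -2.\<close>

lemma exp_minus_approx:
  fixes u :: real assumes u: "0 \<le> u"
  shows "\<bar>exp (- u) - (1 - u)\<bar> \<le> u\<^sup>2 / 2"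
proof -
  have pos: "0 < 1 + u + u\<^sup>2 / 2" using u by (simp add: add_pos_nonneg)
  have "exp (- u) = 1 / exp u" by (simp add: exp_minus field_simps)
  also have "\<dots> \<le> 1 / (1 + u + u\<^sup>2 / 2)"
    using exp_lower_Taylor_quadratic[OF u] pos by (intro divide_left_mono) auto
  also have "\<dots> \<le> 1 - u + u\<^sup>2 / 2"
  proof -
    have "(1 - u + u\<^sup>2 / 2) * (1 + u + u\<^sup>2 / 2) = 1 + u ^ 4 / 4"
      by (simp add: algebra_simps power2_eq_square power4_eq_xxxx)
    then have "1 \<le> (1 - u + u\<^sup>2 / 2) * (1 + u + u\<^sup>2 / 2)" by simp
    then show ?thesis using pos by (simp add: divide_le_eq)
  qed
  finally have "exp (- u) \<le> 1 - u + u\<^sup>2 / 2" .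
  moreover have "1 - u \<le> exp (- u)" using exp_ge_add_one_self[of "- u"] by simp
  ultimately show ?thesis by (simp add: abs_le_iff)
qed

context prob_space
begin

text \<open>One replacement changes the expectation by that of \<open>P j\<close> times the
  difference of two exponentials. Expanded to second order, the difference has a term linear in X j
  and one proportional to X j squared minus v j, and both integrate to 0 against \<open>P j\<close>
  by \<open>orth\<close>; what remains is a third-order error for X j and a second-order one for v
  j. \<open>Z\<close> carries a bounded factor through the replacement unchanged, here the
  characteristic factor of \<open>AA\<close>.\<close>

lemma char_telescope:
  fixes X v :: "nat \<Rightarrow> 'a \<Rightarrow> real" and Z :: "'a \<Rightarrow> complex" and s :: real and n :: nat
  defines "P \<equiv> (\<lambda>j \<omega>. Z \<omega> * iexp (s * (\<Sum>i=1..<j. X i \<omega>)) * of_real (exp (- (s\<^sup>2 / 2) * (\<Sum>i=Suc j..n. v i \<omega>))))"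
  assumes X: "\<And>j. j \<in> {1..n} \<Longrightarrow> X j \<in> borel_measurable M"
      "\<And>j. j \<in> {1..n} \<Longrightarrow> integrable M (\<lambda>\<omega>. \<bar>X j \<omega>\<bar> ^ 3)"
    and v: "\<And>j. j \<in> {1..n} \<Longrightarrow> v j \<in> borel_measurable M" "\<And>j \<omega>. j \<in> {1..n} \<Longrightarrow> 0 \<le> v j \<omega>"
      "\<And>j. j \<in> {1..n} \<Longrightarrow> integrable M (\<lambda>\<omega>. (v j \<omega>)\<^sup>2)"
    and Z: "Z \<in> borel_measurable M" "\<And>\<omega>. norm (Z \<omega>) \<le> 1"
    and orth: "\<And>j. j \<in> {1..n} \<Longrightarrow> (\<integral>\<omega>. P j \<omega> * of_real (X j \<omega>) \<partial>M) = 0"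
      "\<And>j. j \<in> {1..n} \<Longrightarrow> (\<integral>\<omega>. P j \<omega> * of_real ((X j \<omega>)\<^sup>2 - v j \<omega>) \<partial>M) = 0"
  shows "norm ((\<integral>\<omega>. Z \<omega> * iexp (s * (\<Sum>i=1..n. X i \<omega>)) \<partial>M) -
      (\<integral>\<omega>. Z \<omega> * of_real (exp (- (s\<^sup>2 / 2) * (\<Sum>i=1..n. v i \<omega>))) \<partial>M))
    \<le> (\<Sum>j=1..n. \<bar>s\<bar> ^ 3 / 6 * (\<integral>\<omega>. \<bar>X j \<omega>\<bar> ^ 3 \<partial>M) + s ^ 4 / 8 * (\<integral>\<omega>. (v j \<omega>)\<^sup>2 \<partial>M))"
proof -
  note [measurable] = Z(1)
  have mX: "(\<lambda>\<omega>. \<Sum>i\<in>I. X i \<omega>) \<in> borel_measurable M" if "I \<subseteq> {1..n}" for I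
    using X(1) that by (intro borel_measurable_sum) auto
  have mv: "(\<lambda>\<omega>. \<Sum>i\<in>I. v i \<omega>) \<in> borel_measurable M" if "I \<subseteq> {1..n}" for I
    using v(1) that by (intro borel_measurable_sum) auto
  have sv0: "0 \<le> (\<Sum>i\<in>I. v i \<omega>)" if "I \<subseteq> {1..n}" for I \<omega>
    using v(2) that by (intro sum_nonneg) auto
  \<comment> \<open>\<open>Q j\<close> has true summands up to j and Gaussian factors beyond it, so
    \<open>Q n\<close> and \<open>Q 0\<close> are the two sides to be compared. \<open>P j\<close>
    has no factor of index j and is common to \<open>Q j\<close> and
    \<open>Q (j - 1)\<close>.\<close>
  define Q where "Q j \<omega> = Z \<omega> * iexp (s * (\<Sum>i=1..<Suc j. X i \<omega>)) * of_real (exp (- (s\<^sup>2 / 2) * (\<Sum>i=Suc j..n.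
      v i \<omega>)))" for j \<omega>
  have norm_e: "norm (complex_of_real (exp (- (s\<^sup>2 / 2) * (\<Sum>i\<in>I. v i \<omega>)))) \<le> 1" if "I \<subseteq> {1..n}" for I \<omega>
    using sv0[OF that, of \<omega>] by (simp add: zero_le_mult_iff)
  have QM: "Q j \<in> borel_measurable M" if "j \<le> n" for j
  proof -
    have [measurable]: "(\<lambda>\<omega>. \<Sum>i=1..<Suc j. X i \<omega>) \<in> borel_measurable M" using that by (intro mX) auto
    have [measurable]: "(\<lambda>\<omega>. \<Sum>i=Suc j..n. v i \<omega>) \<in> borel_measurable M" by (intro mv) auto
    show ?thesis unfolding Q_def by measurable
  qed
  have PM: "P j \<in> borel_measurable M" if "j \<in> {1..n}" for j
  proof -
    have [measurable]: "(\<lambda>\<omega>. \<Sum>i=1..<j. X i \<omega>) \<in> borel_measurable M" using that by (intro mX) auto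
    have [measurable]: "(\<lambda>\<omega>. \<Sum>i=Suc j..n. v i \<omega>) \<in> borel_measurable M" by (intro mv) auto
    show ?thesis unfolding P_def by measurable
  qed
  have Qb: "norm (Q j \<omega>) \<le> 1" for j \<omega>
  proof -
    have "norm (Q j \<omega>) \<le> 1 * 1 * 1" unfolding Q_def norm_mult
      by (intro mult_mono Z(2) norm_e mult_nonneg_nonneg) (auto simp: norm_exp_i_times)
    then show ?thesis by simp
  qed
  have Pb: "norm (P j \<omega>) \<le> 1" for j \<omega>
  proof -
    have "norm (P j \<omega>) \<le> 1 * 1 * 1" unfolding P_def norm_mult
      by (intro mult_mono Z(2) norm_e mult_nonneg_nonneg) (auto simp: norm_exp_i_times)
    then show ?thesis by simp
  qed
  have Qint: "integrable M (Q j)" if "j \<le> n" for j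
    by (rule integrable_const_bound[where B=1]) (use Qb QM[OF that] in auto)
  have Qn: "Q n \<omega> = Z \<omega> * iexp (s * (\<Sum>i=1..n. X i \<omega>))" for \<omega>
    by (simp add: Q_def atLeastLessThanSuc_atLeastAtMost)
  have Q0: "Q 0 \<omega> = Z \<omega> * of_real (exp (- (s\<^sup>2 / 2) * (\<Sum>i=1..n. v i \<omega>)))" for \<omega>
    by (simp add: Q_def)
  have QP1: "Q j \<omega> = P j \<omega> * iexp (s * X j \<omega>)" if "j \<in> {1..n}" for j \<omega>
    using that by (simp add: Q_def P_def distrib_left exp_add mult_ac)
  have QP0: "Q (j - 1) \<omega> = P j \<omega> * of_real (exp (- (s\<^sup>2 / 2) * v j \<omega>))" if "j \<in> {1..n}" for j \<omega>
  proof -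
    have "{j..n} = insert j {Suc j..n}" using that by auto
    then have "(\<Sum>i=j..n. v i \<omega>) = v j \<omega> + (\<Sum>i=Suc j..n. v i \<omega>)" by simp
    moreover have "Suc (j - 1) = j" using that by simp
    ultimately show ?thesis unfolding Q_def P_def
      by (simp only: distrib_left exp_add of_real_mult mult_ac)
  qed
  have step: "norm ((\<integral>\<omega>. Q j \<omega> \<partial>M) - (\<integral>\<omega>. Q (j - 1) \<omega> \<partial>M))
      \<le> \<bar>s\<bar> ^ 3 / 6 * (\<integral>\<omega>. \<bar>X j \<omega>\<bar> ^ 3 \<partial>M) + s ^ 4 / 8 * (\<integral>\<omega>. (v j \<omega>)\<^sup>2 \<partial>M)" if j: "j \<in> {1..n}" for j
  proof -
    note [measurable] = X(1)[OF j] v(1)[OF j] PM[OF j]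
    \<comment> \<open>Only the third moment of X j and the second of v j are assumed; the lower ones
      follow by comparison with 1 plus the higher power.\<close>
    have pw: "\<bar>x\<bar> \<le> 1 + \<bar>x\<bar> ^ 3" "x\<^sup>2 \<le> 1 + \<bar>x\<bar> ^ 3" "\<bar>x\<bar> \<le> 1 + x\<^sup>2" for x :: real
    proof -
      consider "\<bar>x\<bar> \<le> 1" | "\<bar>x\<bar> \<ge> 1" by linarith
      then have "\<bar>x\<bar> \<le> 1 + \<bar>x\<bar> ^ 3 \<and> \<bar>x\<bar> ^ 2 \<le> 1 + \<bar>x\<bar> ^ 3 \<and> \<bar>x\<bar> \<le> 1 + \<bar>x\<bar> ^ 2"
      proof cases
        case 1
        then have "\<bar>x\<bar> ^ 2 \<le> 1" by (intro power_le_one) auto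
        then show ?thesis using 1 by (smt (verit) zero_le_power abs_ge_zero)
      next
        case 2
        then have "\<bar>x\<bar> ^ 1 \<le> \<bar>x\<bar> ^ 3" "\<bar>x\<bar> ^ 2 \<le> \<bar>x\<bar> ^ 3" "\<bar>x\<bar> ^ 1 \<le> \<bar>x\<bar> ^ 2"
          by (intro power_increasing; simp)+
        then show ?thesis by simp
      qed
      then show "\<bar>x\<bar> \<le> 1 + \<bar>x\<bar> ^ 3" "x\<^sup>2 \<le> 1 + \<bar>x\<bar> ^ 3" "\<bar>x\<bar> \<le> 1 + x\<^sup>2" by auto
    qed
    have i3: "integrable M (\<lambda>\<omega>. 1 + \<bar>X j \<omega>\<bar> ^ 3)" using X(2)[OF j] by simp
    have i1: "integrable M (X j)"
      by (rule Bochner_Integration.integrable_bound[OF i3]) (auto intro!: AE_I2 order.trans[OF pw(1)])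
    have i2: "integrable M (\<lambda>\<omega>. (X j \<omega>)\<^sup>2)"
      by (rule Bochner_Integration.integrable_bound[OF i3]) (auto intro!: AE_I2 order.trans[OF pw(2)])
    have iv: "integrable M (v j)"
    proof (rule Bochner_Integration.integrable_bound)
      show "integrable M (\<lambda>\<omega>. 1 + (v j \<omega>)\<^sup>2)" using v(3)[OF j] by simp
    qed (auto intro!: AE_I2 order.trans[OF pw(3)])
    define R where "R \<omega> = (iexp (s * X j \<omega>) - (\<Sum>k\<le>2. (\<i> * (s * X j \<omega>)) ^ k / fact k)) -
        of_real (exp (- (s\<^sup>2 / 2 * v j \<omega>)) - (1 - s\<^sup>2 / 2 * v j \<omega>))" for \<omega>
    have Rb: "norm (R \<omega>) \<le> \<bar>s\<bar> ^ 3 / 6 * \<bar>X j \<omega>\<bar> ^ 3 + s ^ 4 / 8 * (v j \<omega>)\<^sup>2" for \<omega>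
    proof -
      have "norm (R \<omega>) \<le> norm (iexp (s * X j \<omega>) - (\<Sum>k\<le>2. (\<i> * (s * X j \<omega>)) ^ k / fact k)) +
          norm (complex_of_real (exp (- (s\<^sup>2 / 2 * v j \<omega>)) - (1 - s\<^sup>2 / 2 * v j \<omega>)))"
        unfolding R_def by (rule norm_triangle_ineq4)
      also have "\<dots> \<le> \<bar>s * X j \<omega>\<bar> ^ Suc 2 / fact (Suc 2) + (s\<^sup>2 / 2 * v j \<omega>)\<^sup>2 / 2"
        unfolding norm_of_real using v(2)[OF j]
        by (intro add_mono iexp_approx1 exp_minus_approx) auto
      also have "\<dots> = \<bar>s\<bar> ^ 3 / 6 * \<bar>X j \<omega>\<bar> ^ 3 + s ^ 4 / 8 * (v j \<omega>)\<^sup>2"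
        by (simp add: fact_numeral abs_mult power_mult_distrib power_divide flip: power_mult)
      finally show ?thesis .
    qed
    have Rint: "integrable M (\<lambda>\<omega>. \<bar>s\<bar> ^ 3 / 6 * \<bar>X j \<omega>\<bar> ^ 3 + s ^ 4 / 8 * (v j \<omega>)\<^sup>2)"
      using X(2)[OF j] v(3)[OF j] by simp
    have RM[measurable]: "R \<in> borel_measurable M" unfolding R_def by measurable
    have iPR: "integrable M (\<lambda>\<omega>. P j \<omega> * R \<omega>)"
    proof (rule Bochner_Integration.integrable_bound[OF Rint])
      show "AE \<omega> in M. norm (P j \<omega> * R \<omega>) \<le> norm (\<bar>s\<bar> ^ 3 / 6 * \<bar>X j \<omega>\<bar> ^ 3 + s ^ 4 / 8 * (v j \<omega>)\<^sup>2)"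
      proof (intro AE_I2)
        fix \<omega>
        have "norm (P j \<omega> * R \<omega>) \<le> 1 * norm (R \<omega>)" unfolding norm_mult by (intro mult_right_mono Pb) auto
        then show "norm (P j \<omega> * R \<omega>) \<le> norm (\<bar>s\<bar> ^ 3 / 6 * \<bar>X j \<omega>\<bar> ^ 3 + s ^ 4 / 8 * (v j \<omega>)\<^sup>2)"
          using Rb[of \<omega>] by simp
      qed
    qed measurable
    have iP: "integrable M (\<lambda>\<omega>. P j \<omega> * of_real (f \<omega>))" if "integrable M f" for f :: "'a \<Rightarrow> real"
    proof (rule Bochner_Integration.integrable_bound[OF that])
      have [measurable]: "f \<in> borel_measurable M" using that by auto
      show "(\<lambda>\<omega>. P j \<omega> * of_real (f \<omega>)) \<in> borel_measurable M" by measurable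
      show "AE \<omega> in M. norm (P j \<omega> * of_real (f \<omega>)) \<le> norm (f \<omega>)"
        by (intro AE_I2) (simp add: norm_mult mult_left_le_one_le Pb)
    qed
    \<comment> \<open>The constant terms of the two expansions cancel; \<open>R\<close> is the
      difference of their remainders.\<close>
    have "Q j \<omega> - Q (j - 1) \<omega> = P j \<omega> * R \<omega> + (\<i> * s) * (P j \<omega> * of_real (X j \<omega>))
        - (s\<^sup>2 / 2) * (P j \<omega> * of_real ((X j \<omega>)\<^sup>2 - v j \<omega>))" for \<omega>
      unfolding QP1[OF j] QP0[OF j] R_def
      by (simp add: numeral_2_eq_2 algebra_simps power2_eq_square)
    then have "(\<integral>\<omega>. Q j \<omega> - Q (j - 1) \<omega> \<partial>M) = (\<integral>\<omega>. P j \<omega> * R \<omega> \<partial>M) + (\<i> * s) * (\<integral>\<omega>. P j \<omega> * of_real (X j \<omega>) \<partial>M)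
        - (s\<^sup>2 / 2) * (\<integral>\<omega>. P j \<omega> * of_real ((X j \<omega>)\<^sup>2 - v j \<omega>) \<partial>M)"
      using iPR iP[OF i1] iP[OF Bochner_Integration.integrable_diff[OF i2 iv]] by simp
    then have "(\<integral>\<omega>. Q j \<omega> \<partial>M) - (\<integral>\<omega>. Q (j - 1) \<omega> \<partial>M) = (\<integral>\<omega>. P j \<omega> * R \<omega> \<partial>M)"
      using orth[OF j] Bochner_Integration.integral_diff[OF Qint[of j] Qint[of "j - 1"]] j by auto
    also have "norm \<dots> \<le> (\<integral>\<omega>. norm (P j \<omega> * R \<omega>) \<partial>M)" by (rule integral_norm_bound)
    also have "\<dots> \<le> (\<integral>\<omega>. \<bar>s\<bar> ^ 3 / 6 * \<bar>X j \<omega>\<bar> ^ 3 + s ^ 4 / 8 * (v j \<omega>)\<^sup>2 \<partial>M)"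
    proof (rule integral_mono[OF integrable_norm[OF iPR] Rint])
      fix \<omega>
      have "norm (P j \<omega> * R \<omega>) \<le> 1 * norm (R \<omega>)" unfolding norm_mult by (intro mult_right_mono Pb) auto
      then show "norm (P j \<omega> * R \<omega>) \<le> \<bar>s\<bar> ^ 3 / 6 * \<bar>X j \<omega>\<bar> ^ 3 + s ^ 4 / 8 * (v j \<omega>)\<^sup>2"
        using Rb[of \<omega>] by simp
    qed
    also have "\<dots> = \<bar>s\<bar> ^ 3 / 6 * (\<integral>\<omega>. \<bar>X j \<omega>\<bar> ^ 3 \<partial>M) + s ^ 4 / 8 * (\<integral>\<omega>. (v j \<omega>)\<^sup>2 \<partial>M)"
      using X(2)[OF j] v(3)[OF j] by simp
    finally show ?thesis .
  qed
  have "(\<Sum>j=1..m. F j - F (j - 1)) = F m - F 0" for F :: "nat \<Rightarrow> complex" and m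
    by (induction m) auto
  from this[symmetric] have "(\<integral>\<omega>. Q n \<omega> \<partial>M) - (\<integral>\<omega>. Q 0 \<omega> \<partial>M) = (\<Sum>j=1..n. (\<integral>\<omega>. Q j \<omega> \<partial>M) - (\<integral>\<omega>. Q (j - 1) \<omega> \<partial>M))" .
  also have "norm \<dots> \<le> (\<Sum>j=1..n. \<bar>s\<bar> ^ 3 / 6 * (\<integral>\<omega>. \<bar>X j \<omega>\<bar> ^ 3 \<partial>M) + s ^ 4 / 8 * (\<integral>\<omega>. (v j \<omega>)\<^sup>2 \<partial>M))"
    by (rule sum_norm_le) (use step in auto)
  finally show ?thesis unfolding Qn Q0 .
qed

section \<open>Conditional centering under independence\<close>

text \<open>A conditional mean that is 0 given \<open>E1\<close> stays 0 given \<open>E1\<close> and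
  \<open>E2\<close> together, if \<open>E2\<close> is independent of an algebra \<open>EW\<close>
  that contains \<open>E1\<close> and makes \<open>u\<close> measurable. On a rectangle of an
  \<open>E1\<close>-event and an \<open>E2\<close>-event the integral factors; such rectangles are
  stable under intersection and generate \<open>H\<close>. In the application \<open>E1\<close> is
  the covariate of a unit, \<open>EW\<close> the whole unit, \<open>E2\<close> everything
  else.\<close>

lemma integral_mult_eq_0_of_indep:
  fixes u Z :: "'a \<Rightarrow> real"
  assumes sub: "subalgebra M E1" "subalgebra M EW" "subalgebra M E2" "sets E1 \<subseteq> sets EW"
    and ind: "indep_set (sets EW) (sets E2)"
    and u: "u \<in> borel_measurable EW" "integrable M u" "\<And>A. A \<in> sets E1 \<Longrightarrow> (\<integral>\<omega>. indicator A \<omega> * u \<omega> \<partial>M) = 0"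
  defines "H \<equiv> sigma (space M) {A \<inter> B | A B. A \<in> sets E1 \<and> B \<in> sets E2}"
  assumes Z: "Z \<in> borel_measurable H" "integrable M (\<lambda>\<omega>. Z \<omega> * u \<omega>)"
  shows "(\<integral>\<omega>. Z \<omega> * u \<omega> \<partial>M) = 0"
proof -
  define Gen where "Gen = {A \<inter> B | A B. A \<in> sets E1 \<and> B \<in> sets E2}"
  have sp: "space E1 = space M" "space EW = space M" "space E2 = space M" using sub by (auto simp: subalgebra_def)
  have E1M: "A \<in> sets M" if "A \<in> sets E1" for A using sub that by (auto simp: subalgebra_def)
  have E2M: "A \<in> sets M" if "A \<in> sets E2" for A using sub that by (auto simp: subalgebra_def)
  have GenM: "Gen \<subseteq> sets M" using E1M E2M by (auto simp: Gen_def)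
  have GenP: "Gen \<subseteq> Pow (space M)" using GenM sets.sets_into_space by auto
  have setsH: "sets H = sigma_sets (space M) Gen" unfolding H_def Gen_def[symmetric] using GenP by (rule sets_measure_of)
  have spH: "space H = space M" unfolding H_def Gen_def[symmetric] using GenP by (rule space_measure_of)
  have HM: "subalgebra M H" unfolding subalgebra_def setsH spH using GenM by (simp add: sets.sigma_sets_subset)
  have stable: "Int_stable Gen"
  proof (rule Int_stableI)
    fix a b assume "a \<in> Gen" "b \<in> Gen"
    then obtain A B A' B' where *: "a = A \<inter> B" "b = A' \<inter> B'" "A \<in> sets E1" "B \<in> sets E2" "A' \<in> sets E1" "B' \<in> sets E2"
      by (auto simp: Gen_def)
    then have "a \<inter> b = (A \<inter> A') \<inter> (B \<inter> B')" by auto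
    moreover have "A \<inter> A' \<in> sets E1" "B \<inter> B' \<in> sets E2" using * by auto
    ultimately show "a \<inter> b \<in> Gen" unfolding Gen_def by blast
  qed
  have [measurable]: "u \<in> borel_measurable M" using u(2) by auto
  have int: "integrable M (\<lambda>\<omega>. indicator S \<omega> * u \<omega>)" if "S \<in> sets M" for S
    using integrable_mult_indicator[OF that u(2)] by simp
  have zero: "(\<integral>\<omega>. indicator S \<omega> * u \<omega> \<partial>M) = 0" if "S \<in> sigma_sets (space M) Gen" for S
    using stable GenP that
  proof (induction rule: sigma_sets_induct_disjoint)
    case (basic S)
    then obtain A B where S: "S = A \<inter> B" and A: "A \<in> sets E1" and B: "B \<in> sets E2" by (auto simp: Gen_def)
    define f where "f \<omega> = indicator A \<omega> * u \<omega>" for \<omega>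
    define g where "g = (indicator B :: 'a \<Rightarrow> real)"
    have fEW: "f \<in> borel_measurable EW" unfolding f_def using u(1) A sub(4)
        by (intro borel_measurable_times borel_measurable_indicator) auto
    have gE2: "g \<in> borel_measurable E2" unfolding g_def using B by (intro borel_measurable_indicator)
    have "indep_var borel f borel g"
      unfolding indep_var_eq
    proof (intro conjI)
      show "random_variable borel f" by (rule measurable_from_subalg[OF sub(2) fEW])
      show "random_variable borel g" by (rule measurable_from_subalg[OF sub(3) gE2])
      have "{f -` A \<inter> space M |A. A \<in> sets borel} \<subseteq> sets EW" using fEW by (auto simp: measurable_def sp)
      then have 1: "sigma_sets (space M) {f -` A \<inter> space M |A. A \<in> sets borel} \<subseteq> sets EW"
        using sets.sigma_sets_subset[of _ EW] by (simp add: sp)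
      have "{g -` A \<inter> space M |A. A \<in> sets borel} \<subseteq> sets E2" using gE2 by (auto simp: measurable_def sp)
      then have 2: "sigma_sets (space M) {g -` A \<inter> space M |A. A \<in> sets borel} \<subseteq> sets E2"
        using sets.sigma_sets_subset[of _ E2] by (simp add: sp)
      show "indep_set (sigma_sets (space M) {f -` A \<inter> space M |A. A \<in> sets borel})
          (sigma_sets (space M) {g -` A \<inter> space M |A. A \<in> sets borel})"
        unfolding indep_set_def
      proof (rule indep_sets_mono_sets[OF ind[unfolded indep_set_def]])
        show "case_bool (sigma_sets (space M) {f -` A \<inter> space M |A. A \<in> sets borel})
          (sigma_sets (space M) {g -` A \<inter> space M |A. A \<in> sets borel}) b \<subseteq>
          case_bool (sets EW) (sets E2) b" for b
          using 1 2 by (cases b) simp_all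
      qed
    qed
    \<comment> \<open>Independence is applied to the product of \<open>u\<close> with the
      \<open>E1\<close>-indicator on one side, which is still \<open>EW\<close>-measurable, and the
      \<open>E2\<close>-indicator on the other.\<close>
    then have "(\<integral>\<omega>. f \<omega> * g \<omega> \<partial>M) = (\<integral>\<omega>. f \<omega> \<partial>M) * (\<integral>\<omega>. g \<omega> \<partial>M)"
      by (rule indep_var_lebesgue_integral)
         (use int[OF E1M[OF A]] E2M[OF B] in \<open>auto simp: f_def[abs_def] g_def integrable_real_indicator emeasure_eq_measure\<close>)
    also have "(\<integral>\<omega>. f \<omega> \<partial>M) = 0" unfolding f_def by (rule u(3)[OF A])
    finally show ?case unfolding f_def g_def S by (simp add: indicator_inter_arith mult_ac)
  next
    case empty
    then show ?case by simp
  next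
    case (compl S)
    have SM: "S \<in> sets M" using compl(1) GenM sets.sigma_sets_subset by auto
    have "(\<integral>\<omega>. indicator (space M - S) \<omega> * u \<omega> \<partial>M) = (\<integral>\<omega>. indicator (space M) \<omega> * u \<omega> - indicator S \<omega> * u \<omega> \<partial>M)"
      by (intro Bochner_Integration.integral_cong) (auto simp: indicator_def)
    also have "\<dots> = (\<integral>\<omega>. indicator (space M) \<omega> * u \<omega> \<partial>M) - (\<integral>\<omega>. indicator S \<omega> * u \<omega> \<partial>M)"
      using int SM by (intro Bochner_Integration.integral_diff) auto
    also have "\<dots> = 0" using compl.IH u(3)[of "space M"] sets.top[of E1] sp by simp
    finally show ?case .
  next
    case (union S)
    have SM: "S i \<in> sets M" for i using union(2) GenM sets.sigma_sets_subset[of Gen M] by auto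
    have "(LINT \<omega>:(\<Union>i. S i)|M. u \<omega>) = (\<Sum>i. (LINT \<omega>:S i|M. u \<omega>))"
      using union(1) SM int[of "\<Union>i. S i"]
      by (intro lebesgue_integral_countable_add) (auto simp: disjoint_family_on_def set_integrable_def)
    then show ?case using union.IH by (simp add: set_lebesgue_integral_def)
  qed
  interpret finite_measure_subalgebra M H by (rule finite_measure_subalgebraI[OF HM])
  have "AE \<omega> in M. real_cond_exp M H u \<omega> = 0"
    by (rule real_cond_exp_charact) (use zero u(2) in \<open>auto simp: setsH set_lebesgue_integral_def\<close>)
  then have "(\<integral>\<omega>. Z \<omega> * real_cond_exp M H u \<omega> \<partial>M) = (\<integral>\<omega>. 0 \<partial>M)"
    by (intro integral_cong_AE) (use measurable_from_subalg[OF HM Z(1)] in \<open>auto elim: eventually_mono\<close>)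
  then show ?thesis using real_cond_exp_intg(2)[OF Z(2,1)] by simp
qed

section \<open>Generated sigma-algebras and independence of one unit from the rest\<close>

lemma space_sigma_of [simp]: "space (sigma_of M f N) = space M"
  by (simp add: sigma_of_def)

lemma measurable_sigma_of: "f \<in> M \<rightarrow>\<^sub>M N \<Longrightarrow> f \<in> sigma_of M f N \<rightarrow>\<^sub>M N"
  unfolding sigma_of_def by (rule measurable_vimage_algebra1) (auto dest: measurable_space)

lemma sigma_of_least:
  assumes "f \<in> H \<rightarrow>\<^sub>M N" "space H = space M"
  shows "sets (sigma_of M f N) \<subseteq> sets H"
proof -
  have "f \<in> space M \<rightarrow> space N" using measurable_space[OF assms(1)] assms(2) by auto
  then show ?thesis
    unfolding sigma_of_def using measurable_sets[OF assms(1)] assms(2) by (auto simp: sets_vimage_algebra2)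
qed

lemma subalgebra_sigma_of:
  "f \<in> H \<rightarrow>\<^sub>M N \<Longrightarrow> space H = space M \<Longrightarrow> subalgebra H (sigma_of M f N)"
  unfolding subalgebra_def by (intro conjI sigma_of_least) simp_all

lemma sigma_of_subalgebra: "f \<in> M \<rightarrow>\<^sub>M N \<Longrightarrow> subalgebra M (sigma_of M f N)"
  by (rule subalgebra_sigma_of) auto

text \<open>Two independence assumptions are merged: the units among themselves, and their vector
  jointly with \<pi> and \<xi>. The n + 2 sigma-algebras are shown to be one independent family,
  which may then be regrouped into {j} and its complement.\<close>

lemma indep_set_unit_rest:
  fixes W :: "nat \<Rightarrow> 'a \<Rightarrow> 'w::topological_space"
  assumes W: "indep_vars (\<lambda>_. borel) W {1..}"
    and ind: "mutually_indep3 M (upto_n W n) (borel_vec n) \<pi> NP \<xi> NX"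
    and j: "j \<in> {1..n}"
  shows "indep_set (sets (sigma_of M (W j) borel))
    (sigma_sets (space M) ((\<Union>i\<in>{1..n} - {j}. sets (sigma_of M (W i) borel)) \<union>
       sets (sigma_of M \<pi> NP) \<union> sets (sigma_of M \<xi> NX)))"
proof -
  \<comment> \<open>The random objects have different types, so the family consists of systems of
    events: units at their own index, \<pi> at Suc n, \<xi> at Suc (Suc n).\<close>
  define E where "E i = (if i \<le> n then sets (sigma_of M (W i) borel)
    else if i = Suc n then sets (sigma_of M \<pi> NP) else sets (sigma_of M \<xi> NX))" for i
  have WM: "W i \<in> M \<rightarrow>\<^sub>M borel" if "i \<ge> 1" for i using W that by (auto simp: indep_vars_def)
  have m: "upto_n W n \<in> M \<rightarrow>\<^sub>M borel_vec n" "\<pi> \<in> M \<rightarrow>\<^sub>M NP" "\<xi> \<in> M \<rightarrow>\<^sub>M NX"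
    and i3: "indep_sets (\<lambda>j. [sets (sigma_of M (upto_n W n) (borel_vec n)), sets (sigma_of M \<pi> NP),
        sets (sigma_of M \<xi> NX)] ! j) {..<3}"
    using ind by (auto simp: mutually_indep3_def)
  have sub: "subalgebra M (sigma_of M \<pi> NP)" "subalgebra M (sigma_of M \<xi> NX)"
    "\<And>i. i \<ge> 1 \<Longrightarrow> subalgebra M (sigma_of M (W i) borel)"
    using m WM by (auto intro: sigma_of_subalgebra)
  have Eev: "E i \<subseteq> events" if "i \<in> {1..Suc (Suc n)}" for i
    using sub that by (auto simp: E_def subalgebra_def)
  have Etop: "space M \<in> E i" if "i \<in> {1..Suc (Suc n)}" for i
    using sets.top[of "sigma_of M \<pi> NP"] sets.top[of "sigma_of M \<xi> NX"] sets.top[of "sigma_of M (W i) borel"]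
    by (auto simp: E_def sigma_of_def)
  have Wn: "W i \<in> sigma_of M (upto_n W n) (borel_vec n) \<rightarrow>\<^sub>M borel" if "i \<in> {1..n}" for i
  proof -
    have "(\<lambda>\<omega>. upto_n W n \<omega> i) \<in> sigma_of M (upto_n W n) (borel_vec n) \<rightarrow>\<^sub>M borel"
      by (rule measurable_compose[OF measurable_sigma_of[OF m(1)] measurable_component_singleton[OF that]])
    then show ?thesis using that by (simp add: upto_n_def[abs_def])
  qed
  have n1: "n \<ge> 1" using j by simp
  have indE: "indep_sets E {1..Suc (Suc n)}"
  proof (rule indep_sets_finite[OF _ _ Eev Etop, THEN iffD2], simp, simp, assumption, assumption, intro ballI)
    fix A assume A: "A \<in> Pi {1..Suc (Suc n)} E"
    define J where "J = (\<Inter>i\<in>{1..n}. A i)"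
    have AW: "A i \<in> sets (sigma_of M (W i) borel)" if "i \<in> {1..n}" for i
      using A that by (auto simp: E_def Pi_iff dest!: bspec[of _ _ i])
    have A1: "A (Suc n) \<in> sets (sigma_of M \<pi> NP)" using A by (auto simp: E_def Pi_iff dest!: bspec[of _ _ "Suc n"])
    have A2: "A (Suc (Suc n)) \<in> sets (sigma_of M \<xi> NX)" using A
        by (auto simp: E_def Pi_iff dest!: bspec[of _ _ "Suc (Suc n)"])
    have "A i \<in> sets (sigma_of M (upto_n W n) (borel_vec n))" if "i \<in> {1..n}" for i
      using sigma_of_least[OF Wn[OF that]] AW[OF that] by (auto simp: sigma_of_def)
    then have J: "J \<in> sets (sigma_of M (upto_n W n) (borel_vec n))"
      unfolding J_def using n1 by (intro sets.finite_INT) auto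
    have ev: "{1..Suc (Suc n)} = {1..n} \<union> {Suc n, Suc (Suc n)}" by auto
    \<comment> \<open>The intersection \<open>J\<close> over the units is an event of the vector W,
      so mutual independence of the three objects splits off \<pi> and \<xi>; independence of the
      units then splits \<open>J\<close>.\<close>
    have "prob (\<Inter>i\<in>{1..Suc (Suc n)}. A i) = prob (\<Inter>i\<in>{..<3}. [J, A (Suc n), A (Suc (Suc n))] ! i)"
      unfolding ev by (rule arg_cong[where f=prob]) (auto simp: J_def lessThan_Suc numeral_3_eq_3 INT_Un)
    also have "\<dots> = (\<Prod>i\<in>{..<3}. prob ([J, A (Suc n), A (Suc (Suc n))] ! i))"
      by (rule indep_setsD[OF i3]) (use J A1 A2 in \<open>auto simp: numeral_3_eq_3 less_Suc_eq nth_Cons'\<close>)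
    also have "\<dots> = prob J * prob (A (Suc n)) * prob (A (Suc (Suc n)))"
      by (simp add: lessThan_Suc numeral_3_eq_3 mult_ac)
    also have "prob J = (\<Prod>i\<in>{1..n}. prob (A i))"
    proof -
      have Wi: "indep_sets (\<lambda>i. sets (sigma_of M (W i) borel)) {1..}"
        using W unfolding indep_vars_def sigma_of_def sets_vimage_algebra by simp
      show ?thesis unfolding J_def by (rule indep_setsD[OF Wi]) (use n1 AW in auto)
    qed
    finally show "prob (\<Inter>i\<in>{1..Suc (Suc n)}. A i) = (\<Prod>i\<in>{1..Suc (Suc n)}. prob (A i))"
      by (simp add: mult_ac)
  qed
  define I where "I b = (if b then {j} else {1..Suc (Suc n)} - {j})" for b
  have "indep_sets (\<lambda>b. sigma_sets (space M) (\<Union>i\<in>I b. E i)) UNIV"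
  proof (rule indep_sets_collect_sigma)
    have "(\<Union>b\<in>UNIV. I b) = {1..Suc (Suc n)}" using j by (auto simp: I_def UNIV_bool)
    then show "indep_sets E (\<Union>b\<in>UNIV. I b)" using indE by simp
    show "Int_stable (E i)" for i by (auto simp: E_def intro: sets.Int_stable)
    show "disjoint_family_on I UNIV" by (auto simp: disjoint_family_on_def I_def)
  qed
  then have "indep_set (sigma_sets (space M) (E j)) (sigma_sets (space M) (\<Union>i\<in>{1..Suc (Suc n)} - {j}. E i))"
    unfolding indep_set_def
    by (rule indep_sets_cong[THEN iffD1, rotated 2]) (auto simp: I_def split: bool.split)
  moreover have "sigma_sets (space M) (E j) = sets (sigma_of M (W j) borel)"
    using j sets.sigma_sets_eq[of "sigma_of M (W j) borel"] by (simp add: E_def sigma_of_def)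
  moreover have "(\<Union>i\<in>{1..Suc (Suc n)} - {j}. E i) = (\<Union>i\<in>{1..n} - {j}. sets (sigma_of M (W i) borel)) \<union>
       sets (sigma_of M \<pi> NP) \<union> sets (sigma_of M \<xi> NX)"
  proof -
    have "{1..Suc (Suc n)} - {j} = ({1..n} - {j}) \<union> {Suc n, Suc (Suc n)}" using j by auto
    then show ?thesis by (auto simp: E_def)
  qed
  ultimately show ?thesis by simp
qed

end

section \<open>Auxiliary inequalities and facts on independence and normal laws\<close>

lemma mean_square_le: "((1 / real n) * (\<Sum>i=1..n. x i))\<^sup>2 \<le> (1 / real n) * (\<Sum>i=1..n. (x i)\<^sup>2)"
proof (cases "n = 0")
  case False
  have "(\<Sum>i=1..n. x i * 1)\<^sup>2 \<le> (\<Sum>i=1..n. (x i)\<^sup>2) * (\<Sum>i=1..n. 1\<^sup>2)"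
    by (rule Cauchy_Schwarz_ineq_sum)
  then have "(\<Sum>i=1..n. x i)\<^sup>2 \<le> real n * (\<Sum>i=1..n. (x i)\<^sup>2)" by (simp add: mult.commute)
  then have "(\<Sum>i=1..n. x i)\<^sup>2 / (real n)\<^sup>2 \<le> real n * (\<Sum>i=1..n. (x i)\<^sup>2) / (real n)\<^sup>2"
    by (rule divide_right_mono) simp
  then show ?thesis using False by (simp add: power_mult_distrib power_divide power2_eq_square)
qed simp

text \<open>From u - v = (sqrt u - sqrt v) * (sqrt u + sqrt v), dropping sqrt u from the second
  factor. With \<open>v\<close> bounded away from 0 this turns mean-square errors of variances into
  those of standard deviations.\<close>

lemma sqrt_diff_square_le:
  assumes "u \<ge> 0" "v > 0"
  shows "(sqrt u - sqrt v)\<^sup>2 \<le> (u - v)\<^sup>2 / v"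
proof -
  have pos: "sqrt u + sqrt v > 0" using assms by (simp add: add_nonneg_pos)
  have "u - v = (sqrt u - sqrt v) * (sqrt u + sqrt v)" using assms by (simp add: algebra_simps)
  then have "(u - v)\<^sup>2 = (sqrt u - sqrt v)\<^sup>2 * (sqrt u + sqrt v)\<^sup>2" by (simp add: power_mult_distrib)
  moreover have "v \<le> (sqrt u + sqrt v)\<^sup>2"
    using assms by (simp add: power2_sum)
  ultimately have "(sqrt u - sqrt v)\<^sup>2 * v \<le> (u - v)\<^sup>2" by (simp add: mult_left_mono)
  then show ?thesis using assms by (simp add: le_divide_eq)
qed

text \<open>Units are numbered from 1, the central limit theorem numbers its summands from
  0.\<close>

lemma (in prob_space) indep_vars_Suc:
  assumes "indep_vars (\<lambda>_. N) X {1..}"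
  shows "indep_vars (\<lambda>_. N) (\<lambda>i. X (Suc i)) UNIV"
  unfolding indep_vars_def2
proof (intro conjI ballI)
  have rv: "\<forall>i\<in>{1..}. random_variable N (X i)" and ind: "indep_sets (\<lambda>i. {X i -` A \<inter> space M |A. A \<in> sets N}) {1..}"
    using assms by (auto simp: indep_vars_def2)
  show "random_variable N (X (Suc i))" for i using rv by simp
  show "indep_sets (\<lambda>i. {X (Suc i) -` A \<inter> space M |A. A \<in> sets N}) UNIV"
  proof (rule indep_setsI)
    show "{X (Suc i) -` A \<inter> space M |A. A \<in> sets N} \<subseteq> events" for i
      using rv by (auto intro: measurable_sets)
    fix A J assume J: "J \<noteq> {}" "finite J" "\<forall>j\<in>J. A j \<in> {X (Suc j) -` A \<inter> space M |A. A \<in> sets N}"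
    have "prob (\<Inter>i\<in>Suc ` J. A (i - 1)) = (\<Prod>i\<in>Suc ` J. prob (A (i - 1)))"
      by (rule indep_setsD[OF ind]) (use J in auto)
    then show "prob (\<Inter>j\<in>J. A j) = (\<Prod>j\<in>J. prob (A j))" by (simp add: prod.reindex)
  qed
qed

lemma char_normal_distribution:
  assumes "0 < \<sigma>"
  shows "char (density lborel (normal_density 0 \<sigma>)) s = of_real (exp (- (\<sigma>\<^sup>2 * s\<^sup>2) / 2))"
proof -
  interpret N: prob_space std_normal_distribution by (rule prob_space_normal_density) simp
  have "distributed std_normal_distribution lborel (\<lambda>x. x) std_normal_density"
    by (auto simp: distributed_def distr_id2)
  from N.normal_density_affine[OF this _ , of \<sigma> 0] assms
  have "distr std_normal_distribution lborel (\<lambda>x. \<sigma> * x) = density lborel (normal_density 0 \<sigma>)"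
    by (simp add: distributed_def)
  then have "char (density lborel (normal_density 0 \<sigma>)) s = char (distr std_normal_distribution lborel (\<lambda>x.
      \<sigma> * x)) s" by simp
  also have "\<dots> = char std_normal_distribution (s * \<sigma>)"
    unfolding char_def by (subst integral_distr) (auto simp: mult_ac)
  also have "\<dots> = of_real (exp (- (\<sigma>\<^sup>2 * s\<^sup>2) / 2))"
    by (simp add: char_std_normal_distribution power_mult_distrib mult.commute)
  finally show ?thesis .
qed

section \<open>Locally randomized designs\<close>

locale local_design =
  fixes M :: "'a measure"
    and NP :: "nat \<Rightarrow> 'b measure" and NX :: "nat \<Rightarrow> 'c measure"
    and \<psi> :: "nat \<Rightarrow> 'a \<Rightarrow> real^'d"
    and Y :: "nat \<Rightarrow> nat \<Rightarrow> 'a \<Rightarrow> real"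
    and W :: "nat \<Rightarrow> 'a \<Rightarrow> (real^'d) \<times> real \<times> real"
    and \<pi> :: "nat \<Rightarrow> 'a \<Rightarrow> 'b" and \<xi> :: "nat \<Rightarrow> 'a \<Rightarrow> 'c"
    and p B \<alpha> \<delta> C\<^sub>l C\<^sub>u :: real and p_num p_den :: nat
    and C c :: "real^'d \<Rightarrow> real"
    and \<sigma>2 :: "nat \<Rightarrow> real^'d \<Rightarrow> real"
    and \<sigma>2_hat :: "nat \<Rightarrow> 'a \<Rightarrow> nat \<Rightarrow> real^'d \<Rightarrow> real"
    and q\<^sub>n :: "nat \<Rightarrow> 'a \<Rightarrow> real^'d \<Rightarrow> real"
    and L :: "nat \<Rightarrow> 'a \<Rightarrow> nat" and a k :: "nat \<Rightarrow> 'a \<Rightarrow> nat \<Rightarrow> nat"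
    and k_bar L_bar :: "nat \<Rightarrow> nat"
    and T D :: "nat \<Rightarrow> nat \<Rightarrow> 'a \<Rightarrow> bool"
    and P\<^sub>\<psi> :: "(real^'d) measure"
  assumes M: "prob_space M"
    and W: "W = (\<lambda>i \<omega>. (\<psi> i \<omega>, Y 0 i \<omega>, Y 1 i \<omega>))"
    and W_indep: "prob_space.indep_vars M (\<lambda>_. borel) W {1..}"
    and W_ident: "\<And>i. i \<ge> 1 \<Longrightarrow> distr M borel (W i) = distr M borel (W 1)"
    and P\<psi>: "P\<^sub>\<psi> = distr M borel (\<psi> 1)"
    and indep: "\<And>n. mutually_indep3 M (upto_n W n) (borel_vec n) (\<pi> n) (NP n) (\<xi> n) (NX n)"
    and p: "p = real p_num / real p_den" "0 < p" "p < 1"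
    and B: "0 < B"
    and C: "C \<in> borel_measurable borel"
    and \<sigma>2: "\<And>d. d \<in> {0, 1} \<Longrightarrow> is_cond_var M (\<psi> 1) (Y d 1) (\<sigma>2 d)"
    and c: "is_cond_mean M (\<psi> 1) (\<lambda>\<omega>. Y 1 1 \<omega> - Y 0 1 \<omega>) c"
    and \<sigma>2_hat: "\<And>n d. d \<in> {0, 1} \<Longrightarrow>
          (\<lambda>(\<omega>, x). \<sigma>2_hat n \<omega> d x) \<in> borel_measurable (sigma_of M (\<xi> n) (NX n) \<Otimes>\<^sub>M borel)"
    and \<sigma>2_hat_nonneg: "\<And>n d \<omega> x. d \<in> {0, 1} \<Longrightarrow> \<omega> \<in> space M \<Longrightarrow> \<sigma>2_hat n \<omega> d x \<ge> 0"
    and q\<^sub>n: "\<And>n. (\<lambda>(\<omega>, x). q\<^sub>n n \<omega> x) \<in> borel_measurable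
          (sigma_of M (\<lambda>\<omega>. (\<xi> n \<omega>, upto_n \<psi> n \<omega>)) (NX n \<Otimes>\<^sub>M borel_vec n) \<Otimes>\<^sub>M borel)"
    and L: "\<And>n. L n \<in>
          sigma_of M (\<lambda>\<omega>. (\<xi> n \<omega>, upto_n \<psi> n \<omega>)) (NX n \<Otimes>\<^sub>M borel_vec n) \<rightarrow>\<^sub>M count_space UNIV"
    and a: "\<And>n l. (\<lambda>\<omega>. a n \<omega> l) \<in>
          sigma_of M (\<lambda>\<omega>. (\<xi> n \<omega>, upto_n \<psi> n \<omega>)) (NX n \<Otimes>\<^sub>M borel_vec n) \<rightarrow>\<^sub>M count_space UNIV"
    and k: "\<And>n l. (\<lambda>\<omega>. k n \<omega> l) \<in>
          sigma_of M (\<lambda>\<omega>. (\<xi> n \<omega>, upto_n \<psi> n \<omega>)) (NX n \<Otimes>\<^sub>M borel_vec n) \<rightarrow>\<^sub>M count_space UNIV"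
    and k_pos: "\<And>n \<omega> l. \<omega> \<in> space M \<Longrightarrow> l \<in> {1..L n \<omega>} \<Longrightarrow> 0 < k n \<omega> l"
    and q\<^sub>n_levels: "\<And>n \<omega> x. n \<ge> 1 \<Longrightarrow> \<omega> \<in> space M \<Longrightarrow>
          q\<^sub>n n \<omega> x \<in> {real (a n \<omega> l) / real (k n \<omega> l) | l. l \<in> {1..L n \<omega>}}"
    and k_bar: "\<And>n \<omega> l. \<omega> \<in> space M \<Longrightarrow> l \<in> {1..L n \<omega>} \<Longrightarrow> k n \<omega> l \<le> k_bar n"
    and L_bar: "\<And>n \<omega>. \<omega> \<in> space M \<Longrightarrow> L n \<omega> \<le> L_bar n"
    and T: "loc_sampling M NP NX \<psi> W \<pi> \<xi> q\<^sub>n L a k T"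
    and D: "loc_assignment M NP NX \<psi> W \<pi> \<xi> T p_num p_den D"
    and Y_moment: "\<And>d. d \<in> {0, 1} \<Longrightarrow> integrable M (\<lambda>\<omega>. (Y d 1 \<omega>) ^ 4)"
    and \<alpha>: "\<alpha> > real CARD('d) + 1"
    and \<sigma>2_inf: "\<And>d. d \<in> {0, 1} \<Longrightarrow> \<exists>\<epsilon>>0. AE x in P\<^sub>\<psi>. \<epsilon> \<le> \<sigma>2 d x"
    and \<delta>: "\<delta> > 0"
    and q\<^sub>n_bounds: "\<And>n. AE \<omega> in M. \<forall>i\<in>{1..n}. \<delta> < q\<^sub>n n \<omega> (\<psi> i \<omega>) \<and> q\<^sub>n n \<omega> (\<psi> i \<omega>) \<le> 1"
    and q_star_bounds: "AE x in P\<^sub>\<psi>. \<delta> < q_star P\<^sub>\<psi> B p C \<sigma>2 x \<and> q_star P\<^sub>\<psi> B p C \<sigma>2 x \<le> 1"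
    and C_bounds: "0 < C\<^sub>l" "AE x in P\<^sub>\<psi>. C\<^sub>l \<le> C x \<and> C x \<le> C\<^sub>u"
    and \<sigma>2_hat_consistent: "\<And>d. d \<in> {0, 1} \<Longrightarrow>
          op1 M (\<lambda>n \<omega>. \<integral>\<^sup>+x. ennreal ((\<sigma>2_hat n \<omega> d x - \<sigma>2 d x)\<^sup>2) \<partial>P\<^sub>\<psi>)"
    and discretization: "op1 M (\<lambda>n \<omega>. ennreal ((1 / real n) *
          (\<Sum>i=1..n. (q\<^sub>n n \<omega> (\<psi> i \<omega>)
              - q_hat n (\<lambda>j. \<psi> j \<omega>) B p C (\<sigma>2_hat n \<omega>) (\<psi> i \<omega>))\<^sup>2)))"
    and kL_rate: "(\<lambda>n. real (k_bar n) * real (L_bar n))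
          \<in> o(\<lambda>n. real n powr (1 - (real CARD('d) + 1) / \<alpha>))"
begin

section \<open>The sigma-algebras of the design and measurability\<close>

sublocale prob_space M by (rule M)

text \<open>\<open>FT\<close> and \<open>FD\<close> are the information given which sampling and
  assignment are randomized; \<open>AT\<close> and \<open>AD\<close> are what the partitions may
  depend on. The letters differ in the outcomes: F contains all of W, A only the covariates.
  \<open>XP\<close> determines the propensity and its levels.\<close>

definition "FT n = sigma_of M (\<lambda>\<omega>. (upto_n W n \<omega>, \<pi> n \<omega>, \<xi> n \<omega>)) (borel_vec n \<Otimes>\<^sub>M NP n \<Otimes>\<^sub>M NX n)"
definition "AT n = sigma_of M (\<lambda>\<omega>. (upto_n \<psi> n \<omega>, \<pi> n \<omega>, \<xi> n \<omega>)) (borel_vec n \<Otimes>\<^sub>M NP n \<Otimes>\<^sub>M NX n)"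
definition "FD n = sigma_of M (\<lambda>\<omega>. (upto_n W n \<omega>, \<pi> n \<omega>, \<xi> n \<omega>, upto_n (T n) n \<omega>))
  (borel_vec n \<Otimes>\<^sub>M NP n \<Otimes>\<^sub>M NX n \<Otimes>\<^sub>M bool_vec n)"
definition "AD n = sigma_of M (\<lambda>\<omega>. (upto_n \<psi> n \<omega>, upto_n (T n) n \<omega>, \<pi> n \<omega>, \<xi> n \<omega>))
  (borel_vec n \<Otimes>\<^sub>M bool_vec n \<Otimes>\<^sub>M NP n \<Otimes>\<^sub>M NX n)"
definition "XP n = sigma_of M (\<lambda>\<omega>. (\<xi> n \<omega>, upto_n \<psi> n \<omega>)) (NX n \<Otimes>\<^sub>M borel_vec n)"

lemma space_design_algebras [simp]:
  "space (FT n) = space M" "space (AT n) = space M" "space (FD n) = space M" "space (AD n) =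
      space M" "space (XP n) = space M"
  by (simp_all add: FT_def AT_def FD_def AD_def XP_def)

lemma \<psi>_W: "\<psi> i \<omega> = fst (W i \<omega>)"
  by (simp_all add: W)

lemma measurable_components:
  assumes "W i \<in> H \<rightarrow>\<^sub>M borel"
  shows "\<psi> i \<in> H \<rightarrow>\<^sub>M borel" "Y 0 i \<in> H \<rightarrow>\<^sub>M borel" "Y 1 i \<in> H \<rightarrow>\<^sub>M borel"
proof -
  have c: "f \<in> borel_measurable borel" if "continuous_on UNIV f" for f :: "(real^'d) \<times> real \<times> real \<Rightarrow> 'z::topological_space"
    using that by (rule borel_measurable_continuous_onI)
  have "(\<lambda>\<omega>. fst (W i \<omega>)) \<in> H \<rightarrow>\<^sub>M borel" by (intro measurable_compose[OF assms c] continuous_intros)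
  then show "\<psi> i \<in> H \<rightarrow>\<^sub>M borel" by (simp add: W)
  have "(\<lambda>\<omega>. fst (snd (W i \<omega>))) \<in> H \<rightarrow>\<^sub>M borel"
    by (intro measurable_compose[OF assms c, of "\<lambda>w. fst (snd w)"] continuous_intros)
  then show "Y 0 i \<in> H \<rightarrow>\<^sub>M borel" by (simp add: W)
  have "(\<lambda>\<omega>. snd (snd (W i \<omega>))) \<in> H \<rightarrow>\<^sub>M borel"
    by (intro measurable_compose[OF assms c, of "\<lambda>w. snd (snd w)"] continuous_intros)
  then show "Y 1 i \<in> H \<rightarrow>\<^sub>M borel" by (simp add: W)
qed

lemma W_M: "i \<ge> 1 \<Longrightarrow> W i \<in> M \<rightarrow>\<^sub>M borel"
  using W_indep by (auto simp: indep_vars_def)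

lemmas components_M = measurable_components[OF W_M]

lemma upto_n_measurable: "(\<And>i. i \<in> {1..n} \<Longrightarrow> X i \<in> H \<rightarrow>\<^sub>M N) \<Longrightarrow> upto_n X n \<in> H \<rightarrow>\<^sub>M PiM {1..n} (\<lambda>_. N)"
  unfolding upto_n_def[abs_def] by (rule measurable_restrict)

lemma upto_n_component:
  assumes "upto_n X n \<in> H \<rightarrow>\<^sub>M PiM {1..n} (\<lambda>_. N)" "i \<in> {1..n}" shows "X i \<in> H \<rightarrow>\<^sub>M N"
proof -
  have "(\<lambda>\<omega>. upto_n X n \<omega> i) \<in> H \<rightarrow>\<^sub>M N"
    by (rule measurable_compose[OF assms(1) measurable_component_singleton[OF assms(2)]])
  then show ?thesis using assms(2) by (simp add: upto_n_def[abs_def])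
qed

lemma \<pi>_M: "\<pi> n \<in> M \<rightarrow>\<^sub>M NP n" and \<xi>_M: "\<xi> n \<in> M \<rightarrow>\<^sub>M NX n"
  using indep[of n] by (auto simp: mutually_indep3_def)

lemma T_M: "i \<in> {1..n} \<Longrightarrow> T n i \<in> M \<rightarrow>\<^sub>M count_space UNIV"
  using T by (auto simp: loc_sampling_def local_randomization_def)

lemma D_M: "i \<in> {1..n} \<Longrightarrow> D n i \<in> M \<rightarrow>\<^sub>M count_space UNIV"
  using D by (auto simp: loc_assignment_def local_randomization_def)

lemma FT_tuple: "(\<lambda>\<omega>. (upto_n W n \<omega>, \<pi> n \<omega>, \<xi> n \<omega>)) \<in> M \<rightarrow>\<^sub>M borel_vec n \<Otimes>\<^sub>M NP n \<Otimes>\<^sub>M NX n"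
  by (intro measurable_Pair upto_n_measurable W_M \<pi>_M \<xi>_M) auto

lemma FD_tuple: "(\<lambda>\<omega>. (upto_n W n \<omega>, \<pi> n \<omega>, \<xi> n \<omega>, upto_n (T n) n \<omega>)) \<in> M \<rightarrow>\<^sub>M borel_vec n \<Otimes>\<^sub>M NP n \<Otimes>\<^sub>M NX n \<Otimes>\<^sub>M bool_vec n"
  by (intro measurable_Pair upto_n_measurable W_M \<pi>_M \<xi>_M T_M) auto

lemma sub_FT: "subalgebra M (FT n)" unfolding FT_def by (rule sigma_of_subalgebra[OF FT_tuple])
lemma sub_FD: "subalgebra M (FD n)" unfolding FD_def by (rule sigma_of_subalgebra[OF FD_tuple])

lemma sub_AT:
  assumes "space H = space M" "\<And>i. i \<in> {1..n} \<Longrightarrow> \<psi> i \<in> H \<rightarrow>\<^sub>M borel" "\<pi> n \<in> H \<rightarrow>\<^sub>M NP n" "\<xi> n \<in> H \<rightarrow>\<^sub>M NX n"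
  shows "subalgebra H (AT n)"
  unfolding AT_def by (intro subalgebra_sigma_of measurable_Pair upto_n_measurable assms)

lemma sub_XP:
  assumes "space H = space M" "\<And>i. i \<in> {1..n} \<Longrightarrow> \<psi> i \<in> H \<rightarrow>\<^sub>M borel" "\<xi> n \<in> H \<rightarrow>\<^sub>M NX n"
  shows "subalgebra H (XP n)"
  unfolding XP_def by (intro subalgebra_sigma_of measurable_Pair upto_n_measurable assms)

lemma measurable_AT: "i \<in> {1..n} \<Longrightarrow> \<psi> i \<in> AT n \<rightarrow>\<^sub>M borel" "\<pi> n \<in> AT n \<rightarrow>\<^sub>M NP n" "\<xi> n \<in> AT n \<rightarrow>\<^sub>M NX n"
proof -
  have t: "(\<lambda>\<omega>. (upto_n \<psi> n \<omega>, \<pi> n \<omega>, \<xi> n \<omega>)) \<in> AT n \<rightarrow>\<^sub>M borel_vec n \<Otimes>\<^sub>M NP n \<Otimes>\<^sub>M NX n"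
    unfolding AT_def
    by (intro measurable_sigma_of measurable_Pair upto_n_measurable components_M \<pi>_M \<xi>_M) auto
  have "upto_n \<psi> n \<in> AT n \<rightarrow>\<^sub>M borel_vec n" using measurable_compose[OF t measurable_fst] by simp
  then show "i \<in> {1..n} \<Longrightarrow> \<psi> i \<in> AT n \<rightarrow>\<^sub>M borel" by (rule upto_n_component)
  show "\<pi> n \<in> AT n \<rightarrow>\<^sub>M NP n" "\<xi> n \<in> AT n \<rightarrow>\<^sub>M NX n"
    using measurable_compose[OF t measurable_compose[OF measurable_snd measurable_fst]]
      measurable_compose[OF t measurable_compose[OF measurable_snd measurable_snd]] by simp_all
qed

lemma measurable_FT: "i \<in> {1..n} \<Longrightarrow> W i \<in> FT n \<rightarrow>\<^sub>M borel" "\<pi> n \<in> FT n \<rightarrow>\<^sub>M NP n" "\<xi> n \<in> FT n \<rightarrow>\<^sub>M NX n"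
proof -
  have t: "(\<lambda>\<omega>. (upto_n W n \<omega>, \<pi> n \<omega>, \<xi> n \<omega>)) \<in> FT n \<rightarrow>\<^sub>M borel_vec n \<Otimes>\<^sub>M NP n \<Otimes>\<^sub>M NX n"
    unfolding FT_def by (rule measurable_sigma_of[OF FT_tuple])
  have "upto_n W n \<in> FT n \<rightarrow>\<^sub>M borel_vec n" using measurable_compose[OF t measurable_fst] by simp
  then show "i \<in> {1..n} \<Longrightarrow> W i \<in> FT n \<rightarrow>\<^sub>M borel" by (rule upto_n_component)
  show "\<pi> n \<in> FT n \<rightarrow>\<^sub>M NP n" "\<xi> n \<in> FT n \<rightarrow>\<^sub>M NX n"
    using measurable_compose[OF t measurable_compose[OF measurable_snd measurable_fst]]
      measurable_compose[OF t measurable_compose[OF measurable_snd measurable_snd]] by simp_all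
qed

lemma measurable_FD: "i \<in> {1..n} \<Longrightarrow> W i \<in> FD n \<rightarrow>\<^sub>M borel" "\<pi> n \<in> FD n \<rightarrow>\<^sub>M NP n" "\<xi> n \<in> FD n \<rightarrow>\<^sub>M NX n"
  "i \<in> {1..n} \<Longrightarrow> T n i \<in> FD n \<rightarrow>\<^sub>M count_space UNIV"
proof -
  have t: "(\<lambda>\<omega>. (upto_n W n \<omega>, \<pi> n \<omega>, \<xi> n \<omega>, upto_n (T n) n \<omega>)) \<in> FD n \<rightarrow>\<^sub>M borel_vec n \<Otimes>\<^sub>M NP n \<Otimes>\<^sub>M NX n \<Otimes>\<^sub>M bool_vec n"
    unfolding FD_def by (rule measurable_sigma_of[OF FD_tuple])
  have "upto_n W n \<in> FD n \<rightarrow>\<^sub>M borel_vec n" using measurable_compose[OF t measurable_fst] by simp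
  then show "i \<in> {1..n} \<Longrightarrow> W i \<in> FD n \<rightarrow>\<^sub>M borel" by (rule upto_n_component)
  show "\<pi> n \<in> FD n \<rightarrow>\<^sub>M NP n" "\<xi> n \<in> FD n \<rightarrow>\<^sub>M NX n"
    using measurable_compose[OF t measurable_compose[OF measurable_snd measurable_fst]]
      measurable_compose[OF t measurable_compose[OF measurable_snd measurable_compose[OF measurable_snd
          measurable_fst]]] by simp_all
  have "upto_n (T n) n \<in> FD n \<rightarrow>\<^sub>M bool_vec n"
    using measurable_compose[OF t measurable_compose[OF measurable_snd measurable_compose[OF measurable_snd
        measurable_snd]]] by simp
  then show "i \<in> {1..n} \<Longrightarrow> T n i \<in> FD n \<rightarrow>\<^sub>M count_space UNIV" by (rule upto_n_component)
qed

lemma sub_FT_AT: "subalgebra (FT n) (AT n)"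
  by (intro sub_AT measurable_components measurable_FT) simp_all

lemma sub_FD_AD: "subalgebra (FD n) (AD n)"
  unfolding AD_def
  by (intro subalgebra_sigma_of measurable_Pair upto_n_measurable measurable_components measurable_FD) simp_all

lemma sub_FD_FT: "subalgebra (FD n) (FT n)"
  unfolding FT_def
  by (intro subalgebra_sigma_of measurable_Pair upto_n_measurable measurable_FD) simp_all

lemma sub_AT_XP: "subalgebra (AT n) (XP n)"
  by (intro sub_XP measurable_AT) simp_all

lemma sub_FT_XP: "subalgebra (FT n) (XP n)"
  by (intro sub_XP measurable_components measurable_FT) simp_all

lemma sub_M_XP: "subalgebra M (XP n)"
  by (intro sub_XP components_M \<xi>_M) auto

lemma q_measurable:
  assumes H: "subalgebra H (XP n)" and \<psi>: "\<psi> i \<in> H \<rightarrow>\<^sub>M borel"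
  shows "(\<lambda>\<omega>. q\<^sub>n n \<omega> (\<psi> i \<omega>)) \<in> borel_measurable H"
proof -
  have "(\<lambda>\<omega>. \<omega>) \<in> H \<rightarrow>\<^sub>M XP n" using H by (intro measurableI) (auto simp: subalgebra_def)
  then have "(\<lambda>\<omega>. (\<omega>, \<psi> i \<omega>)) \<in> H \<rightarrow>\<^sub>M XP n \<Otimes>\<^sub>M borel" using \<psi> by (rule measurable_Pair)
  from measurable_compose[OF this q\<^sub>n[of n, folded XP_def]] show ?thesis by simp
qed

lemma distr_\<psi>: "i \<ge> 1 \<Longrightarrow> distr M borel (\<psi> i) = P\<^sub>\<psi>"
proof -
  assume i: "i \<ge> 1"
  have "distr M borel (\<psi> i) = distr (distr M borel (W i)) borel fst" if "i \<ge> 1" for i :: nat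
    using W_M[OF that] by (subst distr_distr) (auto simp: o_def W intro!: borel_measurable_continuous_onI continuous_intros)
  then show ?thesis using W_ident[OF i] i by (simp add: P\<psi>)
qed

lemma rate_T: "(\<lambda>n. real (k_bar n) * real (L_bar n) / real n) \<longlonglongrightarrow> 0"
proof -
  \<comment> \<open>The exponent is at most 1, so the units in remainder groups, at most
    \<open>k_bar n * L_bar n\<close> of them, are o(n).\<close>
  have "(\<lambda>n. real n powr (1 - (real CARD('d) + 1) / \<alpha>)) \<in> O(\<lambda>n. real n)"
  proof (rule bigoI[of _ 1])
    show "\<forall>\<^sub>F n in sequentially. norm (real n powr (1 - (real CARD('d) + 1) / \<alpha>)) \<le> 1 * norm (real n)"
      using eventually_ge_at_top[of 1]
    proof eventually_elim
      case (elim n)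
      have "\<alpha> > 0" using \<alpha> by (simp add: add_nonneg_pos less_trans[of 0 "real CARD('d) + 1" \<alpha>])
      then have "real n powr (1 - (real CARD('d) + 1) / \<alpha>) \<le> real n powr 1"
        using elim by (intro powr_mono) auto
      then show ?case using elim by simp
    qed
  qed
  from landau_o.small_big_trans[OF kL_rate this] show ?thesis by (rule smalloD_tendsto)
qed

section \<open>Imbalances of sampling and of assignment\<close>

lemma T_vanishes:
  assumes x: "\<And>n i. i \<in> {1..n} \<Longrightarrow> x n i \<in> borel_measurable (FT n)"
    and h: "h \<in> borel_measurable borel" "(\<integral>\<^sup>+z. ennreal ((h z)\<^sup>2) \<partial>P\<^sub>\<psi>) < \<infinity>"
    and xh: "vanishes M (\<lambda>n \<omega>. \<Sum>i=1..n. (x n i \<omega> - h (\<psi> i \<omega>) / sqrt (real n))\<^sup>2)"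
  shows "vanishes M (\<lambda>n \<omega>. \<Sum>i=1..n. x n i \<omega> * (of_bool (T n i \<omega>) - q\<^sub>n n \<omega> (\<psi> i \<omega>)))"
proof (rule local_randomization_vanishes[OF T[unfolded loc_sampling_def, folded FT_def AT_def] sub_FT_AT sub_FT _ _ L_bar
    rate_T _ _ _ _ distr_\<psi> x h xh])
  show "0 < k n \<omega> l \<and> k n \<omega> l \<le> k_bar n" if "\<omega> \<in> space M" "l \<in> {1..L n \<omega>}" for n \<omega> l
    using k_pos k_bar that by blast
  show "(\<lambda>\<omega>. q\<^sub>n n \<omega> (\<psi> i \<omega>)) \<in> borel_measurable (FT n)" if "i \<in> {1..n}" for n i
    by (intro q_measurable sub_FT_XP measurable_components measurable_FT that)
  show "AE \<omega> in M. \<forall>i\<in>{1..n}. q\<^sub>n n \<omega> (\<psi> i \<omega>) \<le> 1" for n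
    using q\<^sub>n_bounds[of n] by eventually_elim auto
  show "(\<lambda>\<omega>. k n \<omega> l) \<in> FT n \<rightarrow>\<^sub>M count_space UNIV" for n l
    by (rule measurable_from_subalg[OF sub_FT_XP k[folded XP_def]])
qed (auto intro: components_M)

text \<open>Division by 0 yields 0, so a zero denominator would contradict p > 0.\<close>

lemma p_den_pos: "0 < p_den"
  using p by (cases p_den) auto

lemma D_vanishes:
  assumes x: "\<And>n i. i \<in> {1..n} \<Longrightarrow> x n i \<in> borel_measurable (FD n)"
    and h: "h \<in> borel_measurable borel" "(\<integral>\<^sup>+z. ennreal ((h z)\<^sup>2) \<partial>P\<^sub>\<psi>) < \<infinity>"
    and xh: "vanishes M (\<lambda>n \<omega>. \<Sum>i=1..n. (x n i \<omega> - h (\<psi> i \<omega>) / sqrt (real n))\<^sup>2)"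
  shows "vanishes M (\<lambda>n \<omega>. \<Sum>i\<in>{i \<in> {1..n}. T n i \<omega>}. x n i \<omega> * (of_bool (D n i \<omega>) - p))"
  unfolding p(1)
proof (rule local_randomization_vanishes[OF D[unfolded loc_assignment_def, folded FD_def AD_def] sub_FD_AD sub_FD _ _ _ _ _ _
    _ _ distr_\<psi> x h xh,
    where kb="\<lambda>_. p_den" and Lb="\<lambda>_. 1"])
  show "(\<lambda>n. real p_den * real 1 / real n) \<longlonglongrightarrow> 0"
    by (simp add: lim_const_over_n)
  show "AE \<omega> in M. \<forall>i\<in>{i \<in> {1..n}. T n i \<omega>}. real p_num / real p_den \<le> 1" for n
    using p by auto
qed (use p_den_pos in \<open>auto intro: components_M\<close>)

section \<open>Weights of the assignment vectors\<close>

text \<open>These are the sampled units, T being the sampling indicator, and below it those sampled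
  units that have D = 1. The assignment law says nothing about D outside the sample, so the second
  set is cut down to the first; the estimator depends on the two variables through these sets
  only.\<close>

definition treated :: "nat \<Rightarrow> 'a \<Rightarrow> nat set" where "treated n \<omega> = {i \<in> {1..n}. T n i \<omega>}"
definition assigned :: "nat \<Rightarrow> 'a \<Rightarrow> nat set" where "assigned n \<omega> = {i \<in> {1..n}. T n i \<omega> \<and> D n i \<omega>}"

lemma treated_M: "{\<omega> \<in> space M. treated n \<omega> = t} \<in> sets M"
  and assigned_M: "{\<omega> \<in> space M. assigned n \<omega> = d} \<in> sets M"
proof -
  have [measurable]: "T n i \<in> M \<rightarrow>\<^sub>M count_space UNIV" "D n i \<in> M \<rightarrow>\<^sub>M count_space UNIV" if "i \<in> {1..n}" for i
    using T_M D_M that by auto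
  have "{\<omega> \<in> space M. treated n \<omega> = t} = {\<omega> \<in> space M. t \<subseteq> {1..n} \<and> (\<forall>i\<in>{1..n}. T n i \<omega> = (i \<in> t))}"
    by (auto simp: treated_def)
  also have "\<dots> \<in> sets M" by measurable
  finally show "{\<omega> \<in> space M. treated n \<omega> = t} \<in> sets M" .
  have "{\<omega> \<in> space M. assigned n \<omega> = d} = {\<omega> \<in> space M. d \<subseteq> {1..n} \<and> (\<forall>i\<in>{1..n}. (T n i \<omega> \<and> D n i \<omega>) = (i \<in> d))}"
    by (auto simp: assigned_def)
  also have "\<dots> \<in> sets M" by measurable
  finally show "{\<omega> \<in> space M. assigned n \<omega> = d} \<in> sets M" .
qed

text \<open>The conditional probability is taken given \<open>F\<close>, but its formula contains
  only the partition, the levels and their integers, all measurable for the smaller algebra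
  \<open>A\<close>. Hence outcomes carry no information about the design beyond the
  covariates.\<close>

lemma local_randomization_weight:
  assumes lr: "local_randomization M A F U \<psi>' q' L' a' k' Z"
    and U: "\<And>n \<omega>. \<omega> \<in> space M \<Longrightarrow> U n \<omega> \<subseteq> {1..n}"
    and sp: "\<And>n. space (A n) = space M"
    and ak: "\<And>n l. (\<lambda>\<omega>. a' n \<omega> l) \<in> A n \<rightarrow>\<^sub>M count_space UNIV" "\<And>n l. (\<lambda>\<omega>. k' n \<omega> l) \<in> A n \<rightarrow>\<^sub>M count_space UNIV"
  shows "\<exists>r. r \<in> borel_measurable (A n) \<and> (\<forall>\<omega>\<in>space M. 0 \<le> r \<omega> \<and> r \<omega> \<le> 1) \<and>
    (AE \<omega> in M. real_cond_exp M (F n) (indicator {\<omega> \<in> space M. \<forall>i\<in>U n \<omega>. Z n i \<omega> = t i}) \<omega> = r \<omega>)"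
proof -
  obtain G lev where G: "\<And>n. G n \<in> A n \<rightarrow>\<^sub>M count_space UNIV"
    and lev: "\<And>n g. (\<lambda>\<omega>. lev n \<omega> g) \<in> A n \<rightarrow>\<^sub>M count_space UNIV"
    and part: "\<And>n \<omega>. \<omega> \<in> space M \<Longrightarrow> partition_on (U n \<omega>) (G n \<omega>)"
    and law: "\<And>n t. AE \<omega> in M. real_cond_exp M (F n)
             (indicator {\<omega> \<in> space M. \<forall>i\<in>U n \<omega>. Z n i \<omega> = t i}) \<omega> =
           (\<Prod>g\<in>G n \<omega>. pmf (group_pmf (a' n \<omega> (lev n \<omega> g)) (k' n \<omega> (lev n \<omega> g)) g) (\<lambda>i. i \<in> g \<and> t i))"
    using lr unfolding local_randomization_def by blast
  define r where "r \<omega> = (\<Prod>g\<in>G n \<omega>. pmf (group_pmf (a' n \<omega> (lev n \<omega> g)) (k' n \<omega> (lev n \<omega> g)) g) (\<lambda>i. i \<in> g \<and> t i))" for \<omega>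
  have GA: "G n \<in> A n \<rightarrow>\<^sub>M count_space (Pow (Pow {1..n}))"
  proof -
    have "G n \<omega> \<in> Pow (Pow {1..n})" if "\<omega> \<in> space M" for \<omega>
      using part[OF that, of n] U[OF that, of n] by (auto simp: partition_on_def)
    moreover have "G n -` {Q} \<inter> space (A n) \<in> sets (A n)" for Q
      using G[of n] by (rule measurable_sets) simp
    ultimately show ?thesis
      by (subst measurable_count_space_eq2) (auto simp: sp)
  qed
  have rA: "r \<in> borel_measurable (A n)"
    unfolding r_def[abs_def]
  proof (rule measurable_compose_countable'[OF _ GA])
    fix Q :: "nat set set"
    have "(\<lambda>\<omega>. pmf (group_pmf (a' n \<omega> (lev n \<omega> g)) (k' n \<omega> (lev n \<omega> g)) g) (\<lambda>i. i \<in> g \<and> t i)) \<in> borel_measurable (A n)" for g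
    proof -
      have a: "(\<lambda>\<omega>. a' n \<omega> (lev n \<omega> g)) \<in> A n \<rightarrow>\<^sub>M count_space UNIV"
        by (rule measurable_compose_countable[OF ak(1) lev])
      have k: "(\<lambda>\<omega>. k' n \<omega> (lev n \<omega> g)) \<in> A n \<rightarrow>\<^sub>M count_space UNIV"
        by (rule measurable_compose_countable[OF ak(2) lev])
      show ?thesis
        by (rule measurable_compose_countable[OF measurable_compose_countable[OF _ k] a]) simp
    qed
    then show "(\<lambda>\<omega>. \<Prod>g\<in>Q. pmf (group_pmf (a' n \<omega> (lev n \<omega> g)) (k' n \<omega> (lev n \<omega> g)) g) (\<lambda>i. i \<in> g \<and> t i)) \<in>
        borel_measurable (A n)"
      by (rule borel_measurable_prod)
  qed (auto intro: countable_finite)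
  have "0 \<le> r \<omega> \<and> r \<omega> \<le> 1" for \<omega>
    unfolding r_def by (auto intro!: prod_nonneg prod_le_1 simp: pmf_le_1)
  then show ?thesis using rA law[of n t] unfolding r_def[symmetric] by (intro exI[of _ r]) auto
qed

text \<open>The probability of the design value (t, d) given \<open>FT\<close> is a product of two
  weights free of outcomes. The weight of the assignment is measurable only for \<open>AD\<close>,
  which contains T; on the event that the sample is \<open>t\<close> the constant vector may be put
  in place of T, and this makes it measurable for \<open>AT\<close>.\<close>

lemma design_weights:
  assumes td: "t \<subseteq> {1..n}" "d \<subseteq> t"
  shows "\<exists>r :: 'a \<Rightarrow> real. r \<in> borel_measurable (AT n) \<and> (\<forall>\<omega>\<in>space M. 0 \<le> r \<omega> \<and> r \<omega> \<le> 1) \<and>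
    (\<forall>V. V \<in> borel_measurable (FT n) \<longrightarrow> integrable M V \<longrightarrow>
      (\<integral>\<omega>. indicator {\<omega> \<in> space M. treated n \<omega> = t} \<omega> * indicator {\<omega> \<in> space M. assigned n \<omega> = d} \<omega> * V \<omega> \<partial>M) =
      (\<integral>\<omega>. r \<omega> * V \<omega> \<partial>M))"
proof -
  have subA: "subalgebra (AT n) (XP n)" by (rule sub_AT_XP)
  have "\<exists>r. r \<in> borel_measurable (AT n) \<and> (\<forall>\<omega>\<in>space M. 0 \<le> r \<omega> \<and> r \<omega> \<le> 1) \<and>
    (AE \<omega> in M. real_cond_exp M (FT n) (indicator {\<omega> \<in> space M. \<forall>i\<in>{1..n}. T n i \<omega> = (i \<in> t)}) \<omega> = r \<omega>)"
    by (rule local_randomization_weight[OF T[unfolded loc_sampling_def, folded FT_def AT_def]])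
       (auto intro: measurable_from_subalg[OF sub_AT_XP a[folded XP_def]] measurable_from_subalg[OF
           sub_AT_XP k[folded XP_def]])
  then obtain r1 where r1: "r1 \<in> borel_measurable (AT n)" "\<And>\<omega>. \<omega> \<in> space M \<Longrightarrow> 0 \<le> r1 \<omega> \<and> r1 \<omega> \<le> 1"
    "AE \<omega> in M. real_cond_exp M (FT n) (indicator {\<omega> \<in> space M. \<forall>i\<in>{1..n}. T n i \<omega> = (i \<in> t)}) \<omega> = r1 \<omega>" by blast
  have "\<exists>r. r \<in> borel_measurable (AD n) \<and> (\<forall>\<omega>\<in>space M. 0 \<le> r \<omega> \<and> r \<omega> \<le> 1) \<and>
    (AE \<omega> in M. real_cond_exp M (FD n) (indicator {\<omega> \<in> space M. \<forall>i\<in>{i \<in> {1..n}. T n i \<omega>}. D n i \<omega> = (i \<in> d)}) \<omega> = r \<omega>)"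
    by (rule local_randomization_weight[OF D[unfolded loc_assignment_def, folded FD_def AD_def]]) auto
  then obtain r2 where r2: "r2 \<in> borel_measurable (AD n)" "\<And>\<omega>. \<omega> \<in> space M \<Longrightarrow> 0 \<le> r2 \<omega> \<and> r2 \<omega> \<le> 1"
    "AE \<omega> in M. real_cond_exp M (FD n) (indicator {\<omega> \<in> space M. \<forall>i\<in>{i \<in> {1..n}. T n i \<omega>}. D n i \<omega> = (i \<in> d)}) \<omega> =
        r2 \<omega>" by blast
  have tupM: "(\<lambda>\<omega>. (upto_n \<psi> n \<omega>, upto_n (T n) n \<omega>, \<pi> n \<omega>, \<xi> n \<omega>)) \<in> M \<rightarrow>\<^sub>M borel_vec n \<Otimes>\<^sub>M bool_vec n \<Otimes>\<^sub>M NP n \<Otimes>\<^sub>M NX n"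
    by (intro measurable_Pair upto_n_measurable components_M \<pi>_M \<xi>_M T_M) auto
  obtain g where g: "g \<in> borel_measurable (borel_vec n \<Otimes>\<^sub>M bool_vec n \<Otimes>\<^sub>M NP n \<Otimes>\<^sub>M NX n)"
    "\<And>\<omega>. \<omega> \<in> space M \<Longrightarrow> r2 \<omega> = g (upto_n \<psi> n \<omega>, upto_n (T n) n \<omega>, \<pi> n \<omega>, \<xi> n \<omega>)"
    using measurable_vimage_algebra_factor[OF _ r2(1)[unfolded AD_def sigma_of_def]] measurable_space[OF tupM] by blast
  \<comment> \<open>With a prescribed vector in place of the realized one, \<open>g\<close> may take
    arbitrary values, so it is clipped to [0, 1]; nothing changes where the sample is
    \<open>t\<close>.\<close>
  define r3 where "r3 \<omega> = min 1 (max 0 (g (upto_n \<psi> n \<omega>, (\<lambda>i\<in>{1..n}. i \<in> t), \<pi> n \<omega>, \<xi> n \<omega>)))" for \<omega>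
  have r3A: "r3 \<in> borel_measurable (AT n)"
  proof -
    have "(\<lambda>\<omega>. (upto_n \<psi> n \<omega>, (\<lambda>i\<in>{1..n}. i \<in> t), \<pi> n \<omega>, \<xi> n \<omega>)) \<in> AT n \<rightarrow>\<^sub>M borel_vec n \<Otimes>\<^sub>M bool_vec n \<Otimes>\<^sub>M NP n \<Otimes>\<^sub>M NX n"
      by (intro measurable_Pair upto_n_measurable measurable_AT measurable_const) (auto simp: space_PiM)
    note [measurable] = measurable_compose[OF this g(1)]
    show ?thesis unfolding r3_def by measurable
  qed
  have r23: "r2 \<omega> = r3 \<omega>" if "\<omega> \<in> space M" "treated n \<omega> = t" for \<omega>
  proof -
    have "upto_n (T n) n \<omega> = (\<lambda>i\<in>{1..n}. i \<in> t)" using that(2) by (auto simp: upto_n_def treated_def restrict_def fun_eq_iff)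
    then show ?thesis using g(2)[OF that(1)] r2(2)[OF that(1)] by (simp add: r3_def)
  qed
  have r301: "0 \<le> r3 \<omega> \<and> r3 \<omega> \<le> 1" for \<omega> by (simp add: r3_def)
  define Et where "Et = {\<omega> \<in> space M. treated n \<omega> = t}"
  define Ed where "Ed = {\<omega> \<in> space M. \<forall>i\<in>{i \<in> {1..n}. T n i \<omega>}. D n i \<omega> = (i \<in> d)}"
  have Et: "Et = {\<omega> \<in> space M. \<forall>i\<in>{1..n}. T n i \<omega> = (i \<in> t)}" using td(1) by (auto simp: Et_def treated_def)
  have EtM[measurable]: "Et \<in> sets M" unfolding Et_def by (rule treated_M)
  have EdM[measurable]: "Ed \<in> sets M"
  proof -
    have [measurable]: "T n i \<in> M \<rightarrow>\<^sub>M count_space UNIV" "D n i \<in> M \<rightarrow>\<^sub>M count_space UNIV" if "i \<in> {1..n}" for i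
      using T_M D_M that by auto
    have "Ed = {\<omega> \<in> space M. \<forall>i\<in>{1..n}. T n i \<omega> \<longrightarrow> D n i \<omega> = (i \<in> d)}" by (auto simp: Ed_def)
    also have "\<dots> \<in> sets M" by measurable
    finally show ?thesis .
  qed
  have EtFD: "Et \<in> sets (FD n)"
  proof -
    note [measurable] = measurable_FD(4)
    have "{\<omega> \<in> space (FD n). \<forall>i\<in>{1..n}. T n i \<omega> = (i \<in> t)} \<in> sets (FD n)" by measurable
    then show ?thesis by (simp add: Et)
  qed
  have ind: "indicator Et \<omega> * indicator {\<omega> \<in> space M. assigned n \<omega> = d} \<omega> = (indicator Et \<omega> * indicator Ed \<omega> :: real)" for \<omega>
    using td by (auto simp: indicator_def Et_def Ed_def treated_def assigned_def)
  interpret FT: finite_measure_subalgebra M "FT n" by (rule finite_measure_subalgebraI[OF sub_FT])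
  interpret FD: finite_measure_subalgebra M "FD n" by (rule finite_measure_subalgebraI[OF sub_FD])
  have main: "(\<integral>\<omega>. indicator Et \<omega> * indicator Ed \<omega> * V \<omega> \<partial>M) = (\<integral>\<omega>. (r1 \<omega> * r3 \<omega>) * V \<omega> \<partial>M)"
    if VF: "V \<in> borel_measurable (FT n)" and V: "integrable M V" for V
  proof -
    have VM[measurable]: "V \<in> borel_measurable M" using V by auto
    have r3M[measurable]: "r3 \<in> borel_measurable M"
      by (rule measurable_from_subalg[OF sub_FT measurable_from_subalg[OF sub_FT_AT r3A]])
    have r1M[measurable]: "r1 \<in> borel_measurable M"
      by (rule measurable_from_subalg[OF sub_FT measurable_from_subalg[OF sub_FT_AT r1(1)]])
    have r2M[measurable]: "r2 \<in> borel_measurable M"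
      by (rule measurable_from_subalg[OF sub_FD measurable_from_subalg[OF sub_FD_AD r2(1)]])
    have VFD: "V \<in> borel_measurable (FD n)" by (rule measurable_from_subalg[OF sub_FD_FT VF])
    \<comment> \<open>The tower property in two stages: given \<open>FD n\<close>, where
      \<open>Et\<close> and \<open>V\<close> are known and the weight of the assignment is
      \<open>r3\<close> on \<open>Et\<close>; then given \<open>FT n\<close>, where
      \<open>r3\<close> and \<open>V\<close> are known and the sampling has weight
      \<open>r1\<close>.\<close>
    have "(\<integral>\<omega>. indicator Et \<omega> * indicator Ed \<omega> * V \<omega> \<partial>M) = (\<integral>\<omega>. (indicator Et \<omega> * V \<omega>) * indicator Ed \<omega> \<partial>M)"
      by (simp add: mult_ac)
    also have "\<dots> = (\<integral>\<omega>. (indicator Et \<omega> * V \<omega>) * real_cond_exp M (FD n) (indicator Ed) \<omega> \<partial>M)"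
    proof (rule FD.real_cond_exp_intg(2)[symmetric])
      show "integrable M (\<lambda>\<omega>. (indicator Et \<omega> * V \<omega>) * indicator Ed \<omega>)"
        by (rule Bochner_Integration.integrable_bound[OF V]) (auto simp: indicator_def)
      show "(\<lambda>\<omega>. indicator Et \<omega> * V \<omega>) \<in> borel_measurable (FD n)"
        using VFD EtFD by (intro borel_measurable_times borel_measurable_indicator)
    qed simp
    also have "\<dots> = (\<integral>\<omega>. (r3 \<omega> * V \<omega>) * indicator Et \<omega> \<partial>M)"
    proof (rule integral_cong_AE)
      show "AE \<omega> in M. (indicator Et \<omega> * V \<omega>) * real_cond_exp M (FD n) (indicator Ed) \<omega> = (r3 \<omega> * V \<omega>) * indicator Et \<omega>"
        using r2(3)[folded Ed_def] AE_space by eventually_elim (auto simp: indicator_def Et_def r23)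
    qed measurable
    also have "\<dots> = (\<integral>\<omega>. (r3 \<omega> * V \<omega>) * real_cond_exp M (FT n) (indicator Et) \<omega> \<partial>M)"
    proof (rule FT.real_cond_exp_intg(2)[symmetric])
      show "integrable M (\<lambda>\<omega>. (r3 \<omega> * V \<omega>) * indicator Et \<omega>)"
      proof (rule Bochner_Integration.integrable_bound[OF V])
        have "\<bar>r3 \<omega>\<bar> * \<bar>V \<omega>\<bar> \<le> \<bar>V \<omega>\<bar>" for \<omega> using r301[of \<omega>] by (intro mult_left_le_one_le) auto
        then show "AE \<omega> in M. norm ((r3 \<omega> * V \<omega>) * indicator Et \<omega>) \<le> norm (V \<omega>)" by (auto simp: indicator_def abs_mult)
      qed measurable
      show "(\<lambda>\<omega>. r3 \<omega> * V \<omega>) \<in> borel_measurable (FT n)"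
        using VF measurable_from_subalg[OF sub_FT_AT r3A] by (intro borel_measurable_times)
    qed simp
    also have "\<dots> = (\<integral>\<omega>. (r1 \<omega> * r3 \<omega>) * V \<omega> \<partial>M)"
    proof (rule integral_cong_AE)
      show "AE \<omega> in M. (r3 \<omega> * V \<omega>) * real_cond_exp M (FT n) (indicator Et) \<omega> = (r1 \<omega> * r3 \<omega>) * V \<omega>"
        using r1(3)[folded Et] by eventually_elim (simp add: mult_ac)
    qed measurable
    finally show ?thesis .
  qed
  show ?thesis
  proof (rule exI[of _ "\<lambda>\<omega>. r1 \<omega> * r3 \<omega>"], intro conjI ballI allI impI)
    show "(\<lambda>\<omega>. r1 \<omega> * r3 \<omega>) \<in> borel_measurable (AT n)" using r1(1) r3A by (intro borel_measurable_times)
    fix \<omega> assume "\<omega> \<in> space M"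
    then show "0 \<le> r1 \<omega> * r3 \<omega>" "r1 \<omega> * r3 \<omega> \<le> 1"
      using r1(2) r301[of \<omega>] by (auto intro: mult_nonneg_nonneg mult_le_one)
  next
    fix V :: "'a \<Rightarrow> real" assume "V \<in> borel_measurable (FT n)" "integrable M V"
    then show "(\<integral>\<omega>. indicator {\<omega> \<in> space M. treated n \<omega> = t} \<omega> * indicator {\<omega> \<in> space M. assigned n \<omega> = d} \<omega> * V \<omega> \<partial>M) =
      (\<integral>\<omega>. (r1 \<omega> * r3 \<omega>) * V \<omega> \<partial>M)"
      using main by (simp add: Et_def[symmetric] ind)
  qed
qed

section \<open>Orthogonality of residuals\<close>

definition rest :: "nat \<Rightarrow> nat \<Rightarrow> 'a measure" where
  "rest n j = sigma (space M) ((\<Union>i\<in>{1..n} - {j}. sets (sigma_of M (W i) borel)) \<union>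
       sets (sigma_of M (\<pi> n) (NP n)) \<union> sets (sigma_of M (\<xi> n) (NX n)))"

text \<open>All information except the outcomes of unit j: its covariate, the other units, \<pi> and
  \<xi>. It is generated by rectangles so that it is literally the algebra \<open>H\<close> of
  \<open>integral_mult_eq_0_of_indep\<close>.\<close>

definition leave_out :: "nat \<Rightarrow> nat \<Rightarrow> 'a measure" where
  "leave_out n j = sigma (space M) {A \<inter> B | A B. A \<in> sets (sigma_of M (\<psi> j) borel) \<and> B \<in> sets (rest n j)}"

lemma sub_units:
  "i \<ge> 1 \<Longrightarrow> subalgebra M (sigma_of M (W i) borel)" "i \<ge> 1 \<Longrightarrow> subalgebra M (sigma_of M (\<psi> i) borel)"
  "subalgebra M (sigma_of M (\<pi> n) (NP n))" "subalgebra M (sigma_of M (\<xi> n) (NX n))"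
  by (intro sigma_of_subalgebra W_M components_M \<pi>_M \<xi>_M; assumption)+

lemma rest_gen: "(\<Union>i\<in>{1..n} - {j}. sets (sigma_of M (W i) borel)) \<union>
       sets (sigma_of M (\<pi> n) (NP n)) \<union> sets (sigma_of M (\<xi> n) (NX n)) \<subseteq> sets M"
proof (intro Un_least UN_least)
  show "sets (sigma_of M (W i) borel) \<subseteq> sets M" if "i \<in> {1..n} - {j}" for i
    using sub_units(1)[of i] that by (auto simp: subalgebra_def)
qed (use sub_units(3,4) in \<open>simp_all add: subalgebra_def\<close>)

lemma sets_rest: "sets (rest n j) = sigma_sets (space M) ((\<Union>i\<in>{1..n} - {j}. sets (sigma_of M (W i) borel)) \<union>
       sets (sigma_of M (\<pi> n) (NP n)) \<union> sets (sigma_of M (\<xi> n) (NX n)))"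
  and space_rest [simp]: "space (rest n j) = space M"
proof -
  have "(\<Union>i\<in>{1..n} - {j}. sets (sigma_of M (W i) borel)) \<union>
       sets (sigma_of M (\<pi> n) (NP n)) \<union> sets (sigma_of M (\<xi> n) (NX n)) \<subseteq> Pow (space M)"
    by (rule order.trans[OF rest_gen sets.space_closed])
  then show "sets (rest n j) = sigma_sets (space M) ((\<Union>i\<in>{1..n} - {j}. sets (sigma_of M (W i) borel)) \<union>
       sets (sigma_of M (\<pi> n) (NP n)) \<union> sets (sigma_of M (\<xi> n) (NX n)))" "space (rest n j) = space M"
    unfolding rest_def by (simp_all add: sets_measure_of space_measure_of)
qed

lemma sub_rest: "subalgebra M (rest n j)"
  unfolding subalgebra_def sets_rest using sets.sigma_sets_subset[OF rest_gen] by simp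

lemma sub_rest_units:
  "i \<in> {1..n} - {j} \<Longrightarrow> subalgebra (rest n j) (sigma_of M (W i) borel)"
  "subalgebra (rest n j) (sigma_of M (\<pi> n) (NP n))" "subalgebra (rest n j) (sigma_of M (\<xi> n) (NX n))"
  unfolding subalgebra_def sets_rest by (auto intro!: sigma_sets.Basic)

lemma leave_out_gen:
  assumes "j \<ge> 1"
  shows "{A \<inter> B | A B. A \<in> sets (sigma_of M (\<psi> j) borel) \<and> B \<in> sets (rest n j)} \<subseteq> sets M"
proof clarify
  fix A B assume "A \<in> sets (sigma_of M (\<psi> j) borel)" "B \<in> sets (rest n j)"
  then have "A \<in> sets M" "B \<in> sets M"
    using sub_units(2)[OF assms] sub_rest[of n j] by (auto simp only: subalgebra_def)
  then show "A \<inter> B \<in> sets M" by (rule sets.Int)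
qed

lemma leave_out_facts:
  assumes j: "j \<ge> 1"
  shows "space (leave_out n j) = space M" "subalgebra M (leave_out n j)"
    "subalgebra (leave_out n j) (sigma_of M (\<psi> j) borel)" "subalgebra (leave_out n j) (rest n j)"
proof -
  let ?G = "{A \<inter> B | A B. A \<in> sets (sigma_of M (\<psi> j) borel) \<and> B \<in> sets (rest n j)}"
  have sub: "?G \<subseteq> Pow (space M)" by (rule order.trans[OF leave_out_gen[OF j] sets.space_closed])
  have s: "sets (leave_out n j) = sigma_sets (space M) ?G" and sp: "space (leave_out n j) = space M"
    unfolding leave_out_def using sub by (simp_all add: sets_measure_of space_measure_of)
  show "space (leave_out n j) = space M" by (rule sp)
  show "subalgebra M (leave_out n j)"
    unfolding subalgebra_def s sp using sets.sigma_sets_subset[OF leave_out_gen[OF j]] by simp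
  have top: "space M \<in> sets (sigma_of M (\<psi> j) borel)" "space M \<in> sets (rest n j)"
    using sets.top[of "sigma_of M (\<psi> j) borel"] sets.top[of "rest n j"] by simp_all
  show "subalgebra (leave_out n j) (sigma_of M (\<psi> j) borel)"
    unfolding subalgebra_def s sp
  proof (intro conjI subsetI)
    fix A assume A: "A \<in> sets (sigma_of M (\<psi> j) borel)"
    then have "A = A \<inter> space M" using sets.sets_into_space[OF A] by auto
    then have "A \<in> ?G" using A top by blast
    then show "A \<in> sigma_sets (space M) ?G" by (rule sigma_sets.Basic)
  qed simp
  show "subalgebra (leave_out n j) (rest n j)"
    unfolding subalgebra_def s sp
  proof (intro conjI subsetI)
    fix B assume B: "B \<in> sets (rest n j)"
    then have "B = space M \<inter> B" using sets.sets_into_space[OF B] by auto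
    then have "B \<in> ?G" using B top by blast
    then show "B \<in> sigma_sets (space M) ?G" by (rule sigma_sets.Basic)
  qed simp
qed

lemma measurable_leave_out:
  assumes j: "j \<in> {1..n}"
  shows "i \<in> {1..n} - {j} \<Longrightarrow> W i \<in> leave_out n j \<rightarrow>\<^sub>M borel" "i \<in> {1..n} \<Longrightarrow> \<psi> i \<in> leave_out n j \<rightarrow>\<^sub>M borel"
    "\<pi> n \<in> leave_out n j \<rightarrow>\<^sub>M NP n" "\<xi> n \<in> leave_out n j \<rightarrow>\<^sub>M NX n"
proof -
  have j1: "j \<ge> 1" using j by simp
  note sub = leave_out_facts(3)[OF j1, of n] leave_out_facts(4)[OF j1, of n]
  show W: "W i \<in> leave_out n j \<rightarrow>\<^sub>M borel" if "i \<in> {1..n} - {j}" for i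
    by (rule measurable_from_subalg[OF sub(2) measurable_from_subalg[OF sub_rest_units(1)[OF that]
        measurable_sigma_of[OF W_M]]])
       (use that in auto)
  show "\<psi> i \<in> leave_out n j \<rightarrow>\<^sub>M borel" if "i \<in> {1..n}"
  proof (cases "i = j")
    case True
    then show ?thesis using measurable_from_subalg[OF sub(1) measurable_sigma_of[OF components_M(1)[OF j1]]] by simp
  qed (use W that measurable_components(1) in auto)
  show "\<pi> n \<in> leave_out n j \<rightarrow>\<^sub>M NP n"
    by (rule measurable_from_subalg[OF sub(2) measurable_from_subalg[OF sub_rest_units(2) measurable_sigma_of[OF \<pi>_M]]])
  show "\<xi> n \<in> leave_out n j \<rightarrow>\<^sub>M NX n"
    by (rule measurable_from_subalg[OF sub(2) measurable_from_subalg[OF sub_rest_units(3) measurable_sigma_of[OF \<xi>_M]]])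
qed

lemma sub_leave_out_AT: "j \<in> {1..n} \<Longrightarrow> subalgebra (leave_out n j) (AT n)"
  by (intro sub_AT measurable_leave_out) (auto simp: leave_out_facts)

lemma sub_FT_leave_out:
  assumes j: "j \<in> {1..n}" shows "subalgebra (FT n) (leave_out n j)"
proof -
  have j1: "j \<ge> 1" using j by simp
  have W: "sets (sigma_of M (W i) borel) \<subseteq> sets (FT n)" if "i \<in> {1..n}" for i
    by (rule sigma_of_least[OF measurable_FT(1)[OF that]]) simp
  have "sets (sigma_of M (\<psi> j) borel) \<subseteq> sets (FT n)"
    by (rule sigma_of_least[OF measurable_components(1)[OF measurable_FT(1)[OF j]]]) simp
  moreover have "sets (rest n j) \<subseteq> sets (FT n)"
  proof -
    have "(\<Union>i\<in>{1..n} - {j}. sets (sigma_of M (W i) borel)) \<union>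
       sets (sigma_of M (\<pi> n) (NP n)) \<union> sets (sigma_of M (\<xi> n) (NX n)) \<subseteq> sets (FT n)"
      by (intro Un_least UN_least W sigma_of_least measurable_FT) simp_all
    from sets.sigma_sets_subset[OF this] show ?thesis by (simp add: sets_rest)
  qed
  ultimately have "{A \<inter> B | A B. A \<in> sets (sigma_of M (\<psi> j) borel) \<and> B \<in> sets (rest n j)} \<subseteq> sets (FT n)"
    by auto
  from sets.sigma_sets_subset[OF this]
  have "sigma_sets (space M) {A \<inter> B | A B. A \<in> sets (sigma_of M (\<psi> j) borel) \<and> B \<in> sets (rest n j)} \<subseteq> sets (FT n)" by simp
  moreover have "{A \<inter> B | A B. A \<in> sets (sigma_of M (\<psi> j) borel) \<and> B \<in> sets (rest n j)} \<subseteq> Pow (space M)"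
    by (rule order.trans[OF leave_out_gen[OF j1] sets.space_closed])
  ultimately show ?thesis unfolding subalgebra_def leave_out_def by (simp add: sets_measure_of)
qed

lemma integral_W:
  fixes f :: "(real^'d) \<times> real \<times> real \<Rightarrow> real"
  assumes "f \<in> borel_measurable borel" "i \<ge> 1"
  shows "(\<integral>\<omega>. f (W i \<omega>) \<partial>M) = (\<integral>\<omega>. f (W 1 \<omega>) \<partial>M)" "integrable M (\<lambda>\<omega>. f (W i \<omega>)) \<longleftrightarrow> integrable M (\<lambda>\<omega>. f (W 1 \<omega>))"
proof -
  have "(\<integral>\<omega>. f (W i \<omega>) \<partial>M) = (\<integral>w. f w \<partial>distr M borel (W i))" "integrable M (\<lambda>\<omega>. f (W i \<omega>)) \<longleftrightarrow>
      integrable (distr M borel (W i)) f"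
    if "i \<ge> 1" for i
    using W_M[OF that] assms(1) by (simp_all add: integral_distr integrable_distr_eq)
  from this[OF assms(2)] this[of 1] show "(\<integral>\<omega>. f (W i \<omega>) \<partial>M) = (\<integral>\<omega>. f (W 1 \<omega>) \<partial>M)"
    "integrable M (\<lambda>\<omega>. f (W i \<omega>)) \<longleftrightarrow> integrable M (\<lambda>\<omega>. f (W 1 \<omega>))"
    using W_ident[OF assms(2)] by simp_all
qed

text \<open>Conditional mean zero given the covariate, expressed by integrals over covariate events.
  These are determined by the law of W 1, so the property passes to every other unit without a
  conditional expectation having to be transported.\<close>

definition centered :: "((real^'d) \<times> real \<times> real \<Rightarrow> real) \<Rightarrow> bool" where
  "centered u \<longleftrightarrow> u \<in> borel_measurable borel \<and> integrable M (\<lambda>\<omega>. u (W 1 \<omega>)) \<and>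
    (\<forall>A\<in>sets borel. (\<integral>\<omega>. indicator A (\<psi> 1 \<omega>) * u (W 1 \<omega>) \<partial>M) = 0)"

text \<open>The covariate of unit j centers u(W j), and the remaining information is independent of
  the whole unit, so adding it leaves the conditional mean at 0.\<close>

lemma orthogonal_real:
  assumes u: "centered u" and j: "j \<in> {1..n}"
    and Z: "Z \<in> borel_measurable (leave_out n j)" "\<And>\<omega>. \<bar>Z \<omega>\<bar> \<le> K"
  shows "(\<integral>\<omega>. Z \<omega> * u (W j \<omega>) \<partial>M) = 0"
proof -
  have j1: "j \<ge> 1" using j by simp
  have [measurable]: "u \<in> borel_measurable borel" using u by (simp add: centered_def)
  note WM[measurable] = W_M[OF j1]
  have int: "integrable M (\<lambda>\<omega>. u (W j \<omega>))"
    using u integral_W(2)[OF _ j1, of u] by (simp add: centered_def)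
  have ZM[measurable]: "Z \<in> borel_measurable M" by (rule measurable_from_subalg[OF leave_out_facts(2)[OF j1] Z(1)])
  have K: "0 \<le> K" using Z(2)[of undefined] by linarith
  show ?thesis
  proof (rule integral_mult_eq_0_of_indep[OF sub_units(2)[OF j1] sub_units(1)[OF j1] sub_rest[of n j]])
    show "sets (sigma_of M (\<psi> j) borel) \<subseteq> sets (sigma_of M (W j) borel)"
      by (rule sigma_of_least[OF measurable_components(1)[OF measurable_sigma_of[OF WM]]]) simp
    show "indep_set (sets (sigma_of M (W j) borel)) (sets (rest n j))"
      unfolding sets_rest by (rule indep_set_unit_rest[OF W_indep indep j])
    show "(\<lambda>\<omega>. u (W j \<omega>)) \<in> borel_measurable (sigma_of M (W j) borel)"
      by (rule measurable_compose[OF measurable_sigma_of[OF WM]]) simp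
    fix A assume "A \<in> sets (sigma_of M (\<psi> j) borel)"
    then obtain B where B: "B \<in> sets borel" "A = \<psi> j -` B \<inter> space M"
      unfolding sigma_of_def by (auto simp: sets_vimage_algebra2)
    have [measurable]: "(\<lambda>w. indicator B (fst w) :: real) \<in> borel_measurable (borel :: ((real^'d) \<times> real \<times> real) measure)"
      by (rule measurable_compose[OF _ borel_measurable_indicator[OF B(1)]])
         (intro borel_measurable_continuous_onI continuous_intros)
    have "(\<integral>\<omega>. indicator A \<omega> * u (W j \<omega>) \<partial>M) = (\<integral>\<omega>. indicator B (fst (W j \<omega>)) * u (W j \<omega>) \<partial>M)"
      by (intro Bochner_Integration.integral_cong) (auto simp: indicator_def B(2) \<psi>_W)
    also have "\<dots> = (\<integral>\<omega>. indicator B (fst (W 1 \<omega>)) * u (W 1 \<omega>) \<partial>M)"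
      by (rule integral_W(1)[OF _ j1, of "\<lambda>w. indicator B (fst w) * u w"]) measurable
    also have "\<dots> = 0" using u B(1) by (simp add: centered_def \<psi>_W)
    finally show "(\<integral>\<omega>. indicator A \<omega> * u (W j \<omega>) \<partial>M) = 0" .
  next
    show "Z \<in> borel_measurable (sigma (space M) {A \<inter> B | A B. A \<in> sets (sigma_of M (\<psi> j) borel) \<and> B \<in> sets (rest n j)})"
      using Z(1) unfolding leave_out_def .
    show "integrable M (\<lambda>\<omega>. Z \<omega> * u (W j \<omega>))"
    proof (rule Bochner_Integration.integrable_bound[OF integrable_mult_right[OF int, of K]])
      show "AE \<omega> in M. norm (Z \<omega> * u (W j \<omega>)) \<le> norm (K * u (W j \<omega>))"
        using Z(2) K by (intro AE_I2) (simp add: abs_mult mult_right_mono)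
    qed measurable
  qed (use int in auto)
qed

text \<open>The design itself is not measurable for \<open>leave_out n j\<close>. Summing over its
  finitely many values turns it into indicators, and \<open>design_weights\<close> replaces each
  indicator by a function of covariates, \<pi> and \<xi>. Such a function does not see the outcomes
  of unit j, so \<open>orthogonal_real\<close> applies term by term.\<close>

lemma orthogonal_design_real:
  fixes Z :: "nat set \<Rightarrow> nat set \<Rightarrow> 'a \<Rightarrow> real"
  assumes u: "centered u" and j: "j \<in> {1..n}"
    and Z: "\<And>t d. Z t d \<in> borel_measurable (leave_out n j)" "\<And>t d \<omega>. \<bar>Z t d \<omega>\<bar> \<le> K"
  shows "(\<integral>\<omega>. Z (treated n \<omega>) (assigned n \<omega>) \<omega> * u (W j \<omega>) \<partial>M) = 0"
proof -
  have j1: "j \<ge> 1" using j by simp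
  have [measurable]: "u \<in> borel_measurable borel" using u by (simp add: centered_def)
  have int: "integrable M (\<lambda>\<omega>. u (W j \<omega>))"
    using u integral_W(2)[OF _ j1, of u] by (simp add: centered_def)
  note [measurable] = W_M[OF j1] measurable_from_subalg[OF leave_out_facts(2)[OF j1] Z(1)] treated_M assigned_M
  have K: "0 \<le> K" using Z(2)[of undefined undefined undefined] by linarith
  define It where "It t = (indicator {\<omega> \<in> space M. treated n \<omega> = t} :: 'a \<Rightarrow> real)" for t
  define Id where "Id d = (indicator {\<omega> \<in> space M. assigned n \<omega> = d} :: 'a \<Rightarrow> real)" for d
  have [measurable]: "It t \<in> borel_measurable M" "Id d \<in> borel_measurable M" for t d
    unfolding It_def Id_def by (auto intro!: borel_measurable_indicator treated_M assigned_M)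
  have intZ: "integrable M (\<lambda>\<omega>. Z t d \<omega> * u (W j \<omega>))" for t d
  proof (rule Bochner_Integration.integrable_bound[OF integrable_mult_right[OF int, of K]])
    show "AE \<omega> in M. norm (Z t d \<omega> * u (W j \<omega>)) \<le> norm (K * u (W j \<omega>))"
      using Z(2) K by (intro AE_I2) (simp add: abs_mult mult_right_mono)
  qed measurable
  have intI: "integrable M (\<lambda>\<omega>. It t \<omega> * Id d \<omega> * (Z t d \<omega> * u (W j \<omega>)))" for t d
    by (rule Bochner_Integration.integrable_bound[OF intZ[of t d]]) (auto simp: It_def Id_def indicator_def)
  define S where "S = (SIGMA t:Pow {1..n}. Pow t)"
  have finS: "finite S" unfolding S_def by (intro finite_SigmaI) (auto intro: finite_subset)
  have "(\<integral>\<omega>. Z (treated n \<omega>) (assigned n \<omega>) \<omega> * u (W j \<omega>) \<partial>M) =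
      (\<integral>\<omega>. (\<Sum>(t, d)\<in>S. It t \<omega> * Id d \<omega> * (Z t d \<omega> * u (W j \<omega>))) \<partial>M)"
  proof (rule Bochner_Integration.integral_cong[OF refl])
    fix \<omega> assume \<omega>: "\<omega> \<in> space M"
    have "(\<Sum>(t, d)\<in>S. It t \<omega> * Id d \<omega> * (Z t d \<omega> * u (W j \<omega>))) =
       (\<Sum>x\<in>S. if x = (treated n \<omega>, assigned n \<omega>) then Z (treated n \<omega>) (assigned n \<omega>) \<omega> * u (W j \<omega>) else 0)"
      using \<omega> by (intro sum.cong) (auto simp: It_def Id_def indicator_def)
    also have "\<dots> = Z (treated n \<omega>) (assigned n \<omega>) \<omega> * u (W j \<omega>)"
      using finS by (subst sum.delta) (auto simp: S_def treated_def assigned_def)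
    finally show "Z (treated n \<omega>) (assigned n \<omega>) \<omega> * u (W j \<omega>) =
        (\<Sum>(t, d)\<in>S. It t \<omega> * Id d \<omega> * (Z t d \<omega> * u (W j \<omega>)))" by simp
  qed
  also have "\<dots> = (\<Sum>(t, d)\<in>S. \<integral>\<omega>. It t \<omega> * Id d \<omega> * (Z t d \<omega> * u (W j \<omega>)) \<partial>M)"
    using intI by (subst Bochner_Integration.integral_sum) (auto simp: case_prod_beta)
  also have "\<dots> = 0"
  proof (rule sum.neutral, clarify)
    fix t d assume "(t, d) \<in> S"
    then have td: "t \<subseteq> {1..n}" "d \<subseteq> t" by (auto simp: S_def)
    obtain r where r: "r \<in> borel_measurable (AT n)" "\<And>\<omega>. \<omega> \<in> space M \<Longrightarrow> 0 \<le> r \<omega> \<and> r \<omega> \<le> 1"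
      and rV: "\<And>V. V \<in> borel_measurable (FT n) \<Longrightarrow> integrable M V \<Longrightarrow>
         (\<integral>\<omega>. It t \<omega> * Id d \<omega> * V \<omega> \<partial>M) = (\<integral>\<omega>. r \<omega> * V \<omega> \<partial>M)"
      using design_weights[OF td] unfolding It_def Id_def by blast
    \<comment> \<open>The weight is known to lie in [0, 1] on \<open>space M\<close>, whereas
      \<open>orthogonal_real\<close> wants a bound at every point; clipping provides it.\<close>
    define r' where "r' \<omega> = min 1 (max 0 (r \<omega>))" for \<omega>
    have r'H: "r' \<in> borel_measurable (leave_out n j)"
      unfolding r'_def using measurable_from_subalg[OF sub_leave_out_AT[OF j] r(1)] by measurable
    have "(\<integral>\<omega>. It t \<omega> * Id d \<omega> * (Z t d \<omega> * u (W j \<omega>)) \<partial>M) = (\<integral>\<omega>. r \<omega> * (Z t d \<omega> * u (W j \<omega>)) \<partial>M)"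
    proof (rule rV[OF _ intZ])
      show "(\<lambda>\<omega>. Z t d \<omega> * u (W j \<omega>)) \<in> borel_measurable (FT n)"
        using measurable_from_subalg[OF sub_FT_leave_out[OF j] Z(1)] measurable_compose[OF
            measurable_FT(1)[OF j], of u borel]
        by (intro borel_measurable_times) auto
    qed
    also have "\<dots> = (\<integral>\<omega>. (r' \<omega> * Z t d \<omega>) * u (W j \<omega>) \<partial>M)"
      using r(2) by (intro Bochner_Integration.integral_cong) (auto simp: r'_def)
    also have "\<dots> = 0"
    proof (rule orthogonal_real[OF u j])
      show "(\<lambda>\<omega>. r' \<omega> * Z t d \<omega>) \<in> borel_measurable (leave_out n j)" using r'H Z(1) by (intro borel_measurable_times)
      have "\<bar>r' \<omega>\<bar> * \<bar>Z t d \<omega>\<bar> \<le> 1 * K" for \<omega> using Z(2) by (intro mult_mono) (auto simp: r'_def)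
      then show "\<bar>r' \<omega> * Z t d \<omega>\<bar> \<le> K" for \<omega> by (simp add: abs_mult)
    qed
    finally show "(\<integral>\<omega>. It t \<omega> * Id d \<omega> * (Z t d \<omega> * u (W j \<omega>)) \<partial>M) = 0" .
  qed
  finally show ?thesis .
qed

lemma measurable_design:
  assumes Z: "\<And>t d. Z t d \<in> M \<rightarrow>\<^sub>M N"
  shows "(\<lambda>\<omega>. Z (treated n \<omega>) (assigned n \<omega>) \<omega>) \<in> M \<rightarrow>\<^sub>M N"
proof -
  have t: "treated n \<in> M \<rightarrow>\<^sub>M count_space (Pow {1..n})" and d: "assigned n \<in> M \<rightarrow>\<^sub>M count_space (Pow {1..n})"
  proof -
    have "treated n -` {s} \<inter> space M = {\<omega> \<in> space M. treated n \<omega> = s}" "assigned n -` {s} \<inter> space M =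
        {\<omega> \<in> space M. assigned n \<omega> = s}" for s
      by auto
    then show "treated n \<in> M \<rightarrow>\<^sub>M count_space (Pow {1..n})" "assigned n \<in> M \<rightarrow>\<^sub>M count_space (Pow {1..n})"
      using treated_M[of n] assigned_M[of n]
      by (auto simp: measurable_count_space_eq2 treated_def assigned_def)
  qed
  show ?thesis
    by (rule measurable_compose_countable'[OF measurable_compose_countable'[OF Z d] t]) (auto intro: countable_finite)
qed

lemma orthogonal_design:
  fixes Z :: "nat set \<Rightarrow> nat set \<Rightarrow> 'a \<Rightarrow> complex"
  assumes u: "centered u" and j: "j \<in> {1..n}"
    and Z: "\<And>t d. Z t d \<in> borel_measurable (leave_out n j)" "\<And>t d \<omega>. norm (Z t d \<omega>) \<le> K"
  shows "(\<integral>\<omega>. Z (treated n \<omega>) (assigned n \<omega>) \<omega> * of_real (u (W j \<omega>)) \<partial>M) = 0"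
    "integrable M (\<lambda>\<omega>. Z (treated n \<omega>) (assigned n \<omega>) \<omega> * of_real (u (W j \<omega>)))"
proof -
  have j1: "j \<ge> 1" using j by simp
  have [measurable]: "u \<in> borel_measurable borel" using u by (simp add: centered_def)
  have int: "integrable M (\<lambda>\<omega>. u (W j \<omega>))"
    using u integral_W(2)[OF _ j1, of u] by (simp add: centered_def)
  note [measurable] = W_M[OF j1]
  have [measurable]: "(\<lambda>\<omega>. Z (treated n \<omega>) (assigned n \<omega>) \<omega>) \<in> borel_measurable M"
    by (rule measurable_design[OF measurable_from_subalg[OF leave_out_facts(2)[OF j1] Z(1)]])
  have K: "0 \<le> K" using Z(2)[of undefined undefined undefined] norm_ge_zero order.trans by blast
  show intZ: "integrable M (\<lambda>\<omega>. Z (treated n \<omega>) (assigned n \<omega>) \<omega> * of_real (u (W j \<omega>)))"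
  proof (rule Bochner_Integration.integrable_bound[OF integrable_mult_right[OF int, of K]])
    show "AE \<omega> in M. norm (Z (treated n \<omega>) (assigned n \<omega>) \<omega> * of_real (u (W j \<omega>))) \<le> norm (K * u (W j \<omega>))"
      using Z(2) K by (intro AE_I2) (simp add: norm_mult abs_mult mult_right_mono)
  qed measurable
  have "Re (\<integral>\<omega>. Z (treated n \<omega>) (assigned n \<omega>) \<omega> * of_real (u (W j \<omega>)) \<partial>M) =
      (\<integral>\<omega>. Re (Z (treated n \<omega>) (assigned n \<omega>) \<omega>) * u (W j \<omega>) \<partial>M)"
    using intZ by (simp add: integral_Re[symmetric])
  also have "\<dots> = 0"
    by (rule orthogonal_design_real[OF u j, of "\<lambda>t d \<omega>. Re (Z t d \<omega>)" K])
       (use Z in \<open>auto intro: order.trans[OF abs_Re_le_cmod] borel_measurable_Re measurable_compose\<close>)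
  finally have re: "Re (\<integral>\<omega>. Z (treated n \<omega>) (assigned n \<omega>) \<omega> * of_real (u (W j \<omega>)) \<partial>M) = 0" .
  have "Im (\<integral>\<omega>. Z (treated n \<omega>) (assigned n \<omega>) \<omega> * of_real (u (W j \<omega>)) \<partial>M) =
      (\<integral>\<omega>. Im (Z (treated n \<omega>) (assigned n \<omega>) \<omega>) * u (W j \<omega>) \<partial>M)"
    using intZ by (simp add: integral_Im[symmetric])
  also have "\<dots> = 0"
    by (rule orthogonal_design_real[OF u j, of "\<lambda>t d \<omega>. Im (Z t d \<omega>)" K])
       (use Z in \<open>auto intro: order.trans[OF abs_Im_le_cmod] borel_measurable_Im measurable_compose\<close>)
  finally show "(\<integral>\<omega>. Z (treated n \<omega>) (assigned n \<omega>) \<omega> * of_real (u (W j \<omega>)) \<partial>M) = 0"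
    using re by (simp add: complex_eq_iff)
qed

section \<open>Conditional means and residuals\<close>

text \<open>A Doob-Dynkin factor of the particular version \<open>real_cond_exp\<close>, so that the
  two agree at every point of \<open>space M\<close> and not just almost everywhere.\<close>

definition cmean :: "nat \<Rightarrow> real^'d \<Rightarrow> real" where
  "cmean d = (SOME g. g \<in> borel_measurable borel \<and>
     (\<forall>\<omega>\<in>space M. real_cond_exp M (sigma_of M (\<psi> 1) borel) (Y d 1) \<omega> = g (\<psi> 1 \<omega>)))"

lemma cmean: "cmean d \<in> borel_measurable borel"
  "\<omega> \<in> space M \<Longrightarrow> real_cond_exp M (sigma_of M (\<psi> 1) borel) (Y d 1) \<omega> = cmean d (\<psi> 1 \<omega>)"
proof -
  have "\<exists>g\<in>borel_measurable borel. \<forall>\<omega>\<in>space M. real_cond_exp M (sigma_of M (\<psi> 1) borel) (Y d 1) \<omega> = g (\<psi> 1 \<omega>)"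
    using borel_measurable_cond_exp[of M "sigma_of M (\<psi> 1) borel" "Y d 1"]
    by (intro measurable_vimage_algebra_factor) (auto simp: sigma_of_def)
  then have "\<exists>g. g \<in> borel_measurable borel \<and> (\<forall>\<omega>\<in>space M. real_cond_exp M (sigma_of M (\<psi> 1) borel) (Y d 1) \<omega> = g (\<psi> 1 \<omega>))"
    by blast
  from someI_ex[OF this, folded cmean_def]
  show "cmean d \<in> borel_measurable borel"
    "\<omega> \<in> space M \<Longrightarrow> real_cond_exp M (sigma_of M (\<psi> 1) borel) (Y d 1) \<omega> = cmean d (\<psi> 1 \<omega>)" by blast+
qed

lemmas cmean_simps = cmean(2) cmean(2)[unfolded One_nat_def]

lemma Y_M: "d \<in> {0, 1} \<Longrightarrow> i \<ge> 1 \<Longrightarrow> Y d i \<in> borel_measurable M"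
  using components_M by auto

lemma \<psi>1_M: "\<psi> 1 \<in> M \<rightarrow>\<^sub>M borel"
  by (rule components_M) simp

lemma subalg_\<psi>1: "finite_measure_subalgebra M (sigma_of M (\<psi> 1) borel)"
  by (intro finite_measure_subalgebraI sigma_of_subalgebra \<psi>1_M)

lemma power_le_1_plus_4: "\<bar>x\<bar> \<le> 1 + x ^ 4" "x\<^sup>2 \<le> 1 + x ^ 4" "\<bar>x\<bar> ^ 3 \<le> 1 + x ^ 4" for x :: real
proof -
  have "\<bar>x\<bar> \<le> 1 + \<bar>x\<bar> ^ 4 \<and> \<bar>x\<bar> ^ 2 \<le> 1 + \<bar>x\<bar> ^ 4 \<and> \<bar>x\<bar> ^ 3 \<le> 1 + \<bar>x\<bar> ^ 4"
  proof (cases "\<bar>x\<bar> \<le> 1")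
    case True
    then have "\<bar>x\<bar> ^ 2 \<le> 1" "\<bar>x\<bar> ^ 3 \<le> 1" "0 \<le> \<bar>x\<bar> ^ 4" by (intro power_le_one zero_le_power; simp)+
    then show ?thesis using True by linarith
  next
    case False
    then have "\<bar>x\<bar> ^ 1 \<le> \<bar>x\<bar> ^ 4" "\<bar>x\<bar> ^ 2 \<le> \<bar>x\<bar> ^ 4" "\<bar>x\<bar> ^ 3 \<le> \<bar>x\<bar> ^ 4"
      by (intro power_increasing; simp)+
    then show ?thesis by simp
  qed
  then show "\<bar>x\<bar> \<le> 1 + x ^ 4" "x\<^sup>2 \<le> 1 + x ^ 4" "\<bar>x\<bar> ^ 3 \<le> 1 + x ^ 4" by auto
qed

lemma fourth_moment_imp:
  fixes f :: "'a \<Rightarrow> real"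
  assumes [measurable]: "f \<in> borel_measurable M" and 4: "integrable M (\<lambda>\<omega>. (f \<omega>) ^ 4)"
  shows "integrable M f" "integrable M (\<lambda>\<omega>. (f \<omega>)\<^sup>2)" "integrable M (\<lambda>\<omega>. \<bar>f \<omega>\<bar> ^ 3)"
proof -
  have i: "integrable M (\<lambda>\<omega>. 1 + (f \<omega>) ^ 4)" using 4 by simp
  show "integrable M f"
    by (rule Bochner_Integration.integrable_bound[OF i]) (auto intro!: AE_I2 order.trans[OF power_le_1_plus_4(1)])
  show "integrable M (\<lambda>\<omega>. (f \<omega>)\<^sup>2)"
    by (rule Bochner_Integration.integrable_bound[OF i]) (auto intro!: AE_I2 order.trans[OF power_le_1_plus_4(2)])
  show "integrable M (\<lambda>\<omega>. \<bar>f \<omega>\<bar> ^ 3)"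
    by (rule Bochner_Integration.integrable_bound[OF i]) (auto intro!: AE_I2 order.trans[OF power_le_1_plus_4(3)])
qed

lemma fourth_moment_diff:
  fixes f g :: "'a \<Rightarrow> real"
  assumes [measurable]: "f \<in> borel_measurable M" "g \<in> borel_measurable M"
    and 4: "integrable M (\<lambda>\<omega>. (f \<omega>) ^ 4)" "integrable M (\<lambda>\<omega>. (g \<omega>) ^ 4)"
  shows "integrable M (\<lambda>\<omega>. (f \<omega> - g \<omega>) ^ 4)"
proof (rule Bochner_Integration.integrable_bound)
  show "integrable M (\<lambda>\<omega>. 8 * (f \<omega>) ^ 4 + 8 * (g \<omega>) ^ 4)" using 4 by simp
  have "(a - b) ^ 4 \<le> 8 * a ^ 4 + 8 * b ^ 4" for a b :: real
  proof -
    have "(a - b) ^ 4 = ((a - b)\<^sup>2)\<^sup>2" by (simp flip: power_mult)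
    also have "\<dots> \<le> (2 * a\<^sup>2 + 2 * b\<^sup>2)\<^sup>2" using square_sum_le[of a "- b"] by (intro power_mono) auto
    also have "\<dots> \<le> 2 * (2 * a\<^sup>2)\<^sup>2 + 2 * (2 * b\<^sup>2)\<^sup>2" by (rule square_sum_le)
    also have "\<dots> = 8 * a ^ 4 + 8 * b ^ 4" by (simp add: power_mult_distrib flip: power_mult)
    finally show ?thesis .
  qed
  then show "AE \<omega> in M. norm ((f \<omega> - g \<omega>) ^ 4) \<le> norm (8 * (f \<omega>) ^ 4 + 8 * (g \<omega>) ^ 4)"
    by (intro AE_I2) auto
qed measurable

text \<open>Conditional Jensen for the convex function x ^ 4.\<close>

lemma cmean_moment: "d \<in> {0, 1} \<Longrightarrow> integrable M (\<lambda>\<omega>. (cmean d (\<psi> 1 \<omega>)) ^ 4)"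
proof -
  assume d: "d \<in> {0, 1}"
  interpret G: finite_measure_subalgebra M "sigma_of M (\<psi> 1) borel" by (rule subalg_\<psi>1)
  have "integrable M (\<lambda>\<omega>. (real_cond_exp M (sigma_of M (\<psi> 1) borel) (Y d 1) \<omega>) ^ 4)"
  proof (rule G.integrable_convex_cond_exp[where I=UNIV])
    show "integrable M (Y d 1)" by (rule fourth_moment_imp(1)[OF Y_M[OF d] Y_moment[OF d]]) simp
    show "convex_on UNIV (\<lambda>x::real. x ^ 4)" by (rule convex_power_even) simp
  qed (use Y_moment[OF d] in auto)
  then show ?thesis
    by (rule Bochner_Integration.integrable_cong[OF refl, THEN iffD1, rotated]) (simp add: cmean_simps)
qed

text \<open>A function on the value space of W, so that its moments and centering, established for
  unit 1, pass to all units by identical distribution.\<close>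

definition res :: "nat \<Rightarrow> (real^'d) \<times> real \<times> real \<Rightarrow> real" where
  "res d w = (if d = 0 then fst (snd w) else snd (snd w)) - cmean d (fst w)"

lemma res_W: "d \<in> {0, 1} \<Longrightarrow> res d (W i \<omega>) = Y d i \<omega> - cmean d (\<psi> i \<omega>)"
  by (auto simp: res_def W)

lemma fst_measurable: "f \<in> borel_measurable borel \<Longrightarrow> (\<lambda>w. f (fst w)) \<in> borel_measurable
    (borel :: ((real^'d) \<times> real \<times> real) measure)"
  by (rule measurable_compose[of fst _ borel]) (intro borel_measurable_continuous_onI continuous_intros, assumption)

lemma res_borel [measurable]: "res d \<in> borel_measurable borel"
proof -
  have "(\<lambda>w. if d = 0 then fst (snd w) else snd (snd w)) \<in> borel_measurable (borel :: ((real^'d) \<times> real \<times> real) measure)"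
    by (cases "d = 0") (auto intro!: borel_measurable_continuous_onI continuous_intros)
  then show ?thesis unfolding res_def using fst_measurable[OF cmean(1)] by (intro borel_measurable_diff)
qed

lemma res_moment: "d \<in> {0, 1} \<Longrightarrow> integrable M (\<lambda>\<omega>. (res d (W 1 \<omega>)) ^ 4)"
  unfolding res_W
  by (intro fourth_moment_diff Y_M measurable_compose[OF \<psi>1_M cmean(1)] Y_moment cmean_moment) auto

lemma res_M: "i \<ge> 1 \<Longrightarrow> (\<lambda>\<omega>. res d (W i \<omega>)) \<in> borel_measurable M"
  by (rule measurable_compose[OF W_M]) simp_all

lemmas res_integrable = fourth_moment_imp[OF res_M[OF order_refl] res_moment]

lemma \<sigma>2_borel: "d \<in> {0, 1} \<Longrightarrow> \<sigma>2 d \<in> borel_measurable borel"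
  using \<sigma>2 by (auto simp: is_cond_var_def is_cond_mean_def)

lemma indicator_\<psi>1: "A \<in> sets borel \<Longrightarrow> (\<lambda>\<omega>. indicator A (\<psi> 1 \<omega>) :: real) \<in> borel_measurable (sigma_of M (\<psi> 1) borel)"
  by (rule measurable_compose[OF measurable_sigma_of[OF \<psi>1_M]]) simp

lemma integral_indicator_cond_exp:
  assumes [measurable]: "f \<in> borel_measurable M" "integrable M f" "A \<in> sets borel"
  shows "(\<integral>\<omega>. indicator A (\<psi> 1 \<omega>) * real_cond_exp M (sigma_of M (\<psi> 1) borel) f \<omega> \<partial>M) = (\<integral>\<omega>. indicator A (\<psi> 1 \<omega>) * f \<omega> \<partial>M)"
    "integrable M (\<lambda>\<omega>. indicator A (\<psi> 1 \<omega>) * f \<omega>)"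
proof -
  interpret G: finite_measure_subalgebra M "sigma_of M (\<psi> 1) borel" by (rule subalg_\<psi>1)
  note [measurable] = \<psi>1_M
  show i: "integrable M (\<lambda>\<omega>. indicator A (\<psi> 1 \<omega>) * f \<omega>)"
  proof (rule Bochner_Integration.integrable_bound[OF assms(2)])
    show "AE \<omega> in M. norm (indicator A (\<psi> 1 \<omega>) * f \<omega>) \<le> norm (f \<omega>)" by (auto simp: indicator_def)
  qed measurable
  show "(\<integral>\<omega>. indicator A (\<psi> 1 \<omega>) * real_cond_exp M (sigma_of M (\<psi> 1) borel) f \<omega> \<partial>M) = (\<integral>\<omega>. indicator A (\<psi> 1 \<omega>) * f \<omega> \<partial>M)"
    by (rule G.real_cond_exp_intg(2)[OF i indicator_\<psi>1]) auto
qed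

lemma centered_res:
  assumes d: "d \<in> {0, 1}"
  shows "centered (res d)"
  unfolding centered_def
proof (intro conjI ballI res_borel res_integrable(1)[OF d])
  fix A :: "(real^'d) set" assume A: "A \<in> sets borel"
  have Yi: "integrable M (Y d 1)" by (rule fourth_moment_imp(1)[OF Y_M[OF d] Y_moment[OF d]]) simp
  have ci: "integrable M (\<lambda>\<omega>. cmean d (\<psi> 1 \<omega>))"
    by (rule fourth_moment_imp(1)[OF measurable_compose[OF \<psi>1_M cmean(1)] cmean_moment[OF d]])
  have "(\<integral>\<omega>. indicator A (\<psi> 1 \<omega>) * res d (W 1 \<omega>) \<partial>M) =
      (\<integral>\<omega>. indicator A (\<psi> 1 \<omega>) * Y d 1 \<omega> - indicator A (\<psi> 1 \<omega>) * cmean d (\<psi> 1 \<omega>) \<partial>M)"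
    by (simp add: res_W[OF d] right_diff_distrib)
  also have "\<dots> = (\<integral>\<omega>. indicator A (\<psi> 1 \<omega>) * Y d 1 \<omega> \<partial>M) - (\<integral>\<omega>. indicator A (\<psi> 1 \<omega>) * cmean d (\<psi> 1 \<omega>) \<partial>M)"
    using Yi ci A by (intro Bochner_Integration.integral_diff integral_indicator_cond_exp(2)) auto
  also have "(\<integral>\<omega>. indicator A (\<psi> 1 \<omega>) * cmean d (\<psi> 1 \<omega>) \<partial>M) =
      (\<integral>\<omega>. indicator A (\<psi> 1 \<omega>) * real_cond_exp M (sigma_of M (\<psi> 1) borel) (Y d 1) \<omega> \<partial>M)"
    by (intro Bochner_Integration.integral_cong) (auto simp: cmean_simps)
  also have "\<dots> = (\<integral>\<omega>. indicator A (\<psi> 1 \<omega>) * Y d 1 \<omega> \<partial>M)"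
    using Yi A by (intro integral_indicator_cond_exp(1)) auto
  finally show "(\<integral>\<omega>. indicator A (\<psi> 1 \<omega>) * res d (W 1 \<omega>) \<partial>M) = 0" by simp
qed

lemma centered_res_square:
  assumes d: "d \<in> {0, 1}" and s: "s \<in> borel_measurable borel" "AE x in P\<^sub>\<psi>. s x = \<sigma>2 d x"
  shows "centered (\<lambda>w. (res d w)\<^sup>2 - s (fst w))"
proof -
  interpret G: finite_measure_subalgebra M "sigma_of M (\<psi> 1) borel" by (rule subalg_\<psi>1)
  have sM[measurable]: "(\<lambda>\<omega>. s (\<psi> 1 \<omega>)) \<in> borel_measurable M" by (rule measurable_compose[OF \<psi>1_M s(1)])
  have rM[measurable]: "(\<lambda>\<omega>. res d (W 1 \<omega>)) \<in> borel_measurable M" by (rule res_M) simp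
  note [measurable] = \<psi>1_M
  have r2: "integrable M (\<lambda>\<omega>. (res d (W 1 \<omega>))\<^sup>2)" by (rule res_integrable(2)[OF d])
  have "AE \<omega> in M. real_cond_exp M (sigma_of M (\<psi> 1) borel)
      (\<lambda>\<omega>. (Y d 1 \<omega> - real_cond_exp M (sigma_of M (\<psi> 1) borel) (Y d 1) \<omega>)\<^sup>2) \<omega> = \<sigma>2 d (\<psi> 1 \<omega>)"
    using \<sigma>2[OF d] by (simp add: is_cond_var_def is_cond_mean_def)
  moreover have "AE \<omega> in M. real_cond_exp M (sigma_of M (\<psi> 1) borel)
      (\<lambda>\<omega>. (Y d 1 \<omega> - real_cond_exp M (sigma_of M (\<psi> 1) borel) (Y d 1) \<omega>)\<^sup>2) \<omega> =
      real_cond_exp M (sigma_of M (\<psi> 1) borel) (\<lambda>\<omega>. (res d (W 1 \<omega>))\<^sup>2) \<omega>"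
  proof (rule G.real_cond_exp_cong)
    have [measurable]: "Y d 1 \<in> borel_measurable M" by (rule Y_M[OF d]) simp
    show "AE \<omega> in M. (Y d 1 \<omega> - real_cond_exp M (sigma_of M (\<psi> 1) borel) (Y d 1) \<omega>)\<^sup>2 = (res d (W 1 \<omega>))\<^sup>2"
      by (intro AE_I2) (simp only: res_W[OF d] cmean(2))
    show "(\<lambda>\<omega>. (Y d 1 \<omega> - real_cond_exp M (sigma_of M (\<psi> 1) borel) (Y d 1) \<omega>)\<^sup>2) \<in> borel_measurable M"
      by measurable
  qed measurable
  moreover have "AE \<omega> in M. s (\<psi> 1 \<omega>) = \<sigma>2 d (\<psi> 1 \<omega>)"
    using s(2) unfolding P\<psi> by (rule AE_distrD[OF \<psi>1_M])
  ultimately have eq: "AE \<omega> in M. real_cond_exp M (sigma_of M (\<psi> 1) borel) (\<lambda>\<omega>. (res d (W 1 \<omega>))\<^sup>2) \<omega> = s (\<psi> 1 \<omega>)"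
    by eventually_elim simp
  \<comment> \<open>\<open>s\<close> is integrable as a version of the conditional expectation of
    the integrable squared residual.\<close>
  have si: "integrable M (\<lambda>\<omega>. s (\<psi> 1 \<omega>))"
    by (rule integrable_cong_AE[THEN iffD1, OF _ _ eq G.real_cond_exp_int(1)[OF r2]]) measurable
  show ?thesis
    unfolding centered_def
  proof (intro conjI ballI)
    show "(\<lambda>w. (res d w)\<^sup>2 - s (fst w)) \<in> borel_measurable borel"
      using fst_measurable[OF s(1)] by measurable
    show "integrable M (\<lambda>\<omega>. (res d (W 1 \<omega>))\<^sup>2 - s (fst (W 1 \<omega>)))"
      using r2 si by (simp add: \<psi>_W)
    fix A :: "(real^'d) set" assume A[measurable]: "A \<in> sets borel"
    have "(\<integral>\<omega>. indicator A (\<psi> 1 \<omega>) * ((res d (W 1 \<omega>))\<^sup>2 - s (fst (W 1 \<omega>))) \<partial>M) =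
        (\<integral>\<omega>. indicator A (\<psi> 1 \<omega>) * (res d (W 1 \<omega>))\<^sup>2 - indicator A (\<psi> 1 \<omega>) * s (\<psi> 1 \<omega>) \<partial>M)"
      by (simp add: right_diff_distrib \<psi>_W)
    also have "\<dots> = (\<integral>\<omega>. indicator A (\<psi> 1 \<omega>) * (res d (W 1 \<omega>))\<^sup>2 \<partial>M) - (\<integral>\<omega>. indicator A (\<psi> 1 \<omega>) * s (\<psi> 1 \<omega>) \<partial>M)"
      using r2 si by (intro Bochner_Integration.integral_diff integral_indicator_cond_exp(2)) auto
    also have "(\<integral>\<omega>. indicator A (\<psi> 1 \<omega>) * s (\<psi> 1 \<omega>) \<partial>M) =
        (\<integral>\<omega>. indicator A (\<psi> 1 \<omega>) * real_cond_exp M (sigma_of M (\<psi> 1) borel) (\<lambda>\<omega>. (res d (W 1 \<omega>))\<^sup>2) \<omega> \<partial>M)"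
    proof (rule integral_cong_AE)
      show "AE \<omega> in M. indicator A (\<psi> 1 \<omega>) * s (\<psi> 1 \<omega>) =
          indicator A (\<psi> 1 \<omega>) * real_cond_exp M (sigma_of M (\<psi> 1) borel) (\<lambda>\<omega>. (res d (W 1 \<omega>))\<^sup>2) \<omega>"
        using eq by eventually_elim simp
    qed measurable
    also have "\<dots> = (\<integral>\<omega>. indicator A (\<psi> 1 \<omega>) * (res d (W 1 \<omega>))\<^sup>2 \<partial>M)"
      by (intro integral_indicator_cond_exp(1) r2) measurable
    finally show "(\<integral>\<omega>. indicator A (\<psi> 1 \<omega>) * ((res d (W 1 \<omega>))\<^sup>2 - s (fst (W 1 \<omega>))) \<partial>M) = 0" by simp
  qed
qed

section \<open>The optimal propensity\<close>

sublocale P: prob_space P\<^sub>\<psi>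
  unfolding P\<psi> by (rule prob_space_distr[OF \<psi>1_M])

lemma sets_P [measurable_cong, simp]: "sets P\<^sub>\<psi> = sets borel"
  by (simp add: P\<psi>)

lemma AE_\<psi>:
  assumes "AE x in P\<^sub>\<psi>. Q x"
  shows "AE \<omega> in M. \<forall>i\<in>{1..n}. Q (\<psi> i \<omega>)"
proof (rule AE_finite_allI)
  fix i assume "i \<in> {1..n}"
  then have i: "i \<ge> 1" by simp
  show "AE \<omega> in M. Q (\<psi> i \<omega>)"
    using assms unfolding distr_\<psi>[OF i, symmetric] by (rule AE_distrD[OF components_M(1)[OF i]])
qed simp

definition ss :: "real^'d \<Rightarrow> real" where "ss = sigma_s p \<sigma>2"
definition qs :: "real^'d \<Rightarrow> real" where "qs = q_star P\<^sub>\<psi> B p C \<sigma>2"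
definition \<kappa> :: real where "\<kappa> = (\<integral>z. ss z * sqrt (C z) \<partial>P\<^sub>\<psi>)"

lemma qs_eq: "qs x = B * (ss x / sqrt (C x)) / \<kappa>"
  by (simp add: qs_def q_star_def ss_def \<kappa>_def)

lemma ss_borel [measurable]: "ss \<in> borel_measurable borel"
proof -
  have [measurable]: "\<sigma>2 0 \<in> borel_measurable borel" "\<sigma>2 1 \<in> borel_measurable borel" using \<sigma>2_borel by auto
  show ?thesis unfolding ss_def sigma_s_def by measurable
qed

lemma qs_borel [measurable]: "qs \<in> borel_measurable borel"
  using C unfolding qs_eq[abs_def] by measurable

lemma ex_lower: "\<exists>s0>0. AE x in P\<^sub>\<psi>. s0 \<le> ss x \<and> 0 \<le> \<sigma>2 0 x \<and> 0 \<le> \<sigma>2 1 x"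
proof -
  obtain e0 e1 where e: "e0 > 0" "AE x in P\<^sub>\<psi>. e0 \<le> \<sigma>2 0 x" "e1 > 0" "AE x in P\<^sub>\<psi>. e1 \<le> \<sigma>2 1 x"
    using \<sigma>2_inf[of 0] \<sigma>2_inf[of 1] by auto
  have "AE x in P\<^sub>\<psi>. sqrt (e1 / p + e0 / (1 - p)) \<le> ss x \<and> 0 \<le> \<sigma>2 0 x \<and> 0 \<le> \<sigma>2 1 x"
    using e(2,4)
  proof eventually_elim
    case (elim x)
    then have "e1 / p + e0 / (1 - p) \<le> \<sigma>2 1 x / p + \<sigma>2 0 x / (1 - p)"
      using p by (intro add_mono divide_right_mono) auto
    then show ?case using elim e by (auto simp: ss_def sigma_s_def)
  qed
  moreover have "sqrt (e1 / p + e0 / (1 - p)) > 0"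
    using e p by (intro real_sqrt_gt_zero add_pos_pos divide_pos_pos) auto
  ultimately show ?thesis by blast
qed

text \<open>The numerator of q* is positive almost everywhere, so q* > \<delta> > 0 forces the sign
  of the denominator. This also excludes divergence of the integral: \<kappa> would then be 0 by
  convention, and q* = 0 as a division by 0.\<close>

lemma \<kappa>_pos: "\<kappa> > 0"
proof -
  obtain s0 where s0: "s0 > 0" "AE x in P\<^sub>\<psi>. s0 \<le> ss x \<and> 0 \<le> \<sigma>2 0 x \<and> 0 \<le> \<sigma>2 1 x" using ex_lower by blast
  have "AE x in P\<^sub>\<psi>. \<kappa> > 0"
    using s0(2) C_bounds(2) q_star_bounds[folded qs_def]
  proof eventually_elim
    case (elim x)
    define N where "N = B * (ss x / sqrt (C x))"
    have "N > 0" unfolding N_def using elim s0(1) B C_bounds(1) by (intro mult_pos_pos divide_pos_pos) auto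
    moreover have "N / \<kappa> > 0" using elim \<delta> by (simp add: qs_eq N_def)
    ultimately show ?case by (auto simp: zero_less_divide_iff)
  qed
  then show ?thesis by (simp add: P.AE_const)
qed

text \<open>Solving q* \<le> 1 for \<sigma>_s gives \<sigma>_s \<le> (\<kappa> / B) * sqrt C. With
  the upper bound on C the standard deviation, and through it both conditional variances, is
  bounded.\<close>

definition S\<^sub>m :: real where "S\<^sub>m = \<kappa> / B * sqrt C\<^sub>u"

lemma ss_bounds: "AE x in P\<^sub>\<psi>. 0 < ss x \<and> ss x \<le> S\<^sub>m \<and> 0 \<le> \<sigma>2 0 x \<and> 0 \<le> \<sigma>2 1 x \<and>
  (ss x)\<^sup>2 = \<sigma>2 1 x / p + \<sigma>2 0 x / (1 - p) \<and> \<sigma>2 0 x \<le> S\<^sub>m\<^sup>2 \<and> \<sigma>2 1 x \<le> S\<^sub>m\<^sup>2"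
proof -
  obtain s0 where s0: "s0 > 0" "AE x in P\<^sub>\<psi>. s0 \<le> ss x \<and> 0 \<le> \<sigma>2 0 x \<and> 0 \<le> \<sigma>2 1 x" using ex_lower by blast
  show ?thesis
    using s0(2) C_bounds(2) q_star_bounds[folded qs_def]
  proof eventually_elim
    case (elim x)
    have C0: "sqrt (C x) > 0" "sqrt (C x) \<le> sqrt C\<^sub>u" using elim C_bounds(1) by auto
    have "B * (ss x / sqrt (C x)) / \<kappa> \<le> 1" using elim by (simp add: qs_eq)
    then have "ss x \<le> \<kappa> / B * sqrt (C x)" using \<kappa>_pos B C0 by (simp add: field_simps)
    also have "\<dots> \<le> S\<^sub>m" unfolding S\<^sub>m_def using \<kappa>_pos B C0 by (intro mult_left_mono) auto
    finally have le: "ss x \<le> S\<^sub>m" .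
    have sq: "(ss x)\<^sup>2 = \<sigma>2 1 x / p + \<sigma>2 0 x / (1 - p)"
      unfolding ss_def sigma_s_def using elim p(2,3) by (intro real_sqrt_pow2 add_nonneg_nonneg) auto
    have "(ss x)\<^sup>2 \<le> S\<^sub>m\<^sup>2" using le elim s0(1) by (intro power_mono) auto
    moreover have "\<sigma>2 1 x \<le> \<sigma>2 1 x / p" "\<sigma>2 0 x \<le> \<sigma>2 0 x / (1 - p)"
      using p(2,3) elim by (auto simp: le_divide_eq intro: mult_left_le)
    moreover have "0 \<le> \<sigma>2 1 x / p" "0 \<le> \<sigma>2 0 x / (1 - p)" using p(2,3) elim by auto
    ultimately show ?case using elim s0(1) le sq by auto
  qed
qed

section \<open>Sample averages of functions of the covariate\<close>

lemma integral_\<psi>: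
  fixes f :: "real^'d \<Rightarrow> real"
  assumes "f \<in> borel_measurable borel" "i \<ge> 1"
  shows "(\<integral>\<omega>. f (\<psi> i \<omega>) \<partial>M) = (\<integral>x. f x \<partial>P\<^sub>\<psi>)" "integrable M (\<lambda>\<omega>. f (\<psi> i \<omega>)) \<longleftrightarrow> integrable P\<^sub>\<psi> f"
  using components_M(1)[OF assms(2)] assms(1) unfolding distr_\<psi>[OF assms(2), symmetric]
  by (simp_all add: integral_distr integrable_distr_eq)

text \<open>Chebyshev: after centering, independence removes the mixed products, so the second
  moment of the average is O(1/n).\<close>

lemma weak_law:
  assumes f[measurable]: "f \<in> borel_measurable borel" and K: "AE x in P\<^sub>\<psi>. \<bar>f x\<bar> \<le> K"
  shows "vanishes M (\<lambda>n \<omega>. (1 / real n) * (\<Sum>i=1..n. f (\<psi> i \<omega>)) - (\<integral>x. f x \<partial>P\<^sub>\<psi>))"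
proof -
  define \<mu> where "\<mu> = (\<integral>x. f x \<partial>P\<^sub>\<psi>)"
  define g where "g x = f x - \<mu>" for x
  have [measurable]: "g \<in> borel_measurable borel" unfolding g_def by measurable
  have fi: "integrable P\<^sub>\<psi> f" by (rule P.integrable_const_bound[where B=K]) (use K in auto)
  have g0: "(\<integral>x. g x \<partial>P\<^sub>\<psi>) = 0" unfolding g_def using fi by (simp add: \<mu>_def P.prob_space)
  have "AE x in P\<^sub>\<psi>. \<bar>g x\<bar> \<le> K + \<bar>\<mu>\<bar>" using K by eventually_elim (simp add: g_def)
  then have g2: "AE x in P\<^sub>\<psi>. (g x)\<^sup>2 \<le> (K + \<bar>\<mu>\<bar>)\<^sup>2"
    by eventually_elim (use power_mono[OF _ abs_ge_zero, of "g _" "K + \<bar>\<mu>\<bar>" 2] in simp)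
  have gi: "integrable P\<^sub>\<psi> g" unfolding g_def using fi by simp
  have gi2: "integrable P\<^sub>\<psi> (\<lambda>x. (g x)\<^sup>2)" by (rule P.integrable_const_bound[where B="(K + \<bar>\<mu>\<bar>)\<^sup>2"]) (use g2 in auto)
  have gle: "(\<integral>x. (g x)\<^sup>2 \<partial>P\<^sub>\<psi>) \<le> (K + \<bar>\<mu>\<bar>)\<^sup>2" by (rule P.integral_le_const[OF gi2 g2])
  note [measurable] = components_M(1)
  have iM: "integrable M (\<lambda>\<omega>. g (\<psi> i \<omega>))" if "i \<ge> 1" for i using integral_\<psi>(2)[of g i] gi that by simp
  have off: "(\<integral>\<omega>. g (\<psi> i \<omega>) * g (\<psi> j \<omega>) \<partial>M) = 0 \<and> integrable M (\<lambda>\<omega>. g (\<psi> i \<omega>) * g (\<psi> j \<omega>))"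
    if ij: "i \<ge> 1" "j \<ge> 1" "i \<noteq> j" for i j
  proof -
    have "indep_vars (\<lambda>_. borel) (\<lambda>i \<omega>. g (\<psi> i \<omega>)) {1..}"
      unfolding \<psi>_W by (rule indep_vars_compose2[OF W_indep]) (use fst_measurable[of g] in simp)
    then have ind: "indep_vars (\<lambda>_. borel) (\<lambda>i \<omega>. g (\<psi> i \<omega>)) {i, j}"
      by (rule indep_vars_subset) (use ij in auto)
    have ints: "integrable M (\<lambda>\<omega>. g (\<psi> l \<omega>))" if "l \<in> {i, j}" for l using iM ij that by auto
    from indep_vars_lebesgue_integral[OF _ ind ints] indep_vars_integrable[OF _ ind ints]
    show ?thesis using ij integral_\<psi>(1)[of g i] g0 by simp
  qed
  define X where "X n \<omega> = (1 / real n) * (\<Sum>i=1..n. g (\<psi> i \<omega>))" for n \<omega>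
  have XM: "X n \<in> borel_measurable M" for n unfolding X_def by measurable
  have X2: "integrable M (\<lambda>\<omega>. (X n \<omega>)\<^sup>2) \<and> (\<integral>\<omega>. \<bar>(X n \<omega>)\<^sup>2\<bar> \<partial>M) \<le> (K + \<bar>\<mu>\<bar>)\<^sup>2 / real n" if n: "n \<ge> 1" for n
  proof -
    have eq: "(X n \<omega>)\<^sup>2 = (1 / (real n)\<^sup>2) * (\<Sum>i=1..n. \<Sum>j=1..n. g (\<psi> i \<omega>) * g (\<psi> j \<omega>))" for \<omega>
      by (simp add: X_def power_mult_distrib power_divide power2_eq_square[of "sum _ _"] sum_product)
    have ii: "integrable M (\<lambda>\<omega>. g (\<psi> i \<omega>) * g (\<psi> j \<omega>))" if "i \<in> {1..n}" "j \<in> {1..n}" for i j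
    proof (cases "i = j")
      case True
      then show ?thesis using integral_\<psi>(2)[of "\<lambda>x. (g x)\<^sup>2" i] gi2 that by (simp add: power2_eq_square)
    qed (use off that in auto)
    have swap: "(\<integral>\<omega>. (\<Sum>i=1..n. \<Sum>j=1..n. g (\<psi> i \<omega>) * g (\<psi> j \<omega>)) \<partial>M) =
        (\<Sum>i=1..n. \<Sum>j=1..n. \<integral>\<omega>. g (\<psi> i \<omega>) * g (\<psi> j \<omega>) \<partial>M)"
    proof -
      have "(\<integral>\<omega>. (\<Sum>i=1..n. \<Sum>j=1..n. g (\<psi> i \<omega>) * g (\<psi> j \<omega>)) \<partial>M) =
          (\<Sum>i=1..n. \<integral>\<omega>. (\<Sum>j=1..n. g (\<psi> i \<omega>) * g (\<psi> j \<omega>)) \<partial>M)"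
        by (rule Bochner_Integration.integral_sum) (intro Bochner_Integration.integrable_sum ii)
      also have "\<dots> = (\<Sum>i=1..n. \<Sum>j=1..n. \<integral>\<omega>. g (\<psi> i \<omega>) * g (\<psi> j \<omega>) \<partial>M)"
        by (intro sum.cong refl Bochner_Integration.integral_sum ii)
      finally show ?thesis .
    qed
    have "(\<integral>\<omega>. \<bar>(X n \<omega>)\<^sup>2\<bar> \<partial>M) = (1 / (real n)\<^sup>2) * (\<Sum>i=1..n. \<Sum>j=1..n. \<integral>\<omega>. g (\<psi> i \<omega>) * g (\<psi> j \<omega>) \<partial>M)"
      unfolding eq abs_power2[of "X n _", unfolded eq] by (simp only: integral_mult_right_zero swap)
    also have "(\<Sum>i=1..n. \<Sum>j=1..n. \<integral>\<omega>. g (\<psi> i \<omega>) * g (\<psi> j \<omega>) \<partial>M) = (\<Sum>i=1..n. \<Sum>j=1..n. if j =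
        i then (\<integral>x. (g x)\<^sup>2 \<partial>P\<^sub>\<psi>) else 0)"
    proof (intro sum.cong refl)
      fix i j assume ij: "i \<in> {1..n}" "j \<in> {1..n}"
      show "(\<integral>\<omega>. g (\<psi> i \<omega>) * g (\<psi> j \<omega>) \<partial>M) = (if j = i then (\<integral>x. (g x)\<^sup>2 \<partial>P\<^sub>\<psi>) else 0)"
        using off[of i j] ij integral_\<psi>(1)[of "\<lambda>x. (g x)\<^sup>2" i] by (auto simp: power2_eq_square)
    qed
    also have "\<dots> = real n * (\<integral>x. (g x)\<^sup>2 \<partial>P\<^sub>\<psi>)" by simp
    also have "(1 / (real n)\<^sup>2) * \<dots> = (\<integral>x. (g x)\<^sup>2 \<partial>P\<^sub>\<psi>) / real n" using n by (simp add: power2_eq_square)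
    also have "\<dots> \<le> (K + \<bar>\<mu>\<bar>)\<^sup>2 / real n" by (intro divide_right_mono gle) simp
    finally have "(\<integral>\<omega>. \<bar>(X n \<omega>)\<^sup>2\<bar> \<partial>M) \<le> (K + \<bar>\<mu>\<bar>)\<^sup>2 / real n" .
    moreover have "integrable M (\<lambda>\<omega>. (X n \<omega>)\<^sup>2)"
      unfolding eq by (intro integrable_mult_right Bochner_Integration.integrable_sum ii)
    ultimately show ?thesis by simp
  qed
  have "vanishes M (\<lambda>n \<omega>. (X n \<omega>)\<^sup>2)"
  proof (rule vanishes_L1)
    show "(\<lambda>\<omega>. (X n \<omega>)\<^sup>2) \<in> borel_measurable M" for n using XM by measurable
    show "\<forall>\<^sub>F n in sequentially. integrable M (\<lambda>\<omega>. (X n \<omega>)\<^sup>2) \<and> (\<integral>\<omega>. \<bar>(X n \<omega>)\<^sup>2\<bar> \<partial>M) \<le> (K + \<bar>\<mu>\<bar>)\<^sup>2 / real n"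
      using X2 by (rule eventually_sequentiallyI[of 1])
    show "(\<lambda>n. (K + \<bar>\<mu>\<bar>)\<^sup>2 / real n) \<longlonglongrightarrow> 0" by (rule lim_const_over_n)
  qed
  then have "vanishes M X" using vanishes_power2_iff[of X] XM by simp
  then show ?thesis
  proof (rule vanishes_mono[rotated])
    show "(\<lambda>\<omega>. (1 / real n) * (\<Sum>i=1..n. f (\<psi> i \<omega>)) - (\<integral>x. f x \<partial>P\<^sub>\<psi>)) \<in> borel_measurable M" for n by measurable
    show "\<forall>\<^sub>F n in sequentially. AE \<omega> in M. \<bar>(1 / real n) * (\<Sum>i=1..n. f (\<psi> i \<omega>)) - (\<integral>x. f x \<partial>P\<^sub>\<psi>)\<bar> \<le> \<bar>X n \<omega>\<bar>"
      using eventually_ge_at_top[of 1]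
      by eventually_elim (auto simp: X_def g_def \<mu>_def sum_subtractf right_diff_distrib)
  qed
qed

section \<open>Consistency of the propensity\<close>

text \<open>The covariate of a unit is independent of \<xi>, so its joint law with the external data
  is a product and Fubini applies. This is what turns an error averaged over the population into one
  evaluated at sample points.\<close>

lemma nn_integral_external:
  fixes f :: "'a \<times> (real^'d) \<Rightarrow> ennreal"
  assumes i: "i \<in> {1..n}" and f[measurable]: "f \<in> borel_measurable (sigma_of M (\<xi> n) (NX n) \<Otimes>\<^sub>M borel)"
  shows "(\<integral>\<^sup>+\<omega>. f (\<omega>, \<psi> i \<omega>) \<partial>M) = (\<integral>\<^sup>+\<omega>. (\<integral>\<^sup>+x. f (\<omega>, x) \<partial>P\<^sub>\<psi>) \<partial>M)"
proof -
  have i1: "i \<ge> 1" using i by simp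
  define N where "N = sigma_of M (\<xi> n) (NX n)"
  have subN: "subalgebra M N" unfolding N_def by (rule sub_units)
  have idM[measurable]: "(\<lambda>\<omega>. \<omega>) \<in> M \<rightarrow>\<^sub>M N" using subN by (intro measurableI) (auto simp: subalgebra_def)
  note \<psi>M[measurable] = components_M(1)[OF i1]
  have fN[measurable]: "f \<in> borel_measurable (N \<Otimes>\<^sub>M borel)" using f unfolding N_def .
  have ind: "indep_set (sets (sigma_of M (W i) borel)) (sets (rest n i))"
    unfolding sets_rest by (rule indep_set_unit_rest[OF W_indep indep i])
  interpret N: prob_space "distr M N (\<lambda>\<omega>. \<omega>)" by (rule prob_space_distr[OF idM])
  \<comment> \<open>The estimates take \<omega> itself as argument and are measurable in it through
    \<xi>. The random element paired with the covariate is therefore the identity, regarded as a map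
    into the space equipped with the sigma-algebra \<open>N\<close> of \<xi>.\<close>
  have prod: "P\<^sub>\<psi> \<Otimes>\<^sub>M distr M N (\<lambda>\<omega>. \<omega>) = distr M (borel \<Otimes>\<^sub>M N) (\<lambda>\<omega>. (\<psi> i \<omega>, \<omega>))"
  proof (rule pair_measure_eqI)
    show "sigma_finite_measure P\<^sub>\<psi>" "sigma_finite_measure (distr M N (\<lambda>\<omega>. \<omega>))" ..
    show "sets (P\<^sub>\<psi> \<Otimes>\<^sub>M distr M N (\<lambda>\<omega>. \<omega>)) = sets (distr M (borel \<Otimes>\<^sub>M N) (\<lambda>\<omega>. (\<psi> i \<omega>, \<omega>)))"
      by (simp cong: sets_pair_measure_cong)
    fix A B assume "A \<in> sets P\<^sub>\<psi>" "B \<in> sets (distr M N (\<lambda>\<omega>. \<omega>))"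
    then have A[measurable]: "A \<in> sets borel" and B[measurable]: "B \<in> sets N" by auto
    have "\<psi> i \<in> sigma_of M (W i) borel \<rightarrow>\<^sub>M borel" by (intro measurable_components measurable_sigma_of W_M i1)
    from measurable_sets[OF this A] have A': "\<psi> i -` A \<inter> space M \<in> sets (sigma_of M (W i) borel)" by simp
    have B': "B \<in> sets (rest n i)" using sub_rest_units(3) B by (auto simp: subalgebra_def N_def)
    have BM: "B \<in> sets M" "B \<subseteq> space M" using subN B sets.sets_into_space[OF B] by (auto simp: subalgebra_def)
    have "emeasure P\<^sub>\<psi> A * emeasure (distr M N (\<lambda>\<omega>. \<omega>)) B = ennreal (prob (\<psi> i -` A \<inter> space M) * prob B)"
      unfolding distr_\<psi>[OF i1, symmetric]
      using BM by (simp add: emeasure_distr emeasure_eq_measure ennreal_mult' Int_absorb2)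
    also have "\<dots> = ennreal (prob ((\<psi> i -` A \<inter> space M) \<inter> B))"
      using indep_setD[OF ind A' B'] by simp
    also have "(\<psi> i -` A \<inter> space M) \<inter> B = (\<lambda>\<omega>. (\<psi> i \<omega>, \<omega>)) -` (A \<times> B) \<inter> space M" using BM by auto
    also have "ennreal (prob \<dots>) = emeasure (distr M (borel \<Otimes>\<^sub>M N) (\<lambda>\<omega>. (\<psi> i \<omega>, \<omega>))) (A \<times> B)"
      by (subst emeasure_distr) (auto simp: emeasure_eq_measure)
    finally show "emeasure P\<^sub>\<psi> A * emeasure (distr M N (\<lambda>\<omega>. \<omega>)) B =
      emeasure (distr M (borel \<Otimes>\<^sub>M N) (\<lambda>\<omega>. (\<psi> i \<omega>, \<omega>))) (A \<times> B)" .
  qed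
  interpret PN: pair_sigma_finite P\<^sub>\<psi> "distr M N (\<lambda>\<omega>. \<omega>)" ..
  have g[measurable]: "(\<lambda>z. f (snd z, fst z)) \<in> borel_measurable (borel \<Otimes>\<^sub>M N)"
    by (rule measurable_compose[OF _ fN]) measurable
  have gP: "(\<lambda>z. f (snd z, fst z)) \<in> borel_measurable (P\<^sub>\<psi> \<Otimes>\<^sub>M distr M N (\<lambda>\<omega>. \<omega>))"
    using g by (simp cong: measurable_cong_sets sets_pair_measure_cong)
  have meas: "(\<lambda>\<omega>. \<integral>\<^sup>+x. f (\<omega>, x) \<partial>P\<^sub>\<psi>) \<in> borel_measurable (sigma_of M (\<xi> n) (NX n))"
    using f by (intro P.borel_measurable_nn_integral) (simp cong: measurable_cong_sets sets_pair_measure_cong)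
  have "(\<integral>\<^sup>+\<omega>. f (\<omega>, \<psi> i \<omega>) \<partial>M) = (\<integral>\<^sup>+z. f (snd z, fst z) \<partial>distr M (borel \<Otimes>\<^sub>M N) (\<lambda>\<omega>. (\<psi> i \<omega>, \<omega>)))"
    by (subst nn_integral_distr) auto
  also have "\<dots> = (\<integral>\<^sup>+z. f (snd z, fst z) \<partial>(P\<^sub>\<psi> \<Otimes>\<^sub>M distr M N (\<lambda>\<omega>. \<omega>)))" unfolding prod ..
  also have "\<dots> = (\<integral>\<^sup>+\<omega>. (\<integral>\<^sup>+x. f (\<omega>, x) \<partial>P\<^sub>\<psi>) \<partial>distr M N (\<lambda>\<omega>. \<omega>))"
    using PN.nn_integral_snd[OF gP[unfolded case_prod_beta[symmetric]]] by simp
  also have "\<dots> = (\<integral>\<^sup>+\<omega>. (\<integral>\<^sup>+x. f (\<omega>, x) \<partial>P\<^sub>\<psi>) \<partial>M)"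
    by (subst nn_integral_distr[OF idM]) (use meas in \<open>simp_all add: N_def\<close>)
  finally show "(\<integral>\<^sup>+\<omega>. f (\<omega>, \<psi> i \<omega>) \<partial>M) = (\<integral>\<^sup>+\<omega>. (\<integral>\<^sup>+x. f (\<omega>, x) \<partial>P\<^sub>\<psi>) \<partial>M)" .
qed

lemma \<sigma>2_hat_M:
  assumes d: "d \<in> {0, 1}" and i: "i \<ge> 1"
  shows "(\<lambda>\<omega>. \<sigma>2_hat n \<omega> d (\<psi> i \<omega>)) \<in> borel_measurable M"
proof -
  have "(\<lambda>\<omega>. \<omega>) \<in> M \<rightarrow>\<^sub>M sigma_of M (\<xi> n) (NX n)" using sub_units(4) by (intro measurableI) (auto simp: subalgebra_def)
  then have "(\<lambda>\<omega>. (\<omega>, \<psi> i \<omega>)) \<in> M \<rightarrow>\<^sub>M sigma_of M (\<xi> n) (NX n) \<Otimes>\<^sub>M borel"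
    by (rule measurable_Pair) (rule components_M(1)[OF i])
  from measurable_compose[OF this \<sigma>2_hat[OF d]] show ?thesis by simp
qed

text \<open>Given \<xi>, each summand has the population error \<Delta> n as its mean. That error is
  only small in probability, so its mean may be large; the sum is restricted to \<Delta> n \<le> e
  first.\<close>

lemma \<sigma>2_hat_avg_vanishes:
  assumes d: "d \<in> {0, 1}"
  shows "vanishes M (\<lambda>n \<omega>. (1 / real n) * (\<Sum>i=1..n. (\<sigma>2_hat n \<omega> d (\<psi> i \<omega>) - \<sigma>2 d (\<psi> i \<omega>))\<^sup>2))"
    (is "vanishes M ?X")
proof (rule vanishes_approx)
  note [measurable] = \<sigma>2_borel[OF d]
  have hM[measurable]: "(\<lambda>\<omega>. (\<sigma>2_hat n \<omega> d (\<psi> i \<omega>) - \<sigma>2 d (\<psi> i \<omega>))\<^sup>2) \<in> borel_measurable M" if "i \<ge> 1" for n i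
    using \<sigma>2_hat_M[OF d that] components_M(1)[OF that] by measurable
  show XM: "?X n \<in> borel_measurable M" for n
      by (intro borel_measurable_times borel_measurable_const borel_measurable_sum hM) auto
  define F where "F n z = ennreal ((\<sigma>2_hat n (fst z) d (snd z) - \<sigma>2 d (snd z))\<^sup>2)" for n z
  have F[measurable]: "F n \<in> borel_measurable (sigma_of M (\<xi> n) (NX n) \<Otimes>\<^sub>M borel)" for n
    using \<sigma>2_hat[OF d, of n] unfolding F_def[abs_def] case_prod_beta by measurable
  define \<Delta> where "\<Delta> n \<omega> = (\<integral>\<^sup>+x. F n (\<omega>, x) \<partial>P\<^sub>\<psi>)" for n \<omega>
  have \<Delta>op: "op1 M \<Delta>" using \<sigma>2_hat_consistent[OF d] by (simp add: \<Delta>_def[abs_def] F_def)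
  have \<Delta>M[measurable]: "\<Delta> n \<in> borel_measurable M" for n using \<Delta>op by (simp add: op1_def)
  have \<Delta>N: "\<Delta> n \<in> borel_measurable (sigma_of M (\<xi> n) (NX n))" for n
    unfolding \<Delta>_def[abs_def] using P.borel_measurable_nn_integral[of "\<lambda>\<omega> x. F n (\<omega>, x)" "sigma_of M (\<xi> n) (NX n)"] F[of n]
    by (simp cong: measurable_cong_sets sets_pair_measure_cong add: case_prod_beta)
  fix e :: real assume e: "e > 0"
  \<comment> \<open>This event belongs to the sigma-algebra of \<xi>, so its indicator is constant
    when the covariate is integrated out.\<close>
  define S where "S n = {\<omega> \<in> space M. \<Delta> n \<omega> \<le> ennreal e}" for n
  have S[measurable]: "S n \<in> sets M" for n unfolding S_def by measurable
  have SN: "S n \<in> sets (sigma_of M (\<xi> n) (NX n))" for n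
  proof -
    have "{\<omega> \<in> space (sigma_of M (\<xi> n) (NX n)). \<Delta> n \<omega> \<le> ennreal e} \<in> sets (sigma_of M (\<xi> n) (NX n))"
      using \<Delta>N by measurable
    then show ?thesis by (simp add: S_def)
  qed
  have X0: "0 \<le> ?X n \<omega>" for n \<omega> by (intro mult_nonneg_nonneg sum_nonneg) auto
  define U where "U n \<omega> = ?X n \<omega> * indicator (space M - S n) \<omega>" for n \<omega>
  define V where "V n \<omega> = ?X n \<omega> * indicator (S n) \<omega>" for n \<omega>
  have "vanishes M U" unfolding vanishes_def
  proof (intro conjI allI impI)
    show UM[measurable]: "U n \<in> borel_measurable M" for n unfolding U_def using XM[of n] by measurable
    fix \<epsilon> :: real assume \<epsilon>: "\<epsilon> > 0"
    have "prob {\<omega> \<in> space M. \<epsilon> < \<bar>U n \<omega>\<bar>} \<le> prob {\<omega> \<in> space M. ennreal e < \<Delta> n \<omega>}" for n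
      using \<epsilon> by (intro finite_measure_mono) (auto simp: U_def S_def indicator_def not_le split: if_splits)
    moreover have "(\<lambda>n. prob {\<omega> \<in> space M. ennreal e < \<Delta> n \<omega>}) \<longlonglongrightarrow> 0" using \<Delta>op e by (simp add: op1_def)
    ultimately show "(\<lambda>n. prob {\<omega> \<in> space M. \<epsilon> < \<bar>U n \<omega>\<bar>}) \<longlonglongrightarrow> 0"
      using Lim_null_comparison[of "\<lambda>n. prob {\<omega> \<in> space M. \<epsilon> < \<bar>U n \<omega>\<bar>}" "\<lambda>n. prob {\<omega> \<in> space M. ennreal e <
          \<Delta> n \<omega>}" sequentially] by simp
  qed
  moreover have "integrable M (V n) \<and> (\<integral>\<omega>. \<bar>V n \<omega>\<bar> \<partial>M) \<le> e" if n: "n \<ge> 1" for n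
  proof -
    have VM[measurable]: "V n \<in> borel_measurable M" unfolding V_def using XM[of n] by measurable
    have each: "(\<integral>\<^sup>+\<omega>. F n (\<omega>, \<psi> i \<omega>) * indicator (S n) \<omega> \<partial>M) \<le> ennreal e" if i: "i \<in> {1..n}" for i
    proof -
      have "(\<integral>\<^sup>+\<omega>. F n (\<omega>, \<psi> i \<omega>) * indicator (S n) \<omega> \<partial>M) = (\<integral>\<^sup>+\<omega>. (\<integral>\<^sup>+x. F n (\<omega>, x) * indicator (S n) \<omega> \<partial>P\<^sub>\<psi>) \<partial>M)"
        using nn_integral_external[OF i, of "\<lambda>z. F n z * indicator (S n) (fst z)"] SN F[of n] by simp
      also have "\<dots> = (\<integral>\<^sup>+\<omega>. \<Delta> n \<omega> * indicator (S n) \<omega> \<partial>M)"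
      proof (rule nn_integral_cong)
        fix \<omega> assume "\<omega> \<in> space M"
        then have "\<omega> \<in> space (sigma_of M (\<xi> n) (NX n))" by simp
        then have "(\<lambda>x. F n (\<omega>, x)) \<in> borel_measurable P\<^sub>\<psi>"
          using measurable_Pair2[OF F] by (simp cong: measurable_cong_sets)
        then show "(\<integral>\<^sup>+x. F n (\<omega>, x) * indicator (S n) \<omega> \<partial>P\<^sub>\<psi>) = \<Delta> n \<omega> * indicator (S n) \<omega>"
          unfolding \<Delta>_def by (rule nn_integral_multc)
      qed
      also have "\<dots> \<le> (\<integral>\<^sup>+\<omega>. ennreal e \<partial>M)"
        by (intro nn_integral_mono) (auto simp: S_def indicator_def)
      finally show ?thesis by (simp add: emeasure_space_1)
    qed
    have "(\<integral>\<^sup>+\<omega>. ennreal (V n \<omega>) \<partial>M) = (\<integral>\<^sup>+\<omega>. ennreal (1 / real n) * (\<Sum>i=1..n. F n (\<omega>, \<psi> i \<omega>) * indicator (S n) \<omega>) \<partial>M)"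
    proof (rule nn_integral_cong)
      fix \<omega>
      have "(\<Sum>i=1..n. F n (\<omega>, \<psi> i \<omega>) * indicator (S n) \<omega>) = ennreal ((\<Sum>i=1..n. (\<sigma>2_hat n \<omega> d (\<psi> i \<omega>) - \<sigma>2 d (\<psi> i \<omega>))\<^sup>2) *
          indicator (S n) \<omega>)"
        by (auto simp: F_def indicator_def sum_ennreal)
      then show "ennreal (V n \<omega>) = ennreal (1 / real n) * (\<Sum>i=1..n. F n (\<omega>, \<psi> i \<omega>) * indicator (S n) \<omega>)"
        by (simp only: V_def mult.assoc) (rule ennreal_mult'; simp)
    qed
    also have "\<dots> = ennreal (1 / real n) * (\<Sum>i=1..n. \<integral>\<^sup>+\<omega>. F n (\<omega>, \<psi> i \<omega>) * indicator (S n) \<omega> \<partial>M)"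
    proof -
      have Fm: "(\<lambda>\<omega>. F n (\<omega>, \<psi> i \<omega>) * indicator (S n) \<omega>) \<in> borel_measurable M" if "i \<in> {1..n}" for i
      proof -
        have [measurable]: "(\<lambda>\<omega>. (\<sigma>2_hat n \<omega> d (\<psi> i \<omega>) - \<sigma>2 d (\<psi> i \<omega>))\<^sup>2) \<in> borel_measurable M"
          using hM[of i n] that by simp
        have "(\<lambda>\<omega>. ennreal ((\<sigma>2_hat n \<omega> d (\<psi> i \<omega>) - \<sigma>2 d (\<psi> i \<omega>))\<^sup>2 * indicator (S n) \<omega>)) \<in> borel_measurable M"
          by measurable
        also have "(\<lambda>\<omega>. ennreal ((\<sigma>2_hat n \<omega> d (\<psi> i \<omega>) - \<sigma>2 d (\<psi> i \<omega>))\<^sup>2 * indicator (S n) \<omega>)) =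
            (\<lambda>\<omega>. F n (\<omega>, \<psi> i \<omega>) * indicator (S n) \<omega>)"
          by (auto simp: F_def indicator_def fun_eq_iff)
        finally show ?thesis .
      qed
      show ?thesis
        by (rule trans[OF nn_integral_cmult[OF borel_measurable_sum[OF Fm]] arg_cong[where f="(*) _",
            OF nn_integral_sum[OF Fm]]])
    qed
    also have "\<dots> \<le> ennreal (1 / real n) * (\<Sum>i=1..n. ennreal e)" by (intro mult_left_mono sum_mono each) auto
    also have "\<dots> = ennreal e" using n e by (simp add: ennreal_of_nat_eq_real_of_nat ennreal_mult'[symmetric])
    finally have le: "(\<integral>\<^sup>+\<omega>. ennreal (V n \<omega>) \<partial>M) \<le> ennreal e" .
    have V0: "0 \<le> V n \<omega>" for \<omega> unfolding V_def by (intro mult_nonneg_nonneg sum_nonneg) auto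
    have Vi: "integrable M (V n)"
      by (rule integrableI_nonneg) (use le V0 in \<open>auto intro: order.strict_trans1\<close>)
    have "ennreal (\<integral>\<omega>. V n \<omega> \<partial>M) \<le> ennreal e" using nn_integral_eq_integral[OF Vi] V0 le by simp
    then have "(\<integral>\<omega>. V n \<omega> \<partial>M) \<le> e" using e by (subst (asm) ennreal_le_iff) auto
    then show ?thesis using Vi V0 by simp
  qed
  moreover have "AE \<omega> in M. \<bar>?X n \<omega>\<bar> \<le> \<bar>U n \<omega>\<bar> + \<bar>V n \<omega>\<bar>" for n
    by (intro AE_I2) (auto simp: U_def V_def indicator_def)
  ultimately show "\<exists>U V. vanishes M U \<and> (\<forall>\<^sub>F n in sequentially. integrable M (V n) \<and> (\<integral>\<omega>. \<bar>V n \<omega>\<bar> \<partial>M) \<le> e \<and>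
      (AE \<omega> in M. \<bar>?X n \<omega>\<bar> \<le> \<bar>U n \<omega>\<bar> + \<bar>V n \<omega>\<bar>))"
    by (intro exI[of _ U] exI[of _ V] conjI eventually_sequentiallyI[of 1]) auto
qed

definition sh :: "nat \<Rightarrow> 'a \<Rightarrow> real^'d \<Rightarrow> real" where "sh n \<omega> = sigma_s p (\<sigma>2_hat n \<omega>)"

lemma sh_M: "i \<ge> 1 \<Longrightarrow> (\<lambda>\<omega>. sh n \<omega> (\<psi> i \<omega>)) \<in> borel_measurable M"
proof -
  assume i: "i \<ge> 1"
  have [measurable]: "(\<lambda>\<omega>. \<sigma>2_hat n \<omega> 0 (\<psi> i \<omega>)) \<in> borel_measurable M" "(\<lambda>\<omega>. \<sigma>2_hat n \<omega> 1 (\<psi> i \<omega>)) \<in> borel_measurable M"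
    using \<sigma>2_hat_M i by auto
  show ?thesis unfolding sh_def sigma_s_def by measurable
qed

lemma sh_avg_vanishes: "vanishes M (\<lambda>n \<omega>. (1 / real n) * (\<Sum>i=1..n. (sh n \<omega> (\<psi> i \<omega>) - ss (\<psi> i \<omega>))\<^sup>2))"
proof -
  obtain s0 where s0: "s0 > 0" "AE x in P\<^sub>\<psi>. s0 \<le> ss x \<and> 0 \<le> \<sigma>2 0 x \<and> 0 \<le> \<sigma>2 1 x" using ex_lower by blast
  define A where "A d n \<omega> = (1 / real n) * (\<Sum>i=1..n. (\<sigma>2_hat n \<omega> d (\<psi> i \<omega>) - \<sigma>2 d (\<psi> i \<omega>))\<^sup>2)" for d n \<omega>
  \<comment> \<open>The 2 comes from the square of a sum, p and 1 - p from the definition of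
    \<sigma>_s, and 1 / \<open>s0\<^sup>2\<close> from the difference of square roots with
    \<open>s0\<close> as lower bound of \<sigma>_s.\<close>
  define c0 c1 where "c0 = 2 / ((1 - p)\<^sup>2 * s0\<^sup>2)" and "c1 = 2 / (p\<^sup>2 * s0\<^sup>2)"
  show ?thesis
  proof (rule vanishes_mono)
    show "(\<lambda>\<omega>. (1 / real n) * (\<Sum>i=1..n. (sh n \<omega> (\<psi> i \<omega>) - ss (\<psi> i \<omega>))\<^sup>2)) \<in> borel_measurable M" for n
      by (intro borel_measurable_times borel_measurable_const borel_measurable_sum borel_measurable_power
          borel_measurable_diff
          sh_M measurable_compose[OF components_M(1) ss_borel]) auto
    show "vanishes M (\<lambda>n \<omega>. c1 * A 1 n \<omega> + c0 * A 0 n \<omega>)"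
      unfolding A_def by (intro vanishes_add vanishes_cmult \<sigma>2_hat_avg_vanishes) auto
    show "\<forall>\<^sub>F n in sequentially. AE \<omega> in M. \<bar>(1 / real n) * (\<Sum>i=1..n. (sh n \<omega> (\<psi> i \<omega>) - ss (\<psi> i \<omega>))\<^sup>2)\<bar> \<le> \<bar>c1 * A 1 n \<omega> +
        c0 * A 0 n \<omega>\<bar>"
    proof (rule always_eventually, rule allI)
      fix n
      show "AE \<omega> in M. \<bar>(1 / real n) * (\<Sum>i=1..n. (sh n \<omega> (\<psi> i \<omega>) - ss (\<psi> i \<omega>))\<^sup>2)\<bar> \<le> \<bar>c1 * A 1 n \<omega> + c0 * A 0 n \<omega>\<bar>"
        using AE_\<psi>[OF s0(2), of n] AE_\<psi>[OF ss_bounds, of n] AE_space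
      proof eventually_elim
        case (elim \<omega>)
        have each: "(sh n \<omega> (\<psi> i \<omega>) - ss (\<psi> i \<omega>))\<^sup>2 \<le> c1 * (\<sigma>2_hat n \<omega> 1 (\<psi> i \<omega>) - \<sigma>2 1 (\<psi> i \<omega>))\<^sup>2 +
            c0 * (\<sigma>2_hat n \<omega> 0 (\<psi> i \<omega>) - \<sigma>2 0 (\<psi> i \<omega>))\<^sup>2" if i: "i \<in> {1..n}" for i
        proof -
          define x where "x = \<psi> i \<omega>"
          define u v where "u = \<sigma>2_hat n \<omega> 1 x / p + \<sigma>2_hat n \<omega> 0 x / (1 - p)" and "v = \<sigma>2 1 x / p + \<sigma>2 0 x / (1 - p)"
          have u0: "u \<ge> 0" using \<sigma>2_hat_nonneg[of 0 \<omega>] \<sigma>2_hat_nonneg[of 1 \<omega>] elim p(2,3)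
              by (auto simp: u_def intro!: add_nonneg_nonneg)
          have sv: "(ss x)\<^sup>2 = v" "s0 \<le> ss x" using elim(1,2) i by (auto simp: v_def x_def)
          have s0v: "s0\<^sup>2 \<le> v" using sv s0(1) power_mono[of s0 "ss x" 2] by simp
          have v0: "v > 0" using s0v s0(1) by (smt (verit) zero_less_power)
          have "(sh n \<omega> x - ss x)\<^sup>2 = (sqrt u - sqrt v)\<^sup>2" by (simp add: sh_def ss_def sigma_s_def u_def v_def)
          also have "\<dots> \<le> (u - v)\<^sup>2 / v" by (rule sqrt_diff_square_le[OF u0 v0])
          also have "\<dots> \<le> (u - v)\<^sup>2 / s0\<^sup>2" using s0v s0(1) v0 by (intro divide_left_mono) auto
          also have "\<dots> \<le> (2 * ((\<sigma>2_hat n \<omega> 1 x - \<sigma>2 1 x) / p)\<^sup>2 + 2 * ((\<sigma>2_hat n \<omega> 0 x - \<sigma>2 0 x) / (1 - p))\<^sup>2) / s0\<^sup>2"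
          proof (rule divide_right_mono)
            have "u - v = (\<sigma>2_hat n \<omega> 1 x - \<sigma>2 1 x) / p + (\<sigma>2_hat n \<omega> 0 x - \<sigma>2 0 x) / (1 - p)"
              by (simp add: u_def v_def diff_divide_distrib)
            then show "(u - v)\<^sup>2 \<le> 2 * ((\<sigma>2_hat n \<omega> 1 x - \<sigma>2 1 x) / p)\<^sup>2 + 2 * ((\<sigma>2_hat n \<omega> 0 x - \<sigma>2 0 x) / (1 - p))\<^sup>2"
              using square_sum_le by simp
          qed simp
          also have "\<dots> = c1 * (\<sigma>2_hat n \<omega> 1 x - \<sigma>2 1 x)\<^sup>2 + c0 * (\<sigma>2_hat n \<omega> 0 x - \<sigma>2 0 x)\<^sup>2"
            by (simp add: c0_def c1_def power_divide add_divide_distrib)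
          finally show ?thesis by (simp add: x_def)
        qed
        have "(1 / real n) * (\<Sum>i=1..n. (sh n \<omega> (\<psi> i \<omega>) - ss (\<psi> i \<omega>))\<^sup>2) \<le> (1 / real n) * (\<Sum>i=1..n.
            c1 * (\<sigma>2_hat n \<omega> 1 (\<psi> i \<omega>) - \<sigma>2 1 (\<psi> i \<omega>))\<^sup>2 +
            c0 * (\<sigma>2_hat n \<omega> 0 (\<psi> i \<omega>) - \<sigma>2 0 (\<psi> i \<omega>))\<^sup>2)"
          by (intro mult_left_mono sum_mono each) auto
        also have "\<dots> = c1 * A 1 n \<omega> + c0 * A 0 n \<omega>"
          by (simp add: A_def sum.distrib sum_distrib_left[symmetric] distrib_left)
        finally have le: "(1 / real n) * (\<Sum>i=1..n. (sh n \<omega> (\<psi> i \<omega>) - ss (\<psi> i \<omega>))\<^sup>2) \<le> c1 * A 1 n \<omega> + c0 * A 0 n \<omega>" .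
        have "0 \<le> (1 / real n) * (\<Sum>i=1..n. (sh n \<omega> (\<psi> i \<omega>) - ss (\<psi> i \<omega>))\<^sup>2)" by (intro mult_nonneg_nonneg sum_nonneg) auto
        with le show ?case by linarith
      qed
    qed
  qed
qed

definition Sh :: "nat \<Rightarrow> 'a \<Rightarrow> real" where
  "Sh n \<omega> = (1 / real n) * (\<Sum>i=1..n. sh n \<omega> (\<psi> i \<omega>) * sqrt (C (\<psi> i \<omega>)))"

lemma C_M: "i \<ge> 1 \<Longrightarrow> (\<lambda>\<omega>. C (\<psi> i \<omega>)) \<in> borel_measurable M"
  by (rule measurable_compose[OF components_M(1) C])

lemma Sh_M: "Sh n \<in> borel_measurable M"
  unfolding Sh_def by (intro borel_measurable_times borel_measurable_const borel_measurable_sum sh_M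
     measurable_compose[OF C_M borel_measurable_sqrt]) auto

lemma ss_M: "i \<ge> 1 \<Longrightarrow> (\<lambda>\<omega>. ss (\<psi> i \<omega>)) \<in> borel_measurable M"
  by (rule measurable_compose[OF components_M(1) ss_borel])

lemma qs_M: "i \<ge> 1 \<Longrightarrow> (\<lambda>\<omega>. qs (\<psi> i \<omega>)) \<in> borel_measurable M"
  by (rule measurable_compose[OF components_M(1) qs_borel])

lemma qn_M: "i \<ge> 1 \<Longrightarrow> (\<lambda>\<omega>. q\<^sub>n n \<omega> (\<psi> i \<omega>)) \<in> borel_measurable M"
  by (rule q_measurable[OF sub_M_XP components_M(1)])

text \<open>Two errors: replacing the estimated by the true \<sigma>_s, bounded by Cauchy-Schwarz
  through the mean-square error, and the fluctuation of the average of the true \<sigma>_s times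
  sqrt C, covered by the weak law.\<close>

lemma Sh_consistent: "vanishes M (\<lambda>n \<omega>. Sh n \<omega> - \<kappa>)"
proof -
  define E where "E n \<omega> = (1 / real n) * (\<Sum>i=1..n. (sh n \<omega> (\<psi> i \<omega>) - ss (\<psi> i \<omega>)) * sqrt (C (\<psi> i \<omega>)))" for n \<omega>
  have EM: "E n \<in> borel_measurable M" for n
    unfolding E_def by (intro borel_measurable_times borel_measurable_const borel_measurable_sum
        borel_measurable_diff sh_M ss_M
     measurable_compose[OF C_M borel_measurable_sqrt]) auto
  have "vanishes M (\<lambda>n \<omega>. (E n \<omega>)\<^sup>2)"
  proof (rule vanishes_mono)
    show "(\<lambda>\<omega>. (E n \<omega>)\<^sup>2) \<in> borel_measurable M" for n using EM by measurable
    show "vanishes M (\<lambda>n \<omega>. C\<^sub>u * ((1 / real n) * (\<Sum>i=1..n. (sh n \<omega> (\<psi> i \<omega>) - ss (\<psi> i \<omega>))\<^sup>2)))"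
      by (intro vanishes_cmult sh_avg_vanishes)
    show "\<forall>\<^sub>F n in sequentially. AE \<omega> in M. \<bar>(E n \<omega>)\<^sup>2\<bar> \<le>
        \<bar>C\<^sub>u * ((1 / real n) * (\<Sum>i=1..n. (sh n \<omega> (\<psi> i \<omega>) - ss (\<psi> i \<omega>))\<^sup>2))\<bar>"
    proof (rule always_eventually, rule allI)
      fix n
      show "AE \<omega> in M. \<bar>(E n \<omega>)\<^sup>2\<bar> \<le> \<bar>C\<^sub>u * ((1 / real n) * (\<Sum>i=1..n. (sh n \<omega> (\<psi> i \<omega>) - ss (\<psi> i \<omega>))\<^sup>2))\<bar>"
        using AE_\<psi>[OF C_bounds(2), of n]
      proof eventually_elim
        case (elim \<omega>)
        have "(E n \<omega>)\<^sup>2 \<le> (1 / real n) * (\<Sum>i=1..n. ((sh n \<omega> (\<psi> i \<omega>) - ss (\<psi> i \<omega>)) * sqrt (C (\<psi> i \<omega>)))\<^sup>2)"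
          unfolding E_def by (rule mean_square_le)
        also have "\<dots> \<le> (1 / real n) * (\<Sum>i=1..n. C\<^sub>u * (sh n \<omega> (\<psi> i \<omega>) - ss (\<psi> i \<omega>))\<^sup>2)"
        proof (intro mult_left_mono sum_mono)
          fix i assume i: "i \<in> {1..n}"
          have "C\<^sub>l \<le> C (\<psi> i \<omega>) \<and> C (\<psi> i \<omega>) \<le> C\<^sub>u" by (rule bspec[OF elim i])
          then have "(sqrt (C (\<psi> i \<omega>)))\<^sup>2 \<le> C\<^sub>u" using C_bounds(1) by simp
          then show "((sh n \<omega> (\<psi> i \<omega>) - ss (\<psi> i \<omega>)) * sqrt (C (\<psi> i \<omega>)))\<^sup>2 \<le> C\<^sub>u * (sh n \<omega> (\<psi> i \<omega>) - ss (\<psi> i \<omega>))\<^sup>2"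
            using mult_right_mono[of _ C\<^sub>u "(sh n \<omega> (\<psi> i \<omega>) - ss (\<psi> i \<omega>))\<^sup>2"]
            by (simp only: power_mult_distrib mult.commute zero_le_power2)
        qed simp
        also have "\<dots> = C\<^sub>u * ((1 / real n) * (\<Sum>i=1..n. (sh n \<omega> (\<psi> i \<omega>) - ss (\<psi> i \<omega>))\<^sup>2))"
          by (simp add: sum_distrib_left[symmetric])
        finally show ?case unfolding abs_power2 by (rule order.trans[OF _ abs_ge_self])
      qed
    qed
  qed
  then have "vanishes M E" using vanishes_power2_iff[of E] EM by simp
  moreover have "vanishes M (\<lambda>n \<omega>. (1 / real n) * (\<Sum>i=1..n. ss (\<psi> i \<omega>) * sqrt (C (\<psi> i \<omega>))) - \<kappa>)"
    unfolding \<kappa>_def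
  proof (rule weak_law[where K="S\<^sub>m * sqrt C\<^sub>u"])
    show "(\<lambda>x. ss x * sqrt (C x)) \<in> borel_measurable borel" using C by measurable
    show "AE x in P\<^sub>\<psi>. \<bar>ss x * sqrt (C x)\<bar> \<le> S\<^sub>m * sqrt C\<^sub>u"
      using ss_bounds C_bounds(2)
    proof eventually_elim
      case (elim x)
      then show ?case using C_bounds(1) unfolding abs_mult by (intro mult_mono) auto
    qed
  qed
  ultimately have "vanishes M (\<lambda>n \<omega>. E n \<omega> + ((1 / real n) * (\<Sum>i=1..n. ss (\<psi> i \<omega>) * sqrt (C (\<psi> i \<omega>))) - \<kappa>))"
    by (rule vanishes_add)
  then show ?thesis
    by (simp add: E_def Sh_def left_diff_distrib sum_subtractf right_diff_distrib)
qed

text \<open>The denominator of the estimated propensity is random, so the comparison is made on the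
  event that it is within \<kappa> / 2 of \<kappa>, where it is at least \<kappa> / 2. There the
  error is bounded by the discretization error, the error of \<sigma>_s and that of the
  denominator.\<close>

lemma q_consistent: "vanishes M (\<lambda>n \<omega>. (1 / real n) * (\<Sum>i=1..n. (q\<^sub>n n \<omega> (\<psi> i \<omega>) - qs (\<psi> i \<omega>))\<^sup>2))"
proof (rule vanishes_on[OF _ Sh_consistent])
  define D1 where "D1 n \<omega> = (1 / real n) * (\<Sum>i=1..n. (q\<^sub>n n \<omega> (\<psi> i \<omega>)
              - q_hat n (\<lambda>j. \<psi> j \<omega>) B p C (\<sigma>2_hat n \<omega>) (\<psi> i \<omega>))\<^sup>2)" for n \<omega>
  define D2 where "D2 n \<omega> = (1 / real n) * (\<Sum>i=1..n. (sh n \<omega> (\<psi> i \<omega>) - ss (\<psi> i \<omega>))\<^sup>2)" for n \<omega>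
  \<comment> \<open>In both constants 4 = 2 * 2, the square of a sum having been split twice; the 2
    inside the square comes from \<open>Sh n \<omega>\<close> \<ge> \<kappa> / 2.\<close>
  define c1 where "c1 = 4 * (2 * B / (sqrt C\<^sub>l * \<kappa>))\<^sup>2"
  define c2 where "c2 = 4 * (2 / \<kappa>)\<^sup>2"
  show "(\<lambda>\<omega>. (1 / real n) * (\<Sum>i=1..n. (q\<^sub>n n \<omega> (\<psi> i \<omega>) - qs (\<psi> i \<omega>))\<^sup>2)) \<in> borel_measurable M" for n
    by (intro borel_measurable_times borel_measurable_const borel_measurable_sum borel_measurable_power borel_measurable_diff
        qn_M qs_M) auto
  have D1v: "vanishes M D1"
    unfolding D1_def by (rule op1_imp_vanishes[OF discretization]) (auto intro!: divide_nonneg_nonneg sum_nonneg)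
  show "vanishes M (\<lambda>n \<omega>. 2 * D1 n \<omega> + (c1 * D2 n \<omega> + c2 * (Sh n \<omega> - \<kappa>)\<^sup>2))"
  proof (intro vanishes_add vanishes_cmult D1v)
    show "vanishes M D2" unfolding D2_def by (rule sh_avg_vanishes)
    show "vanishes M (\<lambda>n \<omega>. (Sh n \<omega> - \<kappa>)\<^sup>2)"
      using Sh_consistent Sh_M by (subst vanishes_power2_iff) auto
  qed
  show "\<kappa> / 2 > 0" using \<kappa>_pos by simp
  show "\<forall>\<^sub>F n in sequentially. AE \<omega> in M. \<bar>Sh n \<omega> - \<kappa>\<bar> \<le> \<kappa> / 2 \<longrightarrow>
      \<bar>(1 / real n) * (\<Sum>i=1..n. (q\<^sub>n n \<omega> (\<psi> i \<omega>) - qs (\<psi> i \<omega>))\<^sup>2)\<bar> \<le> \<bar>2 * D1 n \<omega> + (c1 * D2 n \<omega> + c2 * (Sh n \<omega> - \<kappa>)\<^sup>2)\<bar>"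
    using eventually_ge_at_top[of 1]
  proof eventually_elim
    case (elim n)
    note n = this
    show ?case
      using AE_\<psi>[OF C_bounds(2), of n] AE_\<psi>[OF q_star_bounds[folded qs_def], of n]
    proof eventually_elim
      case (elim \<omega>)
      show ?case
      proof
        assume close: "\<bar>Sh n \<omega> - \<kappa>\<bar> \<le> \<kappa> / 2"
        then have S2: "Sh n \<omega> \<ge> \<kappa> / 2" by linarith
        have S0: "Sh n \<omega> > 0" using S2 \<kappa>_pos by linarith
        have each: "(q\<^sub>n n \<omega> (\<psi> i \<omega>) - qs (\<psi> i \<omega>))\<^sup>2 \<le> 2 * (q\<^sub>n n \<omega> (\<psi> i \<omega>)
              - q_hat n (\<lambda>j. \<psi> j \<omega>) B p C (\<sigma>2_hat n \<omega>) (\<psi> i \<omega>))\<^sup>2 +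
              (c1 * (sh n \<omega> (\<psi> i \<omega>) - ss (\<psi> i \<omega>))\<^sup>2 + c2 * (Sh n \<omega> - \<kappa>)\<^sup>2)" if i: "i \<in> {1..n}" for i
        proof -
          define x where "x = \<psi> i \<omega>"
          define qh where "qh = q_hat n (\<lambda>j. \<psi> j \<omega>) B p C (\<sigma>2_hat n \<omega>) x"
          have "C\<^sub>l \<le> C x \<and> C x \<le> C\<^sub>u" unfolding x_def by (rule bspec[OF elim(1) i])
          then have C0: "sqrt (C x) > 0" "sqrt C\<^sub>l \<le> sqrt (C x)" using C_bounds(1) by auto
          have Cl0: "sqrt C\<^sub>l > 0" using C_bounds(1) by simp
          have q01: "0 \<le> qs x" "qs x \<le> 1" using elim(2) i \<delta> by (auto simp: x_def dest!: bspec[of _ _ i])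
          have qh: "qh = B * (sh n \<omega> x / sqrt (C x)) / Sh n \<omega>"
            by (simp add: qh_def q_hat_def sh_def Sh_def)
          \<comment> \<open>Numerator and denominator are exchanged one after the other, so that the
            second error is multiplied by q*, which is at most 1.\<close>
          have "qh - qs x = B / (sqrt (C x) * Sh n \<omega>) * (sh n \<omega> x - ss x) + qs x * ((\<kappa> - Sh n \<omega>) / Sh n \<omega>)"
            unfolding qh qs_eq using C0 S0 \<kappa>_pos by (simp add: field_simps)
          then have "(qh - qs x)\<^sup>2 \<le> 2 * (B / (sqrt (C x) * Sh n \<omega>) * (sh n \<omega> x - ss x))\<^sup>2 +
              2 * (qs x * ((\<kappa> - Sh n \<omega>) / Sh n \<omega>))\<^sup>2"
            using square_sum_le by simp
          also have "(B / (sqrt (C x) * Sh n \<omega>) * (sh n \<omega> x - ss x))\<^sup>2 \<le> (2 * B / (sqrt C\<^sub>l * \<kappa>))\<^sup>2 * (sh n \<omega> x - ss x)\<^sup>2"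
            unfolding power_mult_distrib[of "B / (sqrt (C x) * Sh n \<omega>)"]
          proof (intro mult_right_mono power_mono)
            have "sqrt C\<^sub>l * (\<kappa> / 2) \<le> sqrt (C x) * Sh n \<omega>" using C0 Cl0 S2 \<kappa>_pos by (intro mult_mono) auto
            then have "B / (sqrt (C x) * Sh n \<omega>) \<le> B / (sqrt C\<^sub>l * (\<kappa> / 2))"
              using B Cl0 \<kappa>_pos C0 S0 by (intro divide_left_mono mult_pos_pos) auto
            then show "B / (sqrt (C x) * Sh n \<omega>) \<le> 2 * B / (sqrt C\<^sub>l * \<kappa>)" by (simp add: mult.commute)
          qed (use B C0 S0 in auto)
          also have "(qs x * ((\<kappa> - Sh n \<omega>) / Sh n \<omega>))\<^sup>2 \<le> 1 * ((2 / \<kappa>)\<^sup>2 * (Sh n \<omega> - \<kappa>)\<^sup>2)"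
            unfolding power_mult_distrib
          proof (intro mult_mono)
            show "(qs x)\<^sup>2 \<le> 1" using q01 by (simp add: power_le_one)
            have "((\<kappa> - Sh n \<omega>) / Sh n \<omega>)\<^sup>2 = (1 / Sh n \<omega>)\<^sup>2 * (Sh n \<omega> - \<kappa>)\<^sup>2"
              by (simp add: power_divide power2_commute)
            also have "\<dots> \<le> (2 / \<kappa>)\<^sup>2 * (Sh n \<omega> - \<kappa>)\<^sup>2"
              using S2 S0 \<kappa>_pos by (intro mult_right_mono power_mono) (auto simp: field_simps)
            finally show "((\<kappa> - Sh n \<omega>) / Sh n \<omega>)\<^sup>2 \<le> (2 / \<kappa>)\<^sup>2 * (Sh n \<omega> - \<kappa>)\<^sup>2" .
          qed auto
          finally have a: "(qh - qs x)\<^sup>2 \<le> 2 * ((2 * B / (sqrt C\<^sub>l * \<kappa>))\<^sup>2 * (sh n \<omega> x - ss x)\<^sup>2) +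
              2 * (1 * ((2 / \<kappa>)\<^sup>2 * (Sh n \<omega> - \<kappa>)\<^sup>2))" by simp
          have "(q\<^sub>n n \<omega> x - qs x)\<^sup>2 \<le> 2 * (q\<^sub>n n \<omega> x - qh)\<^sup>2 + 2 * (qh - qs x)\<^sup>2"
            using square_sum_le[of "q\<^sub>n n \<omega> x - qh" "qh - qs x"] by simp
          also have "2 * (qh - qs x)\<^sup>2 \<le> c1 * (sh n \<omega> x - ss x)\<^sup>2 + c2 * (Sh n \<omega> - \<kappa>)\<^sup>2"
            unfolding c1_def c2_def using a by (simp only: mult_1_left mult.assoc)
          finally show ?thesis by (simp add: x_def qh_def)
        qed
        have "(1 / real n) * (\<Sum>i=1..n. (q\<^sub>n n \<omega> (\<psi> i \<omega>) - qs (\<psi> i \<omega>))\<^sup>2) \<le> (1 / real n) * (\<Sum>i=1..n. 2 * (q\<^sub>n n \<omega> (\<psi> i \<omega>)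
              - q_hat n (\<lambda>j. \<psi> j \<omega>) B p C (\<sigma>2_hat n \<omega>) (\<psi> i \<omega>))\<^sup>2 +
              (c1 * (sh n \<omega> (\<psi> i \<omega>) - ss (\<psi> i \<omega>))\<^sup>2 + c2 * (Sh n \<omega> - \<kappa>)\<^sup>2))"
          by (intro mult_left_mono sum_mono each) auto
        also have "\<dots> = 2 * D1 n \<omega> + (c1 * D2 n \<omega> + c2 * (Sh n \<omega> - \<kappa>)\<^sup>2)"
          using n by (simp add: D1_def D2_def sum.distrib sum_distrib_left[symmetric] distrib_left)
        finally have le: "(1 / real n) * (\<Sum>i=1..n. (q\<^sub>n n \<omega> (\<psi> i \<omega>) - qs (\<psi> i \<omega>))\<^sup>2) \<le> 2 * D1 n \<omega> +
            (c1 * D2 n \<omega> + c2 * (Sh n \<omega> - \<kappa>)\<^sup>2)" .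
        have "0 \<le> (1 / real n) * (\<Sum>i=1..n. (q\<^sub>n n \<omega> (\<psi> i \<omega>) - qs (\<psi> i \<omega>))\<^sup>2)" by (intro mult_nonneg_nonneg sum_nonneg) auto
        with le show "\<bar>(1 / real n) * (\<Sum>i=1..n. (q\<^sub>n n \<omega> (\<psi> i \<omega>) - qs (\<psi> i \<omega>))\<^sup>2)\<bar> \<le> \<bar>2 * D1 n \<omega> +
            (c1 * D2 n \<omega> + c2 * (Sh n \<omega> - \<kappa>)\<^sup>2)\<bar>" by linarith
      qed
    qed
  qed
qed

section \<open>Replacing the propensity by its limit\<close>

text \<open>Clipping makes the bounds on the propensity hold everywhere instead of almost everywhere.\<close>

definition qt :: "nat \<Rightarrow> nat \<Rightarrow> 'a \<Rightarrow> real" where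
  "qt n i \<omega> = max \<delta> (min 1 (q\<^sub>n n \<omega> (\<psi> i \<omega>)))"

lemma qt_ge: "\<delta> \<le> qt n i \<omega>" and qt_pos: "0 < qt n i \<omega>"
  using \<delta> by (auto simp: qt_def)

lemma qt_eq: "AE \<omega> in M. \<forall>i\<in>{1..n}. qt n i \<omega> = q\<^sub>n n \<omega> (\<psi> i \<omega>) \<and> \<delta> \<le> q\<^sub>n n \<omega> (\<psi> i \<omega>) \<and> q\<^sub>n n \<omega> (\<psi> i \<omega>) \<le> 1"
  using q\<^sub>n_bounds[of n] by eventually_elim (auto simp: qt_def)

lemma qt_measurable: "subalgebra H (XP n) \<Longrightarrow> \<psi> i \<in> H \<rightarrow>\<^sub>M borel \<Longrightarrow> qt n i \<in> borel_measurable H"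
  unfolding qt_def[abs_def] by (intro borel_measurable_max borel_measurable_min borel_measurable_const q_measurable)

lemma qt_FT: "i \<in> {1..n} \<Longrightarrow> qt n i \<in> borel_measurable (FT n)"
  by (intro qt_measurable sub_FT_XP measurable_components(1) measurable_FT)

lemma qt_M: "i \<ge> 1 \<Longrightarrow> qt n i \<in> borel_measurable M"
  by (intro qt_measurable sub_M_XP components_M(1))

lemma \<psi>_FT: "i \<in> {1..n} \<Longrightarrow> f \<in> borel_measurable borel \<Longrightarrow> (\<lambda>\<omega>. f (\<psi> i \<omega>)) \<in> borel_measurable (FT n)"
  by (rule measurable_compose[OF measurable_components(1)[OF measurable_FT(1)]])

lemma \<psi>_M: "i \<ge> 1 \<Longrightarrow> f \<in> borel_measurable borel \<Longrightarrow> (\<lambda>\<omega>. f (\<psi> i \<omega>)) \<in> borel_measurable M"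
  by (rule measurable_compose[OF components_M(1)])

text \<open>The first bound is small when the propensities are close but needs a bounded multiplier;
  the second is crude and serves where the multiplier itself is small in mean square.\<close>

lemma inverse_diff_bounds:
  fixes u v :: real
  assumes "\<delta> \<le> u" "\<delta> \<le> v"
  shows "(1 / u - 1 / v)\<^sup>2 \<le> (u - v)\<^sup>2 / \<delta> ^ 4" "(1 / u - 1 / v)\<^sup>2 \<le> 1 / \<delta>\<^sup>2"
proof -
  have uv: "u > 0" "v > 0" using assms \<delta> by auto
  have "1 / u - 1 / v = (v - u) / (u * v)" using uv by (simp add: field_simps)
  then have "(1 / u - 1 / v)\<^sup>2 = (u - v)\<^sup>2 / (u * v)\<^sup>2" by (simp add: power_divide power2_commute)
  also have "\<dots> \<le> (u - v)\<^sup>2 / \<delta> ^ 4"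
  proof (rule divide_left_mono)
    have "\<delta> * \<delta> \<le> u * v" using assms \<delta> by (intro mult_mono) auto
    then have "(\<delta> * \<delta>)\<^sup>2 \<le> (u * v)\<^sup>2" using \<delta> by (intro power_mono) auto
    then show "\<delta> ^ 4 \<le> (u * v)\<^sup>2" by (simp add: power2_eq_square power4_eq_xxxx mult.assoc)
  qed (use uv \<delta> in auto)
  finally show "(1 / u - 1 / v)\<^sup>2 \<le> (u - v)\<^sup>2 / \<delta> ^ 4" .
  have "0 < 1 / u" "1 / u \<le> 1 / \<delta>" "0 < 1 / v" "1 / v \<le> 1 / \<delta>"
    using assms uv \<delta> by (auto intro: divide_left_mono)
  then have "\<bar>1 / u - 1 / v\<bar> \<le> 1 / \<delta>" by linarith
  from power_mono[OF this abs_ge_zero, of 2] show "(1 / u - 1 / v)\<^sup>2 \<le> 1 / \<delta>\<^sup>2" by (simp add: power_divide)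
qed

text \<open>Mean-square consistency of the propensity cannot simply be multiplied by an unbounded
  \<open>f\<close>. A bounded approximation \<open>g\<close> takes the consistency, and f - g is
  paid for by the trivial bound on the difference of inverses.\<close>

lemma ratio_vanishes:
  assumes f[measurable]: "f \<in> borel_measurable borel" and f2: "integrable P\<^sub>\<psi> (\<lambda>x. (f x)\<^sup>2)"
  shows "vanishes M (\<lambda>n \<omega>. \<Sum>i=1..n. (f (\<psi> i \<omega>) / qt n i \<omega> / sqrt (real n) - f (\<psi> i \<omega>) / qs (\<psi> i \<omega>) / sqrt (real n))\<^sup>2)"
    (is "vanishes M ?X")
proof (rule vanishes_approx)
  show "?X n \<in> borel_measurable M" for n
    by (intro borel_measurable_sum borel_measurable_power borel_measurable_diff borel_measurable_divide \<psi>_M qt_M f qs_borel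
        borel_measurable_const) auto
  fix e :: real assume e: "e > 0"
  \<comment> \<open>Chosen against the factor 2 / \<open>\<delta>\<^sup>2\<close> in
    \<open>V\<close> below.\<close>
  have e': "e * \<delta>\<^sup>2 / 2 > 0" using e \<delta> by simp
  have fin: "(\<integral>\<^sup>+x. ennreal ((f x)\<^sup>2) \<partial>P\<^sub>\<psi>) < \<infinity>" using f2 by (simp add: integrable_iff_bounded)
  obtain g where g: "bl_fun g" and ge: "(\<integral>\<^sup>+x. ennreal ((f x - g x)\<^sup>2) \<partial>P\<^sub>\<psi>) \<le> ennreal (e * \<delta>\<^sup>2 / 2)"
    using bl_fun_dense_L2[OF P.finite_measure_axioms sets_P f fin e'] by blast
  obtain K where [measurable]: "g \<in> borel_measurable borel" and K: "\<And>x. \<bar>g x\<bar> \<le> K" using g by (auto simp: bl_fun_def)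
  have int: "integrable P\<^sub>\<psi> (\<lambda>x. (f x - g x)\<^sup>2)"
    by (rule integrableI_nonneg) (use ge in \<open>auto intro: order.strict_trans1\<close>)
  have "ennreal (\<integral>x. (f x - g x)\<^sup>2 \<partial>P\<^sub>\<psi>) \<le> ennreal (e * \<delta>\<^sup>2 / 2)"
    using nn_integral_eq_integral[OF int] ge by simp
  then have le: "(\<integral>x. (f x - g x)\<^sup>2 \<partial>P\<^sub>\<psi>) \<le> e * \<delta>\<^sup>2 / 2" using e' by (subst (asm) ennreal_le_iff) auto
  have fgM: "(\<lambda>x. (f x - g x)\<^sup>2) \<in> borel_measurable borel" by measurable
  define U where "U n \<omega> = (2 * K\<^sup>2 / \<delta> ^ 4) * ((1 / real n) * (\<Sum>i=1..n. (q\<^sub>n n \<omega> (\<psi> i \<omega>) - qs (\<psi> i \<omega>))\<^sup>2))" for n \<omega>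
  define V where "V n \<omega> = (2 / \<delta>\<^sup>2) * ((1 / real n) * (\<Sum>i=1..n. (f (\<psi> i \<omega>) - g (\<psi> i \<omega>))\<^sup>2))" for n \<omega>
  have U: "vanishes M U" unfolding U_def by (intro vanishes_cmult q_consistent)
  have Vi: "integrable M (V n)" for n
    unfolding V_def using integral_\<psi>(2)[OF fgM] int
    by (intro integrable_mult_right Bochner_Integration.integrable_sum) auto
  have Ve: "(\<integral>\<omega>. \<bar>V n \<omega>\<bar> \<partial>M) \<le> e" if n: "n \<ge> 1" for n
  proof -
    have "(\<integral>\<omega>. \<bar>V n \<omega>\<bar> \<partial>M) = (\<integral>\<omega>. V n \<omega> \<partial>M)"
      by (intro Bochner_Integration.integral_cong) (auto simp: V_def sum_nonneg)
    also have "\<dots> = (2 / \<delta>\<^sup>2) * ((1 / real n) * (\<Sum>i=1..n. \<integral>\<omega>. (f (\<psi> i \<omega>) - g (\<psi> i \<omega>))\<^sup>2 \<partial>M))"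
      unfolding V_def integral_mult_right_zero using integral_\<psi>(2)[OF fgM] int
      by (subst Bochner_Integration.integral_sum) auto
    also have "\<dots> = (2 / \<delta>\<^sup>2) * (\<integral>x. (f x - g x)\<^sup>2 \<partial>P\<^sub>\<psi>)"
      using n by (simp add: integral_\<psi>(1)[OF fgM])
    also have "\<dots> \<le> (2 / \<delta>\<^sup>2) * (e * \<delta>\<^sup>2 / 2)" by (intro mult_left_mono le) auto
    also have "\<dots> = e" using \<delta> by simp
    finally show ?thesis .
  qed
  have XUV: "AE \<omega> in M. \<bar>?X n \<omega>\<bar> \<le> \<bar>U n \<omega>\<bar> + \<bar>V n \<omega>\<bar>" if n: "n \<ge> 1" for n
    using qt_eq[of n] AE_\<psi>[OF q_star_bounds[folded qs_def], of n]
  proof eventually_elim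
    case (elim \<omega>)
    have each: "(f (\<psi> i \<omega>) / qt n i \<omega> / sqrt (real n) - f (\<psi> i \<omega>) / qs (\<psi> i \<omega>) / sqrt (real n))\<^sup>2 \<le>
        (1 / real n) * ((2 * K\<^sup>2 / \<delta> ^ 4) * (q\<^sub>n n \<omega> (\<psi> i \<omega>) - qs (\<psi> i \<omega>))\<^sup>2 + (2 / \<delta>\<^sup>2) * (f (\<psi> i \<omega>) - g (\<psi> i \<omega>))\<^sup>2)"
      if i: "i \<in> {1..n}" for i
    proof -
      define x where "x = \<psi> i \<omega>"
      define u where "u = qt n i \<omega>"
      define v where "v = qs x"
      have uq: "u = q\<^sub>n n \<omega> x" and uv: "\<delta> \<le> u" "\<delta> \<le> v"
        using bspec[OF elim(1) i] bspec[OF elim(2) i] by (auto simp: u_def v_def x_def)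
      note b = inverse_diff_bounds[OF uv]
      have "(g x)\<^sup>2 \<le> K\<^sup>2" using power_mono[OF K[of x] abs_ge_zero, of 2] by simp
      have "(f x)\<^sup>2 * (1 / u - 1 / v)\<^sup>2 \<le> (2 * (g x)\<^sup>2 + 2 * (f x - g x)\<^sup>2) * (1 / u - 1 / v)\<^sup>2"
        using square_sum_le[of "g x" "f x - g x"] by (intro mult_right_mono) auto
      also have "\<dots> = 2 * ((g x)\<^sup>2 * (1 / u - 1 / v)\<^sup>2) + 2 * ((f x - g x)\<^sup>2 * (1 / u - 1 / v)\<^sup>2)"
          by (simp add: algebra_simps)
      also have "\<dots> \<le> 2 * (K\<^sup>2 * ((u - v)\<^sup>2 / \<delta> ^ 4)) + 2 * ((f x - g x)\<^sup>2 * (1 / \<delta>\<^sup>2))"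
        using b \<open>(g x)\<^sup>2 \<le> K\<^sup>2\<close> by (intro add_mono mult_left_mono mult_mono) auto
      finally have "(f x)\<^sup>2 * (1 / u - 1 / v)\<^sup>2 \<le> (2 * K\<^sup>2 / \<delta> ^ 4) * (u - v)\<^sup>2 + (2 / \<delta>\<^sup>2) * (f x - g x)\<^sup>2" by simp
      then have "(1 / real n) * ((f x)\<^sup>2 * (1 / u - 1 / v)\<^sup>2) \<le> (1 / real n) * ((2 * K\<^sup>2 / \<delta> ^ 4) * (u - v)\<^sup>2 +
          (2 / \<delta>\<^sup>2) * (f x - g x)\<^sup>2)"
        by (rule mult_left_mono) simp
      moreover have "(f x / u / sqrt (real n) - f x / v / sqrt (real n))\<^sup>2 = (1 / real n) * ((f x)\<^sup>2 * (1 / u - 1 / v)\<^sup>2)"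
      proof -
        have "f x / u / sqrt (real n) - f x / v / sqrt (real n) = f x * (1 / u - 1 / v) / sqrt (real n)"
          by (simp add: diff_divide_distrib right_diff_distrib)
        then show ?thesis by (simp add: power_mult_distrib power_divide)
      qed
      ultimately show ?thesis by (simp add: x_def u_def v_def uq[unfolded u_def x_def])
    qed
    have "?X n \<omega> \<le> (\<Sum>i=1..n. (1 / real n) * ((2 * K\<^sup>2 / \<delta> ^ 4) * (q\<^sub>n n \<omega> (\<psi> i \<omega>) - qs (\<psi> i \<omega>))\<^sup>2 +
        (2 / \<delta>\<^sup>2) * (f (\<psi> i \<omega>) - g (\<psi> i \<omega>))\<^sup>2))"
      by (rule sum_mono[OF each])
    also have "\<dots> = U n \<omega> + V n \<omega>"
      by (simp only: U_def V_def sum_distrib_left sum.distrib distrib_left mult.left_commute)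
    finally have "?X n \<omega> \<le> U n \<omega> + V n \<omega>" .
    moreover have "0 \<le> ?X n \<omega>" by (intro sum_nonneg) auto
    ultimately show ?case by linarith
  qed
  show "\<exists>U V. vanishes M U \<and> (\<forall>\<^sub>F n in sequentially. integrable M (V n) \<and> (\<integral>\<omega>. \<bar>V n \<omega>\<bar> \<partial>M) \<le> e \<and>
      (AE \<omega> in M. \<bar>?X n \<omega>\<bar> \<le> \<bar>U n \<omega>\<bar> + \<bar>V n \<omega>\<bar>))"
    using U Vi Ve XUV by (intro exI[of _ U] exI[of _ V] conjI eventually_sequentiallyI[of 1]) auto
qed

lemma ratio_L2:
  assumes f[measurable]: "f \<in> borel_measurable borel" and f2: "integrable P\<^sub>\<psi> (\<lambda>x. (f x)\<^sup>2)"
  shows "(\<lambda>x. f x / qs x) \<in> borel_measurable borel" "(\<integral>\<^sup>+x. ennreal ((f x / qs x)\<^sup>2) \<partial>P\<^sub>\<psi>) < \<infinity>"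
proof -
  show "(\<lambda>x. f x / qs x) \<in> borel_measurable borel" by measurable
  have "integrable P\<^sub>\<psi> (\<lambda>x. (f x / qs x)\<^sup>2)"
  proof (rule Bochner_Integration.integrable_bound[OF integrable_mult_right[OF f2, of "1 / \<delta>\<^sup>2"]])
    show "AE x in P\<^sub>\<psi>. norm ((f x / qs x)\<^sup>2) \<le> norm (1 / \<delta>\<^sup>2 * (f x)\<^sup>2)"
      using q_star_bounds[folded qs_def]
    proof eventually_elim
      case (elim x)
      then have "(f x)\<^sup>2 / (qs x)\<^sup>2 \<le> (f x)\<^sup>2 / \<delta>\<^sup>2"
        using \<delta> by (intro divide_left_mono power_mono) auto
      then show ?case by (simp add: power_divide)
    qed
  qed measurable
  then show "(\<integral>\<^sup>+x. ennreal ((f x / qs x)\<^sup>2) \<partial>P\<^sub>\<psi>) < \<infinity>" by (simp add: integrable_iff_bounded)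
qed

lemma T_term_vanishes:
  assumes f[measurable]: "f \<in> borel_measurable borel" and f2: "integrable P\<^sub>\<psi> (\<lambda>x. (f x)\<^sup>2)"
  shows "vanishes M (\<lambda>n \<omega>. \<Sum>i=1..n. f (\<psi> i \<omega>) / qt n i \<omega> / sqrt (real n) * (of_bool (T n i \<omega>) - q\<^sub>n n \<omega> (\<psi> i \<omega>)))"
  by (rule T_vanishes[OF _ ratio_L2[OF assms] ratio_vanishes[OF assms]])
     (intro borel_measurable_divide \<psi>_FT qt_FT f borel_measurable_const; assumption)

lemma D_term_vanishes:
  assumes f[measurable]: "f \<in> borel_measurable borel" and f2: "integrable P\<^sub>\<psi> (\<lambda>x. (f x)\<^sup>2)"
  shows "vanishes M (\<lambda>n \<omega>. \<Sum>i\<in>{i \<in> {1..n}. T n i \<omega>}. f (\<psi> i \<omega>) / qt n i \<omega> / sqrt (real n) * (of_bool (D n i \<omega>) - p))"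
  by (rule D_vanishes[OF measurable_from_subalg[OF sub_FD_FT] ratio_L2[OF assms] ratio_vanishes[OF assms]])
     (intro borel_measurable_divide \<psi>_FT qt_FT f borel_measurable_const; assumption)

section \<open>The conditional variance\<close>

text \<open>A version of the conditional variance whose bounds hold everywhere; by
  \<open>ss_bounds\<close> the clipping changes it only on a null set.\<close>

definition sb :: "nat \<Rightarrow> real^'d \<Rightarrow> real" where "sb d x = max 0 (min (S\<^sub>m\<^sup>2) (\<sigma>2 d x))"
definition vb :: "real^'d \<Rightarrow> real" where "vb x = sb 1 x / p + sb 0 x / (1 - p)"

lemma sb_borel: "d \<in> {0, 1} \<Longrightarrow> sb d \<in> borel_measurable borel"
  unfolding sb_def[abs_def] by (intro borel_measurable_max borel_measurable_min borel_measurable_const \<sigma>2_borel)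

lemma sb_bounds: "0 \<le> sb d x" "sb d x \<le> S\<^sub>m\<^sup>2"
  by (auto simp: sb_def)

lemma sb_eq: "d \<in> {0, 1} \<Longrightarrow> AE x in P\<^sub>\<psi>. sb d x = \<sigma>2 d x"
  using ss_bounds by eventually_elim (auto simp: sb_def)

lemma vb_borel [measurable]: "vb \<in> borel_measurable borel"
  using sb_borel[of 0] sb_borel[of 1] unfolding vb_def[abs_def] by measurable

lemma vb_eq: "AE x in P\<^sub>\<psi>. vb x = (ss x)\<^sup>2"
proof -
  have "AE x in P\<^sub>\<psi>. sb 0 x = \<sigma>2 0 x" "AE x in P\<^sub>\<psi>. sb 1 x = \<sigma>2 1 x" by (auto intro: sb_eq)
  then show ?thesis using ss_bounds by eventually_elim (simp add: vb_def)
qed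

text \<open>The conditional variance of the i-th residual term when the design takes the value (t,
  d). There is no mixed term because \<open>d\<close> and t - d are disjoint.\<close>

definition vv :: "nat \<Rightarrow> nat set \<Rightarrow> nat set \<Rightarrow> nat \<Rightarrow> 'a \<Rightarrow> real" where
  "vv n t d i \<omega> = 1 / real n * ((of_bool (i \<in> d) / (qt n i \<omega> * p))\<^sup>2 * sb 1 (\<psi> i \<omega>) +
     (of_bool (i \<in> t - d) / (qt n i \<omega> * (1 - p)))\<^sup>2 * sb 0 (\<psi> i \<omega>))"

definition V_lim :: real where "V_lim = (\<integral>x. (ss x)\<^sup>2 / qs x \<partial>P\<^sub>\<psi>)"

text \<open>Weights of order 1/n satisfy the closeness condition on imbalances with h = 0; the
  quotient of 0 is kept so that the statement matches that condition.\<close>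

lemma bounded_sum_squares_vanishes:
  fixes x :: "nat \<Rightarrow> nat \<Rightarrow> 'a \<Rightarrow> real"
  assumes xM: "\<And>n i. i \<in> {1..n} \<Longrightarrow> x n i \<in> borel_measurable M"
    and le: "\<And>n i \<omega>. \<bar>x n i \<omega>\<bar> \<le> K / real n"
  shows "vanishes M (\<lambda>n \<omega>. \<Sum>i=1..n. (x n i \<omega> - 0 / sqrt (real n))\<^sup>2)"
proof (rule vanishes_mono)
  show "(\<lambda>\<omega>. \<Sum>i=1..n. (x n i \<omega> - 0 / sqrt (real n))\<^sup>2) \<in> borel_measurable M" for n
    using xM by (intro borel_measurable_sum borel_measurable_power borel_measurable_diff borel_measurable_const) auto
  show "vanishes M (\<lambda>n \<omega>. K\<^sup>2 / real n)"
    by (rule vanishes_L1[OF _ _ lim_const_over_n[of "K\<^sup>2"]]) (auto simp: prob_space)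
  show "\<forall>\<^sub>F n in sequentially. AE \<omega> in M. \<bar>\<Sum>i=1..n. (x n i \<omega> - 0 / sqrt (real n))\<^sup>2\<bar> \<le> \<bar>K\<^sup>2 / real n\<bar>"
    using eventually_ge_at_top[of 1]
  proof eventually_elim
    case (elim n)
    have "\<bar>\<Sum>i=1..n. (x n i \<omega> - 0 / sqrt (real n))\<^sup>2\<bar> \<le> \<bar>K\<^sup>2 / real n\<bar>" for \<omega>
    proof -
      have "(\<Sum>i=1..n. (x n i \<omega> - 0 / sqrt (real n))\<^sup>2) \<le> (\<Sum>i=1..n. (K / real n)\<^sup>2)"
        proof (rule sum_mono)
          fix i
          show "(x n i \<omega> - 0 / sqrt (real n))\<^sup>2 \<le> (K / real n)\<^sup>2"
            using power_mono[OF le[of n i \<omega>] abs_ge_zero, of 2] by simp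
        qed
      also have "\<dots> = K\<^sup>2 / real n" using elim by (simp add: power_divide power2_eq_square)
      finally show ?thesis by (simp add: sum_nonneg)
    qed
    then show ?case by simp
  qed
qed

text \<open>The conditional variance is itself an average over the design. Replacing D by p and then
  T by its propensity costs two imbalances with weights of order 1/n; the result is an average of
  \<open>vb\<close> over the propensity, in which q* is substituted before the weak law
  applies.\<close>

lemma V_consistent: "vanishes M (\<lambda>n \<omega>. (\<Sum>i=1..n. vv n (treated n \<omega>) (assigned n \<omega>) i \<omega>) - V_lim)"
proof -
  define a b where "a x = sb 1 x / p\<^sup>2" and "b x = sb 0 x / (1 - p)\<^sup>2" for x
  have [measurable]: "a \<in> borel_measurable borel" "b \<in> borel_measurable borel"
    using sb_borel[of 0] sb_borel[of 1] unfolding a_def b_def by measurable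
  define Ka where "Ka = S\<^sub>m\<^sup>2 / p\<^sup>2 + S\<^sub>m\<^sup>2 / (1 - p)\<^sup>2"
  define Kv where "Kv = S\<^sub>m\<^sup>2 / p + S\<^sub>m\<^sup>2 / (1 - p)"
  have ab: "\<bar>a x - b x\<bar> \<le> Ka" for x
  proof -
    have "0 \<le> a x" "a x \<le> S\<^sub>m\<^sup>2 / p\<^sup>2" "0 \<le> b x" "b x \<le> S\<^sub>m\<^sup>2 / (1 - p)\<^sup>2"
      using sb_bounds by (auto simp: a_def b_def intro: divide_right_mono)
    moreover have "0 \<le> S\<^sub>m\<^sup>2 / p\<^sup>2" "0 \<le> S\<^sub>m\<^sup>2 / (1 - p)\<^sup>2" by auto
    ultimately show ?thesis unfolding Ka_def by linarith
  qed
  have vb0: "0 \<le> vb x" and vbK: "vb x \<le> Kv" for x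
    using sb_bounds p(2,3) by (auto simp: vb_def Kv_def intro!: add_nonneg_nonneg add_mono divide_right_mono)
  have Kv0: "0 \<le> Kv" using vb0 vbK order.trans by blast
  have Ka0: "0 \<le> Ka" using ab order.trans[OF abs_ge_zero] by blast
  have qt2: "0 \<le> 1 / (qt n i \<omega>)\<^sup>2" "1 / (qt n i \<omega>)\<^sup>2 \<le> 1 / \<delta>\<^sup>2" for n i \<omega>
    using qt_ge[of n i \<omega>] \<delta> by (auto intro!: divide_left_mono power_mono)
  define x1 where "x1 n i \<omega> = 1 / real n * (vb (\<psi> i \<omega>) * (1 / (qt n i \<omega>)\<^sup>2))" for n i \<omega>
  define x2 where "x2 n i \<omega> = 1 / real n * ((a (\<psi> i \<omega>) - b (\<psi> i \<omega>)) * (1 / (qt n i \<omega>)\<^sup>2))" for n i \<omega>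
  have x1F: "x1 n i \<in> borel_measurable (FT n)" if "i \<in> {1..n}" for n i
    unfolding x1_def using that
    by (intro borel_measurable_times borel_measurable_divide borel_measurable_power borel_measurable_const \<psi>_FT qt_FT) auto
  have x2F: "x2 n i \<in> borel_measurable (FT n)" if "i \<in> {1..n}" for n i
    unfolding x2_def using that
    by (intro borel_measurable_times borel_measurable_divide borel_measurable_power borel_measurable_diff
        borel_measurable_const \<psi>_FT qt_FT) auto
  have x1b: "\<bar>x1 n i \<omega>\<bar> \<le> (Kv * (1 / \<delta>\<^sup>2)) / real n" for n i \<omega>
  proof -
    have "vb (\<psi> i \<omega>) * (1 / (qt n i \<omega>)\<^sup>2) \<le> Kv * (1 / \<delta>\<^sup>2)"
      by (intro mult_mono vbK qt2 Kv0)
    moreover have "0 \<le> vb (\<psi> i \<omega>) * (1 / (qt n i \<omega>)\<^sup>2)" by (intro mult_nonneg_nonneg vb0 qt2)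
    ultimately have "\<bar>vb (\<psi> i \<omega>) * (1 / (qt n i \<omega>)\<^sup>2)\<bar> / real n \<le> (Kv * (1 / \<delta>\<^sup>2)) / real n"
      by (intro divide_right_mono) auto
    then show ?thesis unfolding x1_def
        by (simp only: abs_mult abs_divide abs_of_nat abs_one mult_1_left times_divide_eq_left)
  qed
  have x2b: "\<bar>x2 n i \<omega>\<bar> \<le> (Ka * (1 / \<delta>\<^sup>2)) / real n" for n i \<omega>
  proof -
    have "\<bar>a (\<psi> i \<omega>) - b (\<psi> i \<omega>)\<bar> * (1 / (qt n i \<omega>)\<^sup>2) \<le> Ka * (1 / \<delta>\<^sup>2)"
      by (intro mult_mono ab qt2 Ka0)
    then have "\<bar>(a (\<psi> i \<omega>) - b (\<psi> i \<omega>)) * (1 / (qt n i \<omega>)\<^sup>2)\<bar> / real n \<le> (Ka * (1 / \<delta>\<^sup>2)) / real n"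
      unfolding abs_mult using qt2(1)[of n i \<omega>] by (intro divide_right_mono) auto
    then show ?thesis unfolding x2_def
        by (simp only: abs_mult abs_divide abs_of_nat abs_one mult_1_left times_divide_eq_left)
  qed
  have R1: "vanishes M (\<lambda>n \<omega>. \<Sum>i=1..n. x1 n i \<omega> * (of_bool (T n i \<omega>) - q\<^sub>n n \<omega> (\<psi> i \<omega>)))"
    by (rule T_vanishes[OF x1F _ _ bounded_sum_squares_vanishes[OF measurable_from_subalg[OF sub_FT x1F] x1b]]) auto
  have R2: "vanishes M (\<lambda>n \<omega>. \<Sum>i\<in>{i \<in> {1..n}. T n i \<omega>}. x2 n i \<omega> * (of_bool (D n i \<omega>) - p))"
    by (rule D_vanishes[OF measurable_from_subalg[OF sub_FD_FT x2F] _ _ bounded_sum_squares_vanishes[OF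
        measurable_from_subalg[OF sub_FT x2F] x2b]]) auto
  have vb2: "integrable P\<^sub>\<psi> (\<lambda>x. (vb x)\<^sup>2)"
    by (rule P.integrable_const_bound[where B="Kv\<^sup>2"]) (use vb0 vbK in \<open>auto intro!: power_mono\<close>)
  define R3 where "R3 n \<omega> = (1 / real n) * (\<Sum>i=1..n. vb (\<psi> i \<omega>) / qt n i \<omega> - vb (\<psi> i \<omega>) / qs (\<psi> i \<omega>))" for n \<omega>
  have R3M: "R3 n \<in> borel_measurable M" for n
    unfolding R3_def
    by (intro borel_measurable_times borel_measurable_sum borel_measurable_diff borel_measurable_divide \<psi>_M qt_M vb_borel
        qs_borel borel_measurable_const) auto
  \<comment> \<open>Exchanging the propensity for its limit inside an average costs, by
    Cauchy-Schwarz, no more than the mean-square error from \<open>ratio_vanishes\<close>.\<close>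
  have "vanishes M (\<lambda>n \<omega>. (R3 n \<omega>)\<^sup>2)"
  proof (rule vanishes_mono[OF _ ratio_vanishes[OF vb_borel vb2]])
    show "(\<lambda>\<omega>. (R3 n \<omega>)\<^sup>2) \<in> borel_measurable M" for n using R3M by measurable
    have "\<bar>(R3 n \<omega>)\<^sup>2\<bar> \<le> \<bar>\<Sum>i=1..n. (vb (\<psi> i \<omega>) / qt n i \<omega> / sqrt (real n) - vb (\<psi> i \<omega>) / qs (\<psi> i \<omega>) / sqrt
        (real n))\<^sup>2\<bar>" for n \<omega>
    proof -
      have "(R3 n \<omega>)\<^sup>2 \<le> (1 / real n) * (\<Sum>i=1..n. (vb (\<psi> i \<omega>) / qt n i \<omega> - vb (\<psi> i \<omega>) / qs (\<psi> i \<omega>))\<^sup>2)"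
        unfolding R3_def by (rule mean_square_le)
      also have "\<dots> = (\<Sum>i=1..n. (vb (\<psi> i \<omega>) / qt n i \<omega> / sqrt (real n) - vb (\<psi> i \<omega>) / qs (\<psi> i \<omega>) / sqrt (real n))\<^sup>2)"
        unfolding sum_distrib_left by (intro sum.cong refl)
          (simp only: diff_divide_distrib[symmetric] power_divide real_sqrt_pow2 of_nat_0_le_iff mult_1_left
              times_divide_eq_left)
      finally show ?thesis by (simp add: sum_nonneg)
    qed
    then show "\<forall>\<^sub>F n in sequentially. AE \<omega> in M. \<bar>(R3 n \<omega>)\<^sup>2\<bar> \<le>
        \<bar>\<Sum>i=1..n. (vb (\<psi> i \<omega>) / qt n i \<omega> / sqrt (real n) - vb (\<psi> i \<omega>) / qs (\<psi> i \<omega>) / sqrt (real n))\<^sup>2\<bar>"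
      by (intro always_eventually allI AE_I2)
  qed
  then have R3: "vanishes M R3" using vanishes_power2_iff[of R3] R3M by simp
  define R4 where "R4 n \<omega> = (1 / real n) * (\<Sum>i=1..n. vb (\<psi> i \<omega>) / qs (\<psi> i \<omega>)) - V_lim" for n \<omega>
  have R4: "vanishes M R4"
  proof -
    have V: "V_lim = (\<integral>x. vb x / qs x \<partial>P\<^sub>\<psi>)"
      unfolding V_lim_def by (intro integral_cong_AE) (use vb_eq in \<open>auto elim!: eventually_mono\<close>)
    have K: "AE x in P\<^sub>\<psi>. \<bar>vb x / qs x\<bar> \<le> Kv / \<delta>"
      using q_star_bounds[folded qs_def]
    proof eventually_elim
      case (elim x)
      have "vb x / qs x \<le> Kv / \<delta>" using elim \<delta> vb0[of x] vbK[of x] Kv0 by (intro frac_le) auto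
      then show ?case using vb0[of x] elim \<delta> by simp
    qed
    show ?thesis unfolding R4_def V by (rule weak_law[OF _ K]) measurable
  qed
  have VM: "(\<lambda>\<omega>. (\<Sum>i=1..n. vv n (treated n \<omega>) (assigned n \<omega>) i \<omega>) - V_lim) \<in> borel_measurable M" for n
  proof -
    have "(\<lambda>\<omega>. vv n (treated n \<omega>) (assigned n \<omega>) i \<omega>) \<in> borel_measurable M" if i: "i \<in> {1..n}" for i
    proof (rule measurable_design)
      have [measurable]: "(\<lambda>\<omega>. sb 0 (\<psi> i \<omega>)) \<in> borel_measurable M" "(\<lambda>\<omega>. sb 1 (\<psi> i \<omega>)) \<in> borel_measurable M"
        "qt n i \<in> borel_measurable M" using i by (auto intro!: \<psi>_M sb_borel qt_M)
      show "vv n t d i \<in> borel_measurable M" for t d unfolding vv_def by measurable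
    qed
    then show ?thesis by (intro borel_measurable_diff borel_measurable_sum borel_measurable_const)
  qed
  have tot: "vanishes M (\<lambda>n \<omega>. ((\<Sum>i=1..n. x1 n i \<omega> * (of_bool (T n i \<omega>) - q\<^sub>n n \<omega> (\<psi> i \<omega>))) +
      (\<Sum>i\<in>{i \<in> {1..n}. T n i \<omega>}. x2 n i \<omega> * (of_bool (D n i \<omega>) - p))) + (R3 n \<omega> + R4 n \<omega>))"
    by (intro vanishes_add R1 R2 R3 R4)
  show ?thesis
  proof (rule vanishes_mono[OF VM tot], rule always_eventually, rule allI)
    fix n
    show "AE \<omega> in M. \<bar>(\<Sum>i=1..n. vv n (treated n \<omega>) (assigned n \<omega>) i \<omega>) - V_lim\<bar> \<le>
       \<bar>((\<Sum>i=1..n. x1 n i \<omega> * (of_bool (T n i \<omega>) - q\<^sub>n n \<omega> (\<psi> i \<omega>))) +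
      (\<Sum>i\<in>{i \<in> {1..n}. T n i \<omega>}. x2 n i \<omega> * (of_bool (D n i \<omega>) - p))) + (R3 n \<omega> + R4 n \<omega>)\<bar>"
      using qt_eq[of n]
    proof eventually_elim
      case (elim \<omega>)
      have "(\<Sum>i=1..n. vv n (treated n \<omega>) (assigned n \<omega>) i \<omega>) =
        (\<Sum>i=1..n. x1 n i \<omega> * (of_bool (T n i \<omega>) - q\<^sub>n n \<omega> (\<psi> i \<omega>)) +
           of_bool (T n i \<omega>) * (x2 n i \<omega> * (of_bool (D n i \<omega>) - p)) + 1 / real n * (vb (\<psi> i \<omega>) / qt n i \<omega>))"
      proof (rule sum.cong[OF refl])
        fix i assume i: "i \<in> {1..n}"
        define Q where "Q = qt n i \<omega>"
        have Q: "q\<^sub>n n \<omega> (\<psi> i \<omega>) = Q" "Q > 0" using bspec[OF elim i] qt_pos[of n i \<omega>] by (auto simp: Q_def)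
        have vbab: "vb (\<psi> i \<omega>) = p * a (\<psi> i \<omega>) + (1 - p) * b (\<psi> i \<omega>)"
          using p(2,3) by (simp add: vb_def a_def b_def power2_eq_square)
        have td: "i \<in> assigned n \<omega> \<longleftrightarrow> T n i \<omega> \<and> D n i \<omega>" "i \<in> treated n \<omega> \<longleftrightarrow> T n i \<omega>"
          using i by (auto simp: assigned_def treated_def)
        have "vv n (treated n \<omega>) (assigned n \<omega>) i \<omega> = 1 / real n * (of_bool (T n i \<omega>) *
            (of_bool (D n i \<omega>) * a (\<psi> i \<omega>) + (1 - of_bool (D n i \<omega>)) * b (\<psi> i \<omega>)) * (1 / Q\<^sup>2))"
          unfolding vv_def Q_def[symmetric] a_def b_def
          by (cases "T n i \<omega>"; cases "D n i \<omega>") (simp_all add: td power_divide power_mult_distrib)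
        also have "\<dots> = 1 / real n * (vb (\<psi> i \<omega>) * (1 / Q\<^sup>2)) * (of_bool (T n i \<omega>) - Q) +
           of_bool (T n i \<omega>) * (1 / real n * ((a (\<psi> i \<omega>) - b (\<psi> i \<omega>)) * (1 / Q\<^sup>2)) * (of_bool (D n i \<omega>) - p)) + 1 / real n *
               (vb (\<psi> i \<omega>) / Q)"
        proof -
          have Q2: "z / Q = z * (1 / Q\<^sup>2) * Q" for z using Q by (simp add: power2_eq_square)
          \<comment> \<open>A polynomial identity, with the indicators as free variables: d * y + (1
            - d) * z equals its value at d = p plus (y - z) * (d - p), and t is split as (t - Q) + Q
            in the first part.\<close>
          have "N * (t * (d * y + (1 - d) * z) * R) = N * ((p * y + (1 - p) * z) * R) * (t - Q) +
              t * (N * ((y - z) * R) * (d - p)) + N * ((p * y + (1 - p) * z) * R * Q)" for N t d y z R :: real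
            by (simp add: algebra_simps)
          then show ?thesis unfolding Q2[of "vb (\<psi> i \<omega>)"] unfolding vbab .
        qed
        finally show "vv n (treated n \<omega>) (assigned n \<omega>) i \<omega> = x1 n i \<omega> * (of_bool (T n i \<omega>) - q\<^sub>n n \<omega> (\<psi> i \<omega>)) +
           of_bool (T n i \<omega>) * (x2 n i \<omega> * (of_bool (D n i \<omega>) - p)) + 1 / real n * (vb (\<psi> i \<omega>) / qt n i \<omega>)"
          unfolding x1_def x2_def Q_def[symmetric] Q(1) .
      qed
      also have "\<dots> = (\<Sum>i=1..n. x1 n i \<omega> * (of_bool (T n i \<omega>) - q\<^sub>n n \<omega> (\<psi> i \<omega>))) +
          (\<Sum>i=1..n. of_bool (T n i \<omega>) * (x2 n i \<omega> * (of_bool (D n i \<omega>) - p))) + 1 / real n *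
              (\<Sum>i=1..n. vb (\<psi> i \<omega>) / qt n i \<omega>)"
        by (simp add: sum.distrib sum_distrib_left)
      also have "(\<Sum>i=1..n. of_bool (T n i \<omega>) * (x2 n i \<omega> * (of_bool (D n i \<omega>) - p))) = (\<Sum>i\<in>{i \<in> {1..n}. T n i \<omega>}.
          x2 n i \<omega> * (of_bool (D n i \<omega>) - p))"
        unfolding sum.inter_filter[OF finite_atLeastAtMost] by (intro sum.cong refl) simp
      also have "1 / real n * (\<Sum>i=1..n. vb (\<psi> i \<omega>) / qt n i \<omega>) = R3 n \<omega> + R4 n \<omega> + V_lim"
        by (simp add: R3_def R4_def sum_subtractf right_diff_distrib)
      finally show ?case by simp
    qed
  qed
qed

section \<open>The minimal variance\<close>

text \<open>At q* the integrands of the objective and of the cost are both multiples of \<sigma>_s *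
  sqrt C, which is the equality case of Cauchy-Schwarz.\<close>

lemma qs_AE: "AE x in P\<^sub>\<psi>. (ss x)\<^sup>2 / qs x = \<kappa> / B * (ss x * sqrt (C x)) \<and> C x * qs x = B / \<kappa> * (ss x * sqrt (C x)) \<and>
   0 < C x \<and> 0 < ss x \<and> 0 < qs x \<and> qs x \<le> 1"
  using ss_bounds C_bounds(2) q_star_bounds[folded qs_def]
proof eventually_elim
  case (elim x)
  have C0: "C x > 0" "sqrt (C x) > 0" "C x = sqrt (C x) * sqrt (C x)" using elim C_bounds(1) by auto
  have "(ss x)\<^sup>2 / qs x = \<kappa> / B * (ss x * sqrt (C x))"
  proof -
    have "ss x > 0" using elim by simp
    then show ?thesis unfolding qs_eq using B \<kappa>_pos C0(2) by (simp add: field_simps power2_eq_square)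
  qed
  moreover have "C x * qs x = B / \<kappa> * (ss x * sqrt (C x))"
  proof -
    have "C x * qs x = B / \<kappa> * (ss x * (C x / sqrt (C x)))" unfolding qs_eq by (simp add: mult_ac)
    then show ?thesis using C0(1) by (simp only: real_div_sqrt[OF less_imp_le])
  qed
  ultimately show ?case using elim \<delta> C0 by simp
qed

text \<open>The integral of a function that is not integrable is 0 by convention, and \<kappa> is
  positive.\<close>

lemma ss_sqrt_C_integrable: "integrable P\<^sub>\<psi> (\<lambda>x. ss x * sqrt (C x))"
  using \<kappa>_pos not_integrable_integral_eq[of P\<^sub>\<psi> "\<lambda>x. ss x * sqrt (C x)"] by (auto simp: \<kappa>_def)

lemma V_lim_eq: "V_lim = \<kappa>\<^sup>2 / B"
proof -
  note [measurable] = C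
  have "V_lim = (\<integral>x. \<kappa> / B * (ss x * sqrt (C x)) \<partial>P\<^sub>\<psi>)"
    unfolding V_lim_def by (intro integral_cong_AE) (use qs_AE in \<open>auto elim!: eventually_mono\<close>)
  also have "\<dots> = \<kappa> / B * \<kappa>" unfolding integral_mult_right_zero by (simp add: \<kappa>_def)
  finally show ?thesis by (simp add: power2_eq_square)
qed

lemma V_lim_pos: "V_lim > 0"
  unfolding V_lim_eq using \<kappa>_pos B by simp

text \<open>Cauchy-Schwarz in the form of a pointwise arithmetic-geometric mean inequality with
  weight \<open>l\<close>. Integrating it gives \<kappa> \<le> (l * J + \<kappa>) / 2, hence
  \<kappa> \<le> l * J.\<close>

lemma objective_ge:
  assumes q: "q \<in> feasible P\<^sub>\<psi> B C"
  shows "ennreal V_lim \<le> objective P\<^sub>\<psi> p \<sigma>2 q"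
proof (cases "objective P\<^sub>\<psi> p \<sigma>2 q < \<infinity>")
  case True
  note [measurable] = C
  have qb[measurable]: "q \<in> borel_measurable borel" and q01: "\<And>x. 0 < q x \<and> q x \<le> 1" and qB: "(\<integral>x. C x * q x \<partial>P\<^sub>\<psi>) = B"
    using q by (auto simp: feasible_def)
  have iC: "integrable P\<^sub>\<psi> (\<lambda>x. C x * q x)"
    using B qB not_integrable_integral_eq[of P\<^sub>\<psi> "\<lambda>x. C x * q x"] by auto
  have obj: "objective P\<^sub>\<psi> p \<sigma>2 q = (\<integral>\<^sup>+x. ennreal ((ss x)\<^sup>2 / q x) \<partial>P\<^sub>\<psi>)" by (simp add: objective_def ss_def)
  have nn: "0 \<le> (ss x)\<^sup>2 / q x" for x using q01[of x] by simp
  have iq: "integrable P\<^sub>\<psi> (\<lambda>x. (ss x)\<^sup>2 / q x)"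
    by (rule integrableI_nonneg) (use True nn obj in auto)
  define J where "J = (\<integral>x. (ss x)\<^sup>2 / q x \<partial>P\<^sub>\<psi>)"
  have J: "objective P\<^sub>\<psi> p \<sigma>2 q = ennreal J"
    unfolding obj J_def by (rule nn_integral_eq_integral[OF iq]) (simp add: nn)
  \<comment> \<open>The weight for which the pointwise inequality is an equality at q*.\<close>
  define l where "l = B / \<kappa>"
  have l: "l > 0" using B \<kappa>_pos by (simp add: l_def)
  have "\<kappa> \<le> (\<integral>x. (l * ((ss x)\<^sup>2 / q x) + 1 / l * (C x * q x)) / 2 \<partial>P\<^sub>\<psi>)"
    unfolding \<kappa>_def
  proof (rule integral_mono_AE[OF ss_sqrt_C_integrable])
    show "integrable P\<^sub>\<psi> (\<lambda>x. (l * ((ss x)\<^sup>2 / q x) + 1 / l * (C x * q x)) / 2)"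
      by (intro integrable_divide Bochner_Integration.integrable_add integrable_mult_right iq iC)
    show "AE x in P\<^sub>\<psi>. ss x * sqrt (C x) \<le> (l * ((ss x)\<^sup>2 / q x) + 1 / l * (C x * q x)) / 2"
      using qs_AE
    proof eventually_elim
      case (elim x)
      define u w where "u = sqrt (l / q x) * ss x" and "w = sqrt (q x / l) * sqrt (C x)"
      have "u * w = ss x * sqrt (C x) * sqrt (l / q x * (q x / l))"
          by (simp add: u_def w_def real_sqrt_mult real_sqrt_divide)
      also have "l / q x * (q x / l) = 1" using l q01[of x] by simp
      finally have uw: "u * w = ss x * sqrt (C x)" by simp
      have "u\<^sup>2 = l * ((ss x)\<^sup>2 / q x)" using l q01[of x] by (simp add: u_def power_mult_distrib)
      moreover have "w\<^sup>2 = 1 / l * (C x * q x)" using l q01[of x] elim by (simp add: w_def power_mult_distrib)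
      ultimately show ?case using sum_squares_bound[of u w] uw by simp
    qed
  qed
  also have "\<dots> = (l * J + 1 / l * B) / 2"
    unfolding integral_divide_zero Bochner_Integration.integral_add[OF integrable_mult_right[OF iq]
        integrable_mult_right[OF iC]]
      integral_mult_right_zero qB J_def ..
  also have "1 / l * B = \<kappa>" using B \<kappa>_pos by (simp add: l_def)
  finally have "\<kappa> \<le> l * J" by simp
  then have "V_lim \<le> J" unfolding V_lim_eq l_def using B \<kappa>_pos by (simp add: field_simps power2_eq_square)
  then show ?thesis unfolding J by (rule ennreal_leI)
qed (simp add: not_less top_unique)

lemma objective_attained: "\<exists>q\<in>feasible P\<^sub>\<psi> B C. objective P\<^sub>\<psi> p \<sigma>2 q = ennreal V_lim"
proof
  note [measurable] = C
  \<comment> \<open>Feasibility requires the bounds at every point, but q* has them only almost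
    everywhere; on the exceptional null set the value 1 is substituted.\<close>
  define q where "q x = (if 0 < qs x \<and> qs x \<le> 1 then qs x else 1)" for x
  have qb[measurable]: "q \<in> borel_measurable borel" unfolding q_def by measurable
  have qq: "AE x in P\<^sub>\<psi>. q x = qs x" using qs_AE by eventually_elim (simp add: q_def)
  have "(\<integral>x. C x * q x \<partial>P\<^sub>\<psi>) = (\<integral>x. B / \<kappa> * (ss x * sqrt (C x)) \<partial>P\<^sub>\<psi>)"
    by (intro integral_cong_AE) (use qs_AE qq in \<open>auto elim!: eventually_elim2\<close>)
  also have "\<dots> = B / \<kappa> * \<kappa>" unfolding integral_mult_right_zero by (simp add: \<kappa>_def)
  finally show "q \<in> feasible P\<^sub>\<psi> B C" using \<kappa>_pos by (auto simp: feasible_def q_def[of x for x])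
  have "objective P\<^sub>\<psi> p \<sigma>2 q = (\<integral>\<^sup>+x. ennreal (\<kappa> / B * (ss x * sqrt (C x))) \<partial>P\<^sub>\<psi>)"
    unfolding objective_def ss_def[symmetric]
    by (intro nn_integral_cong_AE) (use qs_AE qq in \<open>auto elim!: eventually_elim2\<close>)
  also have "\<dots> = ennreal (\<integral>x. \<kappa> / B * (ss x * sqrt (C x)) \<partial>P\<^sub>\<psi>)"
  proof (rule nn_integral_eq_integral)
    show "AE x in P\<^sub>\<psi>. 0 \<le> \<kappa> / B * (ss x * sqrt (C x))"
      using qs_AE by eventually_elim (use \<kappa>_pos B in \<open>auto intro!: mult_nonneg_nonneg\<close>)
  qed (use ss_sqrt_C_integrable in simp)
  also have "(\<integral>x. \<kappa> / B * (ss x * sqrt (C x)) \<partial>P\<^sub>\<psi>) = V_lim"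
    unfolding V_lim_eq integral_mult_right_zero by (simp add: \<kappa>_def[symmetric] power2_eq_square)
  finally show "objective P\<^sub>\<psi> p \<sigma>2 q = ennreal V_lim" .
qed

section \<open>The central limit theorem\<close>

definition ct :: "real^'d \<Rightarrow> real" where "ct x = cmean 1 x - cmean 0 x"
definition bt :: "real^'d \<Rightarrow> real" where "bt x = cmean 1 x / p + cmean 0 x / (1 - p)"
definition \<mu>c :: real where "\<mu>c = (\<integral>x. ct x \<partial>P\<^sub>\<psi>)"
definition vc :: real where "vc = (\<integral>x. (ct x - \<mu>c)\<^sup>2 \<partial>P\<^sub>\<psi>)"

lemma ct_borel [measurable]: "ct \<in> borel_measurable borel" and bt_borel [measurable]: "bt \<in> borel_measurable borel"
  using cmean(1) unfolding ct_def[abs_def] bt_def[abs_def] by measurable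

lemma cmean_L2:
  assumes d: "d \<in> {0, 1}"
  shows "integrable P\<^sub>\<psi> (cmean d)" "integrable P\<^sub>\<psi> (\<lambda>x. (cmean d x)\<^sup>2)"
proof -
  note m = fourth_moment_imp[OF measurable_compose[OF \<psi>1_M cmean(1)] cmean_moment[OF d]]
  have 2: "(\<lambda>x. (cmean d x)\<^sup>2) \<in> borel_measurable borel" using cmean(1)[of d] by measurable
  show "integrable P\<^sub>\<psi> (cmean d)" using m(1) integral_\<psi>(2)[OF cmean(1), of 1 d] by simp
  show "integrable P\<^sub>\<psi> (\<lambda>x. (cmean d x)\<^sup>2)" using m(2) integral_\<psi>(2)[OF 2, of 1] by simp
qed

lemma square_integrable_combination:
  fixes f g :: "real^'d \<Rightarrow> real" and u v :: real
  assumes [measurable]: "f \<in> borel_measurable P\<^sub>\<psi>" "g \<in> borel_measurable P\<^sub>\<psi>"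
    and "integrable P\<^sub>\<psi> (\<lambda>x. (f x)\<^sup>2)" "integrable P\<^sub>\<psi> (\<lambda>x. (g x)\<^sup>2)"
  shows "integrable P\<^sub>\<psi> (\<lambda>x. (u * f x + v * g x)\<^sup>2)"
proof (rule Bochner_Integration.integrable_bound)
  show "integrable P\<^sub>\<psi> (\<lambda>x. 2 * (u\<^sup>2 * (f x)\<^sup>2) + 2 * (v\<^sup>2 * (g x)\<^sup>2))"
    by (intro Bochner_Integration.integrable_add integrable_mult_right assms)
  show "AE x in P\<^sub>\<psi>. norm ((u * f x + v * g x)\<^sup>2) \<le> norm (2 * (u\<^sup>2 * (f x)\<^sup>2) + 2 * (v\<^sup>2 * (g x)\<^sup>2))"
  proof (rule AE_I2)
    fix x
    show "norm ((u * f x + v * g x)\<^sup>2) \<le> norm (2 * (u\<^sup>2 * (f x)\<^sup>2) + 2 * (v\<^sup>2 * (g x)\<^sup>2))"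
      using square_sum_le[of "u * f x" "v * g x"] by (simp add: power_mult_distrib)
  qed
qed measurable

lemma ct_L2: "integrable P\<^sub>\<psi> ct" "integrable P\<^sub>\<psi> (\<lambda>x. (ct x)\<^sup>2)" "integrable P\<^sub>\<psi> (\<lambda>x. (ct x - \<mu>c)\<^sup>2)"
  and bt_L2: "integrable P\<^sub>\<psi> (\<lambda>x. (bt x)\<^sup>2)"
proof -
  have m[measurable]: "cmean d \<in> borel_measurable P\<^sub>\<psi>" for d using cmean(1)[of d] by measurable
  have L1: "integrable P\<^sub>\<psi> (cmean 1)" "integrable P\<^sub>\<psi> (\<lambda>x. (cmean 1 x)\<^sup>2)" by (auto intro: cmean_L2)
  have L0: "integrable P\<^sub>\<psi> (cmean 0)" "integrable P\<^sub>\<psi> (\<lambda>x. (cmean 0 x)\<^sup>2)" by (auto intro: cmean_L2)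
  show "integrable P\<^sub>\<psi> ct" unfolding ct_def[abs_def] using L1 L0 by (intro Bochner_Integration.integrable_diff)
  show c2: "integrable P\<^sub>\<psi> (\<lambda>x. (ct x)\<^sup>2)"
    using square_integrable_combination[OF m m L1(2) L0(2), of 1 "-1"] by (simp add: ct_def)
  show "integrable P\<^sub>\<psi> (\<lambda>x. (ct x - \<mu>c)\<^sup>2)"
    using square_integrable_combination[OF _ _ c2, of "\<lambda>_. 1" 1 "- \<mu>c"] by simp
  show "integrable P\<^sub>\<psi> (\<lambda>x. (bt x)\<^sup>2)"
    using square_integrable_combination[OF m m L1(2) L0(2), of "1 / p" "1 / (1 - p)"] by (simp add: bt_def)
qed

lemma vc_nonneg: "0 \<le> vc"
  unfolding vc_def by (rule integral_nonneg_AE) simp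

lemma \<mu>c_eq: "\<mu>c = (\<integral>\<omega>. Y 1 1 \<omega> - Y 0 1 \<omega> \<partial>M)"
proof -
  have mean: "(\<integral>\<omega>. Y d 1 \<omega> \<partial>M) = (\<integral>x. cmean d x \<partial>P\<^sub>\<psi>)" and int: "integrable M (Y d 1)" if d: "d \<in> {0, 1}" for d
  proof -
    show i: "integrable M (Y d 1)" by (rule fourth_moment_imp(1)[OF Y_M[OF d] Y_moment[OF d]]) simp
    have ci: "integrable M (\<lambda>\<omega>. cmean d (\<psi> 1 \<omega>))"
      by (rule fourth_moment_imp(1)[OF measurable_compose[OF \<psi>1_M cmean(1)] cmean_moment[OF d]])
    have "(\<integral>\<omega>. indicator UNIV (\<psi> 1 \<omega>) * res d (W 1 \<omega>) \<partial>M) = 0"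
      by (rule bspec[OF conjunct2[OF conjunct2[OF centered_res[OF d, unfolded centered_def]]]]) simp
    then have "(\<integral>\<omega>. Y d 1 \<omega> - cmean d (\<psi> 1 \<omega>) \<partial>M) = 0" by (simp add: res_W[OF d])
    then show "(\<integral>\<omega>. Y d 1 \<omega> \<partial>M) = (\<integral>x. cmean d x \<partial>P\<^sub>\<psi>)"
      using i ci integral_\<psi>(1)[OF cmean(1), of 1 d] by (simp add: Bochner_Integration.integral_diff)
  qed
  have "\<mu>c = (\<integral>x. cmean 1 x \<partial>P\<^sub>\<psi>) - (\<integral>x. cmean 0 x \<partial>P\<^sub>\<psi>)"
    unfolding \<mu>c_def ct_def by (rule Bochner_Integration.integral_diff) (auto intro: cmean_L2)
  also have "\<dots> = (\<integral>\<omega>. Y 1 1 \<omega> - Y 0 1 \<omega> \<partial>M)"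
    using mean[of 1] mean[of 0] int[of 1] int[of 0] by (simp add: Bochner_Integration.integral_diff)
  finally show ?thesis .
qed

definition AA :: "nat \<Rightarrow> 'a \<Rightarrow> real" where
  "AA n \<omega> = (\<Sum>i=1..n. (ct (\<psi> i \<omega>) - \<mu>c) / sqrt (real n))"

lemma AA_measurable: "(\<And>i. i \<in> {1..n} \<Longrightarrow> \<psi> i \<in> H \<rightarrow>\<^sub>M borel) \<Longrightarrow> AA n \<in> borel_measurable H"
  unfolding AA_def[abs_def]
  by (intro borel_measurable_sum borel_measurable_divide borel_measurable_diff borel_measurable_const
      measurable_compose[OF _ ct_borel])

lemma AA_M: "AA n \<in> borel_measurable M"
  by (intro AA_measurable components_M(1)) auto

text \<open>The central limit theorem normalizes by the standard deviation, so a constant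
  conditional effect, with \<open>vc\<close> = 0, is treated separately: \<open>AA n\<close> is then
  0 almost everywhere.\<close>

lemma AA_char: "(\<lambda>n. \<integral>\<omega>. iexp (s * AA n \<omega>) \<partial>M) \<longlonglongrightarrow> of_real (exp (- (s\<^sup>2 * vc) / 2))"
proof (cases "vc = 0")
  case True
  have "AE x in P\<^sub>\<psi>. (ct x - \<mu>c)\<^sup>2 = 0"
    using integral_nonneg_eq_0_iff_AE[OF ct_L2(3)] True by (simp add: vc_def)
  then have z: "AE x in P\<^sub>\<psi>. ct x - \<mu>c = 0" by simp
  have "(\<integral>\<omega>. iexp (s * AA n \<omega>) \<partial>M) = 1" for n
  proof -
    have "(\<integral>\<omega>. iexp (s * AA n \<omega>) \<partial>M) = (\<integral>\<omega>. 1 \<partial>M)"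
    proof (rule integral_cong_AE)
      show "AE \<omega> in M. iexp (s * AA n \<omega>) = 1"
        using AE_\<psi>[OF z, of n]
      proof eventually_elim
        case (elim \<omega>)
        have "AA n \<omega> = 0" unfolding AA_def by (rule sum.neutral) (use elim in auto)
        then show ?case by simp
      qed
    qed (use AA_M in measurable)
    then show ?thesis by (simp add: prob_space)
  qed
  then show ?thesis using True by simp
next
  case False
  then have vc: "vc > 0" using vc_nonneg by simp
  define X where "X i \<omega> = ct (\<psi> (Suc i) \<omega>)" for i \<omega>
  have XM: "X i \<in> borel_measurable M" for i unfolding X_def[abs_def] by (intro \<psi>_M ct_borel) simp
  have indep: "indep_vars (\<lambda>_. borel) X UNIV"
  proof -
    have "indep_vars (\<lambda>_. borel) (\<lambda>i \<omega>. ct (\<psi> i \<omega>)) {1..}"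

      using indep_vars_compose2[OF W_indep, of "\<lambda>_ w. ct (fst w)"] fst_measurable[OF ct_borel] by (simp only: \<psi>_W[symmetric])
    from indep_vars_Suc[OF this] show ?thesis by (simp add: X_def[abs_def])
  qed
  have mean: "expectation (X i) = \<mu>c" for i
    unfolding X_def[abs_def] \<mu>c_def by (rule integral_\<psi>(1)) auto
  have distr: "distr M borel (X i) = distr P\<^sub>\<psi> borel ct" for i
  proof -
    have "distr P\<^sub>\<psi> borel ct = distr (distr M borel (\<psi> (Suc i))) borel ct" by (simp add: distr_\<psi>)
    also have "\<dots> = distr M borel (X i)"
      using components_M(1)[of "Suc i"] by (subst distr_distr) (auto simp: X_def[abs_def] o_def)
    finally show ?thesis ..
  qed
  have "weak_conv_m (\<lambda>n. distr M borel (\<lambda>x. (\<Sum>i<n. X i x - \<mu>c) / sqrt (n * (sqrt vc)\<^sup>2))) std_normal_distribution"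
  proof (rule central_limit_theorem[OF indep mean _ _ _ distr])
    show "sqrt vc > 0" using vc by simp
    show "integrable M (\<lambda>x. (X i x)\<^sup>2)" for i
      using integral_\<psi>(2)[of "\<lambda>x. (ct x)\<^sup>2" "Suc i"] ct_L2(2) by (simp add: X_def)
    show "variance (X i) = (sqrt vc)\<^sup>2" for i
      using integral_\<psi>(1)[of "\<lambda>x. (ct x - \<mu>c)\<^sup>2" "Suc i"] vc unfolding mean by (simp add: X_def vc_def)
  qed
  note conv = this
  have m: "(\<lambda>\<omega>. (\<Sum>i<n. X i \<omega> - \<mu>c) / sqrt (n * (sqrt vc)\<^sup>2)) \<in> borel_measurable M" for n
    by (intro borel_measurable_divide borel_measurable_sum borel_measurable_diff XM borel_measurable_const)
  have "(\<lambda>n. char (distr M borel (\<lambda>x. (\<Sum>i<n. X i x - \<mu>c) / sqrt (n * (sqrt vc)\<^sup>2))) (s * sqrt vc)) \<longlonglongrightarrow>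
      char std_normal_distribution (s * sqrt vc)"
    by (rule levy_continuity1[OF real_distribution_distr[OF m] real_dist_normal_dist conv])
  moreover have "char (distr M borel (\<lambda>x. (\<Sum>i<n. X i x - \<mu>c) / sqrt (n * (sqrt vc)\<^sup>2))) (s * sqrt vc) =
      (\<integral>\<omega>. iexp (s * AA n \<omega>) \<partial>M)" for n
  proof -
    have eq: "s * sqrt vc * ((\<Sum>i<n. X i \<omega> - \<mu>c) / sqrt (n * (sqrt vc)\<^sup>2)) = s * AA n \<omega>" for \<omega>
    proof -
      have "(\<Sum>i<n. X i \<omega> - \<mu>c) = (\<Sum>i=1..n. ct (\<psi> i \<omega>) - \<mu>c)"
        unfolding X_def by (rule sum.reindex_bij_witness[of _ "\<lambda>i. i - 1" Suc]) auto
      then show ?thesis using vc by (simp add: AA_def sum_divide_distrib[symmetric] real_sqrt_mult)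
    qed
    show ?thesis unfolding char_def by (subst integral_distr[OF m], simp) (simp only: eq)
  qed
  ultimately show ?thesis using vc by (simp add: char_std_normal_distribution power_mult_distrib)
qed

section \<open>The weighted residual sum and its Gaussian replacement\<close>

definition w1 :: "nat \<Rightarrow> nat set \<Rightarrow> nat \<Rightarrow> 'a \<Rightarrow> real" where
  "w1 n d i \<omega> = of_bool (i \<in> d) / (qt n i \<omega> * p)"
definition w0 :: "nat \<Rightarrow> nat set \<Rightarrow> nat \<Rightarrow> 'a \<Rightarrow> real" where
  "w0 n d i \<omega> = of_bool (i \<in> d) / (qt n i \<omega> * (1 - p))"
text \<open>The design enters as explicit arguments \<open>t\<close> and \<open>d\<close>, so that
  it can be frozen. Each term is written as a sum of products of a design weight and a residual, the
  form to which orthogonality applies; at most one of the two products is nonzero.\<close>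

definition XX :: "nat \<Rightarrow> nat set \<Rightarrow> nat set \<Rightarrow> nat \<Rightarrow> 'a \<Rightarrow> real" where
  "XX n t d i \<omega> = 1 / sqrt (real n) * w1 n d i \<omega> * res 1 (W i \<omega>) + (- 1 / sqrt (real n) * w0 n (t - d) i \<omega>) * res 0 (W i \<omega>)"
definition K\<^sub>w :: real where "K\<^sub>w = 1 / (\<delta> * p) + 1 / (\<delta> * (1 - p))"

lemma K\<^sub>w_nonneg: "0 \<le> K\<^sub>w"
  using \<delta> p(2,3) by (simp add: K\<^sub>w_def)

lemma w_bounds: "0 \<le> w1 n d i \<omega>" "w1 n d i \<omega> \<le> K\<^sub>w" "0 \<le> w0 n d i \<omega>" "w0 n d i \<omega> \<le> K\<^sub>w"
proof -
  have a: "0 \<le> 1 / (\<delta> * p)" "0 \<le> 1 / (\<delta> * (1 - p))" using \<delta> p(2,3) by auto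
  note q = qt_pos[of n i \<omega>] qt_ge[of n i \<omega>]
  show nn: "0 \<le> w1 n d i \<omega>" "0 \<le> w0 n d i \<omega>" using q p(2,3) by (auto simp: w1_def w0_def)
  have b: "1 / (qt n i \<omega> * p) \<le> 1 / (\<delta> * p)" "1 / (qt n i \<omega> * (1 - p)) \<le> 1 / (\<delta> * (1 - p))"
    using q p(2,3) \<delta> by (intro divide_left_mono mult_right_mono mult_pos_pos; simp)+
  have "w1 n d i \<omega> \<le> 1 / (\<delta> * p)"
  proof (cases "i \<in> d")
    case True
    then have "w1 n d i \<omega> = 1 / (qt n i \<omega> * p)" by (simp add: w1_def)
    then show ?thesis using b by linarith
  next
    case False
    then have "w1 n d i \<omega> = 0" by (simp add: w1_def)
    then show ?thesis using a by linarith
  qed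
  moreover have "w0 n d i \<omega> \<le> 1 / (\<delta> * (1 - p))"
  proof (cases "i \<in> d")
    case True
    then have "w0 n d i \<omega> = 1 / (qt n i \<omega> * (1 - p))" by (simp add: w0_def)
    then show ?thesis using b by linarith
  next
    case False
    then have "w0 n d i \<omega> = 0" by (simp add: w0_def)
    then show ?thesis using a by linarith
  qed
  ultimately show "w1 n d i \<omega> \<le> K\<^sub>w" "w0 n d i \<omega> \<le> K\<^sub>w" using a unfolding K\<^sub>w_def by linarith+
qed

lemma vv_eq: "vv n t d i \<omega> = 1 / real n * ((w1 n d i \<omega>)\<^sup>2 * sb 1 (\<psi> i \<omega>) + (w0 n (t - d) i \<omega>)\<^sup>2 * sb 0 (\<psi> i \<omega>))"
  by (simp add: vv_def w1_def w0_def)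

lemma w_measurable: "qt n i \<in> borel_measurable H \<Longrightarrow> w1 n d i \<in> borel_measurable H"
  "qt n i \<in> borel_measurable H \<Longrightarrow> w0 n d i \<in> borel_measurable H"
  unfolding w1_def[abs_def] w0_def[abs_def]
      by (intro borel_measurable_divide borel_measurable_times borel_measurable_const; assumption)+

lemma XX_measurable: "qt n i \<in> borel_measurable H \<Longrightarrow> W i \<in> H \<rightarrow>\<^sub>M borel \<Longrightarrow> XX n t d i \<in> borel_measurable H"
  unfolding XX_def[abs_def]
  by (intro borel_measurable_add borel_measurable_times borel_measurable_const w_measurable
      measurable_compose[OF _ res_borel])

lemma vv_measurable: "qt n i \<in> borel_measurable H \<Longrightarrow> \<psi> i \<in> H \<rightarrow>\<^sub>M borel \<Longrightarrow> vv n t d i \<in> borel_measurable H"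
  unfolding vv_eq[abs_def]
  by (intro borel_measurable_add borel_measurable_times borel_measurable_power borel_measurable_const w_measurable
      measurable_compose[OF _ sb_borel]) auto

lemma XX_M: "i \<ge> 1 \<Longrightarrow> (\<lambda>\<omega>. XX n (treated n \<omega>) (assigned n \<omega>) i \<omega>) \<in> borel_measurable M"
  by (rule measurable_design[where Z="\<lambda>t d. XX n t d i"], rule XX_measurable[OF qt_M W_M])

lemma vv_M: "i \<ge> 1 \<Longrightarrow> (\<lambda>\<omega>. vv n (treated n \<omega>) (assigned n \<omega>) i \<omega>) \<in> borel_measurable M"
  by (rule measurable_design[where Z="\<lambda>t d. vv n t d i"], rule vv_measurable[OF qt_M components_M(1)])

lemma vv_nonneg: "0 \<le> vv n t d i \<omega>"
  unfolding vv_def using sb_bounds by (intro mult_nonneg_nonneg add_nonneg_nonneg) auto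

lemma vv_le: "vv n t d i \<omega> \<le> (2 * K\<^sub>w\<^sup>2 * S\<^sub>m\<^sup>2) / real n"
proof -
  have "(w1 n d i \<omega>)\<^sup>2 * sb 1 (\<psi> i \<omega>) \<le> K\<^sub>w\<^sup>2 * S\<^sub>m\<^sup>2" "(w0 n (t - d) i \<omega>)\<^sup>2 * sb 0 (\<psi> i \<omega>) \<le> K\<^sub>w\<^sup>2 * S\<^sub>m\<^sup>2"
    using w_bounds sb_bounds K\<^sub>w_nonneg by (intro mult_mono power_mono; simp)+
  then show ?thesis unfolding vv_eq by (simp add: divide_right_mono)
qed

lemma qt_leave_out: "j \<in> {1..n} \<Longrightarrow> i \<in> {1..n} \<Longrightarrow> qt n i \<in> borel_measurable (leave_out n j)"
  by (intro qt_measurable sub_XP measurable_leave_out) (auto simp: leave_out_facts)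

definition S3 :: real where
  "S3 = (\<integral>\<omega>. \<bar>res 1 (W 1 \<omega>)\<bar> ^ 3 \<partial>M) + (\<integral>\<omega>. \<bar>res 0 (W 1 \<omega>)\<bar> ^ 3 \<partial>M)"

text \<open>The design weights are bounded by \<open>K\<^sub>w\<close>, so only the residual
  contributes to the moment. The factor n to the power -3/2 leaves n to the power -1/2 after
  summation over the sample.\<close>

lemma XX_third_moment:
  assumes j: "j \<in> {1..n}"
  shows "integrable M (\<lambda>\<omega>. \<bar>XX n (treated n \<omega>) (assigned n \<omega>) j \<omega>\<bar> ^ 3)"
    "(\<integral>\<omega>. \<bar>XX n (treated n \<omega>) (assigned n \<omega>) j \<omega>\<bar> ^ 3 \<partial>M) \<le> (K\<^sub>w / sqrt (real n)) ^ 3 * S3"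
    "(\<lambda>\<omega>. XX n (treated n \<omega>) (assigned n \<omega>) j \<omega>) \<in> borel_measurable M"
proof -
  have j1: "j \<ge> 1" using j by simp
  show XM[measurable]: "(\<lambda>\<omega>. XX n (treated n \<omega>) (assigned n \<omega>) j \<omega>) \<in> borel_measurable M"
    by (rule XX_M[OF j1])
  define F where "F \<omega> = (K\<^sub>w / sqrt (real n)) ^ 3 * (\<bar>res 1 (W j \<omega>)\<bar> ^ 3 + \<bar>res 0 (W j \<omega>)\<bar> ^ 3)" for \<omega>
  have r3: "integrable M (\<lambda>\<omega>. \<bar>res d (W j \<omega>)\<bar> ^ 3)" "(\<integral>\<omega>. \<bar>res d (W j \<omega>)\<bar> ^ 3 \<partial>M) = (\<integral>\<omega>. \<bar>res d (W 1 \<omega>)\<bar> ^ 3 \<partial>M)"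
      if "d \<in> {0, 1}" for d
    using integral_W[of "\<lambda>w. \<bar>res d w\<bar> ^ 3" j] res_integrable(3)[OF that] j1 by auto
  have Fi: "integrable M F" unfolding F_def using r3(1)[of 1] r3(1)[of 0] by simp
  have FS: "(\<integral>\<omega>. F \<omega> \<partial>M) = (K\<^sub>w / sqrt (real n)) ^ 3 * S3"
    unfolding F_def S3_def integral_mult_right_zero using r3[of 1] r3[of 0] by (subst Bochner_Integration.integral_add) auto
  have le: "\<bar>XX n t d j \<omega>\<bar> ^ 3 \<le> F \<omega>" for t d \<omega>
  proof -
    have K0: "0 \<le> K\<^sub>w / sqrt (real n)" using K\<^sub>w_nonneg by simp
    have w: "\<bar>1 / sqrt (real n) * w1 n d j \<omega>\<bar> \<le> K\<^sub>w / sqrt (real n)" "\<bar>- 1 / sqrt (real n) * w0 n (t - d) j \<omega>\<bar> \<le>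
        K\<^sub>w / sqrt (real n)"
      using w_bounds[of n d j \<omega>] w_bounds[of n "t - d" j \<omega>] by (auto simp: abs_mult divide_right_mono)
    have pw: "\<bar>a * r\<bar> ^ 3 \<le> (K\<^sub>w / sqrt (real n)) ^ 3 * \<bar>r\<bar> ^ 3" if "\<bar>a\<bar> \<le> K\<^sub>w / sqrt (real n)" for a r :: real
      unfolding abs_mult power_mult_distrib by (intro mult_right_mono power_mono that) auto
    have r0: "0 \<le> (K\<^sub>w / sqrt (real n)) ^ 3 * \<bar>res d (W j \<omega>)\<bar> ^ 3" for d using K0 by simp
    show ?thesis
    proof (cases "j \<in> d")
      case True
      then have "XX n t d j \<omega> = 1 / sqrt (real n) * w1 n d j \<omega> * res 1 (W j \<omega>)" by (simp add: XX_def w0_def)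
      then show ?thesis using pw[OF w(1), of "res 1 (W j \<omega>)"] r0[of 0] by (simp add: F_def distrib_left)
    next
      case False
      then have "XX n t d j \<omega> = (- 1 / sqrt (real n) * w0 n (t - d) j \<omega>) * res 0 (W j \<omega>)" by (simp add: XX_def w1_def)
      then have "\<bar>XX n t d j \<omega>\<bar> ^ 3 \<le> (K\<^sub>w / sqrt (real n)) ^ 3 * \<bar>res 0 (W j \<omega>)\<bar> ^ 3"
        using pw[OF w(2), of "res 0 (W j \<omega>)"] by simp
      then show ?thesis using r0[of 1] by (simp add: F_def distrib_left)
    qed
  qed
  have F0: "0 \<le> F \<omega>" for \<omega> using le[of "{}" "{}" \<omega>] order.trans[OF _ le[of "{}" "{}" \<omega>]] by auto
  show i: "integrable M (\<lambda>\<omega>. \<bar>XX n (treated n \<omega>) (assigned n \<omega>) j \<omega>\<bar> ^ 3)"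
    by (rule Bochner_Integration.integrable_bound[OF Fi]) (use le F0 in auto)
  have "(\<integral>\<omega>. \<bar>XX n (treated n \<omega>) (assigned n \<omega>) j \<omega>\<bar> ^ 3 \<partial>M) \<le> (\<integral>\<omega>. F \<omega> \<partial>M)"
    by (rule integral_mono[OF i Fi le])
  then show "(\<integral>\<omega>. \<bar>XX n (treated n \<omega>) (assigned n \<omega>) j \<omega>\<bar> ^ 3 \<partial>M) \<le> (K\<^sub>w / sqrt (real n)) ^ 3 * S3"
    unfolding FS .
qed

text \<open>Instance of \<open>char_telescope\<close>; the point is its orthogonality hypothesis.
  With the design frozen, the prefix \<open>P\<close> contains residuals of units before j and
  otherwise only covariates and propensities, so it is measurable for
  \<open>leave_out n j\<close>.\<close>

lemma S_compare:
  assumes n: "n \<ge> 1"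
  shows "norm ((\<integral>\<omega>. iexp (s * AA n \<omega>) * iexp (s * (\<Sum>i=1..n. XX n (treated n \<omega>) (assigned n \<omega>) i \<omega>)) \<partial>M) -
      (\<integral>\<omega>. iexp (s * AA n \<omega>) * of_real (exp (- (s\<^sup>2 / 2) * (\<Sum>i=1..n. vv n (treated n \<omega>) (assigned n \<omega>) i \<omega>))) \<partial>M))
    \<le> \<bar>s\<bar> ^ 3 / 6 * K\<^sub>w ^ 3 * S3 / sqrt (real n) + s ^ 4 / 8 * (2 * K\<^sub>w\<^sup>2 * S\<^sub>m\<^sup>2)\<^sup>2 / real n"
    (is "?L \<le> _")
proof -
  define X where "X j \<omega> = XX n (treated n \<omega>) (assigned n \<omega>) j \<omega>" for j \<omega>
  define v where "v j \<omega> = vv n (treated n \<omega>) (assigned n \<omega>) j \<omega>" for j \<omega>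
  define P where "P j t d \<omega> = iexp (s * AA n \<omega>) * iexp (s * (\<Sum>i=1..<j. XX n t d i \<omega>)) *
    of_real (exp (- (s\<^sup>2 / 2) * (\<Sum>i=Suc j..n. vv n t d i \<omega>)))" for j t d \<omega>
  have vM: "v j \<in> borel_measurable M" if "j \<in> {1..n}" for j
    unfolding v_def[abs_def] using that by (intro vv_M) simp
  have v2: "(v j \<omega>)\<^sup>2 \<le> ((2 * K\<^sub>w\<^sup>2 * S\<^sub>m\<^sup>2) / real n)\<^sup>2" for j \<omega>
    unfolding v_def by (intro power_mono vv_le vv_nonneg)
  have v2i: "integrable M (\<lambda>\<omega>. (v j \<omega>)\<^sup>2)" if "j \<in> {1..n}" for j
    by (rule integrable_const_bound[where B="((2 * K\<^sub>w\<^sup>2 * S\<^sub>m\<^sup>2) / real n)\<^sup>2"]) (use v2 vM[OF that] in auto)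
  have PH: "P j t d \<in> borel_measurable (leave_out n j)" if j: "j \<in> {1..n}" for j t d
  proof -
    have [measurable]: "AA n \<in> borel_measurable (leave_out n j)" by (intro AA_measurable measurable_leave_out(2)[OF j])
    have [measurable]: "(\<lambda>\<omega>. \<Sum>i=1..<j. XX n t d i \<omega>) \<in> borel_measurable (leave_out n j)"
      using j by (intro borel_measurable_sum XX_measurable qt_leave_out[OF j] measurable_leave_out(1)[OF j]) auto
    have [measurable]: "(\<lambda>\<omega>. \<Sum>i=Suc j..n. vv n t d i \<omega>) \<in> borel_measurable (leave_out n j)"
      using j by (intro borel_measurable_sum vv_measurable qt_leave_out[OF j] measurable_leave_out(2)[OF j]) auto
    show ?thesis unfolding P_def by measurable
  qed
  have Pb: "norm (P j t d \<omega>) \<le> 1" for j t d \<omega>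
  proof -
    have "norm (P j t d \<omega>) = exp (- (s\<^sup>2 / 2) * (\<Sum>i=Suc j..n. vv n t d i \<omega>))"
      unfolding P_def norm_mult by (simp add: norm_exp_i_times)
    also have "\<dots> \<le> 1" by (simp add: zero_le_mult_iff sum_nonneg vv_nonneg)
    finally show ?thesis .
  qed
  have sq0: "0 \<le> 1 / sqrt (real n)" "1 / sqrt (real n) \<le> 1" using n by auto
  have dn: "0 \<le> 1 / real n" "1 / real n \<le> 1" using n by auto
  \<comment> \<open>\<open>g\<close> stands for a bounded design weight of unit j and
    \<open>u\<close> for a centered function of its data; both the summand and its square minus the
    conditional variance are sums of two such products.\<close>
  have orth: "(\<integral>\<omega>. P j (treated n \<omega>) (assigned n \<omega>) \<omega> * of_real (g (treated n \<omega>) (assigned n \<omega>) \<omega>) * of_real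
      (u (W j \<omega>)) \<partial>M) = 0"
    "integrable M (\<lambda>\<omega>. P j (treated n \<omega>) (assigned n \<omega>) \<omega> * of_real (g (treated n \<omega>) (assigned n \<omega>) \<omega>) * of_real
        (u (W j \<omega>)))"
    if j: "j \<in> {1..n}" and u: "centered u" and g: "\<And>t d. g t d \<in> borel_measurable (leave_out n j)" "\<And>t d \<omega>. \<bar>g t d \<omega>\<bar> \<le> K"
    for j u g K
  proof -
    have m: "(\<lambda>\<omega>. P j t d \<omega> * of_real (g t d \<omega>)) \<in> borel_measurable (leave_out n j)" for t d
      by (intro borel_measurable_times PH[OF j] measurable_compose[OF g(1) borel_measurable_of_real])
    have b: "norm (P j t d \<omega> * of_real (g t d \<omega>)) \<le> K" for t d \<omega>
    proof -
      have "norm (P j t d \<omega>) * \<bar>g t d \<omega>\<bar> \<le> 1 * K" using g(2) Pb by (intro mult_mono) auto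
      then show ?thesis by (simp add: norm_mult)
    qed
    from orthogonal_design[OF u j, of "\<lambda>t d \<omega>. P j t d \<omega> * of_real (g t d \<omega>)", OF m b]
    show "(\<integral>\<omega>. P j (treated n \<omega>) (assigned n \<omega>) \<omega> * of_real (g (treated n \<omega>) (assigned n \<omega>) \<omega>) * of_real (u (W j \<omega>)) \<partial>M) = 0"
      "integrable M (\<lambda>\<omega>. P j (treated n \<omega>) (assigned n \<omega>) \<omega> * of_real (g (treated n \<omega>) (assigned n \<omega>) \<omega>) * of_real
          (u (W j \<omega>)))"
      by auto
  qed
  have c1: "centered (res 1)" and c0: "centered (res 0)" by (auto intro: centered_res)
  have s1: "centered (\<lambda>w. (res 1 w)\<^sup>2 - sb 1 (fst w))" and s0: "centered (\<lambda>w. (res 0 w)\<^sup>2 - sb 0 (fst w))"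
    by (auto intro!: centered_res_square sb_borel sb_eq)
  have "?L \<le> (\<Sum>j=1..n. \<bar>s\<bar> ^ 3 / 6 * (\<integral>\<omega>. \<bar>X j \<omega>\<bar> ^ 3 \<partial>M) + s ^ 4 / 8 * (\<integral>\<omega>. (v j \<omega>)\<^sup>2 \<partial>M))"
    unfolding X_def[symmetric] v_def[symmetric]
  proof (rule char_telescope)
    show "X j \<in> borel_measurable M" "integrable M (\<lambda>\<omega>. \<bar>X j \<omega>\<bar> ^ 3)" if "j \<in> {1..n}" for j
      unfolding X_def[abs_def] using XX_third_moment[OF that] by auto
    show "v j \<in> borel_measurable M" "integrable M (\<lambda>\<omega>. (v j \<omega>)\<^sup>2)" if "j \<in> {1..n}" for j
      using vM v2i that by auto
    show "0 \<le> v j \<omega>" for j \<omega> by (simp add: v_def vv_nonneg)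
    show "(\<lambda>\<omega>. iexp (s * AA n \<omega>)) \<in> borel_measurable M" using AA_M by measurable
    show "norm (iexp (s * AA n \<omega>)) \<le> 1" for \<omega> by (simp add: norm_exp_i_times)
    fix j assume j: "j \<in> {1..n}"
    have PP: "iexp (s * AA n \<omega>) * iexp (s * (\<Sum>i=1..<j. X i \<omega>)) * of_real (exp (- (s\<^sup>2 / 2) * (\<Sum>i=Suc j..n. v i \<omega>))) =
        P j (treated n \<omega>) (assigned n \<omega>) \<omega>" for \<omega> by (simp add: P_def X_def v_def)
    define g1 where "g1 t d \<omega> = 1 / sqrt (real n) * w1 n d j \<omega>" for t d :: "nat set" and \<omega>
    define g0 where "g0 t d \<omega> = - 1 / sqrt (real n) * w0 n (t - d) j \<omega>" for t d :: "nat set" and \<omega>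
    define h1 where "h1 t d \<omega> = 1 / real n * (w1 n d j \<omega>)\<^sup>2" for t d :: "nat set" and \<omega>
    define h0 where "h0 t d \<omega> = 1 / real n * (w0 n (t - d) j \<omega>)\<^sup>2" for t d :: "nat set" and \<omega>
    have qj: "qt n j \<in> borel_measurable (leave_out n j)" by (rule qt_leave_out[OF j j])
    have gm: "g1 t d \<in> borel_measurable (leave_out n j)" "g0 t d \<in> borel_measurable (leave_out n j)"
      "h1 t d \<in> borel_measurable (leave_out n j)" "h0 t d \<in> borel_measurable (leave_out n j)" for t d
      unfolding g1_def[abs_def] g0_def[abs_def] h1_def[abs_def] h0_def[abs_def]
      by (intro borel_measurable_times borel_measurable_power borel_measurable_const w_measurable qj)+
    have gb: "\<bar>g1 t d \<omega>\<bar> \<le> 1 * K\<^sub>w" "\<bar>g0 t d \<omega>\<bar> \<le> 1 * K\<^sub>w" "\<bar>h1 t d \<omega>\<bar> \<le> 1 * K\<^sub>w\<^sup>2" "\<bar>h0 t d \<omega>\<bar> \<le> 1 * K\<^sub>w\<^sup>2" for t d \<omega>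
      unfolding g1_def g0_def h1_def h0_def abs_mult using w_bounds sq0 dn K\<^sub>w_nonneg
      by (intro mult_mono; simp add: power_mono)+
    note o1 = orth[of j _ g1, OF j c1 gm(1) gb(1)] and o0 = orth[of j _ g0, OF j c0 gm(2) gb(2)]
    note q1 = orth[of j _ h1, OF j s1 gm(3) gb(3)] and q0 = orth[of j _ h0, OF j s0 gm(4) gb(4)]
    have X1: "P j (treated n \<omega>) (assigned n \<omega>) \<omega> * of_real (X j \<omega>) =
      P j (treated n \<omega>) (assigned n \<omega>) \<omega> * of_real (g1 (treated n \<omega>) (assigned n \<omega>) \<omega>) * of_real (res 1 (W j \<omega>)) +
      P j (treated n \<omega>) (assigned n \<omega>) \<omega> * of_real (g0 (treated n \<omega>) (assigned n \<omega>) \<omega>) * of_real (res 0 (W j \<omega>))" for \<omega>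
      unfolding X_def XX_def g1_def g0_def by (simp only: of_real_add of_real_mult distrib_left mult.assoc)
    show "(\<integral>\<omega>. iexp (s * AA n \<omega>) * iexp (s * (\<Sum>i=1..<j. X i \<omega>)) * of_real (exp (- (s\<^sup>2 / 2) * (\<Sum>i=Suc j..n. v i \<omega>))) *
        of_real (X j \<omega>) \<partial>M) = 0"
      unfolding PP X1 by (rule trans[OF Bochner_Integration.integral_add[OF o1(2) o0(2)]]) (simp only: o1(1) o0(1) add_0)
    have X2: "(X j \<omega>)\<^sup>2 - v j \<omega> = h1 (treated n \<omega>) (assigned n \<omega>) \<omega> * ((res 1 (W j \<omega>))\<^sup>2 - sb 1 (fst (W j \<omega>))) +
        h0 (treated n \<omega>) (assigned n \<omega>) \<omega> * ((res 0 (W j \<omega>))\<^sup>2 - sb 0 (fst (W j \<omega>)))" for \<omega>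
    proof -
      \<comment> \<open>A unit has at most one of the two weights, so squaring produces no product
        of the two residuals, whose conditional covariance is unknown.\<close>
      have "w1 n (assigned n \<omega>) j \<omega> * w0 n (treated n \<omega> - assigned n \<omega>) j \<omega> = 0" by (simp add: w1_def w0_def)
      then have "(X j \<omega>)\<^sup>2 = 1 / real n * ((w1 n (assigned n \<omega>) j \<omega>)\<^sup>2 * (res 1 (W j \<omega>))\<^sup>2 +
          (w0 n (treated n \<omega> - assigned n \<omega>) j \<omega>)\<^sup>2 * (res 0 (W j \<omega>))\<^sup>2)"
        by (auto simp: X_def XX_def power_mult_distrib power_divide)
      then show ?thesis unfolding v_def vv_eq h1_def h0_def \<psi>_W[of j \<omega>, symmetric]
          by (simp add: algebra_simps diff_divide_distrib)
    qed
    have X2': "P j (treated n \<omega>) (assigned n \<omega>) \<omega> * of_real ((X j \<omega>)\<^sup>2 - v j \<omega>) =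
      P j (treated n \<omega>) (assigned n \<omega>) \<omega> * of_real (h1 (treated n \<omega>) (assigned n \<omega>) \<omega>) * of_real ((res 1 (W j \<omega>))\<^sup>2 - sb 1
          (fst (W j \<omega>))) +
      P j (treated n \<omega>) (assigned n \<omega>) \<omega> * of_real (h0 (treated n \<omega>) (assigned n \<omega>) \<omega>) * of_real ((res 0 (W j \<omega>))\<^sup>2 - sb 0
          (fst (W j \<omega>)))" for \<omega>
      unfolding X2 by (simp only: of_real_add of_real_mult distrib_left mult.assoc)
    show "(\<integral>\<omega>. iexp (s * AA n \<omega>) * iexp (s * (\<Sum>i=1..<j. X i \<omega>)) * of_real (exp (- (s\<^sup>2 / 2) * (\<Sum>i=Suc j..n. v i \<omega>))) *
        of_real ((X j \<omega>)\<^sup>2 - v j \<omega>) \<partial>M) = 0"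
      unfolding PP X2' by (rule trans[OF Bochner_Integration.integral_add[OF q1(2) q0(2)]]) (simp only: q1(1) q0(1) add_0)
  qed
  also have "\<dots> \<le> (\<Sum>j=1..n. \<bar>s\<bar> ^ 3 / 6 * ((K\<^sub>w / sqrt (real n)) ^ 3 * S3) + s ^ 4 / 8 * ((2 * K\<^sub>w\<^sup>2 * S\<^sub>m\<^sup>2) / real n)\<^sup>2)"
  proof (rule sum_mono, intro add_mono mult_left_mono)
    fix j assume j: "j \<in> {1..n}"
    show "(\<integral>\<omega>. \<bar>X j \<omega>\<bar> ^ 3 \<partial>M) \<le> (K\<^sub>w / sqrt (real n)) ^ 3 * S3" unfolding X_def by (rule XX_third_moment(2)[OF j])
    show "(\<integral>\<omega>. (v j \<omega>)\<^sup>2 \<partial>M) \<le> ((2 * K\<^sub>w\<^sup>2 * S\<^sub>m\<^sup>2) / real n)\<^sup>2"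
      by (rule integral_le_const[OF v2i[OF j]]) (use v2 in simp)
  qed auto
  also have "\<dots> = \<bar>s\<bar> ^ 3 / 6 * K\<^sub>w ^ 3 * S3 / sqrt (real n) + s ^ 4 / 8 * (2 * K\<^sub>w\<^sup>2 * S\<^sub>m\<^sup>2)\<^sup>2 / real n"
  proof -
    have a: "real n / (sqrt (real n)) ^ 3 = 1 / sqrt (real n)" using n by (simp add: power3_eq_cube)
    have b: "real n / (real n)\<^sup>2 = 1 / real n" using n by (simp add: power2_eq_square)
    have "(\<Sum>j=1..n. \<bar>s\<bar> ^ 3 / 6 * ((K\<^sub>w / sqrt (real n)) ^ 3 * S3) + s ^ 4 / 8 * ((2 * K\<^sub>w\<^sup>2 * S\<^sub>m\<^sup>2) / real n)\<^sup>2) =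
      (\<bar>s\<bar> ^ 3 / 6 * K\<^sub>w ^ 3 * S3) * (real n / (sqrt (real n)) ^ 3) + (s ^ 4 / 8 * (2 * K\<^sub>w\<^sup>2 * S\<^sub>m\<^sup>2)\<^sup>2) *
          (real n / (real n)\<^sup>2)"
      by (simp add: power_divide distrib_left mult_ac)
    then show ?thesis unfolding a b by simp
  qed
  finally show ?thesis .
qed

section \<open>Decomposition of the estimator and its characteristic function\<close>

definition RR :: "nat \<Rightarrow> 'a \<Rightarrow> real" where
  "RR n \<omega> = (\<Sum>i=1..n. ct (\<psi> i \<omega>) / qt n i \<omega> / sqrt (real n) * (of_bool (T n i \<omega>) - q\<^sub>n n \<omega> (\<psi> i \<omega>))) +
     (\<Sum>i\<in>{i \<in> {1..n}. T n i \<omega>}. bt (\<psi> i \<omega>) / qt n i \<omega> / sqrt (real n) * (of_bool (D n i \<omega>) - p))"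

lemma RR_vanishes: "vanishes M RR"
  unfolding RR_def by (intro vanishes_add T_term_vanishes D_term_vanishes ct_borel bt_borel ct_L2 bt_L2)

text \<open>In either arm the inverse-probability score of a sampled unit is c + b * (D - p) plus a
  weighted residual, and this determines b: the two arms give m1 / p = c + b * (1 - p) and - m0 / (1
  - p) = c - b * p, both solved by m1 / p + m0 / (1 - p).\<close>

lemma estimator_decomposition:
  assumes n: "n \<ge> 1"
  shows "AE \<omega> in M. sqrt (real n) * (theta_hat p \<psi> Y q\<^sub>n T D n \<omega> - \<mu>c) =
    AA n \<omega> + (\<Sum>i=1..n. XX n (treated n \<omega>) (assigned n \<omega>) i \<omega>) + RR n \<omega>"
  using qt_eq[of n]
proof eventually_elim
  case (elim \<omega>)
  define r where "r = sqrt (real n)"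
  have r: "r > 0" "r * r = real n" using n by (auto simp: r_def)
  define h where "h i = of_bool (T n i \<omega>) / q\<^sub>n n \<omega> (\<psi> i \<omega>) *
        (of_bool (D n i \<omega>) * observed Y T D n i \<omega> / p -
         (1 - of_bool (D n i \<omega>)) * observed Y T D n i \<omega> / (1 - p))" for i
  have each: "1 / r * (h i - \<mu>c) = (ct (\<psi> i \<omega>) - \<mu>c) / r + XX n (treated n \<omega>) (assigned n \<omega>) i \<omega> +
      ct (\<psi> i \<omega>) / qt n i \<omega> / r * (of_bool (T n i \<omega>) - q\<^sub>n n \<omega> (\<psi> i \<omega>)) +
      of_bool (T n i \<omega>) * (bt (\<psi> i \<omega>) / qt n i \<omega> / r * (of_bool (D n i \<omega>) - p))" if i: "i \<in> {1..n}" for i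
  proof -
    define Q where "Q = qt n i \<omega>"
    have Q: "q\<^sub>n n \<omega> (\<psi> i \<omega>) = Q" "Q > 0" using bspec[OF elim i] qt_pos[of n i \<omega>] by (auto simp: Q_def)
    have td: "i \<in> assigned n \<omega> \<longleftrightarrow> T n i \<omega> \<and> D n i \<omega>" "i \<in> treated n \<omega> - assigned n \<omega> \<longleftrightarrow> T n i \<omega> \<and> \<not> D n i \<omega>"
      using i by (auto simp: assigned_def treated_def)
    have e1: "res 1 (W i \<omega>) = Y 1 i \<omega> - cmean 1 (\<psi> i \<omega>)" and e0: "res 0 (W i \<omega>) = Y 0 i \<omega> - cmean 0 (\<psi> i \<omega>)"
      by (auto intro: res_W)
    have XXr: "XX n (treated n \<omega>) (assigned n \<omega>) i \<omega> = 1 / r * (of_bool (T n i \<omega> \<and> D n i \<omega>) / (Q * p)) * (Y 1 i \<omega> - cmean 1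
        (\<psi> i \<omega>)) +
       (- 1 / r * (of_bool (T n i \<omega> \<and> \<not> D n i \<omega>) / (Q * (1 - p)))) * (Y 0 i \<omega> - cmean 0 (\<psi> i \<omega>))"
      unfolding XX_def w1_def w0_def e1 e0 td r_def Q_def ..
    define m1 m0 y1 y0 where "m1 = cmean 1 (\<psi> i \<omega>)" and "m0 = cmean 0 (\<psi> i \<omega>)" and "y1 = Y 1 i \<omega>" and "y0 = Y 0 i \<omega>"
    have p1: "p \<noteq> 0" "1 - p \<noteq> 0" using p(2,3) by auto
    note m = m1_def[symmetric] m0_def[symmetric] y1_def[symmetric] y0_def[symmetric]
    define b where "b = m1 / p + m0 / (1 - p)"
    \<comment> \<open>For a sampled unit, u / Q = u + u * (1 - Q) / Q: the effect itself goes to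
      \<open>AA\<close>, the excess is the sampling imbalance.\<close>
    have alg: "1 / r * (1 / Q * (u + v + e) - \<mu>c) = (u - \<mu>c) * (1 / r) + 1 / r * (1 / Q) * e +
        u * (1 / Q) * (1 / r) * (1 - Q) + v * (1 / Q) * (1 / r)" for u v e
    proof -
      have "1 / Q * Q = 1" using Q(2) by simp
      then show ?thesis by algebra
    qed
    have cr: "(ct (\<psi> i \<omega>) - \<mu>c) / r = ((m1 - m0) - \<mu>c) * (1 / r)" by (simp add: ct_def m1_def m0_def)
    consider "\<not> T n i \<omega>" | "T n i \<omega>" "D n i \<omega>" | "T n i \<omega>" "\<not> D n i \<omega>" by blast
    then show ?thesis
    proof cases
      case 1
      then show ?thesis unfolding XXr h_def ct_def Q(1) Q_def[symmetric] m using r(1) Q(2) by (simp add: field_simps)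
    next
      case 2
      have y: "y1 / p = (m1 - m0) + b * (1 - p) + (y1 - m1) / p" using p1 by (simp add: b_def field_simps)
      have "1 / r * (h i - \<mu>c) = 1 / r * (1 / Q * (y1 / p) - \<mu>c)"
        using 2 by (simp add: h_def Q(1) observed_def y1_def)
      moreover have "XX n (treated n \<omega>) (assigned n \<omega>) i \<omega> = 1 / r * (1 / Q) * ((y1 - m1) / p)"
        unfolding XXr using 2 by (simp add: y1_def m1_def)
      moreover have "ct (\<psi> i \<omega>) / qt n i \<omega> / r * (of_bool (T n i \<omega>) - q\<^sub>n n \<omega> (\<psi> i \<omega>)) =
          (m1 - m0) * (1 / Q) * (1 / r) * (1 - Q)"
        unfolding Q(1) Q_def[symmetric] using 2 by (simp add: ct_def m1_def m0_def)
      moreover have "of_bool (T n i \<omega>) * (bt (\<psi> i \<omega>) / qt n i \<omega> / r * (of_bool (D n i \<omega>) - p)) =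
          (b * (1 - p)) * (1 / Q) * (1 / r)"
        unfolding Q_def[symmetric] using 2 by (simp add: bt_def b_def m1_def m0_def)
      ultimately show ?thesis unfolding cr y by (simp only: alg)
    next
      case 3
      have "- (m0 / (1 - p)) = (m1 - m0) + b * (0 - p)" using p1 by (simp add: b_def field_simps)
      then have y: "- (y0 / (1 - p)) = (m1 - m0) + b * (0 - p) + (- ((y0 - m0) / (1 - p)))"
        by (simp add: diff_divide_distrib)
      have "1 / r * (h i - \<mu>c) = 1 / r * (1 / Q * (- (y0 / (1 - p))) - \<mu>c)"
        using 3 by (simp add: h_def Q(1) observed_def y0_def)
      moreover have "XX n (treated n \<omega>) (assigned n \<omega>) i \<omega> = 1 / r * (1 / Q) * (- ((y0 - m0) / (1 - p)))"
        unfolding XXr using 3 by (simp add: y0_def m0_def)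
      moreover have "ct (\<psi> i \<omega>) / qt n i \<omega> / r * (of_bool (T n i \<omega>) - q\<^sub>n n \<omega> (\<psi> i \<omega>)) =
          (m1 - m0) * (1 / Q) * (1 / r) * (1 - Q)"
        unfolding Q(1) Q_def[symmetric] using 3 by (simp add: ct_def m1_def m0_def)
      moreover have "of_bool (T n i \<omega>) * (bt (\<psi> i \<omega>) / qt n i \<omega> / r * (of_bool (D n i \<omega>) - p)) =
          (b * (0 - p)) * (1 / Q) * (1 / r)"
        unfolding Q_def[symmetric] using 3 by (simp add: bt_def b_def m1_def m0_def)
      ultimately show ?thesis unfolding cr y by (simp only: alg)
    qed
  qed
  have "r * (theta_hat p \<psi> Y q\<^sub>n T D n \<omega> - \<mu>c) = (\<Sum>i=1..n. 1 / r * (h i - \<mu>c))"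
  proof -
    have "theta_hat p \<psi> Y q\<^sub>n T D n \<omega> = 1 / real n * (\<Sum>i=1..n. h i)" by (simp add: theta_hat_def h_def)
    then have "r * (theta_hat p \<psi> Y q\<^sub>n T D n \<omega> - \<mu>c) = r * (1 / real n * (\<Sum>i=1..n. h i - \<mu>c))"
      using n by (simp add: sum_subtractf right_diff_distrib)
    also have "\<dots> = 1 / r * (\<Sum>i=1..n. h i - \<mu>c)" using r by (simp flip: r(2))
    finally show ?thesis by (simp only: sum_distrib_left)
  qed
  also have "\<dots> = (\<Sum>i=1..n. (ct (\<psi> i \<omega>) - \<mu>c) / r + XX n (treated n \<omega>) (assigned n \<omega>) i \<omega> +
      ct (\<psi> i \<omega>) / qt n i \<omega> / r * (of_bool (T n i \<omega>) - q\<^sub>n n \<omega> (\<psi> i \<omega>)) +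
      of_bool (T n i \<omega>) * (bt (\<psi> i \<omega>) / qt n i \<omega> / r * (of_bool (D n i \<omega>) - p)))"
    by (rule sum.cong[OF refl each])
  also have "\<dots> = AA n \<omega> + (\<Sum>i=1..n. XX n (treated n \<omega>) (assigned n \<omega>) i \<omega>) + RR n \<omega>"
  proof -
    have "(\<Sum>i\<in>{i \<in> {1..n}. T n i \<omega>}. bt (\<psi> i \<omega>) / qt n i \<omega> / r * (of_bool (D n i \<omega>) - p)) =
       (\<Sum>i=1..n. of_bool (T n i \<omega>) * (bt (\<psi> i \<omega>) / qt n i \<omega> / r * (of_bool (D n i \<omega>) - p)))"
      unfolding sum.inter_filter[OF finite_atLeastAtMost] by (intro sum.cong refl) simp
    then show ?thesis unfolding sum.distrib AA_def RR_def r_def[symmetric] by simp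
  qed
  finally show ?case by (simp add: r_def)
qed

lemma theta_hat_M: "theta_hat p \<psi> Y q\<^sub>n T D n \<in> borel_measurable M"
proof -
  have [measurable]: "T n i \<in> M \<rightarrow>\<^sub>M count_space UNIV" "D n i \<in> M \<rightarrow>\<^sub>M count_space UNIV" "Y 0 i \<in> borel_measurable M"
    "Y 1 i \<in> borel_measurable M" "(\<lambda>\<omega>. q\<^sub>n n \<omega> (\<psi> i \<omega>)) \<in> borel_measurable M" if "i \<in> {1..n}" for i
  proof -
    have i1: "i \<ge> 1" using that by simp
    show "T n i \<in> M \<rightarrow>\<^sub>M count_space UNIV" "D n i \<in> M \<rightarrow>\<^sub>M count_space UNIV" "Y 0 i \<in> borel_measurable M"
      "Y 1 i \<in> borel_measurable M" "(\<lambda>\<omega>. q\<^sub>n n \<omega> (\<psi> i \<omega>)) \<in> borel_measurable M"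
      by (rule T_M[OF that], rule D_M[OF that], rule components_M(2)[OF i1], rule components_M(3)[OF i1], rule qn_M[OF i1])
  qed
  show ?thesis unfolding theta_hat_def[abs_def] observed_def
    by (intro borel_measurable_times borel_measurable_const borel_measurable_sum) measurable
qed

text \<open>\<open>AA\<close> and the conditional variance both depend on the covariates, so the
  factor with \<open>AA\<close> stays inside the expectation through all comparisons. Only once the
  variance has been replaced by a constant can the Gaussian factor be taken out and the limit of
  \<open>AA\<close> used alone; the two variances then add in the exponent.\<close>

theorem estimator_char:
  "(\<lambda>n. \<integral>\<omega>. iexp (s * (sqrt (real n) * (theta_hat p \<psi> Y q\<^sub>n T D n \<omega> - \<mu>c))) \<partial>M) \<longlonglongrightarrow> of_real (exp (- (s\<^sup>2 * (vc + V_lim)) / 2))"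
proof -
  define \<Theta> where "\<Theta> n \<omega> = sqrt (real n) * (theta_hat p \<psi> Y q\<^sub>n T D n \<omega> - \<mu>c)" for n \<omega>
  define S where "S n \<omega> = (\<Sum>i=1..n. XX n (treated n \<omega>) (assigned n \<omega>) i \<omega>)" for n \<omega>
  define V where "V n \<omega> = (\<Sum>i=1..n. vv n (treated n \<omega>) (assigned n \<omega>) i \<omega>)" for n \<omega>
  have \<Theta>M[measurable]: "\<Theta> n \<in> borel_measurable M" for n unfolding \<Theta>_def[abs_def] using theta_hat_M by measurable
  have SM[measurable]: "S n \<in> borel_measurable M" for n
    unfolding S_def[abs_def] by (intro borel_measurable_sum XX_third_moment(3))
  have VM[measurable]: "V n \<in> borel_measurable M" for n
    unfolding V_def[abs_def] by (intro borel_measurable_sum vv_M) simp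
  note [measurable] = AA_M vanishes_measurable[OF RR_vanishes]
  have V0: "0 \<le> V n \<omega>" for n \<omega> unfolding V_def by (intro sum_nonneg vv_nonneg)
  have int: "integrable M f" if "f \<in> borel_measurable M" "\<And>\<omega>. norm (f \<omega>) \<le> 1" for f :: "'a \<Rightarrow> complex"
    by (rule integrable_const_bound[where B=1]) (use that in auto)
  have i1: "integrable M (\<lambda>\<omega>. iexp (s * \<Theta> n \<omega>))" for n by (rule int) (auto simp: norm_exp_i_times)
  have i2: "integrable M (\<lambda>\<omega>. iexp (s * AA n \<omega>) * iexp (s * S n \<omega>))" for n
    by (rule int) (auto simp: norm_exp_i_times norm_mult)
  have i3: "integrable M (\<lambda>\<omega>. iexp (s * AA n \<omega>) * of_real (exp (- (s\<^sup>2 / 2) * V n \<omega>)))" for n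
    by (rule int) (auto simp: norm_exp_i_times norm_mult V0)
  have i4: "integrable M (\<lambda>\<omega>. iexp (s * AA n \<omega>) * of_real (exp (- (s\<^sup>2 / 2) * V_lim)))" for n
    by (rule int) (use V_lim_pos in \<open>auto simp: norm_exp_i_times norm_mult\<close>)
  have d1: "(\<lambda>n. (\<integral>\<omega>. iexp (s * \<Theta> n \<omega>) \<partial>M) - (\<integral>\<omega>. iexp (s * AA n \<omega>) * iexp (s * S n \<omega>) \<partial>M)) \<longlonglongrightarrow> 0"
  proof (rule Lim_null_comparison)
    \<comment> \<open>The modulus of \<open>iexp x - 1\<close> is at most both 2 and |x|; the first
      bound makes convergence in probability of \<open>RR\<close> sufficient.\<close>
    define \<rho> where "\<rho> n \<omega> = min 2 (\<bar>s\<bar> * \<bar>RR n \<omega>\<bar>)" for n \<omega>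
    have \<rho>: "vanishes M \<rho>"
    proof (rule vanishes_mono[OF _ vanishes_cmult[OF RR_vanishes, of s]])
      show "\<rho> n \<in> borel_measurable M" for n unfolding \<rho>_def[abs_def] by measurable
      show "\<forall>\<^sub>F n in sequentially. AE \<omega> in M. \<bar>\<rho> n \<omega>\<bar> \<le> \<bar>s * RR n \<omega>\<bar>"
        by (rule always_eventually, rule allI, rule AE_I2) (auto simp: \<rho>_def abs_mult)
    qed
    then show "(\<lambda>n. \<integral>\<omega>. \<bar>\<rho> n \<omega>\<bar> \<partial>M) \<longlonglongrightarrow> 0"
      by (rule vanishes_bounded_L1[where K=2]) (auto simp: \<rho>_def)
    show "\<forall>\<^sub>F n in sequentially. norm ((\<integral>\<omega>. iexp (s * \<Theta> n \<omega>) \<partial>M) - (\<integral>\<omega>. iexp (s * AA n \<omega>) * iexp (s * S n \<omega>) \<partial>M)) \<le>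
        (\<integral>\<omega>. \<bar>\<rho> n \<omega>\<bar> \<partial>M)"
      using eventually_ge_at_top[of 1]
    proof eventually_elim
      case (elim n)
      have "norm ((\<integral>\<omega>. iexp (s * \<Theta> n \<omega>) \<partial>M) - (\<integral>\<omega>. iexp (s * AA n \<omega>) * iexp (s * S n \<omega>) \<partial>M)) =
          norm (\<integral>\<omega>. iexp (s * \<Theta> n \<omega>) - iexp (s * AA n \<omega>) * iexp (s * S n \<omega>) \<partial>M)"
        using i1 i2 by simp
      also have "\<dots> \<le> (\<integral>\<omega>. norm (iexp (s * \<Theta> n \<omega>) - iexp (s * AA n \<omega>) * iexp (s * S n \<omega>)) \<partial>M)" by (rule integral_norm_bound)
      also have "\<dots> \<le> (\<integral>\<omega>. \<bar>\<rho> n \<omega>\<bar> \<partial>M)"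
      proof (rule integral_mono_AE)
        show "integrable M (\<lambda>\<omega>. norm (iexp (s * \<Theta> n \<omega>) - iexp (s * AA n \<omega>) * iexp (s * S n \<omega>)))" using i1 i2 by simp
        have [measurable]: "\<rho> n \<in> borel_measurable M" by (rule vanishes_measurable[OF \<rho>])
        show "integrable M (\<lambda>\<omega>. \<bar>\<rho> n \<omega>\<bar>)" by (rule integrable_const_bound[where B=2]) (auto simp: \<rho>_def[of n])
        show "AE \<omega> in M. norm (iexp (s * \<Theta> n \<omega>) - iexp (s * AA n \<omega>) * iexp (s * S n \<omega>)) \<le> \<bar>\<rho> n \<omega>\<bar>"
          using estimator_decomposition[OF elim]
        proof eventually_elim
          case (elim \<omega>)
          then have "\<Theta> n \<omega> = AA n \<omega> + S n \<omega> + RR n \<omega>" by (simp add: \<Theta>_def S_def)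
          then have "iexp (s * \<Theta> n \<omega>) = iexp (s * AA n \<omega>) * iexp (s * S n \<omega>) * iexp (s * RR n \<omega>)"
            by (simp add: distrib_left exp_add)
          then have "iexp (s * \<Theta> n \<omega>) - iexp (s * AA n \<omega>) * iexp (s * S n \<omega>) = iexp (s * AA n \<omega>) * iexp (s * S n \<omega>) *
              (iexp (s * RR n \<omega>) - 1)"
            by (simp add: right_diff_distrib)
          then have "norm (iexp (s * \<Theta> n \<omega>) - iexp (s * AA n \<omega>) * iexp (s * S n \<omega>)) = norm (iexp (s * RR n \<omega>) - 1)"
            by (simp add: norm_mult norm_exp_i_times)
          also have "\<dots> \<le> \<bar>\<rho> n \<omega>\<bar>"
            using iexp_approx1[of "s * RR n \<omega>" 0] iexp_approx2[of "s * RR n \<omega>" 0] by (simp add: \<rho>_def abs_mult)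
          finally show ?case .
        qed
      qed
      finally show ?case .
    qed
  qed
  have d2: "(\<lambda>n. (\<integral>\<omega>. iexp (s * AA n \<omega>) * iexp (s * S n \<omega>) \<partial>M) - (\<integral>\<omega>. iexp (s * AA n \<omega>) * of_real (exp (- (s\<^sup>2 / 2) * V n \<omega>))
      \<partial>M)) \<longlonglongrightarrow> 0"
  proof (rule Lim_null_comparison)
    show "\<forall>\<^sub>F n in sequentially. norm ((\<integral>\<omega>. iexp (s * AA n \<omega>) * iexp (s * S n \<omega>) \<partial>M) - (\<integral>\<omega>. iexp (s * AA n \<omega>) * of_real
        (exp (- (s\<^sup>2 / 2) * V n \<omega>)) \<partial>M))
      \<le> \<bar>s\<bar> ^ 3 / 6 * K\<^sub>w ^ 3 * S3 / sqrt (real n) + s ^ 4 / 8 * (2 * K\<^sub>w\<^sup>2 * S\<^sub>m\<^sup>2)\<^sup>2 / real n"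
      using eventually_ge_at_top[of 1] by eventually_elim (unfold S_def V_def, rule S_compare)
    have sq: "filterlim (\<lambda>n. sqrt (real n)) at_top sequentially"
      by (rule filterlim_compose[OF sqrt_at_top filterlim_real_sequentially])
    have "(\<lambda>n. \<bar>s\<bar> ^ 3 / 6 * K\<^sub>w ^ 3 * S3 / sqrt (real n) + s ^ 4 / 8 * (2 * K\<^sub>w\<^sup>2 * S\<^sub>m\<^sup>2)\<^sup>2 / real n) \<longlonglongrightarrow> 0 + 0"
      by (intro tendsto_add lim_const_over_n tendsto_divide_0[OF tendsto_const] filterlim_at_top_imp_at_infinity[OF sq])
    then show "(\<lambda>n. \<bar>s\<bar> ^ 3 / 6 * K\<^sub>w ^ 3 * S3 / sqrt (real n) + s ^ 4 / 8 * (2 * K\<^sub>w\<^sup>2 * S\<^sub>m\<^sup>2)\<^sup>2 / real n) \<longlonglongrightarrow> 0" by simp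
  qed
  have d3: "(\<lambda>n. (\<integral>\<omega>. iexp (s * AA n \<omega>) * of_real (exp (- (s\<^sup>2 / 2) * V n \<omega>)) \<partial>M) - (\<integral>\<omega>. iexp (s * AA n \<omega>) * of_real
      (exp (- (s\<^sup>2 / 2) * V_lim)) \<partial>M)) \<longlonglongrightarrow> 0"
  proof (rule Lim_null_comparison)
    define \<rho> where "\<rho> n \<omega> = exp (- (s\<^sup>2 / 2) * V n \<omega>) - exp (- (s\<^sup>2 / 2) * V_lim)" for n \<omega>
    \<comment> \<open>On nonnegative arguments exp (- a) is Lipschitz with constant 1, so the error
      in the variance bounds the error in the factor.\<close>
    have lip: "\<bar>exp (- a) - exp (- b)\<bar> \<le> \<bar>a - b\<bar>" if ab: "0 \<le> a" "0 \<le> b" for a b :: real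
    proof -
      have *: "exp (- a) - exp (- b) \<le> b - a" if "a \<le> b" "0 \<le> a" for a b :: real
      proof -
        have "exp (- b) = exp (- a) * exp (a - b)" by (simp flip: exp_add)
        moreover have "1 + (a - b) \<le> exp (a - b)" by (rule exp_ge_add_one_self)
        ultimately have "exp (- a) - exp (- b) \<le> exp (- a) * (b - a)"
          using mult_left_mono[of "1 + (a - b)" "exp (a - b)" "exp (- a)"] by (simp add: algebra_simps)
        also have "\<dots> \<le> 1 * (b - a)" using that by (intro mult_right_mono) auto
        finally show ?thesis by simp
      qed
      show ?thesis
      proof (cases "a \<le> b")
        case True
        then show ?thesis using *[OF True ab(1)] by simp
      next
        case False
        then show ?thesis using *[of b a] ab by simp
      qed
    qed
    have \<rho>M[measurable]: "\<rho> n \<in> borel_measurable M" for n unfolding \<rho>_def[abs_def] by measurable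
    have \<rho>: "vanishes M \<rho>"
    proof (rule vanishes_mono[OF \<rho>M vanishes_cmult[OF V_consistent, of "s\<^sup>2 / 2"]], rule always_eventually,
        rule allI, rule AE_I2)
      fix n \<omega>
      have "\<bar>\<rho> n \<omega>\<bar> \<le> \<bar>s\<^sup>2 / 2 * V n \<omega> - s\<^sup>2 / 2 * V_lim\<bar>"
        using lip[of "s\<^sup>2 / 2 * V n \<omega>" "s\<^sup>2 / 2 * V_lim"] V0[of n \<omega>] V_lim_pos by (simp add: \<rho>_def)
      then show "\<bar>\<rho> n \<omega>\<bar> \<le> \<bar>s\<^sup>2 / 2 * ((\<Sum>i=1..n. vv n (treated n \<omega>) (assigned n \<omega>) i \<omega>) - V_lim)\<bar>"
        by (simp only: V_def right_diff_distrib)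
    qed
    have \<rho>1: "\<bar>\<rho> n \<omega>\<bar> \<le> 1" for n \<omega>
    proof -
      have "0 \<le> s\<^sup>2 / 2 * V n \<omega>" "0 \<le> s\<^sup>2 / 2 * V_lim" using V0[of n \<omega>] V_lim_pos by auto
      then have "0 < exp (- (s\<^sup>2 / 2) * V n \<omega>)" "exp (- (s\<^sup>2 / 2) * V n \<omega>) \<le> 1" "0 < exp (- (s\<^sup>2 / 2) * V_lim)"
          "exp (- (s\<^sup>2 / 2) * V_lim) \<le> 1"
        by auto
      then show ?thesis unfolding \<rho>_def by linarith
    qed
    show "(\<lambda>n. \<integral>\<omega>. \<bar>\<rho> n \<omega>\<bar> \<partial>M) \<longlonglongrightarrow> 0"
      by (rule vanishes_bounded_L1[OF \<rho>, of 1]) (use \<rho>1 in simp)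
    show "\<forall>\<^sub>F n in sequentially. norm ((\<integral>\<omega>. iexp (s * AA n \<omega>) * of_real (exp (- (s\<^sup>2 / 2) * V n \<omega>)) \<partial>M) - (\<integral>\<omega>.
        iexp (s * AA n \<omega>) * of_real (exp (- (s\<^sup>2 / 2) * V_lim)) \<partial>M)) \<le> (\<integral>\<omega>. \<bar>\<rho> n \<omega>\<bar> \<partial>M)"
    proof (rule always_eventually, rule allI)
      fix n
      have eq: "iexp (s * AA n \<omega>) * of_real (exp (- (s\<^sup>2 / 2) * V n \<omega>)) - iexp (s * AA n \<omega>) * of_real
          (exp (- (s\<^sup>2 / 2) * V_lim)) =
          iexp (s * AA n \<omega>) * of_real (\<rho> n \<omega>)" for \<omega>
        by (simp only: \<rho>_def of_real_diff right_diff_distrib)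
      have "norm (\<integral>\<omega>. iexp (s * AA n \<omega>) * of_real (\<rho> n \<omega>) \<partial>M) \<le> (\<integral>\<omega>. norm (iexp (s * AA n \<omega>) * of_real (\<rho> n \<omega>)) \<partial>M)"
        by (rule integral_norm_bound)
      also have "\<dots> = (\<integral>\<omega>. \<bar>\<rho> n \<omega>\<bar> \<partial>M)" by (simp add: norm_mult norm_exp_i_times)
      finally show "norm ((\<integral>\<omega>. iexp (s * AA n \<omega>) * of_real (exp (- (s\<^sup>2 / 2) * V n \<omega>)) \<partial>M) - (\<integral>\<omega>. iexp (s * AA n \<omega>) * of_real
          (exp (- (s\<^sup>2 / 2) * V_lim)) \<partial>M)) \<le> (\<integral>\<omega>. \<bar>\<rho> n \<omega>\<bar> \<partial>M)"
        unfolding Bochner_Integration.integral_diff[OF i3 i4, symmetric] eq .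
    qed
  qed
  have d4: "(\<lambda>n. \<integral>\<omega>. iexp (s * AA n \<omega>) * of_real (exp (- (s\<^sup>2 / 2) * V_lim)) \<partial>M) \<longlonglongrightarrow>
      of_real (exp (- (s\<^sup>2 * vc) / 2)) * of_real (exp (- (s\<^sup>2 / 2) * V_lim))"
    unfolding integral_mult_left_zero by (intro tendsto_mult AA_char tendsto_const)
  have "complex_of_real (exp (- (s\<^sup>2 * vc) / 2)) * of_real (exp (- (s\<^sup>2 / 2) * V_lim)) =
      of_real (exp (- (s\<^sup>2 * (vc + V_lim)) / 2))"
    unfolding of_real_mult[symmetric] exp_add[symmetric] by (intro arg_cong[where f="\<lambda>x. of_real (exp x)"])
        (simp add: field_simps)
  with tendsto_add[OF d1 tendsto_add[OF d2 tendsto_add[OF d3 d4]]]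
  show ?thesis unfolding \<Theta>_def[symmetric] by simp
qed

section \<open>Versions of the conditional effect and weak convergence\<close>

lemma ct_unique: "AE x in P\<^sub>\<psi>. c x = ct x"
proof -
  interpret G: finite_measure_subalgebra M "sigma_of M (\<psi> 1) borel" by (rule subalg_\<psi>1)
  have cb[measurable]: "c \<in> borel_measurable borel" and
    ce: "AE \<omega> in M. real_cond_exp M (sigma_of M (\<psi> 1) borel) (\<lambda>\<omega>. Y 1 1 \<omega> - Y 0 1 \<omega>) \<omega> = c (\<psi> 1 \<omega>)"
    using c by (auto simp: is_cond_mean_def)
  have i: "integrable M (Y d 1)" if "d \<in> {0, 1}" for d
    by (rule fourth_moment_imp(1)[OF Y_M[OF that] Y_moment[OF that]]) simp
  have "AE \<omega> in M. real_cond_exp M (sigma_of M (\<psi> 1) borel) (\<lambda>\<omega>. Y 1 1 \<omega> - Y 0 1 \<omega>) \<omega> =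
      real_cond_exp M (sigma_of M (\<psi> 1) borel) (Y 1 1) \<omega> - real_cond_exp M (sigma_of M (\<psi> 1) borel) (Y 0 1) \<omega>"
    by (rule G.real_cond_exp_diff; rule i; simp)
  with ce AE_space have "AE \<omega> in M. c (\<psi> 1 \<omega>) = ct (\<psi> 1 \<omega>)"
    by eventually_elim (simp only: ct_def cmean(2))
  then show ?thesis unfolding P\<psi> by (subst AE_distr_iff[OF \<psi>1_M]) auto
qed

lemma vc_eq: "vc = (\<integral>x. (c x - (\<integral>z. c z \<partial>P\<^sub>\<psi>))\<^sup>2 \<partial>P\<^sub>\<psi>)"
proof -
  have [measurable]: "c \<in> borel_measurable borel" using c by (simp add: is_cond_mean_def)
  have m: "(\<integral>z. c z \<partial>P\<^sub>\<psi>) = \<mu>c" unfolding \<mu>c_def by (rule integral_cong_AE) (use ct_unique in auto)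
  show ?thesis unfolding vc_def m by (rule integral_cong_AE) (use ct_unique in \<open>auto elim: eventually_mono\<close>)
qed

theorem estimator_weak_conv:
  "weak_conv_m
     (\<lambda>n. distr M borel (\<lambda>\<omega>. sqrt (real n) * (theta_hat p \<psi> Y q\<^sub>n T D n \<omega> - \<mu>c)))
     (density lborel (normal_density 0 (sqrt (vc + V_lim))))"
proof (rule levy_continuity)
  have pos: "vc + V_lim > 0" using vc_nonneg V_lim_pos by simp
  have m: "(\<lambda>\<omega>. sqrt (real n) * (theta_hat p \<psi> Y q\<^sub>n T D n \<omega> - \<mu>c)) \<in> borel_measurable M" for n
    using theta_hat_M by measurable
  show "real_distribution (distr M borel (\<lambda>\<omega>. sqrt (real n) * (theta_hat p \<psi> Y q\<^sub>n T D n \<omega> - \<mu>c)))" for n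
    using m by (rule real_distribution_distr)
  show "real_distribution (density lborel (normal_density 0 (sqrt (vc + V_lim))))"
    unfolding real_distribution_def real_distribution_axioms_def
    using prob_space_normal_density[of "sqrt (vc + V_lim)" 0] pos by auto
  fix s :: real
  have "char (distr M borel (\<lambda>\<omega>. sqrt (real n) * (theta_hat p \<psi> Y q\<^sub>n T D n \<omega> - \<mu>c))) s =
      (\<integral>\<omega>. iexp (s * (sqrt (real n) * (theta_hat p \<psi> Y q\<^sub>n T D n \<omega> - \<mu>c))) \<partial>M)" for n
    unfolding char_def by (subst integral_distr[OF m]) auto
  then show "(\<lambda>n. char (distr M borel (\<lambda>\<omega>. sqrt (real n) * (theta_hat p \<psi> Y q\<^sub>n T D n \<omega> - \<mu>c))) s) \<longlonglongrightarrow>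
      char (density lborel (normal_density 0 (sqrt (vc + V_lim)))) s"
    using estimator_char[of s] pos by (subst char_normal_distribution) (simp_all add: mult.commute)
qed

end

theorem theorem5p3:
  fixes M :: "'a measure"
    and NP :: "nat \<Rightarrow> 'b measure" and NX :: "nat \<Rightarrow> 'c measure"
    and \<psi> :: "nat \<Rightarrow> 'a \<Rightarrow> real^'d"
    and Y :: "nat \<Rightarrow> nat \<Rightarrow> 'a \<Rightarrow> real"
    and W :: "nat \<Rightarrow> 'a \<Rightarrow> (real^'d) \<times> real \<times> real"
    and \<pi> :: "nat \<Rightarrow> 'a \<Rightarrow> 'b" and \<xi> :: "nat \<Rightarrow> 'a \<Rightarrow> 'c"
    and p B \<alpha> \<delta> C\<^sub>l C\<^sub>u :: real and p_num p_den :: nat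
    and C c :: "real^'d \<Rightarrow> real"
    and \<sigma>2 :: "nat \<Rightarrow> real^'d \<Rightarrow> real"
    and \<sigma>2_hat :: "nat \<Rightarrow> 'a \<Rightarrow> nat \<Rightarrow> real^'d \<Rightarrow> real"
    and q\<^sub>n :: "nat \<Rightarrow> 'a \<Rightarrow> real^'d \<Rightarrow> real"
    and L :: "nat \<Rightarrow> 'a \<Rightarrow> nat" and a k :: "nat \<Rightarrow> 'a \<Rightarrow> nat \<Rightarrow> nat"
    and k_bar L_bar :: "nat \<Rightarrow> nat"
    and T D :: "nat \<Rightarrow> nat \<Rightarrow> 'a \<Rightarrow> bool"
    and P\<^sub>\<psi> :: "(real^'d) measure"
    and ATE V_min V_star :: real
  assumes M: "prob_space M"
    \<comment> \<open>i.i.d. units\<close>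
    and W: "W = (\<lambda>i \<omega>. (\<psi> i \<omega>, Y 0 i \<omega>, Y 1 i \<omega>))"
    and W_indep: "prob_space.indep_vars M (\<lambda>_. borel) W {1..}"
    and W_ident: "\<And>i. i \<ge> 1 \<Longrightarrow> distr M borel (W i) = distr M borel (W 1)"
    and P\<psi>: "P\<^sub>\<psi> = distr M borel (\<psi> 1)"
    \<comment> \<open>tie-breaking randomness and external data\<close>
    and indep: "\<And>n. mutually_indep3 M (upto_n W n) (borel_vec n) (\<pi> n) (NP n) (\<xi> n) (NX n)"
    \<comment> \<open>constants, budget and cost\<close>
    and p: "p = real p_num / real p_den" "0 < p" "p < 1"
    and B: "0 < B"
    and C: "C \<in> borel_measurable borel"
    \<comment> \<open>conditional variances and conditional treatment effect\<close>
    and \<sigma>2: "\<And>d. d \<in> {0, 1} \<Longrightarrow> is_cond_var M (\<psi> 1) (Y d 1) (\<sigma>2 d)"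
    and c: "is_cond_mean M (\<psi> 1) (\<lambda>\<omega>. Y 1 1 \<omega> - Y 0 1 \<omega>) c"
    \<comment> \<open>variance estimates, computed from the external data\<close>
    and \<sigma>2_hat: "\<And>n d. d \<in> {0, 1} \<Longrightarrow>
          (\<lambda>(\<omega>, x). \<sigma>2_hat n \<omega> d x) \<in> borel_measurable (sigma_of M (\<xi> n) (NX n) \<Otimes>\<^sub>M borel)"
    and \<sigma>2_hat_nonneg: "\<And>n d \<omega> x. d \<in> {0, 1} \<Longrightarrow> \<omega> \<in> space M \<Longrightarrow> \<sigma>2_hat n \<omega> d x \<ge> 0"
    \<comment> \<open>discretized propensity, determined by the external data and the covariates\<close>
    and q\<^sub>n: "\<And>n. (\<lambda>(\<omega>, x). q\<^sub>n n \<omega> x) \<in> borel_measurable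
          (sigma_of M (\<lambda>\<omega>. (\<xi> n \<omega>, upto_n \<psi> n \<omega>)) (NX n \<Otimes>\<^sub>M borel_vec n) \<Otimes>\<^sub>M borel)"
    and L: "\<And>n. L n \<in>
          sigma_of M (\<lambda>\<omega>. (\<xi> n \<omega>, upto_n \<psi> n \<omega>)) (NX n \<Otimes>\<^sub>M borel_vec n) \<rightarrow>\<^sub>M count_space UNIV"
    and a: "\<And>n l. (\<lambda>\<omega>. a n \<omega> l) \<in>
          sigma_of M (\<lambda>\<omega>. (\<xi> n \<omega>, upto_n \<psi> n \<omega>)) (NX n \<Otimes>\<^sub>M borel_vec n) \<rightarrow>\<^sub>M count_space UNIV"
    and k: "\<And>n l. (\<lambda>\<omega>. k n \<omega> l) \<in>
          sigma_of M (\<lambda>\<omega>. (\<xi> n \<omega>, upto_n \<psi> n \<omega>)) (NX n \<Otimes>\<^sub>M borel_vec n) \<rightarrow>\<^sub>M count_space UNIV"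
    and k_pos: "\<And>n \<omega> l. \<omega> \<in> space M \<Longrightarrow> l \<in> {1..L n \<omega>} \<Longrightarrow> 0 < k n \<omega> l"
    and q\<^sub>n_levels: "\<And>n \<omega> x. n \<ge> 1 \<Longrightarrow> \<omega> \<in> space M \<Longrightarrow>
          q\<^sub>n n \<omega> x \<in> {real (a n \<omega> l) / real (k n \<omega> l) | l. l \<in> {1..L n \<omega>}}"
    and k_bar: "\<And>n \<omega> l. \<omega> \<in> space M \<Longrightarrow> l \<in> {1..L n \<omega>} \<Longrightarrow> k n \<omega> l \<le> k_bar n"
    and L_bar: "\<And>n \<omega>. \<omega> \<in> space M \<Longrightarrow> L n \<omega> \<le> L_bar n"
    \<comment> \<open>(i)\<close>
    and T: "loc_sampling M NP NX \<psi> W \<pi> \<xi> q\<^sub>n L a k T"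
    and D: "loc_assignment M NP NX \<psi> W \<pi> \<xi> T p_num p_den D"
    \<comment> \<open>(ii)\<close>
    and Y_moment: "\<And>d. d \<in> {0, 1} \<Longrightarrow> integrable M (\<lambda>\<omega>. (Y d 1 \<omega>) ^ 4)"
    and \<alpha>: "\<alpha> > real CARD('d) + 1"
    and \<psi>_moment: "integrable M (\<lambda>\<omega>. norm (\<psi> 1 \<omega>) powr \<alpha>)"
    and \<sigma>2_inf: "\<And>d. d \<in> {0, 1} \<Longrightarrow> \<exists>\<epsilon>>0. AE x in P\<^sub>\<psi>. \<epsilon> \<le> \<sigma>2 d x"
    and \<delta>: "\<delta> > 0"
    and q\<^sub>n_bounds: "\<And>n. AE \<omega> in M. \<forall>i\<in>{1..n}. \<delta> < q\<^sub>n n \<omega> (\<psi> i \<omega>) \<and> q\<^sub>n n \<omega> (\<psi> i \<omega>) \<le> 1"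
    and q_star_bounds: "AE x in P\<^sub>\<psi>. \<delta> < q_star P\<^sub>\<psi> B p C \<sigma>2 x \<and> q_star P\<^sub>\<psi> B p C \<sigma>2 x \<le> 1"
    and C_bounds: "0 < C\<^sub>l" "AE x in P\<^sub>\<psi>. C\<^sub>l \<le> C x \<and> C x \<le> C\<^sub>u"
    \<comment> \<open>(iii)\<close>
    and \<sigma>2_hat_consistent: "\<And>d. d \<in> {0, 1} \<Longrightarrow>
          op1 M (\<lambda>n \<omega>. \<integral>\<^sup>+x. ennreal ((\<sigma>2_hat n \<omega> d x - \<sigma>2 d x)\<^sup>2) \<partial>P\<^sub>\<psi>)"
    \<comment> \<open>(iv)\<close>
    and discretization: "op1 M (\<lambda>n \<omega>. ennreal ((1 / real n) *
          (\<Sum>i=1..n. (q\<^sub>n n \<omega> (\<psi> i \<omega>)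
              - q_hat n (\<lambda>j. \<psi> j \<omega>) B p C (\<sigma>2_hat n \<omega>) (\<psi> i \<omega>))\<^sup>2)))"
    and kL_rate: "(\<lambda>n. real (k_bar n) * real (L_bar n))
          \<in> o(\<lambda>n. real n powr (1 - (real CARD('d) + 1) / \<alpha>))"
    and k_rate: "(\<lambda>n. real (k_bar n)) \<in> o(\<lambda>n. real n powr (1 / 4))"
    \<comment> \<open>estimand and limit variance\<close>
    and ATE: "ATE = (\<integral>\<omega>. (Y 1 1 \<omega> - Y 0 1 \<omega>) \<partial>M)"
    and V_min: "V_min = enn2real (INF q \<in> feasible P\<^sub>\<psi> B C. objective P\<^sub>\<psi> p \<sigma>2 q)"
    and V_star: "V_star = (\<integral>x. (c x - (\<integral>z. c z \<partial>P\<^sub>\<psi>))\<^sup>2 \<partial>P\<^sub>\<psi>) + V_min"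
  shows "(\<exists>q \<in> feasible P\<^sub>\<psi> B C. objective P\<^sub>\<psi> p \<sigma>2 q = ennreal V_min \<and>
            (\<forall>q' \<in> feasible P\<^sub>\<psi> B C. objective P\<^sub>\<psi> p \<sigma>2 q \<le> objective P\<^sub>\<psi> p \<sigma>2 q')) \<and>
         weak_conv_m
           (\<lambda>n. distr M borel (\<lambda>\<omega>. sqrt (real n) * (theta_hat p \<psi> Y q\<^sub>n T D n \<omega> - ATE)))
           (density lborel (normal_density 0 (sqrt V_star)))"
proof -
  interpret local_design M NP NX \<psi> Y W \<pi> \<xi> p B \<alpha> \<delta> C\<^sub>l C\<^sub>u p_num p_den C c \<sigma>2 \<sigma>2_hat q\<^sub>n L a k k_bar L_bar T D P\<^sub>\<psi>
    by (rule local_design.intro; fact assms)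
  obtain q where q: "q \<in> feasible P\<^sub>\<psi> B C" "objective P\<^sub>\<psi> p \<sigma>2 q = ennreal V_lim"
    using objective_attained by blast
  have "(INF q \<in> feasible P\<^sub>\<psi> B C. objective P\<^sub>\<psi> p \<sigma>2 q) = ennreal V_lim"
  proof (rule antisym)
    show "(INF q \<in> feasible P\<^sub>\<psi> B C. objective P\<^sub>\<psi> p \<sigma>2 q) \<le> ennreal V_lim"
      using INF_lower[OF q(1), of "objective P\<^sub>\<psi> p \<sigma>2"] by (simp only: q(2))
    show "ennreal V_lim \<le> (INF q \<in> feasible P\<^sub>\<psi> B C. objective P\<^sub>\<psi> p \<sigma>2 q)"
      by (rule INF_greatest) (rule objective_ge)
  qed
  \<comment> \<open>\<open>enn2real\<close> undoes \<open>ennreal\<close> because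
    \<open>V_lim\<close> is positive.\<close>
  then have min: "V_min = V_lim" unfolding V_min using V_lim_pos by simp
  have star: "V_star = vc + V_lim" unfolding V_star vc_eq min ..
  have ate: "ATE = \<mu>c" unfolding ATE \<mu>c_eq ..
  have "\<forall>q' \<in> feasible P\<^sub>\<psi> B C. objective P\<^sub>\<psi> p \<sigma>2 q \<le> objective P\<^sub>\<psi> p \<sigma>2 q'"
    unfolding q(2) using objective_ge by blast
  with q show ?thesis unfolding star ate min using estimator_weak_conv by blast
qed

end
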